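(* For the distributionally robust discrete 2-stage versions of the following problems, in the setting where every subset of the ground set is a scenario and the ball of distributions is defined by the $L_\infty$ metric, there are approximation algorithms with the following approximation factors: (a) $O(\log n)$ for set cover; (b) $8+O(\varepsilon)$ for vertex cover; (c) $6+O(\varepsilon)$ for edge cover; (d) $10.98+O(\varepsilon)$ for facility location.
   Context: Distributionally robust discrete 2-stage problem: first-stage actions $x$ (integral) are taken with cost $c^\top x$ before a scenario $A$ is realized; after $A$ is realized, integral recourse actions $z^A$ are taken, with $(x,z^A)$ feasible for $A$; given a central distribution $p^*$ over scenarios (accessed only via independent samples) and a radius $r\in(0,1]$, the objective is $c^\top x+\max_{q:\max_A|p^*_A-q_A|\le r}\mathbb{E}_{A\sim q}[\text{cost of }z^A]$. Set cover: sets $\mathcal{S}\subseteq 2^U$ with first/second-stage costs $c_S,c^{II}_S$; a scenario $A\subseteq U$ must be covered by the sets bought in stage I and in scenario $A$; $n=|U|$. Vertex cover: special case where the elements are the edges of a graph and the sets are its vertices. Edge cover: elements are vertices and sets are edges. Facility location: facilities $\mathcal{F}$, clients $\mathcal{C}$, metric $d$, costs $f_i,f^{II}_i$; in scenario $A\subseteq\mathcal{C}$ each client $j\in A$ must be assigned to a facility opened in stage I or in scenario $A$, paying $d_{ij}$; second-stage cost is opening costs $f^{II}$ in the scenario plus assignment costs. The inflation factor $\lambda$ is the maximum ratio of second- to first-stage cost of an action. An approximation algorithm runs in time polynomial in the input size, $\lambda/(\varepsilon r)$ and $\log(1/\delta)$ and succeeds with high probability. *)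

theory Defs
  imports
    "HOL-Probability.Probability"
    "HOL-Library.Landau_Symbols"
    "HOL-Library.Nat_Bijection"
    "HOL-Library.Log_Nat"
begin

section \<open>Randomized machines with a sampling oracle\<close>

text \<open>
  A random-access machine with finitely many registers per program and an unbounded memory, both
  holding natural numbers.  Every step has unit cost.  There is no multiplication, so (up to the
  size of the oracle answers) a number grows by at most one bit per step, and polynomial time on
  this machine coincides with polynomial time on Turing machines.  \<open>Flip\<close> draws a fair random bit
  and \<open>Sample\<close> a fresh independent answer of the sampling oracle.
\<close>

datatype com =
    Const nat nat        \<comment> \<open>\<open>R a := k\<close>\<close>
  | Add nat nat nat      \<comment> \<open>\<open>R a := R b + R c\<close>\<close>
  | Sub nat nat nat      \<comment> \<open>\<open>R a := R b - R c\<close>, truncated at 0\<close>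
  | Half nat nat         \<comment> \<open>\<open>R a := R b div 2\<close>\<close>
  | Load nat nat         \<comment> \<open>\<open>R a := M (R b)\<close>\<close>
  | Store nat nat        \<comment> \<open>\<open>M (R a) := R b\<close>\<close>
  | Flip nat
  | Sample nat
  | Seq com com
  | Cond nat com com     \<comment> \<open>first branch iff \<open>R a \<noteq> 0\<close>\<close>
  | While nat com        \<comment> \<open>repeat as long as \<open>R a \<noteq> 0\<close>\<close>

type_synonym state = "(nat \<Rightarrow> nat) \<times> (nat \<Rightarrow> nat)"
type_synonym config = "com list \<times> state"

fun step :: "nat pmf \<Rightarrow> config \<Rightarrow> config pmf" where
  "step D ([], s) = return_pmf ([], s)"
| "step D (Const a k # cs, (R, M)) = return_pmf (cs, (R(a := k), M))"
| "step D (Add a b c # cs, (R, M)) = return_pmf (cs, (R(a := R b + R c), M))"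
| "step D (Sub a b c # cs, (R, M)) = return_pmf (cs, (R(a := R b - R c), M))"
| "step D (Half a b # cs, (R, M)) = return_pmf (cs, (R(a := R b div 2), M))"
| "step D (Load a b # cs, (R, M)) = return_pmf (cs, (R(a := M (R b)), M))"
| "step D (Store a b # cs, (R, M)) = return_pmf (cs, (R, M(R a := R b)))"
| "step D (Flip a # cs, (R, M)) =
     map_pmf (\<lambda>b. (cs, (R(a := of_bool b), M))) (bernoulli_pmf (1/2))"
| "step D (Sample a # cs, (R, M)) = map_pmf (\<lambda>k. (cs, (R(a := k), M))) D"
| "step D (Seq c1 c2 # cs, s) = return_pmf (c1 # c2 # cs, s)"
| "step D (Cond a c1 c2 # cs, (R, M)) = return_pmf ((if R a \<noteq> 0 then c1 else c2) # cs, (R, M))"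
| "step D (While a c # cs, (R, M)) =
     return_pmf (if R a \<noteq> 0 then c # While a c # cs else cs, (R, M))"

primrec exec :: "nat pmf \<Rightarrow> nat \<Rightarrow> config \<Rightarrow> config pmf" where
  "exec D 0 cfg = return_pmf cfg"
| "exec D (Suc t) cfg = bind_pmf (step D cfg) (exec D t)"

definition start :: "com \<Rightarrow> nat list \<Rightarrow> config" where
  "start c inp =
     ([c], ((\<lambda>a. if a = 0 then length inp else 0), (\<lambda>i. if i < length inp then inp ! i else 0)))"

definition halted :: "config \<Rightarrow> bool" where
  "halted cfg \<longleftrightarrow> fst cfg = []"

definition reg :: "config \<Rightarrow> nat \<Rightarrow> nat" where
  "reg cfg = fst (snd cfg)"

text \<open>Total bit length of the input; the summand 1 accounts for the delimiter of each number.\<close>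

definition input_size :: "nat list \<Rightarrow> nat" where
  "input_size inp = (\<Sum>k\<leftarrow>inp. floorlog 2 k + 1)"

text \<open>Deterministic computations: the oracle is useless, and the result has to be a point mass.\<close>

definition computes_within :: "nat \<Rightarrow> com \<Rightarrow> nat list \<Rightarrow> state \<Rightarrow> bool" where
  "computes_within t c inp s \<longleftrightarrow> exec (return_pmf 0) t (start c inp) = return_pmf ([], s)"

definition rat_code :: "rat \<Rightarrow> nat list" where
  "rat_code q = [nat (fst (quotient_of q)), nat (snd (quotient_of q))]"


section \<open>Distributionally robust discrete 2-stage problems\<close>

text \<open>
  The scenarios are all subsets of \<open>ground\<close>.  A first-stage decision is a set of actions;
  the type of recourse decisions \<open>'z\<close> depends on the problem.  \<open>feasible x A z\<close> says that
  first-stage decision \<open>x\<close> and recourse \<open>z\<close> are feasible for scenario \<open>A\<close>.  The costs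
  \<open>cost1\<close> and \<open>cost2\<close> are the first- and second-stage costs of a single action, and
  \<open>recourse_cost A z\<close> is the total second-stage cost in scenario \<open>A\<close>.  \<open>recourse_of\<close> reads a
  recourse decision off the final state of a machine, and \<open>encoding\<close> is the machine input
  describing the instance (which contains no information about the central distribution).
\<close>

record 'z two_stage =
  ground :: "nat set"
  actions :: "nat set"
  cost1 :: "nat \<Rightarrow> real"
  cost2 :: "nat \<Rightarrow> real"
  feasible :: "nat set \<Rightarrow> nat set \<Rightarrow> 'z \<Rightarrow> bool"
  recourse_cost :: "nat set \<Rightarrow> 'z \<Rightarrow> real"
  recourse_of :: "state \<Rightarrow> 'z"
  encoding :: "nat list"

definition distributions :: "'z two_stage \<Rightarrow> nat set pmf set" where
  "distributions P = {q. set_pmf q \<subseteq> Pow (ground P)}"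

definition linf_ball :: "'z two_stage \<Rightarrow> nat set pmf \<Rightarrow> real \<Rightarrow> nat set pmf set" where
  "linf_ball P p r =
     {q \<in> distributions P. \<forall>A \<in> Pow (ground P). \<bar>pmf p A - pmf q A\<bar> \<le> r}"

definition objective ::
  "'z two_stage \<Rightarrow> nat set pmf \<Rightarrow> real \<Rightarrow> nat set \<Rightarrow> (nat set \<Rightarrow> 'z) \<Rightarrow> real" where
  "objective P p r x z =
     (\<Sum>a\<in>x. cost1 P a) +
     (SUP q \<in> linf_ball P p r. measure_pmf.expectation q (\<lambda>A. recourse_cost P A (z A)))"

definition solutions :: "'z two_stage \<Rightarrow> (nat set \<times> (nat set \<Rightarrow> 'z)) set" where
  "solutions P = {(x, z). x \<subseteq> actions P \<and> (\<forall>A \<in> Pow (ground P). feasible P x A (z A))}"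

definition opt :: "'z two_stage \<Rightarrow> nat set pmf \<Rightarrow> real \<Rightarrow> real" where
  "opt P p r = (INF (x, z) \<in> solutions P. objective P p r x z)"

text \<open>
  The maximum ratio of second- to first-stage cost.  All ratios are nonnegative, so 0 only
  matters if there is no action at all; for actions that are free in both stages the
  convention \<open>0 / 0 = 0\<close> is the intended one.
\<close>

definition inflation :: "'z two_stage \<Rightarrow> real" where
  "inflation P = Max (insert 0 ((\<lambda>a. cost2 P a / cost1 P a) ` actions P))"


section \<open>Approximation algorithms\<close>

text \<open>
  An algorithm consists of two programs.  The first one runs before the scenario is known; it
  gets the instance, the radius and the accuracy parameters, and it may flip coins and sample from
  the central distribution.  It returns the first-stage decision (as a bit mask in register 0) and
  a number in register 1 that is kept for the second stage.  The second program additionally gets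
  these two numbers and the realized scenario, and it computes the recourse decision.  This second
  program is deterministic, but random bits drawn in the first stage may be handed over in
  register 1.
\<close>

definition stage1_input :: "'z two_stage \<Rightarrow> rat \<Rightarrow> rat \<Rightarrow> rat \<Rightarrow> nat list" where
  "stage1_input P r \<epsilon> \<delta> = encoding P @ rat_code r @ rat_code \<epsilon> @ rat_code \<delta>"

definition stage2_input ::
  "'z two_stage \<Rightarrow> rat \<Rightarrow> rat \<Rightarrow> rat \<Rightarrow> config \<Rightarrow> nat set \<Rightarrow> nat list" where
  "stage2_input P r \<epsilon> \<delta> cfg A =
     stage1_input P r \<epsilon> \<delta> @ [reg cfg 0, reg cfg 1, set_encode A]"

definition time_bound :: "nat \<Rightarrow> 'z two_stage \<Rightarrow> rat \<Rightarrow> rat \<Rightarrow> rat \<Rightarrow> nat" where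
  "time_bound k P r \<epsilon> \<delta> =
     nat \<lfloor>real k * (1 + real (input_size (stage1_input P r \<epsilon> \<delta>))
                    + inflation P / (of_rat \<epsilon> * of_rat r) + ln (1 / of_rat \<delta>)) ^ k\<rfloor>"

definition stage1_run ::
  "com \<Rightarrow> nat \<Rightarrow> 'z two_stage \<Rightarrow> nat set pmf \<Rightarrow> rat \<Rightarrow> rat \<Rightarrow> rat \<Rightarrow> config pmf" where
  "stage1_run c t P p r \<epsilon> \<delta> = exec (map_pmf set_encode p) t (start c (stage1_input P r \<epsilon> \<delta>))"

definition good_outcome ::
  "com \<Rightarrow> nat \<Rightarrow> real \<Rightarrow> 'z two_stage \<Rightarrow> nat set pmf \<Rightarrow> rat \<Rightarrow> rat \<Rightarrow> rat \<Rightarrow> config \<Rightarrow> bool" where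
  "good_outcome c t \<rho> P p r \<epsilon> \<delta> cfg \<longleftrightarrow>
     (\<exists>z. (\<forall>A \<in> Pow (ground P).
              \<exists>s. computes_within t c (stage2_input P r \<epsilon> \<delta> cfg A) s \<and> z A = recourse_of P s) \<and>
          (set_decode (reg cfg 0), z) \<in> solutions P \<and>
          objective P p (of_rat r) (set_decode (reg cfg 0)) z \<le> \<rho> * opt P p (of_rat r))"

definition has_approx_algorithm ::
  "'z two_stage set \<Rightarrow> ('z two_stage \<Rightarrow> real \<Rightarrow> real) \<Rightarrow> bool" where
  "has_approx_algorithm \<P> \<rho> \<longleftrightarrow>
     (\<exists>c1 c2 k. \<forall>P \<in> \<P>. \<forall>p \<in> distributions P. \<forall>r \<epsilon> \<delta>.
        0 < r \<and> r \<le> 1 \<and> 0 < \<epsilon> \<and> \<epsilon> < 1 \<and> 0 < \<delta> \<and> \<delta> < 1 \<longrightarrow>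
        (let t = time_bound k P r \<epsilon> \<delta>; run = stage1_run c1 t P p r \<epsilon> \<delta> in
           (\<forall>cfg \<in> set_pmf run. halted cfg \<and>
              (\<forall>A \<in> Pow (ground P). \<exists>s. computes_within t c2 (stage2_input P r \<epsilon> \<delta> cfg A) s)) \<and>
           measure_pmf.prob run {cfg. good_outcome c2 t (\<rho> P (of_rat \<epsilon>)) P p r \<epsilon> \<delta> cfg}
             \<ge> 1 - of_rat \<delta>))"


section \<open>Set cover, vertex cover and edge cover\<close>

text \<open>Elements are \<open>0, \<dots>, nelems - 1\<close> and sets are indexed by \<open>0, \<dots>, nsets - 1\<close>.\<close>

record set_cover_inst =
  nelems :: nat
  nsets :: nat
  members :: "nat \<Rightarrow> nat set"
  scost1 :: "nat \<Rightarrow> rat"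
  scost2 :: "nat \<Rightarrow> rat"

definition set_cover_problem :: "set_cover_inst \<Rightarrow> nat set two_stage" where
  "set_cover_problem I =
     \<lparr>ground = {..<nelems I},
      actions = {..<nsets I},
      cost1 = (\<lambda>i. of_rat (scost1 I i)),
      cost2 = (\<lambda>i. of_rat (scost2 I i)),
      feasible = (\<lambda>x A z. z \<subseteq> {..<nsets I} \<and> A \<subseteq> (\<Union>i \<in> x \<union> z. members I i)),
      recourse_cost = (\<lambda>A z. \<Sum>i\<in>z. of_rat (scost2 I i)),
      recourse_of = (\<lambda>(R, M). set_decode (R 0)),
      encoding =
        [nelems I, nsets I] @ map (\<lambda>i. set_encode (members I i)) [0..<nsets I] @
        concat (map (\<lambda>i. rat_code (scost1 I i) @ rat_code (scost2 I i)) [0..<nsets I])\<rparr>"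

text \<open>
  The last conjunct says that no action has infinite inflation: with infinite inflation a
  running time polynomial in the inflation factor is no restriction.
\<close>

definition valid_costs :: "nat set \<Rightarrow> (nat \<Rightarrow> rat) \<Rightarrow> (nat \<Rightarrow> rat) \<Rightarrow> bool" where
  "valid_costs X f g \<longleftrightarrow> (\<forall>i\<in>X. 0 \<le> f i \<and> 0 \<le> g i \<and> (f i = 0 \<longrightarrow> g i = 0))"

definition set_cover_problems :: "nat set two_stage set" where
  "set_cover_problems = set_cover_problem `
     {I. inj_on (members I) {..<nsets I} \<and>
         (\<Union>i<nsets I. members I i) = {..<nelems I} \<and>
         valid_costs {..<nsets I} (scost1 I) (scost2 I)}"

text \<open>A finite simple graph with vertices \<open>0, \<dots>, n - 1\<close>, given by its list of edges.\<close>

definition simple_graph :: "nat \<Rightarrow> nat set list \<Rightarrow> bool" where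
  "simple_graph n es \<longleftrightarrow> distinct es \<and> (\<forall>e \<in> set es. e \<subseteq> {..<n} \<and> card e = 2)"

definition vertex_cover_inst ::
  "nat \<Rightarrow> nat set list \<Rightarrow> (nat \<Rightarrow> rat) \<Rightarrow> (nat \<Rightarrow> rat) \<Rightarrow> set_cover_inst" where
  "vertex_cover_inst n es f g =
     \<lparr>nelems = length es, nsets = n, members = (\<lambda>v. {i. i < length es \<and> v \<in> es ! i}),
      scost1 = f, scost2 = g\<rparr>"

definition edge_cover_inst ::
  "nat \<Rightarrow> nat set list \<Rightarrow> (nat \<Rightarrow> rat) \<Rightarrow> (nat \<Rightarrow> rat) \<Rightarrow> set_cover_inst" where
  "edge_cover_inst n es f g =
     \<lparr>nelems = n, nsets = length es, members = (\<lambda>i. es ! i), scost1 = f, scost2 = g\<rparr>"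

definition vertex_cover_problems :: "nat set two_stage set" where
  "vertex_cover_problems =
     {set_cover_problem (vertex_cover_inst n es f g) | n es f g.
        simple_graph n es \<and> valid_costs {..<n} f g}"

definition edge_cover_problems :: "nat set two_stage set" where
  "edge_cover_problems =
     {set_cover_problem (edge_cover_inst n es f g) | n es f g.
        simple_graph n es \<and> \<Union>(set es) = {..<n} \<and> valid_costs {..<length es} f g}"


section \<open>Facility location\<close>

text \<open>
  Facilities \<open>0, \<dots>, nfac - 1\<close> and clients \<open>0, \<dots>, ncli - 1\<close> sit at points of the finite metric
  space \<open>0, \<dots>, npoints - 1\<close>; several of them may share a point.
\<close>

record facility_inst =
  npoints :: nat
  nfac :: nat
  ncli :: nat
  dst :: "nat \<Rightarrow> nat \<Rightarrow> rat"
  fac_loc :: "nat \<Rightarrow> nat"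
  cli_loc :: "nat \<Rightarrow> nat"
  open1 :: "nat \<Rightarrow> rat"
  open2 :: "nat \<Rightarrow> rat"

text \<open>
  A recourse decision is the set of facilities opened in the scenario together with the
  assignment of clients to facilities; a machine returns the latter in its memory.
\<close>

definition facility_problem :: "facility_inst \<Rightarrow> (nat set \<times> (nat \<Rightarrow> nat)) two_stage" where
  "facility_problem I =
     \<lparr>ground = {..<ncli I},
      actions = {..<nfac I},
      cost1 = (\<lambda>i. of_rat (open1 I i)),
      cost2 = (\<lambda>i. of_rat (open2 I i)),
      feasible = (\<lambda>x A (F, \<sigma>). F \<subseteq> {..<nfac I} \<and> (\<forall>j\<in>A. \<sigma> j \<in> x \<union> F)),
      recourse_cost = (\<lambda>A (F, \<sigma>).
        (\<Sum>i\<in>F. of_rat (open2 I i)) + (\<Sum>j\<in>A. of_rat (dst I (fac_loc I (\<sigma> j)) (cli_loc I j)))),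
      recourse_of = (\<lambda>(R, M). (set_decode (R 0), M)),
      encoding =
        [npoints I, nfac I, ncli I] @
        map (fac_loc I) [0..<nfac I] @ map (cli_loc I) [0..<ncli I] @
        concat (map (\<lambda>i. rat_code (open1 I i) @ rat_code (open2 I i)) [0..<nfac I]) @
        concat (map (\<lambda>(u, v). rat_code (dst I u v))
          (List.product [0..<npoints I] [0..<npoints I]))\<rparr>"

definition facility_problems :: "(nat set \<times> (nat \<Rightarrow> nat)) two_stage set" where
  "facility_problems = facility_problem `
     {I. Metric_space {..<npoints I} (\<lambda>u v. of_rat (dst I u v)) \<and>
         fac_loc I ` {..<nfac I} \<subseteq> {..<npoints I} \<and>
         cli_loc I ` {..<ncli I} \<subseteq> {..<npoints I} \<and>
         (ncli I > 0 \<longrightarrow> nfac I > 0) \<and>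
         valid_costs {..<nfac I} (open1 I) (open2 I)}"

end

theory Submission
  imports Defs
begin

text \<open>
  A central distribution enters the objective only through the excess masses \<open>max 0 (p A - r)\<close> and
  the remaining movable mass.  Spreading the movable mass uniformly and pairing complementary
  scenarios shows that, up to a factor 2 on the second stage, it may be placed on the full scenario.
  Hence, after estimating the excess masses by sampling (Hoeffding and a union bound over all
  scenarios), it suffices to solve a 2-stage stochastic problem with polynomially many weighted
  scenarios.  This is done combinatorially: edge cover by comparing the cheapest edges of a vertex,
  vertex cover by local ratio, set cover by greedy multicover followed by rounding at the threshold
  where the first stage does half of the covering, and facility location by the primal-dual greedy of Mettu
  and Plaxton with an additional level for the first stage.  If no action gets more expensive, the first
  stage stays empty and no sample is drawn.  All algorithms are compiled to the
  machine through closure properties of the class of polynomial-time functions.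
\<close>

section \<open>From machine programs to a function class closed under bounded iteration\<close>

section \<open>Deterministic runs\<close>

text \<open>The obstacle is the exponential number of scenarios. At most \<open>1 / r\<close> of
  them can carry mass above \<open>r\<close>, so few excess masses are nonzero, and frequencies
  accurate up to \<open>\<epsilon> * r\<^sup>2 / 2\<close> cost only factors
  \<open>1 + \<epsilon>\<close>.

  Scenarios that were never sampled enter through one number, a bound on the recourse cost over all
  subsets, to which the movable mass is charged. Each second-stage algorithm must respect on every
  subset a bound that is paid for by the full scenario.

  If no action gets more expensive, the inflation divided by \<open>\<epsilon> * r\<close> can be
  tiny, and the time bound would not pay for samples; hence the separate case.

  For set cover, plain greedy on pairs of scenario and element would also lose the logarithm of the
  number of scenarios. Covering each pair very often makes the loss per unit of coverage constant,
  so the greedy history acts like an LP solution.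

  The second stage counts twice. This gives 4 = 2 * 2 for edge cover, 8 = 2 * 2 * 2 for vertex cover
  (the third factor pays for recomputing the recourse) and 9 = 2 * 9/2 for facility
  location.\<close>

definition runs :: "com => state => nat => state => bool" where
 "runs c s t s' \<longleftrightarrow> (\<forall>D cs n. exec D (t + n) (c # cs, s) = exec D n (cs, s'))"

lemma runsD: "runs c s t s' ==> exec D (t + n) (c # cs, s) = exec D n (cs, s')"
 by (simp add: runs_def)

fun bstep :: "com => state => state" where
 "bstep (Const a k) (R, M) = (R(a := k), M)"
| "bstep (Add a b c) (R, M) = (R(a := R b + R c), M)"
| "bstep (Sub a b c) (R, M) = (R(a := R b - R c), M)"
| "bstep (Half a b) (R, M) = (R(a := R b div 2), M)"
| "bstep (Load a b) (R, M) = (R(a := M (R b)), M)"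
| "bstep (Store a b) (R, M) = (R, M(R a := R b))"
| "bstep _ s = s"

fun basic :: "com => bool" where
 "basic (Const a k) = True"
| "basic (Add a b c) = True"
| "basic (Sub a b c) = True"
| "basic (Half a b) = True"
| "basic (Load a b) = True"
| "basic (Store a b) = True"
| "basic _ = False"

lemma runs_basic: "basic c ==> runs c s 1 (bstep c s)"
 by (cases s; cases c) (auto simp: runs_def bind_return_pmf)

lemma runs_Seq:
 assumes "runs c1 s t1 s1" "runs c2 s1 t2 s2"
 shows "runs (Seq c1 c2) s (Suc (t1 + t2)) s2"
 unfolding runs_def
proof (intro allI)
 fix D cs n
 have "exec D (Suc (t1 + t2) + n) (Seq c1 c2 # cs, s) = exec D (t1 + (t2 + n)) (c1 # c2 # cs, s)"
  by (cases s) (simp add: bind_return_pmf add.assoc)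
 then show "exec D (Suc (t1 + t2) + n) (Seq c1 c2 # cs, s) = exec D n (cs, s2)"
  using assms by (simp add: runs_def)
qed

lemma runs_Cond:
 assumes "runs (if R a \<noteq> 0 then c1 else c2) (R, M) t s"
 shows "runs (Cond a c1 c2) (R, M) (Suc t) s"
 using assms by (auto simp: runs_def bind_return_pmf)

lemma runs_While_done: "R a = 0 ==> runs (While a c) (R, M) 1 (R, M)"
 by (auto simp: runs_def bind_return_pmf)

lemma runs_While_step:
 assumes "R a \<noteq> 0" "runs c (R, M) t1 s1" "runs (While a c) s1 t2 s2"
 shows "runs (While a c) (R, M) (Suc (t1 + t2)) s2"
 unfolding runs_def
proof (intro allI)
 fix D cs n
 have "exec D (Suc (t1 + t2) + n) (While a c # cs, (R, M))
   = exec D (t1 + (t2 + n)) (c # While a c # cs, (R, M))"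
  using assms(1) by (simp add: bind_return_pmf add.assoc)
 then show "exec D (Suc (t1 + t2) + n) (While a c # cs, (R, M)) = exec D n (cs, s2)"
  using assms by (simp add: runs_def)
qed

fun block :: "com list => com" where
 "block [] = Const 0 0"
| "block [c] = c"
| "block (c # cs) = Seq c (block cs)"

text \<open>The \<open>l - 1\<close> nested \<open>Seq\<close> commands take one step each, hence
  \<open>2 * l - 1\<close> steps for \<open>l\<close> basic commands.\<close>

lemma runs_block:
 assumes "list_all basic cs" "cs \<noteq> []"
 shows "runs (block cs) s (2 * length cs - 1) (fold bstep cs s)"
 using assms
proof (induction cs arbitrary: s rule: block.induct)
 case (2 c)
 then show ?case using runs_basic[of c s] by simp
next
 case (3 c c' cs)
 then have "runs (block (c' # cs)) (bstep c s) (2 * length (c' # cs) - 1) (fold bstep (c' # cs) (bstep c s))"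
  by simp
 from runs_Seq[OF runs_basic this, of] 3 show ?case by simp
qed simp

lemma runs_blockI:
 assumes "list_all basic cs" "cs \<noteq> []" "fold bstep cs s = s'"
 shows "runs (block cs) s (2 * length cs - 1) s'"
 using runs_block assms by blast

section \<open>Data in the heap\<close>

text \<open>
 Register 1 points to the first free cell, register 0 is scratch, and cells below the free pointer
 are never overwritten.  Naturals are unboxed, pairs and cons cells occupy two consecutive cells,
 and the null pointer is the empty list.
\<close>

class data =
 fixes sz :: "'a => nat"
  and rep :: "(nat => nat) => nat => nat => 'a => bool"
 assumes sz_pos: "0 < sz x"
  and rep_mono: "rep M F p x ==> F <= F' ==> (\<And>q. q < F ==> M' q = M q) ==> rep M' F' p x"

instantiation nat :: data
begin
definition sz_nat :: "nat => nat" where "sz_nat n = floorlog 2 n + 1"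
definition rep_nat :: "(nat => nat) => nat => nat => nat => bool" where
 "rep_nat M F p n \<longleftrightarrow> p = n"
instance by standard (auto simp: sz_nat_def rep_nat_def)
end

instantiation bool :: data
begin
definition sz_bool :: "bool => nat" where "sz_bool b = 1"
definition rep_bool :: "(nat => nat) => nat => nat => bool => bool" where
 "rep_bool M F p b \<longleftrightarrow> p = of_bool b"
instance by standard (auto simp: sz_bool_def rep_bool_def)
end

instantiation prod :: (data, data) data
begin
definition sz_prod :: "'a \<times> 'b => nat" where "sz_prod x = sz (fst x) + sz (snd x)"
definition rep_prod :: "(nat => nat) => nat => nat => 'a \<times> 'b => bool" where
 "rep_prod M F p x \<longleftrightarrow> 0 < p \<and> Suc p < F \<and> rep M F (M p) (fst x) \<and> rep M F (M (Suc p)) (snd x)"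
instance
proof
 fix x :: "'a \<times> 'b" and M F p F' M'
 show "0 < sz x" using sz_pos[of "fst x"] by (simp add: sz_prod_def)
 show "rep M' F' p x" if "rep M F p x" "F <= F'" "\<And>q. q < F ==> M' q = M q"
  using that rep_mono[OF _ that(2,3), of M p "fst x"] by (auto simp: rep_prod_def intro: rep_mono)
qed
end

instantiation list :: (data) data
begin
primrec sz_list :: "'a list => nat" where
 "sz_list [] = 1"
| "sz_list (x # xs) = sz x + sz_list xs"
primrec rep_list :: "(nat => nat) => nat => nat => 'a list => bool" where
 "rep_list M F p [] \<longleftrightarrow> p = 0"
| "rep_list M F p (x # xs) \<longleftrightarrow>
   0 < p \<and> Suc p < F \<and> rep M F (M p) x \<and> rep_list M F (M (Suc p)) xs"
instance
proof
 fix x :: "'a list" and M F p F' M'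
 show "0 < sz x" by (induction x) auto
 show "rep M' F' p x" if "rep M F p x" "F <= F'" "\<And>q. q < F ==> M' q = M q"
  using that(1) by (induction x arbitrary: p) (use that(2,3) in \<open>auto intro: rep_mono\<close>)
qed
end

lemma sz_list_conv: "sz (xs :: 'a::data list) = Suc (sum_list (map sz xs))"
 by (induction xs) auto

lemma length_le_sz: "length xs < sz (xs :: 'a::data list)"
proof (induction xs)
 case (Cons x xs)
 then show ?case using sz_pos[of x] by simp
qed simp

lemma sz_mem: "x \<in> set xs ==> sz (x :: 'a::data) < sz xs"
proof (induction xs)
 case (Cons y ys)
 then show ?case using sz_pos[of y] sz_pos[of ys] by auto
qed simp

lemma sz_append: "sz (xs @ ys :: 'a::data list) + 1 = sz xs + sz ys"
 by (simp add: sz_list_conv)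

lemma sz_list_le:
 assumes "\<And>x. x \<in> set xs ==> sz (x :: 'a::data) <= B"
 shows "sz xs <= 1 + length xs * B"
 using assms
proof (induction xs)
 case (Cons x xs)
 then have "sz xs <= 1 + length xs * B" "sz x <= B" by auto
 then show ?case by simp
qed simp

lemma sz_Pair [simp]: "sz (x, y) = sz x + sz y"
 by (simp add: sz_prod_def)

lemma sz_bool [simp]: "sz (b :: bool) = 1"
 by (simp add: sz_bool_def)

lemma sz_fst_le: "sz (fst x) <= sz x" and sz_snd_le: "sz (snd x) <= sz x"
 by (auto simp: sz_prod_def)

section \<open>Polynomial-time functions\<close>

text \<open>One constant serves as factor and as exponent, as in \<open>time_bound\<close>; this
  loses nothing because sizes are at least 1.\<close>

definition pbd :: "('a::data => nat) => bool" where
 "pbd g \<longleftrightarrow> (\<exists>k. \<forall>x. g x <= k * sz x ^ k)"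

lemma pbdI:
 fixes g :: "'a::data => nat"
 assumes "\<And>x. g x <= c * sz x ^ e"
 shows "pbd g"
 unfolding pbd_def
proof (intro exI allI)
 fix x :: 'a
 have "c * sz x ^ e <= (c + e) * sz x ^ (c + e)"
  by (intro mult_mono power_increasing) (use sz_pos[of x] in auto)
 with assms show "g x <= (c + e) * sz x ^ (c + e)" using le_trans by blast
qed

lemma pbd_mono: "pbd g ==> (\<And>x. f x <= g x) ==> pbd f"
 unfolding pbd_def using le_trans by blast

lemma pbd_const [intro]: "pbd (%x. c)"
 by (rule pbdI[of _ c 0]) simp

lemma pbd_sz [intro]: "pbd sz"
 by (rule pbdI[of _ 1 1]) simp

lemma pbd_add [intro]:
 fixes f g :: "'a::data => nat"
 assumes "pbd f" "pbd g"
 shows "pbd (%x. f x + g x)"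
proof -
 obtain k l where k: "\<And>x. f x <= k * sz x ^ k" and l: "\<And>x. g x <= l * sz x ^ l"
  using assms unfolding pbd_def by blast
 show ?thesis
 proof (rule pbdI)
  fix x :: 'a
  have "k * sz x ^ k <= k * sz x ^ (k + l)" "l * sz x ^ l <= l * sz x ^ (k + l)"
   by (intro mult_mono power_increasing; use sz_pos[of x] in auto)+
  then show "f x + g x <= (k + l) * sz x ^ (k + l)"
   using k[of x] l[of x] unfolding add_mult_distrib by linarith
 qed
qed

lemma pbd_mult [intro]:
 fixes f g :: "'a::data => nat"
 assumes "pbd f" "pbd g"
 shows "pbd (%x. f x * g x)"
proof -
 obtain k l where k: "\<And>x. f x <= k * sz x ^ k" and l: "\<And>x. g x <= l * sz x ^ l"
  using assms unfolding pbd_def by blast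
 show ?thesis
 proof (rule pbdI)
  fix x :: 'a
  show "f x * g x <= (k * l) * sz x ^ (k + l)"
   using mult_mono[OF k[of x] l[of x]] by (simp add: power_add mult_ac)
 qed
qed

lemma pbd_comp:
 fixes f :: "'a::data => 'b::data"
 assumes "pbd g" "pbd (%x. sz (f x))"
 shows "pbd (%x. g (f x))"
proof -
 obtain k l where k: "\<And>x. g x <= k * sz x ^ k" and l: "\<And>x. sz (f x) <= l * sz x ^ l"
  using assms unfolding pbd_def by blast
 show ?thesis
 proof (rule pbdI)
  fix x :: 'a
  have "k * sz (f x) ^ k <= k * (l * sz x ^ l) ^ k"
   by (intro mult_mono power_mono l) auto
  also have "\<dots> = (k * l ^ k) * sz x ^ (l * k)"
   by (simp add: power_mult_distrib power_mult)
  finally show "g (f x) <= (k * l ^ k) * sz x ^ (l * k)" using k[of "f x"] le_trans by blast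
 qed
qed

text \<open>The registers from 2 on form a stack whose frames are fixed at compile time: a program
  with base \<open>a\<close> may change the registers from \<open>a\<close> on, and it only extends
  the heap. A value represented before a call is therefore still represented afterwards
  (\<open>keeps_rep\<close>), without copying.\<close>

definition keeps :: "nat => state => state => bool" where
 "keeps a s s' \<longleftrightarrow> fst s 1 <= fst s' 1 \<and> (\<forall>q < fst s 1. snd s' q = snd s q) \<and>
   (\<forall>b. 2 <= b \<and> b < a --> fst s' b = fst s b)"

lemma keeps_refl: "keeps a s s"
 by (simp add: keeps_def)

lemma keeps_trans: "keeps a s s' ==> keeps a' s' s'' ==> a <= a' ==> keeps a s s''"
 by (auto simp: keeps_def)

lemma keeps_rep:
 "keeps a (R, M) (R', M') ==> rep M (R 1) p x ==> rep M' (R' 1) p x"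
 by (auto simp: keeps_def intro: rep_mono)

definition computes :: "nat => com => ('a::data => 'b::data) => ('a => nat) => bool" where
 "computes a c f T \<longleftrightarrow> (\<forall>R M x. 0 < R 1 \<and> rep M (R 1) (R a) x -->
   (\<exists>t R' M'. t <= T x \<and> runs c (R, M) t (R', M') \<and> keeps a (R, M) (R', M') \<and>
    rep M' (R' 1) (R' a) (f x)))"

text \<open>The program may depend on the base register, the time bound may not. The size of the
  result is bounded separately because heap values share cells: by repeatedly pairing a value with
  itself, a fast program can represent a value whose size as a tree is exponential in the running
  time.\<close>

definition pt :: "('a::data => 'b::data) => bool" where
 "pt f \<longleftrightarrow> pbd (%x. sz (f x)) \<and> (\<exists>T. pbd T \<and> (\<forall>a\<ge>2. \<exists>c. computes a c f T))"

lemma ptI: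
 assumes "pbd (%x. sz (f x))" "pbd T" "\<And>a. a \<ge> 2 ==> \<exists>c. computes a c f T"
 shows "pt f"
 using assms by (auto simp: pt_def)

lemma pt_sz: "pt f ==> pbd (%x. sz (f x))"
 by (simp add: pt_def)

lemma computesI:
 assumes "\<And>R M x. 0 < R 1 ==> rep M (R 1) (R a) x ==>
   \<exists>t R' M'. t <= T x \<and> runs c (R, M) t (R', M') \<and> keeps a (R, M) (R', M') \<and>
    rep M' (R' 1) (R' a) (f x)"
 shows "computes a c f T"
 using assms by (auto simp: computes_def)

lemma outcomeI:
 "runs c (R, M) t (R', M') ==> t <= T ==> keeps a (R, M) (R', M') ==> rep M' (R' 1) (R' a) y ==>
  \<exists>t R' M'. t <= T \<and> runs c (R, M) t (R', M') \<and> keeps a (R, M) (R', M') \<and> rep M' (R' 1) (R' a) y"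
 by blast

lemma computesE:
 assumes "computes a c f T" "0 < R 1" "rep M (R 1) (R a) x"
 obtains t R' M' where "t <= T x" "runs c (R, M) t (R', M')" "keeps a (R, M) (R', M')"
  "rep M' (R' 1) (R' a) (f x)" "0 < R' 1"
proof -
 from assms obtain t R' M' where *: "t <= T x" "runs c (R, M) t (R', M')" "keeps a (R, M) (R', M')"
  "rep M' (R' 1) (R' a) (f x)"
  unfolding computes_def by blast
 moreover have "0 < R' 1" using *(3) assms(2) by (auto simp: keeps_def)
 ultimately show ?thesis using that by blast
qed

lemma pt_block:
 fixes f :: "'a::data => 'b::data"
 assumes "pbd (%x. sz (f x))"
  and "\<And>a. list_all basic (cs a)" "\<And>a. cs a \<noteq> []" "\<And>a. length (cs a) = l"
  and "\<And>a R M x. a \<ge> 2 ==> 0 < R 1 ==> rep M (R 1) (R a) x ==>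
    keeps a (R, M) (fold bstep (cs a) (R, M)) \<and>
    rep (snd (fold bstep (cs a) (R, M))) (fst (fold bstep (cs a) (R, M)) 1)
     (fst (fold bstep (cs a) (R, M)) a) (f x)"
 shows "pt f"
proof (rule ptI[OF assms(1) pbd_const[of "2 * l"]])
 fix a :: nat assume a: "a \<ge> 2"
 show "\<exists>c. computes a c f (%x. 2 * l)"
 proof (rule exI, rule computesI)
  fix R M and x :: 'a assume x: "0 < R 1" "rep M (R 1) (R a) x"
  obtain R' M' where e: "fold bstep (cs a) (R, M) = (R', M')" by force
  show "\<exists>t R' M'. t <= 2 * l \<and> runs (block (cs a)) (R, M) t (R', M') \<and> keeps a (R, M) (R', M') \<and>
    rep M' (R' 1) (R' a) (f x)"
   using runs_blockI[OF assms(2,3) e] assms(5)[OF a x] assms(4)[of a] unfolding e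
   by (intro exI[of _ "2 * l - 1"] exI[of _ R'] exI[of _ M']) simp
 qed
qed

lemma pt_id: "pt (%x. x)"
 by (rule pt_block[where cs = "%a. [Const 0 0]" and l = 1]) (auto simp: keeps_def pbd_sz)

lemma pt_compose:
 fixes f :: "'a::data => 'b::data"
 assumes "pt g" "pt f"
 shows "pt (%x. g (f x))"
proof -
 obtain Tg where Tg: "pbd Tg" "\<And>a. a \<ge> 2 ==> \<exists>c. computes a c g Tg"
  using assms(1) by (auto simp: pt_def)
 obtain Tf where Tf: "pbd Tf" "\<And>a. a \<ge> 2 ==> \<exists>c. computes a c f Tf"
  using assms(2) by (auto simp: pt_def)
 show ?thesis
 proof (rule ptI)
  show "pbd (%x. sz (g (f x)))"
   using pbd_comp[OF pt_sz[OF assms(1)] pt_sz[OF assms(2)]] .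
  show "pbd (%x. 1 + (Tf x + Tg (f x)))"
   by (intro pbd_add pbd_const Tf pbd_comp[OF Tg(1)] pt_sz assms)
  fix a :: nat assume a: "a \<ge> 2"
  obtain cf cg where c: "computes a cf f Tf" "computes a cg g Tg" using Tf(2) Tg(2) a by blast
  show "\<exists>c. computes a c (%x. g (f x)) (%x. 1 + (Tf x + Tg (f x)))"
  proof (rule exI, rule computesI)
   fix R M and x :: 'a assume x: "0 < R 1" "rep M (R 1) (R a) x"
   obtain t1 R1 M1 where 1: "t1 <= Tf x" "runs cf (R, M) t1 (R1, M1)" "keeps a (R, M) (R1, M1)"
    "rep M1 (R1 1) (R1 a) (f x)" "0 < R1 1" using computesE[where x=x, OF c(1) x] by blast
   obtain t2 R2 M2 where 2: "t2 <= Tg (f x)" "runs cg (R1, M1) t2 (R2, M2)" "keeps a (R1, M1) (R2, M2)"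
    "rep M2 (R2 1) (R2 a) (g (f x))" using computesE[where x="f x", OF c(2) 1(5,4)] by blast
   show "\<exists>t R' M'. t <= 1 + (Tf x + Tg (f x)) \<and> runs (Seq cf cg) (R, M) t (R', M') \<and> keeps a (R, M) (R', M') \<and>
    rep M' (R' 1) (R' a) (g (f x))"
    using runs_Seq[OF 1(2) 2(2)] 1(1) 2(1) keeps_trans[OF 1(3) 2(3)] 2(4)
    by (intro exI[of _ "Suc (t1 + t2)"] exI[of _ R2] exI[of _ M2]) auto
  qed
 qed
qed

lemma pt_fst': "pt (fst :: 'a::data \<times> 'b::data => 'a)"
proof (rule pt_block[where cs = "%a. [Load a a]" and l = 1])
 show "pbd (%x :: 'a \<times> 'b. sz (fst x))" by (rule pbd_mono[OF pbd_sz]) (simp add: sz_prod_def)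
qed (auto simp: keeps_def rep_prod_def)

lemma pt_snd': "pt (snd :: 'a::data \<times> 'b::data => 'b)"
proof (rule pt_block[where cs = "%a. [Const 0 1, Add a a 0, Load a a]" and l = 3])
 show "pbd (%x :: 'a \<times> 'b. sz (snd x))" by (rule pbd_mono[OF pbd_sz]) (simp add: sz_prod_def)
qed (auto simp: keeps_def rep_prod_def)

text \<open>The argument stays in register \<open>a\<close> while \<open>f\<close> runs with base
  \<open>a + 1\<close> and \<open>g\<close> with base \<open>a + 2\<close>. When \<open>g\<close>
  starts, the cells of the first result lie below the free pointer, so they survive.\<close>

lemma pt_Pair:
 fixes f :: "'a::data => 'b::data" and g :: "'a => 'c::data"
 assumes "pt f" "pt g"
 shows "pt (%x. (f x, g x))"
proof -
 obtain Tg where Tg: "pbd Tg" "\<And>a. a \<ge> 2 ==> \<exists>c. computes a c g Tg"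
  using assms(2) by (auto simp: pt_def)
 obtain Tf where Tf: "pbd Tf" "\<And>a. a \<ge> 2 ==> \<exists>c. computes a c f Tf"
  using assms(1) by (auto simp: pt_def)
 show ?thesis
 proof (rule ptI)
  show "pbd (%x. sz (f x, g x))" using pt_sz[OF assms(1)] pt_sz[OF assms(2)] by auto
  show "pbd (%x. 30 + (Tf x + Tg x))" by (intro pbd_add pbd_const Tf Tg)
  fix a :: nat assume a: "a \<ge> 2"
  obtain cf cg where c: "computes (a+1) cf f Tf" "computes (a+2) cg g Tg"
   using Tf(2)[of "a+1"] Tg(2)[of "a+2"] a by auto
  define b1 where "b1 = [Const 0 0, Add (a+1) a 0]"
  define b2 where "b2 = [Const 0 0, Add (a+2) a 0]"
  define b3 where "b3 = [Const 0 0, Add a 1 0, Store 1 (a+1), Const 0 1, Add 1 1 0, Store 1 (a+2), Add 1 1 0]"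
  let ?c = "Seq (block b1) (Seq cf (Seq (block b2) (Seq cg (block b3))))"
  show "\<exists>c. computes a c (%x. (f x, g x)) (%x. 30 + (Tf x + Tg x))"
  proof (rule exI, rule computesI)
   fix R M and x :: 'a assume x: "0 < R 1" "rep M (R 1) (R a) x"
   let ?R0 = "R(0 := 0, a+1 := R a)"
   have r1: "runs (block b1) (R, M) 3 (?R0, M)"
    using runs_blockI[of b1 "(R, M)"] a by (simp add: b1_def)
   have k1: "keeps (a+1) (R, M) (?R0, M)" using a by (auto simp: keeps_def)
   have "0 < ?R0 1" "rep M (?R0 1) (?R0 (a+1)) x" using x a by auto
   from computesE[OF c(1) this] obtain t1 R1 M1 where 1: "t1 <= Tf x" "runs cf (?R0, M) t1 (R1, M1)"
     "keeps (a+1) (?R0, M) (R1, M1)" "rep M1 (R1 1) (R1 (a+1)) (f x)" "0 < R1 1" by blast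
   have kk1: "keeps (a+1) (R, M) (R1, M1)" using keeps_trans[OF k1 1(3)] by simp
   have x1: "rep M1 (R1 1) (R a) x" using keeps_rep[OF kk1 x(2)] .
   have a1: "R1 a = R a" using kk1 a by (auto simp: keeps_def)
   let ?R2 = "R1(0 := 0, a+2 := R1 a)"
   have r2: "runs (block b2) (R1, M1) 3 (?R2, M1)"
    using runs_blockI[of b2 "(R1, M1)"] a by (simp add: b2_def)
   have k2: "keeps (a+2) (R1, M1) (?R2, M1)" using a by (auto simp: keeps_def)
   have "0 < ?R2 1" "rep M1 (?R2 1) (?R2 (a+2)) x" using 1 x1 a1 a by auto
   from computesE[OF c(2) this] obtain t2 R3 M3 where 2: "t2 <= Tg x" "runs cg (?R2, M1) t2 (R3, M3)"
     "keeps (a+2) (?R2, M1) (R3, M3)" "rep M3 (R3 1) (R3 (a+2)) (g x)" "0 < R3 1" by blast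
   have kk2: "keeps (a+2) (R1, M1) (R3, M3)" using keeps_trans[OF k2 2(3)] by simp
   have f3: "rep M3 (R3 1) (R1 (a+1)) (f x)" using keeps_rep[OF kk2 1(4)] .
   have a3: "R3 (a+1) = R1 (a+1)" using kk2 a by (auto simp: keeps_def)
   let ?F = "R3 1"
   let ?M4 = "M3(?F := R3 (a+1), Suc ?F := R3 (a+2))"
   let ?R4 = "R3(0 := 1, a := ?F, 1 := Suc (Suc ?F))"
   have r3: "runs (block b3) (R3, M3) 13 (?R4, ?M4)"
    using runs_blockI[of b3 "(R3, M3)"] a by (simp add: b3_def fun_upd_twist)
   have k3: "keeps a (R3, M3) (?R4, ?M4)" using a by (auto simp: keeps_def)
   have rp: "rep ?M4 (?R4 1) (?R4 a) (f x, g x)"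
    using a 2(5) rep_mono[OF f3, of "Suc (Suc ?F)" ?M4] rep_mono[OF 2(4), of "Suc (Suc ?F)" ?M4] a3
    by (auto simp: rep_prod_def)
   have kk: "keeps a (R, M) (?R4, ?M4)"
    using keeps_trans[OF keeps_trans[OF kk1 kk2] k3] kk1 kk2 k3 by (auto simp: keeps_def)
   have rr: "runs ?c (R, M) (Suc (3 + (Suc (t1 + (Suc (3 + Suc (t2 + 13))))))) (?R4, ?M4)"
    by (intro runs_Seq[OF r1] runs_Seq[OF 1(2)] runs_Seq[OF r2] runs_Seq[OF 2(2)] r3)
   show "\<exists>t R' M'. t <= 30 + (Tf x + Tg x) \<and> runs ?c (R, M) t (R', M') \<and> keeps a (R, M) (R', M') \<and>
    rep M' (R' 1) (R' a) (f x, g x)"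
    using 1(1) 2(1) by (intro outcomeI[OF rr _ kk rp]) simp
  qed
 qed
qed

lemma pt_if:
 fixes f :: "'a::data => 'b::data"
 assumes "pt b" "pt f" "pt g"
 shows "pt (%x. if b x then f x else g x)"
proof -
 obtain Tg where Tg: "pbd Tg" "\<And>a. a \<ge> 2 ==> \<exists>c. computes a c g Tg"
  using assms(3) by (auto simp: pt_def)
 obtain Tf where Tf: "pbd Tf" "\<And>a. a \<ge> 2 ==> \<exists>c. computes a c f Tf"
  using assms(2) by (auto simp: pt_def)
 obtain Tb where Tb: "pbd Tb" "\<And>a. a \<ge> 2 ==> \<exists>c. computes a c b Tb"
  using assms(1) by (auto simp: pt_def)
 show ?thesis
 proof (rule ptI)
  show "pbd (%x. sz (if b x then f x else g x))"
   by (rule pbd_mono[OF pbd_add[OF pt_sz[OF assms(2)] pt_sz[OF assms(3)]]]) simp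
  show "pbd (%x. 30 + (Tb x + (Tf x + Tg x)))" by (intro pbd_add pbd_const Tf Tg Tb)
  fix a :: nat assume a: "a \<ge> 2"
  obtain cb cf cg where c: "computes (a+1) cb b Tb" "computes a cf f Tf" "computes a cg g Tg"
   using Tb(2)[of "a+1"] Tf(2)[of a] Tg(2)[of a] a by auto
  define b1 where "b1 = [Const 0 0, Add (a+1) a 0]"
  let ?c = "Seq (block b1) (Seq cb (Cond (a+1) cf cg))"
  show "\<exists>c. computes a c (%x. if b x then f x else g x) (%x. 30 + (Tb x + (Tf x + Tg x)))"
  proof (rule exI, rule computesI)
   fix R M and x :: 'a assume x: "0 < R 1" "rep M (R 1) (R a) x"
   let ?R0 = "R(0 := 0, a+1 := R a)"
   have r1: "runs (block b1) (R, M) 3 (?R0, M)"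
    using runs_blockI[of b1 "(R, M)"] a by (simp add: b1_def)
   have k1: "keeps (a+1) (R, M) (?R0, M)" using a by (auto simp: keeps_def)
   have "0 < ?R0 1" "rep M (?R0 1) (?R0 (a+1)) x" using x a by auto
   from computesE[OF c(1) this] obtain t1 R1 M1 where 1: "t1 <= Tb x" "runs cb (?R0, M) t1 (R1, M1)"
     "keeps (a+1) (?R0, M) (R1, M1)" "rep M1 (R1 1) (R1 (a+1)) (b x)" "0 < R1 1" by blast
   have kk1: "keeps (a+1) (R, M) (R1, M1)" using keeps_trans[OF k1 1(3)] by simp
   have a1: "R1 a = R a" using kk1 a by (auto simp: keeps_def)
   have x1: "rep M1 (R1 1) (R1 a) x" using keeps_rep[OF kk1 x(2)] a1 by simp
   have b1: "R1 (a+1) \<noteq> 0 \<longleftrightarrow> b x" using 1(4) by (simp add: rep_bool_def)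
   obtain t2 R2 M2 where 2: "t2 <= Tf x + Tg x" "runs (if R1 (a+1) \<noteq> 0 then cf else cg) (R1, M1) t2 (R2, M2)"
     "keeps a (R1, M1) (R2, M2)" "rep M2 (R2 1) (R2 a) (if b x then f x else g x)"
   proof (cases "b x")
    case True
    from computesE[OF c(2) 1(5) x1] obtain t2 R2 M2 where "t2 <= Tf x" "runs cf (R1, M1) t2 (R2, M2)"
     "keeps a (R1, M1) (R2, M2)" "rep M2 (R2 1) (R2 a) (f x)" by blast
    with True b1 show ?thesis by (intro that[of t2 R2 M2]) auto
   next
    case False
    from computesE[OF c(3) 1(5) x1] obtain t2 R2 M2 where "t2 <= Tg x" "runs cg (R1, M1) t2 (R2, M2)"
     "keeps a (R1, M1) (R2, M2)" "rep M2 (R2 1) (R2 a) (g x)" by blast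
    with False b1 show ?thesis by (intro that[of t2 R2 M2]) auto
   qed
   have rr: "runs ?c (R, M) (Suc (3 + (Suc (t1 + Suc t2)))) (R2, M2)"
    by (intro runs_Seq[OF r1] runs_Seq[OF 1(2)] runs_Cond 2(2))
   have kk: "keeps a (R, M) (R2, M2)"
    using kk1 2(3) by (auto simp: keeps_def)
   show "\<exists>t R' M'. t <= 30 + (Tb x + (Tf x + Tg x)) \<and> runs ?c (R, M) t (R', M') \<and> keeps a (R, M) (R', M') \<and>
    rep M' (R' 1) (R' a) (if b x then f x else g x)"
    using 2(1) 1(1) by (intro outcomeI[OF rr _ kk 2(4)]) simp
  qed
 qed
qed

section \<open>Arithmetic, tests and constructors as machine programs\<close>

lemma sz_nat_add_le: "sz (m + n :: nat) <= sz m + sz n"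
proof -
 have b: "x < 2 ^ floorlog 2 x" for x :: nat
  using floorlog_leD[of 2 x "floorlog 2 x"] by simp
 have "m + n < 2 ^ (floorlog 2 m + floorlog 2 n + 1)"
 proof -
  have "m + n < 2 ^ floorlog 2 m + 2 ^ floorlog 2 n" using b[of m] b[of n] by simp
  also have "\<dots> <= 2 ^ (floorlog 2 m + floorlog 2 n) + 2 ^ (floorlog 2 m + floorlog 2 n)"
   by (intro add_mono power_increasing) auto
  finally show ?thesis by simp
 qed
 then have "floorlog 2 (m + n) <= floorlog 2 m + floorlog 2 n + 1"
  by (intro floorlog_leI) auto
 then show ?thesis by (simp add: sz_nat_def)
qed

lemma sz_nat_mult_le: "sz (m * n :: nat) <= sz m + sz n"
proof -
 have b: "x < 2 ^ floorlog 2 x" for x :: nat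
  using floorlog_leD[of 2 x "floorlog 2 x"] by simp
 have "m * n < 2 ^ (floorlog 2 m + floorlog 2 n)"
  using mult_strict_mono[OF b[of m] b[of n]] by (simp add: power_add)
 then have "floorlog 2 (m * n) <= floorlog 2 m + floorlog 2 n"
  by (intro floorlog_leI) auto
 then show ?thesis by (simp add: sz_nat_def)
qed

lemma sz_nat_mono: "m <= n ==> sz (m::nat) <= sz n"
 by (simp add: sz_nat_def floorlog_mono)

lemma pt_nat_const: "pt (%x. k :: nat)"
 by (rule pt_block[where cs = "%a. [Const a k]" and l = 1]) (auto simp: keeps_def rep_nat_def)

lemma pt_True: "pt (%x. True)"
 by (rule pt_block[where cs = "%a. [Const a 1]" and l = 1]) (auto simp: keeps_def rep_bool_def)

lemma pt_False: "pt (%x. False)"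
 by (rule pt_block[where cs = "%a. [Const a 0]" and l = 1]) (auto simp: keeps_def rep_bool_def)

lemma pt_Nil: "pt (%x. [])"
 by (rule pt_block[where cs = "%a. [Const a 0]" and l = 1]) (auto simp: keeps_def)

lemma pt_add': "pt (%x. fst x + snd x :: nat)"
proof (rule pt_block[where cs = "%a. [Const 0 1, Load (a+1) a, Add a a 0, Load a a, Add a (a+1) a]" and l = 5])
 show "pbd (%x. sz (fst x + snd x :: nat))"
  by (rule pbd_mono[OF pbd_sz]) (auto simp: sz_nat_add_le)
qed (auto simp: keeps_def rep_prod_def rep_nat_def)

lemma pt_sub': "pt (%x. fst x - snd x :: nat)"
proof (rule pt_block[where cs = "%a. [Const 0 1, Load (a+1) a, Add a a 0, Load a a, Sub a (a+1) a]" and l = 5])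
 show "pbd (%x. sz (fst x - snd x :: nat))"
 proof (rule pbd_mono[OF pbd_sz])
  fix x :: "nat \<times> nat"
  show "sz (fst x - snd x) <= sz x" using sz_nat_mono[of "fst x - snd x" "fst x"] by (simp add: sz_prod_def)
 qed
qed (auto simp: keeps_def rep_prod_def rep_nat_def)

lemma pt_half': "pt (%x. x div 2 :: nat)"
proof (rule pt_block[where cs = "%a. [Half a a]" and l = 1])
 show "pbd (%x. sz (x div 2 :: nat))" by (rule pbd_mono[OF pbd_sz]) (auto intro: sz_nat_mono)
qed (auto simp: keeps_def rep_nat_def)

text \<open>A cons cell has the layout of a pair of head and tail, so nothing has to be computed;
  the assignment to the scratch register stands for the empty program.\<close>

lemma pt_Cons': "pt (%x. fst x # snd x)"
proof (rule pt_block[where cs = "%a. [Const 0 0]" and l = 1])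
 show "pbd (%x :: 'a \<times> 'a list. sz (fst x # snd x))" by (rule pbd_mono[OF pbd_sz]) (simp add: sz_prod_def)
qed (auto simp: keeps_def rep_prod_def)

lemma pt_is0': "pt (%x::nat. x = 0)"
 by (rule pt_block[where cs = "%a. [Const 0 1, Sub a 0 a]" and l = 2])
  (auto simp: keeps_def rep_nat_def rep_bool_def)

lemma pt_null': "pt (%x :: 'a::data list. x = [])"
proof (rule pt_block[where cs = "%a. [Const 0 1, Sub a 0 a]" and l = 2])
 fix a R M and x :: "'a list" assume "a \<ge> (2::nat)" "0 < R 1" "rep M (R 1) (R a) x"
 then show "keeps a (R, M) (fold bstep [Const 0 1, Sub a 0 a] (R, M)) \<and>
    rep (snd (fold bstep [Const 0 1, Sub a 0 a] (R, M))) (fst (fold bstep [Const 0 1, Sub a 0 a] (R, M)) 1)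
     (fst (fold bstep [Const 0 1, Sub a 0 a] (R, M)) a) (x = [])"
  by (cases x) (auto simp: keeps_def rep_bool_def)
qed auto

lemma pbd_power [intro]: "pbd f ==> pbd (%x. f x ^ k)"
 by (induction k) auto

text \<open>Register \<open>a\<close> holds the parameter \<open>x\<close>, \<open>a + 1\<close> the
  remaining list and \<open>a + 2\<close> the accumulator. The block \<open>b1\<close> allocates the
  nested pair \<open>(x, (y, s))\<close> that the step program expects in \<open>a + 3\<close>;
  \<open>b2\<close> moves the result back and advances the list. The bound \<open>B\<close> concerns
  the step times along this particular run only.\<close>

lemma fold_loop:
 fixes h :: "'x::data => 'y::data => 's::data => 's" and x :: 'x
 assumes c: "computes (a+3) c (%p. h (fst p) (fst (snd p)) (snd (snd p))) T" and a: "a \<ge> 2"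
  and b1: "b1 = [Load 0 (a+1), Store 1 0, Const (a+3) 0, Add (a+4) 1 (a+3), Const 0 1, Add 1 1 0,
    Store 1 (a+2), Add 1 1 0, Add (a+3) 1 (a+3), Store 1 a, Add 1 1 0, Store 1 (a+4), Add 1 1 0]"
  and b2: "b2 = [Const 0 0, Add (a+2) (a+3) 0, Const 0 1, Add (a+1) (a+1) 0, Load (a+1) (a+1)]"
  and body: "body = Seq (block b1) (Seq c (block b2))"
 shows "0 < R 1 ==> rep M (R 1) (R a) x ==> rep M (R 1) (R (a+1)) ys ==> rep M (R 1) (R (a+2)) s ==>
  (\<And>i. i < length ys ==> T (x, (ys ! i, fold (h x) (take i ys) s)) <= B) ==>
  \<exists>t R' M'. t <= 1 + length ys * (B + 50) \<and> runs (While (a+1) body) (R, M) t (R', M') \<and>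
   keeps (a+1) (R, M) (R', M') \<and> rep M' (R' 1) (R' (a+2)) (fold (h x) ys s)"
proof (induction ys arbitrary: R M s)
 case Nil
 then have "runs (While (a+1) body) (R, M) 1 (R, M)" by (intro runs_While_done) simp
 with Nil show ?case by (intro exI[of _ 1] exI[of _ R] exI[of _ M]) (auto simp: keeps_refl)
next
 case (Cons y ys)
 let ?F = "R 1"
 let ?R1 = "R(0 := 1, a+3 := ?F + 2, a+4 := ?F, 1 := ?F + 4)"
 let ?M1 = "M(?F := M (R (a+1)), ?F+1 := R (a+2), ?F+2 := R a, ?F+3 := ?F)"
 have r1: "runs (block b1) (R, M) 25 (?R1, ?M1)"
 proof -
  have "fold bstep b1 (R, M) = (?R1, ?M1)"
   using a by (simp add: b1 fun_eq_iff)
  from runs_blockI[OF _ _ this] show ?thesis by (simp add: b1)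
 qed
 have k1: "keeps (a+3) (R, M) (?R1, ?M1)" using a by (auto simp: keeps_def)
 have rp: "rep ?M1 (?R1 1) p v" if "rep M (R 1) p v" for p and v :: "'v::data"
  using keeps_rep[OF k1 that] .
 have p1: "0 < ?R1 1" using a by simp
 have q1: "rep ?M1 (?R1 1) (?R1 (a+3)) (x, (y, s))"
  using rp[OF Cons.prems(2)] rp[OF Cons.prems(4)] rp[of "M (R (a+1))" y] Cons.prems(1,3) a
  by (simp add: rep_prod_def)
 obtain t2 R2 M2 where 2: "t2 <= T (x, (y, s))" "runs c (?R1, ?M1) t2 (R2, M2)"
  "keeps (a+3) (?R1, ?M1) (R2, M2)" "rep M2 (R2 1) (R2 (a+3)) (h x y s)" "0 < R2 1"
  using computesE[OF c p1 q1, unfolded fst_conv snd_conv] by blast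
 have k2: "keeps (a+3) (R, M) (R2, M2)" using keeps_trans[OF k1 2(3)] by simp
 have eq: "R2 a = R a" "R2 (a+1) = R (a+1)" using k2 a by (auto simp: keeps_def)
 have ys: "rep M2 (R2 1) (R (a+1)) (y # ys)" using keeps_rep[OF k2 Cons.prems(3)] .
 let ?R3 = "R2(0 := 1, a+2 := R2 (a+3), a+1 := M2 (Suc (R (a+1))))"
 have r3: "runs (block b2) (R2, M2) 9 (?R3, M2)"
 proof -
  have "fold bstep b2 (R2, M2) = (?R3, M2)"
   using a eq by (simp add: b2 fun_eq_iff)
  from runs_blockI[OF _ _ this] show ?thesis by (simp add: b2)
 qed
 have rb: "runs body (R, M) (Suc (25 + Suc (t2 + 9))) (?R3, M2)"
  unfolding body by (intro runs_Seq[OF r1] runs_Seq[OF 2(2)] r3)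
 have k3: "keeps (a+1) (R, M) (?R3, M2)" using k2 a by (auto simp: keeps_def)
 have "\<exists>t R' M'. t <= 1 + length ys * (B + 50) \<and> runs (While (a+1) body) (?R3, M2) t (R', M') \<and>
   keeps (a+1) (?R3, M2) (R', M') \<and> rep M' (R' 1) (R' (a+2)) (fold (h x) ys (h x y s))"
 proof (rule Cons.IH)
  show "0 < ?R3 1" using 2(5) a by simp
  show "rep M2 (?R3 1) (?R3 a) x" using keeps_rep[OF k2 Cons.prems(2)] eq a by simp
  show "rep M2 (?R3 1) (?R3 (a+1)) ys" using ys a by simp
  show "rep M2 (?R3 1) (?R3 (a+2)) (h x y s)" using 2(4) a by simp
  show "T (x, ys ! i, fold (h x) (take i ys) (h x y s)) <= B" if "i < length ys" for i
   using Cons.prems(5)[of "Suc i"] that by simp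
 qed
 then obtain t R' M' where 4: "t <= 1 + length ys * (B + 50)" "runs (While (a+1) body) (?R3, M2) t (R', M')"
   "keeps (a+1) (?R3, M2) (R', M')" "rep M' (R' 1) (R' (a+2)) (fold (h x) ys (h x y s))" by blast
 have rr: "runs (While (a+1) body) (R, M) (Suc (Suc (25 + Suc (t2 + 9)) + t)) (R', M')"
  using Cons.prems(3) by (intro runs_While_step[OF _ rb 4(2)]) simp
 have "t2 <= B" using Cons.prems(5)[of 0] 2(1) by simp
 then show ?case using rr keeps_trans[OF k3 4(3)] 4(1,4)
  by (intro exI[of _ "Suc (Suc (25 + Suc (t2 + 9)) + t)"] exI[of _ R'] exI[of _ M']) simp
qed

text \<open>Bounded recursion in the style of Cobham: a polynomial-time step that is iterated
  polynomially often may still blow up its state, for instance by squaring a number in every round.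
  Therefore the states after all prefixes of the list need a polynomial bound \<open>B\<close>. The
  loops of the algorithms are instances of this rule.\<close>

lemma pt_fold:
 fixes h :: "'x::data => 'y::data => 's::data => 's"
 assumes l: "pt l" and s: "pt s" and h: "pt (%p. h (fst p) (fst (snd p)) (snd (snd p)))"
  and B: "pbd B" "\<And>x n. n <= length (l x) ==> sz (fold (h x) (take n (l x)) (s x)) <= B x"
 shows "pt (%x. fold (h x) (l x) (s x))"
proof -
 obtain Tl where Tl: "pbd Tl" "\<And>a. a \<ge> 2 ==> \<exists>c. computes a c l Tl"
  using l by (auto simp: pt_def)
 obtain Ts where Ts: "pbd Ts" "\<And>a. a \<ge> 2 ==> \<exists>c. computes a c s Ts"
  using s by (auto simp: pt_def)
 obtain Th where Th: "pbd Th"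
  "\<And>a. a \<ge> 2 ==> \<exists>c. computes a c (%p. h (fst p) (fst (snd p)) (snd (snd p))) Th"
  using h unfolding pt_def by blast
 obtain k where k: "\<And>z. Th z <= k * sz z ^ k" using Th(1) unfolding pbd_def by blast
 let ?B = "%x. k * (sz x + (sz (l x) + B x)) ^ k"
 let ?T = "%x. 60 + (Tl x + Ts x + sz (l x) * (?B x + 50))"
 show ?thesis
 proof (rule ptI)
  show "pbd (%x. sz (fold (h x) (l x) (s x)))"
   by (rule pbd_mono[OF B(1)]) (use B(2)[OF order_refl] in simp)
  show "pbd ?T" by (intro pbd_add pbd_const Tl Ts pbd_mult pbd_power pt_sz l B pbd_sz)
  fix a :: nat assume a: "a \<ge> 2"
  obtain cl cs ch where c: "computes (a+1) cl l Tl" "computes (a+2) cs s Ts"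
   "computes (a+3) ch (%p. h (fst p) (fst (snd p)) (snd (snd p))) Th"
   using Tl(2)[of "a+1"] Ts(2)[of "a+2"] Th(2)[of "a+3"] a by auto
  define b1 where "b1 = [Const 0 0, Add (a+1) a 0]"
  define b2 where "b2 = [Const 0 0, Add (a+2) a 0]"
  define b3 where "b3 = [Const 0 0, Add a (a+2) 0]"
  define d1 where "d1 = [Load 0 (a+1), Store 1 0, Const (a+3) 0, Add (a+4) 1 (a+3), Const 0 1, Add 1 1 0,
    Store 1 (a+2), Add 1 1 0, Add (a+3) 1 (a+3), Store 1 a, Add 1 1 0, Store 1 (a+4), Add 1 1 0]"
  define d2 where "d2 = [Const 0 0, Add (a+2) (a+3) 0, Const 0 1, Add (a+1) (a+1) 0, Load (a+1) (a+1)]"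
  define body where "body = Seq (block d1) (Seq ch (block d2))"
  note loop = fold_loop[OF c(3) a d1_def d2_def body_def]
  let ?c = "Seq (block b1) (Seq cl (Seq (block b2) (Seq cs (Seq (While (a+1) body) (block b3)))))"
  show "\<exists>c. computes a c (%x. fold (h x) (l x) (s x)) ?T"
  proof (rule exI, rule computesI)
   fix R M and x :: 'x assume x: "0 < R 1" "rep M (R 1) (R a) x"
   let ?R0 = "R(0 := 0, a+1 := R a)"
   have r1: "runs (block b1) (R, M) 3 (?R0, M)"
    using runs_blockI[of b1 "(R, M)"] a by (simp add: b1_def)
   have k1: "keeps (a+1) (R, M) (?R0, M)" using a by (auto simp: keeps_def)
   have "0 < ?R0 1" "rep M (?R0 1) (?R0 (a+1)) x" using x a by auto
   from computesE[OF c(1) this] obtain t1 R1 M1 where 1: "t1 <= Tl x" "runs cl (?R0, M) t1 (R1, M1)"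
     "keeps (a+1) (?R0, M) (R1, M1)" "rep M1 (R1 1) (R1 (a+1)) (l x)" "0 < R1 1" by blast
   have kk1: "keeps (a+1) (R, M) (R1, M1)" using keeps_trans[OF k1 1(3)] by simp
   have x1: "rep M1 (R1 1) (R a) x" using keeps_rep[OF kk1 x(2)] .
   have a1: "R1 a = R a" using kk1 a by (auto simp: keeps_def)
   let ?R2 = "R1(0 := 0, a+2 := R1 a)"
   have r2: "runs (block b2) (R1, M1) 3 (?R2, M1)"
    using runs_blockI[of b2 "(R1, M1)"] a by (simp add: b2_def)
   have k2: "keeps (a+2) (R1, M1) (?R2, M1)" using a by (auto simp: keeps_def)
   have "0 < ?R2 1" "rep M1 (?R2 1) (?R2 (a+2)) x" using 1 x1 a1 a by auto
   from computesE[OF c(2) this] obtain t2 R3 M3 where 2: "t2 <= Ts x" "runs cs (?R2, M1) t2 (R3, M3)"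
     "keeps (a+2) (?R2, M1) (R3, M3)" "rep M3 (R3 1) (R3 (a+2)) (s x)" "0 < R3 1" by blast
   have kk2: "keeps (a+2) (R1, M1) (R3, M3)" using keeps_trans[OF k2 2(3)] by simp
   have a3: "R3 (a+1) = R1 (a+1)" "R3 a = R a" using kk2 a a1 by (auto simp: keeps_def)
   have "rep M3 (R3 1) (R3 (a+1)) (l x)" using keeps_rep[OF kk2 1(4)] a3 by simp
   moreover have "rep M3 (R3 1) (R3 a) x" using keeps_rep[OF kk2 x1] a3 by simp
   moreover have "Th (x, l x ! i, fold (h x) (take i (l x)) (s x)) <= ?B x" if i: "i < length (l x)" for i
   proof -
    have "sz (x, l x ! i, fold (h x) (take i (l x)) (s x)) <= sz x + (sz (l x) + B x)"
     using B(2)[of i x] i sz_mem[of "l x ! i" "l x"] by simp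
    then show ?thesis using k[of "(x, l x ! i, fold (h x) (take i (l x)) (s x))"]
     by (meson le_trans mult_le_mono2 power_mono zero_le)
   qed
   ultimately obtain t4 R4 M4 where 4: "t4 <= 1 + length (l x) * (?B x + 50)"
    "runs (While (a+1) body) (R3, M3) t4 (R4, M4)" "keeps (a+1) (R3, M3) (R4, M4)"
    "rep M4 (R4 1) (R4 (a+2)) (fold (h x) (l x) (s x))"
    using loop[of R3 M3 x "l x" "s x" "?B x"] 2(4,5) by blast
   let ?R5 = "R4(0 := 0, a := R4 (a+2))"
   have r5: "runs (block b3) (R4, M4) 3 (?R5, M4)"
    using runs_blockI[of b3 "(R4, M4)"] a by (simp add: b3_def)
   have rp: "rep M4 (?R5 1) (?R5 a) (fold (h x) (l x) (s x))" using 4(4) a by simp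
   have kk: "keeps a (R, M) (?R5, M4)" using kk1 kk2 4(3) a by (auto simp: keeps_def)
   have rr: "runs ?c (R, M) (Suc (3 + (Suc (t1 + (Suc (3 + Suc (t2 + Suc (t4 + 3)))))))) (?R5, M4)"
    by (intro runs_Seq[OF r1] runs_Seq[OF 1(2)] runs_Seq[OF r2] runs_Seq[OF 2(2)] runs_Seq[OF 4(2)] r5)
   have "length (l x) * (?B x + 50) <= sz (l x) * (?B x + 50)"
    using length_le_sz[of "l x"] by (intro mult_le_mono1) simp
   then show "\<exists>t R' M'. t <= ?T x \<and> runs ?c (R, M) t (R', M') \<and> keeps a (R, M) (R', M') \<and>
    rep M' (R' 1) (R' a) (fold (h x) (l x) (s x))"
    using 1(1) 2(1) 4(1) by (intro outcomeI[OF rr _ kk rp]) linarith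
  qed
 qed
qed

text \<open>Most significant bit first, which is the order that consing the parities while halving
  produces. The list turns the bit length of a number into something a fold can run along.\<close>

fun bits :: "nat => bool list" where
 "bits n = (if n = 0 then [] else bits (n div 2) @ [odd n])"

declare bits.simps [simp del]

lemma bits_0 [simp]: "bits 0 = []" by (simp add: bits.simps)

lemma length_bits: "length (bits n) = floorlog 2 n"
 by (induction n rule: bits.induct) (subst bits.simps, subst compute_floorlog, auto)

lemma less_pow_length_bits: "n < 2 ^ length (bits n)"
 using floorlog_leD[of 2 n "floorlog 2 n"] by (simp add: length_bits)

lemma pt_bits': "pt bits"
proof (rule ptI)
 have "sz (bits n) = sz n" for n
  by (simp add: sz_list_conv sz_nat_def length_bits sz_bool_def sum_list_triv cong: map_cong)
   (simp add: sum_list_triv map_replicate_const sum_list_replicate length_bits)?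
 then show "pbd (%n. sz (bits n))" by (simp add: pbd_sz)
 show "pbd (%n::nat. 60 + 40 * sz n)" by (intro pbd_add pbd_mult pbd_const pbd_sz)
 fix a :: nat assume a: "a \<ge> 2"
 define b1 where "b1 = [Const (a+1) 0]"
 define b2 where "b2 = [Half (a+2) a, Sub 0 a (a+2), Sub 0 0 (a+2), Store 1 0, Const a 0, Add (a+3) 1 a,
  Const 0 1, Add 1 1 0, Store 1 (a+1), Add 1 1 0, Add (a+1) (a+3) a, Add a (a+2) a]"
 define b3 where "b3 = [Const 0 0, Add a (a+1) 0]"
 let ?W = "While a (block b2)"
 have loop: "\<exists>t R' M'. t <= 1 + 30 * floorlog 2 n \<and> runs ?W (R, M) t (R', M') \<and>
   keeps a (R, M) (R', M') \<and> rep M' (R' 1) (R' (a+1)) (bits n @ acc)"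
  if "R a = n" "rep M (R 1) (R (a+1)) acc" "0 < R 1" for n R M acc
  using that
 proof (induction n arbitrary: R M acc rule: bits.induct)
  case (1 n)
  show ?case
  proof (cases "n = 0")
   case True
   with 1 have "runs ?W (R, M) 1 (R, M)" by (intro runs_While_done) simp
   with True 1 show ?thesis by (intro exI[of _ 1] exI[of _ R] exI[of _ M]) (auto simp: keeps_refl)
  next
   case False
   let ?F = "R 1"
   let ?R1 = "R(0 := 1, a := n div 2, a+1 := ?F, a+2 := n div 2, a+3 := ?F, 1 := ?F + 2)"
   let ?M1 = "M(?F := of_bool (odd n), ?F+1 := R (a+1))"
   \<comment> \<open>The machine has no remainder; the parity is what remains after subtracting the
     half twice.\<close>
   have od: "n - n div 2 - n div 2 = of_bool (odd n)" by (auto elim!: evenE oddE)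
   have r1: "runs (block b2) (R, M) 23 (?R1, ?M1)"
   proof -
    have "fold bstep b2 (R, M) = (?R1, ?M1)"
     using a 1(2) od by (auto simp add: b2_def fun_eq_iff)
    from runs_blockI[OF _ _ this] show ?thesis by (simp add: b2_def)
   qed
   have k1: "keeps a (R, M) (?R1, ?M1)" using a by (auto simp: keeps_def)
   have "rep ?M1 (?R1 1) (?R1 (a+1)) (odd n # acc)"
    using 1(4) keeps_rep[OF k1 1(3)] a by (auto simp: rep_bool_def)
   moreover have "?R1 a = n div 2" "0 < ?R1 1" using a by auto
   ultimately obtain t R' M' where 2: "t <= 1 + 30 * floorlog 2 (n div 2)" "runs ?W (?R1, ?M1) t (R', M')"
    "keeps a (?R1, ?M1) (R', M')" "rep M' (R' 1) (R' (a+1)) (bits (n div 2) @ (odd n # acc))"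
    using 1(1)[OF False, of ?R1 ?M1 "odd n # acc"] by blast
   have rr: "runs ?W (R, M) (Suc (23 + t)) (R', M')"
    using False 1(2) by (intro runs_While_step[OF _ r1 2(2)]) simp
   have "floorlog 2 n = floorlog 2 (n div 2) + 1" using False by (subst compute_floorlog) simp
   moreover have "bits n @ acc = bits (n div 2) @ (odd n # acc)" using False by (subst bits.simps) simp
   ultimately show ?thesis using rr keeps_trans[OF k1 2(3)] 2(1,4)
    by (intro exI[of _ "Suc (23 + t)"] exI[of _ R'] exI[of _ M']) simp
  qed
 qed
 let ?c = "Seq (block b1) (Seq ?W (block b3))"
 show "\<exists>c. computes a c bits (%n. 60 + 40 * sz n)"
 proof (rule exI, rule computesI)
  fix R M and n :: nat assume n: "0 < R 1" "rep M (R 1) (R a) n"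
  let ?R0 = "R(a+1 := 0)"
  have r1: "runs (block b1) (R, M) 1 (?R0, M)"
   using runs_blockI[of b1 "(R, M)"] by (simp add: b1_def)
  obtain t R1 M1 where 1: "t <= 1 + 30 * floorlog 2 n" "runs ?W (?R0, M) t (R1, M1)"
   "keeps a (?R0, M) (R1, M1)" "rep M1 (R1 1) (R1 (a+1)) (bits n)"
   using loop[of ?R0 n M "[]"] n a by (auto simp: rep_nat_def)
  let ?R2 = "R1(0 := 0, a := R1 (a+1))"
  have r2: "runs (block b3) (R1, M1) 3 (?R2, M1)"
   using runs_blockI[of b3 "(R1, M1)"] a by (simp add: b3_def)
  have rr: "runs ?c (R, M) (Suc (1 + Suc (t + 3))) (?R2, M1)"
   by (intro runs_Seq[OF r1] runs_Seq[OF 1(2)] r2)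
  have kk: "keeps a (R, M) (?R2, M1)" using 1(3) a by (auto simp: keeps_def)
  have rp: "rep M1 (?R2 1) (?R2 a) (bits n)" using 1(4) a by simp
  show "\<exists>t R' M'. t <= 60 + 40 * sz n \<and> runs ?c (R, M) t (R', M') \<and> keeps a (R, M) (R', M') \<and>
    rep M' (R' 1) (R' a) (bits n)"
   using 1(1) by (intro outcomeI[OF rr _ kk rp]) (simp add: sz_nat_def)
 qed
qed

section \<open>A calculus of polynomial-time functions\<close>

named_theorems pt_intros

text \<open>The premise speaks of projections of a single variable. After unfolding a definition its
  parameters have become such projections, so \<open>pt_intros\<close> applies to the body directly;
  this is how defined functions of several arguments enter the calculus.\<close>

lemma pt_lift2:
 "pt (%p. g (fst p) (snd p)) ==> pt a ==> pt b ==> pt (%x. g (a x) (b x))"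
 using pt_compose[OF _ pt_Pair, of "%p. g (fst p) (snd p)" a b] by simp

lemma pt_lift3:
 "pt (%p. g (fst p) (fst (snd p)) (snd (snd p))) ==> pt a ==> pt b ==> pt c ==>
  pt (%x. g (a x) (b x) (c x))"
 using pt_compose[OF _ pt_Pair[OF _ pt_Pair], of "%p. g (fst p) (fst (snd p)) (snd (snd p))" a b c] by simp

lemma pt_lift4:
 "pt (%p. g (fst p) (fst (snd p)) (fst (snd (snd p))) (snd (snd (snd p)))) ==> pt a ==> pt b ==> pt c ==> pt d ==>
  pt (%x. g (a x) (b x) (c x) (d x))"
 using pt_compose[OF _ pt_Pair[OF _ pt_Pair[OF _ pt_Pair]],
   of "%p. g (fst p) (fst (snd p)) (fst (snd (snd p))) (snd (snd (snd p)))" a b c d] by simp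

lemma pt_cong: "pt f ==> (\<And>x. f x = g x) ==> pt g"
 by (simp add: ext[of f g])

lemmas [pt_intros] = pt_id pt_Pair pt_if pt_nat_const pt_True pt_False pt_Nil
lemma pt_fst [pt_intros]: "pt f ==> pt (%x. fst (f x))" by (rule pt_compose[OF pt_fst'])
lemma pt_snd [pt_intros]: "pt f ==> pt (%x. snd (f x))" by (rule pt_compose[OF pt_snd'])
lemma pt_half [pt_intros]: "pt f ==> pt (%x. f x div 2 :: nat)" by (rule pt_compose[OF pt_half'])
lemma pt_bits [pt_intros]: "pt f ==> pt (%x. bits (f x))" by (rule pt_compose[OF pt_bits'])
lemma pt_null [pt_intros]: "pt f ==> pt (%x. f x = [])" by (rule pt_compose[OF pt_null'])
lemmas pt_add [pt_intros] = pt_lift2[OF pt_add']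
lemmas pt_sub [pt_intros] = pt_lift2[OF pt_sub']
lemmas pt_Cons [pt_intros] = pt_lift2[OF pt_Cons']

lemma pt_Suc [pt_intros]: "pt f ==> pt (%x. Suc (f x))"
 using pt_add[OF _ pt_nat_const, of f 1] by simp

lemma pt_not [pt_intros]: "pt b ==> pt (%x. \<not> b x)"
 by (rule pt_cong[OF pt_if[OF _ pt_False pt_True, of b]]) auto

lemma pt_conj [pt_intros]: "pt b ==> pt c ==> pt (%x. b x \<and> c x)"
 by (rule pt_cong[OF pt_if[OF _ _ pt_False, of b c]]) auto

lemma pt_disj [pt_intros]: "pt b ==> pt c ==> pt (%x. b x \<or> c x)"
 using pt_not[OF pt_conj[OF pt_not pt_not], of b c] by simp

lemma pt_imp [pt_intros]: "pt b ==> pt c ==> pt (%x. b x --> c x)"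
 by (rule pt_cong[OF pt_disj[OF pt_not, of b c]]) auto

lemma pt_le [pt_intros]: "pt f ==> pt g ==> pt (%x. (f x :: nat) <= g x)"
 using pt_compose[OF pt_is0' pt_sub, of f g] by simp

lemma pt_less [pt_intros]: "pt f ==> pt g ==> pt (%x. (f x :: nat) < g x)"
 using pt_not[OF pt_le, of g f] by (simp add: not_le)

lemma pt_eq [pt_intros]: "pt f ==> pt g ==> pt (%x. (f x :: nat) = g x)"
 using pt_conj[OF pt_le pt_le, of f g g f] by (simp add: eq_iff)

lemma pt_eq_pair [pt_intros]: "pt f ==> pt g ==> pt (%x. (f x :: nat \<times> nat) = g x)"
 using pt_conj[OF pt_eq[OF pt_fst pt_fst] pt_eq[OF pt_snd pt_snd], of f g f g] by (simp add: prod_eq_iff)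

lemma pt_min [pt_intros]: "pt f ==> pt g ==> pt (%x. min (f x :: nat) (g x))"
 unfolding min_def by (intro pt_intros)

lemma pt_max [pt_intros]: "pt f ==> pt g ==> pt (%x. max (f x :: nat) (g x))"
 unfolding max_def by (intro pt_intros)

lemma pt_Let [pt_intros]:
 assumes "pt f" "pt (%p. g (fst p) (snd p))"
 shows "pt (%x. let y = f x in g x y)"
 unfolding Let_def by (rule pt_lift2[OF assms(2) pt_id assms(1)])

subsection \<open>Lists\<close>

lemma sz_rev [simp]: "sz (rev xs) = sz (xs :: 'a::data list)"
 by (simp add: sz_list_conv rev_map[symmetric])

lemma sz_take_le: "sz (take n xs) <= sz (xs :: 'a::data list)"
 using sz_append[of "take n xs" "drop n xs"] sz_pos[of "drop n xs"] by simp

lemma sz_filter_le: "sz (filter P xs) <= sz (xs :: 'a::data list)"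
 by (induction xs) auto

lemma sz_concat_le: "sz (concat xss) <= sz (xss :: 'a::data list list)"
proof (induction xss)
 case (Cons xs xss)
 then show ?case using sz_append[of xs "concat xss"] by simp
qed simp

lemma sz_nat_le: "sz (n :: nat) <= Suc n"
proof -
 have "n < 2 ^ n" by simp
 then have "floorlog 2 n <= n" by (intro floorlog_leI) auto
 then show ?thesis by (simp add: sz_nat_def)
qed

lemma sz_0 [simp]: "sz (0::nat) = 1" and sz_1 [simp]: "sz (Suc 0) = 2"
 by (auto simp: sz_nat_def floorlog_def)

lemma sz_sum_list_le: "sz (sum_list xs) <= sz (xs :: nat list)"
proof (induction xs)
 case (Cons x xs)
 then show ?case using sz_nat_add_le[of x "sum_list xs"] by simp
qed simp

lemma sz_prod_list_le: "sz (prod_list xs) <= Suc (sz (xs :: nat list))"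
proof (induction xs)
 case (Cons x xs)
 then show ?case using sz_nat_mult_le[of x "prod_list xs"] by simp
qed simp

lemma pt_sz_elem:
 assumes "pt (%p. h (fst p) (snd p))" "pt l"
 obtains B where "pbd B" "\<And>x y. y \<in> set (l x) ==> sz (h x y) <= B x"
proof -
 obtain k where k: "\<And>p. sz (h (fst p) (snd p)) <= k * sz p ^ k"
  using pt_sz[OF assms(1)] unfolding pbd_def by blast
 show ?thesis
 proof
  show "pbd (%x. k * (sz x + sz (l x)) ^ k)"
   by (intro pbd_mult pbd_const pbd_power pbd_add pbd_sz pt_sz[OF assms(2)])
  fix x y assume "y \<in> set (l x)"
  then have "sz (x, y) <= sz x + sz (l x)" using sz_mem[of y "l x"] by simp
  then have "k * sz (x, y) ^ k <= k * (sz x + sz (l x)) ^ k" by (intro mult_le_mono2 power_mono) auto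
  then show "sz (h x y) <= k * (sz x + sz (l x)) ^ k"
   using k[of "(x, y)"] unfolding fst_conv snd_conv by linarith
 qed
qed

lemma fold_Cons_conv: "fold (%y acc. f y # acc) xs acc = rev (map f xs) @ acc"
 by (induction xs arbitrary: acc) auto

lemma pt_rev [pt_intros]:
 assumes "pt l"
 shows "pt (%x. rev (l x))"
proof -
 have "pt (%x. fold (%y acc. y # acc) (l x) [])"
 proof (rule pt_fold[where h = "%x y acc. y # acc"])
  show "pbd (%x. sz (l x))" by (rule pt_sz[OF assms])
 qed (auto intro!: pt_intros assms simp: fold_Cons_conv[of "%x. x"] sz_take_le)
 then show ?thesis by (simp add: fold_Cons_conv[of "%x. x"])
qed

lemma pt_append [pt_intros]:
 assumes "pt l" "pt m"
 shows "pt (%x. l x @ m x)"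
proof -
 have "pt (%x. fold (%y acc. y # acc) (rev (l x)) (m x))"
 proof (rule pt_fold[where h = "%x y acc. y # acc"])
  show "pbd (%x. sz (l x) + sz (m x))" by (intro pbd_add pt_sz assms)
  show "sz (fold (#) (take n (rev (l x))) (m x)) <= sz (l x) + sz (m x)" for x n
   using sz_append[of "rev (take n (rev (l x)))" "m x"] sz_take_le[of n "rev (l x)"]
   by (simp add: fold_Cons_conv[of "%x. x", simplified])
 qed (auto intro!: pt_intros assms)
 then show ?thesis by (simp add: fold_Cons_conv[of "%x. x"])
qed

lemma pt_map [pt_intros]:
 assumes "pt l" "pt (%p. h (fst p) (snd p))"
 shows "pt (%x. map (h x) (l x))"
proof -
 obtain B where B: "pbd B" "\<And>x y. y \<in> set (l x) ==> sz (h x y) <= B x"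
  using pt_sz_elem[OF assms(2,1)] by blast
 have "pt (%x. fold (%y acc. h x y # acc) (l x) [])"
 proof (rule pt_fold[where h = "%x y acc. h x y # acc"])
  show "pbd (%x. 1 + sz (l x) * B x)" by (intro pbd_add pbd_mult pbd_const pt_sz assms B)
  show "sz (fold (%y acc. h x y # acc) (take n (l x)) []) <= 1 + sz (l x) * B x" for x n
  proof -
   have "sz (map (h x) (take n (l x))) <= 1 + length (map (h x) (take n (l x))) * B x"
    by (rule sz_list_le) (auto dest: in_set_takeD intro: B)
   also have "\<dots> <= 1 + sz (l x) * B x"
    using length_le_sz[of "l x"] by (intro add_mono mult_le_mono) auto
   finally show ?thesis by (simp add: fold_Cons_conv)
  qed
  show "pt (%p. h (fst p) (fst (snd p)) # snd (snd p))"
   by (intro pt_intros pt_lift2[OF assms(2)])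
 qed (auto intro!: pt_intros assms)
 from pt_rev[OF this] show ?thesis by (simp add: fold_Cons_conv)
qed

lemma fold_filter_conv: "fold (%y acc. if P y then y # acc else acc) xs acc = rev (filter P xs) @ acc"
 by (induction xs arbitrary: acc) auto

lemma pt_filter [pt_intros]:
 assumes "pt l" "pt (%p. P (fst p) (snd p))"
 shows "pt (%x. filter (P x) (l x))"
proof -
 have "pt (%x. fold (%y acc. if P x y then y # acc else acc) (l x) [])"
 proof (rule pt_fold[where h = "%x y acc. if P x y then y # acc else acc"])
  show "pbd (%x. sz (l x))" by (rule pt_sz[OF assms(1)])
  show "sz (fold (%y acc. if P x y then y # acc else acc) (take n (l x)) []) <= sz (l x)" for x n
   using sz_filter_le[of "P x" "take n (l x)"] sz_take_le[of n "l x"] by (simp add: fold_filter_conv)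
  show "pt (%p. if P (fst p) (fst (snd p)) then fst (snd p) # snd (snd p) else snd (snd p))"
   by (intro pt_intros pt_lift2[OF assms(2)])
 qed (auto intro!: pt_intros assms)
 from pt_rev[OF this] show ?thesis by (simp add: fold_filter_conv)
qed

lemma pt_concat [pt_intros]:
 assumes "pt (l :: 'a::data => 'b::data list list)"
 shows "pt (%x. concat (l x))"
proof -
 have conv: "fold (%ys acc. rev ys @ acc) xss acc = rev (concat xss) @ acc" for xss and acc :: "'b list"
  by (induction xss arbitrary: acc) auto
 have "pt (%x. fold (%ys acc. rev ys @ acc) (l x) [])"
 proof (rule pt_fold[where h = "%x ys acc. rev ys @ acc"])
  show "pbd (%x. sz (l x))" by (rule pt_sz[OF assms(1)])
  show "sz (fold (%ys acc. rev ys @ acc) (take n (l x)) []) <= sz (l x)" for x n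
   using sz_concat_le[of "take n (l x)"] sz_take_le[of n "l x"] by (simp add: conv)
 qed (auto intro!: pt_intros assms)
 from pt_rev[OF this] show ?thesis by (simp add: conv)
qed

lemma pt_length [pt_intros]:
 assumes "pt (l :: 'a::data => 'b::data list)"
 shows "pt (%x. length (l x))"
proof -
 have conv: "fold (%y n. Suc n) xs k = length xs + k" for xs :: "'b list" and k
  by (induction xs arbitrary: k) auto
 have "pt (%x. fold (%y n. Suc n) (l x) 0)"
 proof (rule pt_fold[where h = "%x y n. Suc n"])
  show "pbd (%x. 1 + sz (l x))" by (intro pbd_add pbd_const pt_sz[OF assms(1)])
  show "sz (fold (%y n. Suc n) (take n (l x)) 0) <= 1 + sz (l x)" for x n
   using sz_nat_le[of "length (take n (l x))"] length_le_sz[of "l x"] by (simp add: conv)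
 qed (auto intro!: pt_intros assms)
 then show ?thesis by (simp add: conv)
qed

lemma pt_sum_list [pt_intros]:
 assumes "pt l"
 shows "pt (%x. sum_list (l x) :: nat)"
proof -
 have conv: "fold (%y n. y + n) xs k = sum_list xs + k" for xs and k :: nat
  by (induction xs arbitrary: k) auto
 have "pt (%x. fold (%y n. y + n) (l x) 0)"
 proof (rule pt_fold[where h = "%x y n. y + n"])
  show "pbd (%x. sz (l x))" by (intro pt_sz[OF assms(1)])
  show "sz (fold (%y n. y + n) (take n (l x)) 0) <= sz (l x)" for x n
   using sz_sum_list_le[of "take n (l x)"] sz_take_le[of n "l x"] unfolding conv by simp
 qed (auto intro!: pt_intros assms)
 then show ?thesis unfolding conv by simp
qed

definition bval :: "bool list => nat" where
 "bval bs = fold (%b a. a + a + of_bool b) bs 0"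

lemma bval_snoc: "bval (bs @ [b]) = 2 * bval bs + of_bool b" and bval_Nil [simp]: "bval [] = 0"
 by (simp_all add: bval_def)

lemma bval_bits [simp]: "bval (bits n) = n"
proof (induction n rule: bits.induct)
 case (1 n)
 then show ?case by (cases "n = 0"; subst bits.simps) (auto simp: bval_snoc)
qed

lemma bval_take_le: "bval (take n bs) <= bval bs"
proof (induction bs arbitrary: n rule: rev_induct)
 case (snoc b bs)
 show ?case
 proof (cases "n <= length bs")
  case True
  then show ?thesis using snoc[of n] by (simp add: bval_snoc)
 qed simp
qed simp

lemma bval_less: "bval bs < 2 ^ length bs"
 by (induction bs rule: rev_induct) (auto simp: bval_snoc)

text \<open>Shift and add. After a prefix of the bits, the accumulator is the product with the
  number formed by that prefix and hence at most the final product.\<close>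

lemma pt_mult [pt_intros]:
 assumes "pt f" "pt g"
 shows "pt (%x. f x * g x :: nat)"
proof -
 have conv: "fold (%b a. a + a + (if b then n else 0)) bs 0 = bval bs * n" for bs and n :: nat
  by (induction bs rule: rev_induct) (auto simp: bval_snoc algebra_simps)
 have "pt (%x. fold (%b a. a + a + (if b then g x else 0)) (bits (f x)) 0)"
 proof (rule pt_fold[where h = "%x b a. a + a + (if b then g x else 0)"])
  show "pbd (%x. sz (f x) + sz (g x))" by (intro pbd_add pt_sz assms)
  show "sz (fold (%b a. a + a + (if b then g x else 0)) (take n (bits (f x))) 0) <= sz (f x) + sz (g x)" for x n
   using sz_nat_mono[OF mult_le_mono1[OF bval_take_le[of n "bits (f x)"]], of "g x"]
    sz_nat_mult_le[of "f x" "g x"] unfolding conv by simp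
  show "pt (%p. snd (snd p) + snd (snd p) + (if fst (snd p) then g (fst p) else 0))"
   by (intro pt_intros pt_compose[OF assms(2)])
 qed (auto intro!: pt_intros assms)
 then show ?thesis unfolding conv by simp
qed

lemma pt_prod_list [pt_intros]:
 assumes "pt l"
 shows "pt (%x. prod_list (l x) :: nat)"
proof -
 have conv: "fold (%y n. y * n) xs k = prod_list xs * k" for xs and k :: nat
  by (induction xs arbitrary: k) auto
 have "pt (%x. fold (%y n. y * n) (l x) 1)"
 proof (rule pt_fold[where h = "%x y n. y * n"])
  show "pbd (%x. 1 + sz (l x))" by (intro pbd_add pbd_const pt_sz[OF assms(1)])
  show "sz (fold (%y n. y * n) (take n (l x)) 1) <= 1 + sz (l x)" for x n
   using sz_prod_list_le[of "take n (l x)"] sz_take_le[of n "l x"] unfolding conv by simp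
 qed (auto intro!: pt_intros assms)
 then show ?thesis unfolding conv by simp
qed

lemma pt_bval [pt_intros]:
 assumes "pt l"
 shows "pt (%x. bval (l x))"
proof -
 have "pt (%x. fold (%b a. a + a + (if b then 1 else 0 :: nat)) (l x) 0)"
 proof (rule pt_fold[where h = "%x b a. a + a + (if b then 1 else 0 :: nat)"])
  show "pbd (%x. 1 + sz (l x))" by (intro pbd_add pbd_const pt_sz[OF assms(1)])
  show "sz (fold (%b a. a + a + (if b then 1 else 0 :: nat)) (take n (l x)) 0) <= 1 + sz (l x)" for x n
  proof -
   have "floorlog 2 (bval (take n (l x))) <= length (take n (l x))"
    by (intro floorlog_leI bval_less) auto
   then show ?thesis using length_le_sz[of "l x"]
    by (simp add: bval_def of_bool_def sz_nat_def)
  qed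
 qed (auto intro!: pt_intros assms)
 then show ?thesis by (simp add: bval_def of_bool_def)
qed

lemma pt_list_ex [pt_intros]:
 assumes "pt l" "pt (%p. P (fst p) (snd p))"
 shows "pt (%x. list_ex (P x) (l x))"
proof -
 have conv: "fold (%y b. b \<or> Q y) xs c \<longleftrightarrow> c \<or> list_ex Q xs" for Q and xs :: "'b list" and c
  by (induction xs arbitrary: c) auto
 have "pt (%x. fold (%y b. b \<or> P x y) (l x) False)"
 proof (rule pt_fold[where h = "%x y b. b \<or> P x y" and B = "%x. 1"])
  show "pt (%p. snd (snd p) \<or> P (fst p) (fst (snd p)))" by (intro pt_intros pt_lift2[OF assms(2)])
 qed (auto intro!: pt_intros assms)
 then show ?thesis by (simp add: conv)
qed

lemma pt_mem_gen:
 assumes "pt (%p. fst p = (snd p :: 'b::data))" "pt f" "pt l"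
 shows "pt (%x. (f x :: 'b) \<in> set (l x))"
proof -
 have "pt (%x. list_ex (%y. f x = y) (l x))"
  by (intro pt_intros assms(3) pt_lift2[OF assms(1)] pt_compose[OF assms(2)])
 then show ?thesis by (simp add: list_ex_iff Bex_def conj_commute)
qed

lemma pt_mem [pt_intros]: "pt f ==> pt l ==> pt (%x. (f x :: nat) \<in> set (l x))"
 by (rule pt_mem_gen) (intro pt_intros)

lemma pt_mem_pair [pt_intros]: "pt f ==> pt l ==> pt (%x. (f x :: nat \<times> nat) \<in> set (l x))"
 by (rule pt_mem_gen) (intro pt_intros)

text \<open>Ranges have to follow a list: for a number \<open>n\<close> in binary,
  \<open>[0..<n]\<close> has a length exponential in the size of \<open>n\<close>.\<close>

lemma pt_upt_length [pt_intros]: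
 assumes "pt (l :: 'a::data => 'b::data list)"
 shows "pt (%x. [0..<length (l x)])"
proof -
 have conv: "fold (%y acc. length acc # acc) xs [] = rev [0..<length xs]" for xs :: "'b list"
  by (induction xs rule: rev_induct) auto
 have "pt (%x. fold (%y acc. length acc # acc) (l x) [])"
 proof (rule pt_fold[where h = "%x y acc. length acc # acc"])
  show "pbd (%x. 1 + sz (l x) * (1 + sz (l x)))" by (intro pbd_add pbd_mult pbd_const pt_sz[OF assms(1)])
  show "sz (fold (%y acc. length acc # acc) (take n (l x)) []) <= 1 + sz (l x) * (1 + sz (l x))" for x n
  proof -
   have "sz [0..<length (take n (l x))] <= 1 + length [0..<length (take n (l x))] * (1 + sz (l x))"
   proof (rule sz_list_le)
    fix i assume "i \<in> set [0..<length (take n (l x))]"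
    then show "sz i <= 1 + sz (l x)" using sz_nat_le[of i] length_le_sz[of "l x"] by auto
   qed
   also have "\<dots> <= 1 + sz (l x) * (1 + sz (l x))"
    using length_le_sz[of "l x"] by (intro add_mono mult_le_mono) auto
   finally show ?thesis by (simp add: conv)
  qed
 qed (auto intro!: pt_intros assms)
 from pt_rev[OF this] show ?thesis by (simp add: conv)
qed

text \<open>The flag records whether an entry has been seen, so that the default \<open>d\<close>
  never competes with an entry. Ties are decided in favour of the earlier entry.\<close>

definition best :: "('a => 'a => bool) => 'a => 'a list => 'a" where
 "best lt d xs =
   snd (fold (%y s. if fst s \<and> \<not> lt y (snd s) then s else (True, y)) xs (False, d))"

lemma fold_best:
 "fold (%y s. if fst s \<and> \<not> lt y (snd s) then s else (True, y)) xs (False, d) \<in>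
   (if xs = [] then {(False, d)} else Pair True ` set xs)"
 by (induction xs rule: rev_induct) (auto split: if_splits)

lemma best_Nil [simp]: "best lt d [] = d"
 by (simp add: best_def)

lemma best_in: "xs \<noteq> [] ==> best lt d xs \<in> set xs"
 using fold_best[of lt xs d] by (auto simp: best_def)

text \<open>The comparison has to behave well on \<open>S\<close> only: ratios that are compared by
  cross-multiplication, as in the greedy multicover, are ordered consistently only as long as the
  denominators are positive.\<close>

lemma best_min:
 assumes tr: "\<And>x y z. x \<in> S ==> y \<in> S ==> z \<in> S ==> lt x y ==> \<not> lt z y ==> \<not> lt z x"
  and irr: "\<And>x. \<not> lt x x" and "set xs \<subseteq> S" "y \<in> set xs"
 shows "\<not> lt y (best lt d xs)"
 using assms(3,4)
proof (induction xs rule: rev_induct)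
 case (snoc x xs)
 let ?s = "fold (%y s. if fst s \<and> \<not> lt y (snd s) then s else (True, y)) xs (False, d)"
 show ?case
 proof (cases "xs = []")
  case True
  with snoc show ?thesis by (simp add: best_def irr)
 next
  case False
  then have f: "fst ?s" and b: "snd ?s = best lt d xs"
   using fold_best[of lt xs d] by (auto simp: best_def)
  have bs: "best lt d xs \<in> S" using best_in[OF False] snoc.prems by auto
  have e: "best lt d (xs @ [x]) = (if \<not> lt x (best lt d xs) then best lt d xs else x)"
   using f by (simp add: best_def)
  show ?thesis
  proof (cases "y \<in> set xs")
   case True
   then have "\<not> lt y (best lt d xs)" using snoc by auto
   then show ?thesis using tr[of x "best lt d xs" y] snoc.prems bs True unfolding e by auto
  next
   case False
   then have "y = x" using snoc.prems by auto
   then show ?thesis unfolding e by (simp add: irr)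
  qed
 qed
qed simp

lemma best_key_min:
 fixes key :: "'a => nat"
 assumes "y \<in> set xs"
 shows "key (best (%a b. key a < key b) d xs) <= key y"
 using best_min[of UNIV "%a b. key a < key b" xs y d] assms by force

lemma pt_best [pt_intros]:
 assumes l: "pt l" and d: "pt d" and lt: "pt (%p. lt (fst p) (fst (snd p)) (snd (snd p)))"
 shows "pt (%x. best (lt x) (d x) (l x))"
proof -
 let ?h = "%x y s. if fst s \<and> \<not> lt x y (snd s) then s else (True, y)"
 have "pt (%x. fold (?h x) (l x) (False, d x))"
 proof (rule pt_fold)
  show "pbd (%x. 1 + sz (d x) + sz (l x))" by (intro pbd_add pbd_const pt_sz l d)
  show "sz (fold (?h x) (take n (l x)) (False, d x)) <= 1 + sz (d x) + sz (l x)" for x n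
  proof (cases "take n (l x) = []")
   case False
   then obtain y where "y \<in> set (take n (l x))"
    "fold (?h x) (take n (l x)) (False, d x) = (True, y)"
    using fold_best[of "lt x" "take n (l x)" "d x"] by auto
   then show ?thesis using sz_mem[of y "l x"] by (auto dest: in_set_takeD)
  next
   case True
   then show ?thesis unfolding True by simp
  qed
  show "pt (%p. ?h (fst p) (fst (snd p)) (snd (snd p)))"
   by (intro pt_intros pt_lift3[OF lt])
 qed (intro pt_intros l d)+
 then show ?thesis unfolding best_def by (rule pt_snd)
qed

section \<open>Indexing and bit masks\<close>

definition nthd :: "'a => 'a list => nat => 'a" where
 "nthd d xs i = (if i < length xs then xs ! i else d)"

lemma fold_nthd:
 "fold (%y s. (Suc (fst s), if fst s = i then y else snd s)) xs (0, d) = (length xs, nthd d xs i)"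
 by (induction xs rule: rev_induct) (auto simp: nthd_def nth_append)

lemma pt_nthd [pt_intros]:
 assumes "pt d" "pt l" "pt i"
 shows "pt (%x. nthd (d x) (l x) (i x))"
proof -
 let ?h = "%x y s. (Suc (fst s), if fst s = i x then y else snd s)"
 have "pt (%x. fold (?h x) (l x) (0, d x))"
 proof (rule pt_fold)
  show "pbd (%x. 1 + sz (l x) + (sz (d x) + sz (l x)))" by (intro pbd_add pbd_const pt_sz assms)
  show "sz (fold (?h x) (take n (l x)) (0, d x)) <= 1 + sz (l x) + (sz (d x) + sz (l x))" for x n
  proof -
   have "sz (length (take n (l x))) <= 1 + sz (l x)"
    using sz_nat_le[of "length (take n (l x))"] length_le_sz[of "l x"] by simp
   moreover have "sz (nthd (d x) (take n (l x)) (i x)) <= sz (d x) + sz (l x)"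
   proof (cases "i x < length (take n (l x))")
    case True
    then have "nthd (d x) (take n (l x)) (i x) \<in> set (l x)"
     by (auto simp: nthd_def)
    from sz_mem[OF this] show ?thesis by simp
   next
    case False
    then have "nthd (d x) (take n (l x)) (i x) = d x" unfolding nthd_def by (rule if_not_P)
    then show ?thesis by simp
   qed
   ultimately show ?thesis unfolding fold_nthd by simp
  qed
  show "pt (%p. ?h (fst p) (fst (snd p)) (snd (snd p)))"
   by (intro pt_intros pt_compose[OF assms(3)])
 qed (intro pt_intros assms)+
 from pt_snd[OF this] show ?thesis by (simp add: fold_nthd)
qed

text \<open>The list counterpart of \<open>set_decode\<close>. Its range is taken along the bits of
  \<open>m\<close>, which is where all elements lie.\<close>

definition dec :: "nat => nat list" where
 "dec m = filter (%i. nthd False (rev (bits m)) i) [0..<length (bits m)]"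

lemma pt_dec [pt_intros]: "pt f ==> pt (%x. dec (f x))"
proof -
 have "pt dec" unfolding dec_def by (intro pt_intros)
 then show "pt f ==> pt (%x. dec (f x))" by (rule pt_compose)
qed

lemma nthd_bits: "nthd False (rev (bits m)) i \<longleftrightarrow> i \<in> set_decode m"
proof (induction m arbitrary: i rule: bits.induct)
 case (1 m)
 show ?case
 proof (cases "m = 0")
  case False
  then have "rev (bits m) = odd m # rev (bits (m div 2))" by (subst bits.simps) simp
  then show ?thesis using 1[OF False, of "i - 1"] by (cases i) (auto simp: nthd_def)
 qed (simp add: nthd_def)
qed

lemma set_dec [simp]: "set (dec m) = set_decode m"
proof -
 have "i < length (bits m)" if "i \<in> set_decode m" for i
  using that unfolding nthd_bits[symmetric] by (simp add: nthd_def split: if_splits)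
 then show ?thesis by (auto simp: dec_def nthd_bits)
qed

lemma distinct_dec [simp]: "distinct (dec m)"
 by (simp add: dec_def)

text \<open>Reversed because \<open>bval\<close> reads the most significant bit first; on
  \<open>[0..<n]\<close> the result is the \<open>set_encode\<close> of a subset.\<close>

definition mask :: "(nat => bool) => nat list => nat" where
 "mask P xs = bval (map P (rev xs))"

lemma pt_mask [pt_intros]:
 assumes "pt l" "pt (%p. P (fst p) (snd p))"
 shows "pt (%x. mask (P x) (l x))"
 unfolding mask_def by (intro pt_intros assms)

lemma mask_upt: "mask P [0..<n] = set_encode {i. i < n \<and> P i}"
proof (induction n arbitrary: P)
 case 0
 then show ?case by (simp add: mask_def)
next
 case (Suc n)
 have "[0..<Suc n] = 0 # map Suc [0..<n]" by (simp add: map_Suc_upt upt_conv_Cons del: upt_Suc)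
 then have "rev [0..<Suc n] = map Suc (rev [0..<n]) @ [0]" by (simp add: rev_map del: upt_Suc)
 then have "mask P [0..<Suc n] = 2 * mask (P \<circ> Suc) [0..<n] + of_bool (P 0)"
  by (simp add: mask_def bval_snoc del: upt_Suc)
 also have "\<dots> = 2 * set_encode {i. i < n \<and> P (Suc i)} + of_bool (P 0)" using Suc by simp
 also have "{i. i < n \<and> P (Suc i)} = Suc -` {i. i < Suc n \<and> P i}" by auto
 also have "2 * set_encode \<dots> + of_bool (P 0) = set_encode {i. i < Suc n \<and> P i}"
 proof -
  have "P 0 \<longleftrightarrow> odd (set_encode {i. i < Suc n \<and> P i})"
   by (subst even_set_encode_iff) auto
  moreover have "2 * (e div 2) + of_bool (odd e) = e" for e :: nat by (cases "odd e") auto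
  ultimately show ?thesis unfolding set_encode_vimage_Suc by simp
 qed
 finally show ?case .
qed

lemma set_decode_mask: "set_decode (mask P [0..<n]) = {i. i < n \<and> P i}"
 by (simp add: mask_upt)

definition dedup :: "nat list => nat list" where
 "dedup xs = fold (%y acc. if y \<in> set acc then acc else y # acc) xs []"

lemma dedup_snoc: "dedup (xs @ [x]) = (if x \<in> set (dedup xs) then dedup xs else x # dedup xs)"
 by (simp add: dedup_def)

lemma dedup_Nil [simp]: "dedup [] = []"
 by (simp add: dedup_def)

lemma set_dedup [simp]: "set (dedup xs) = set xs"
 by (induction xs rule: rev_induct) (auto simp: dedup_snoc)

lemma distinct_dedup [simp]: "distinct (dedup xs)"
 by (induction xs rule: rev_induct) (auto simp: dedup_snoc)

lemma sz_dedup_le: "sz (dedup xs) <= sz xs"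
proof (induction xs rule: rev_induct)
 case (snoc x xs)
 then show ?case using sz_append[of xs "[x]"] by (auto simp: dedup_snoc)
qed (simp add: dedup_def)

lemma pt_dedup [pt_intros]:
 assumes "pt l"
 shows "pt (%x. dedup (l x))"
 unfolding dedup_def
proof (rule pt_fold[where h = "%x y acc. if y \<in> set acc then acc else y # acc"])
 show "pbd (%x. sz (l x))" by (rule pt_sz[OF assms])
 show "sz (fold (%y acc. if y \<in> set acc then acc else y # acc) (take n (l x)) []) <= sz (l x)" for x n
  using sz_dedup_le[of "take n (l x)"] sz_take_le[of n "l x"] unfolding dedup_def by linarith
 show "pt (%p. if fst (snd p) \<in> set (snd (snd p)) then snd (snd p) else fst (snd p) # snd (snd p) :: nat list)"
  by (intro pt_intros)
qed (intro pt_intros assms)+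

section \<open>Programs with input and output\<close>

definition init :: "nat list => state" where
 "init inp = ((%a. if a = 0 then length inp else 0), (%i. if i < length inp then inp ! i else 0))"

lemma start_init: "start c inp = ([c], init inp)"
 by (simp add: start_def init_def)

lemma exec_halted: "exec D n ([], s) = return_pmf ([], s)"
 by (induction n) (auto simp: bind_return_pmf)

lemma exec_runs: "runs c s t s' ==> t <= n ==> exec D n ([c], s) = return_pmf ([], s')"
 using runsD[of c s t s' D "n - t" "[]"] by (simp add: exec_halted)

text \<open>\<open>runs\<close> is quantified over all oracles. Hence the same facts serve for the
  constant oracle of the second stage and, before and after the sampling loop, for the genuine
  oracle of the first stage.\<close>

lemma computes_within_runs: "runs c (init inp) t s ==> t <= n ==> computes_within n c inp s"
 by (simp add: computes_within_def start_init exec_runs)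

lemma sz_input: "sz inp <= 1 + input_size inp"
 by (induction inp) (auto simp: input_size_def sz_nat_def)

lemma length_le_input_size: "length inp <= input_size inp"
 by (induction inp) (auto simp: input_size_def)

text \<open>Turns the input array into a heap list, from the last entry to the first, with register
  0 as the counter. The free pointer starts one above the input length: this protects the entries
  still to be read, and it keeps addresses positive even for the empty input, as address 0 means the
  empty list.\<close>

definition prelude :: com where
 "prelude = Seq (block [Const 2 1, Add 1 0 2, Const 2 0])
   (While 0 (block [Const 3 1, Sub 0 0 3, Load 4 0, Store 1 4, Const 4 0, Add 5 1 4, Add 1 1 3,
    Store 1 2, Add 1 1 3, Add 2 5 4]))"

lemma runs_prelude:
 "\<exists>t R M. t <= 10 + 30 * length inp \<and> runs prelude (init inp) t (R, M) \<and>
   length inp < R 1 \<and> rep M (R 1) (R 2) inp"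
proof -
 define b where "b = [Const 3 1, Sub 0 0 3, Load 4 0, Store 1 4, Const 4 0, Add 5 1 4, Add 1 1 3,
    Store 1 2, Add 1 1 3, Add 2 5 4]"
 have loop: "\<exists>t R' M'. t <= 1 + 30 * n \<and> runs (While 0 (block b)) (R, M) t (R', M') \<and>
   length inp < R' 1 \<and> rep M' (R' 1) (R' 2) inp"
  if "n <= length inp" "R 0 = n" "length inp < R 1" "\<And>i. i < length inp ==> M i = inp ! i"
   "rep M (R 1) (R 2) (drop n inp)" for n R M
  using that
 proof (induction n arbitrary: R M)
  case 0
  then have "runs (While 0 (block b)) (R, M) 1 (R, M)" by (intro runs_While_done) simp
  with 0 show ?case by (intro exI[of _ 1] exI[of _ R] exI[of _ M]) auto
 next
  case (Suc n)
  let ?F = "R 1"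
  let ?R1 = "R(0 := n, 3 := 1, 4 := 0, 5 := ?F, 1 := ?F + 2, 2 := ?F)"
  let ?M1 = "M(?F := inp ! n, ?F+1 := R 2)"
  have r1: "runs (block b) (R, M) 19 (?R1, ?M1)"
  proof -
   have "fold bstep b (R, M) = (?R1, ?M1)" using Suc.prems by (simp add: b_def fun_eq_iff)
   from runs_blockI[OF _ _ this] show ?thesis by (simp add: b_def)
  qed
  have "rep ?M1 (?F + 2) (R 2) (drop (Suc n) inp)" by (rule rep_mono[OF Suc.prems(5)]) auto
  moreover have "drop n inp = inp ! n # drop (Suc n) inp" using Suc.prems(1) by (simp add: Cons_nth_drop_Suc)
  ultimately have "rep ?M1 (?R1 1) (?R1 2) (drop n inp)"
   using Suc.prems(3) by (simp add: rep_nat_def)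
  moreover have "\<And>i. i < length inp ==> ?M1 i = inp ! i" using Suc.prems(3,4) by auto
  moreover have "n <= length inp" "?R1 0 = n" "length inp < ?R1 1" using Suc.prems by auto
  ultimately obtain t R' M' where 2: "t <= 1 + 30 * n" "runs (While 0 (block b)) (?R1, ?M1) t (R', M')"
   "length inp < R' 1" "rep M' (R' 1) (R' 2) inp"
   using Suc.IH[of ?R1 ?M1] by blast
  have "runs (While 0 (block b)) (R, M) (Suc (19 + t)) (R', M')"
   using Suc.prems(2) by (intro runs_While_step[OF _ r1 2(2)]) simp
  with 2 show ?case by (intro exI[of _ "Suc (19 + t)"] exI[of _ R'] exI[of _ M']) auto
 qed
 obtain R0 M0 where i: "init inp = (R0, M0)" by force
 then have R0: "R0 0 = length inp" "\<And>i. i < length inp ==> M0 i = inp ! i" by (auto simp: init_def)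
 let ?R = "R0(2 := 0, 1 := length inp + 1)"
 have r: "runs (block [Const 2 1, Add 1 0 2, Const 2 0]) (init inp) 5 (?R, M0)"
  using runs_blockI[of "[Const 2 1, Add 1 0 2, Const 2 0]" "init inp"] by (simp add: i R0 fun_upd_twist)
 obtain t R' M' where 2: "t <= 1 + 30 * length inp" "runs (While 0 (block b)) (?R, M0) t (R', M')"
   "length inp < R' 1" "rep M' (R' 1) (R' 2) inp"
  using loop[of "length inp" ?R M0] R0 by auto
 have "runs prelude (init inp) (Suc (5 + t)) (R', M')"
  unfolding prelude_def b_def[symmetric] by (rule runs_Seq[OF r 2(2)])
 with 2 show ?thesis by (intro exI[of _ "Suc (5 + t)"] exI[of _ R'] exI[of _ M']) auto
qed

text \<open>The list is first copied to fresh cells, since its own cells might be overwritten by the output.\<close>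

lemma runs_output_list:
 assumes "rep M (R 1) (R 3) (ys :: nat list)" "length ys <= R 1"
 defines "b1 \<equiv> [Const 0 0, Add 4 1 0]"
  and "w1 \<equiv> [Load 0 3, Store 4 0, Const 0 1, Add 4 4 0, Add 3 3 0, Load 3 3]"
  and "b2 \<equiv> [Sub 4 4 1, Const 3 0]"
  and "w2 \<equiv> [Add 0 1 3, Load 0 0, Store 3 0, Const 0 1, Add 3 3 0, Sub 4 4 0]"
 shows "\<exists>t R' M'. t <= 30 + 40 * length ys \<and>
  runs (Seq (block b1) (Seq (While 3 (block w1)) (Seq (block b2) (While 4 (block w2))))) (R, M) t (R', M') \<and>
  R' 2 = R 2 \<and> (\<forall>j < length ys. M' j = ys ! j)"
proof -
 let ?F = "R 1"
 have l1: "\<exists>t R' M'. t <= 1 + 20 * length zs \<and> runs (While 3 (block w1)) (R1, M1) t (R', M') \<and>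
   R' 1 = ?F \<and> R' 2 = R 2 \<and> R' 4 = R1 4 + length zs \<and> (\<forall>q < R1 4. M' q = M1 q) \<and>
   (\<forall>j < length zs. M' (R1 4 + j) = zs ! j)"
  if "R1 1 = ?F" "R1 2 = R 2" "?F <= R1 4" "rep M1 ?F (R1 3) zs" for R1 M1 and zs :: "nat list"
  using that
 proof (induction zs arbitrary: R1 M1)
  case Nil
  then have "runs (While 3 (block w1)) (R1, M1) 1 (R1, M1)" by (intro runs_While_done) simp
  with Nil show ?case by (intro exI[of _ 1] exI[of _ R1] exI[of _ M1]) auto
 next
  case (Cons z zs)
  let ?R2 = "R1(0 := 1, 4 := R1 4 + 1, 3 := M1 (Suc (R1 3)))"
  let ?M2 = "M1(R1 4 := z)"
  have r: "runs (block w1) (R1, M1) 11 (?R2, ?M2)"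
  proof -
   have "fold bstep w1 (R1, M1) = (?R2, ?M2)" using Cons.prems by (simp add: w1_def fun_eq_iff rep_nat_def)
   from runs_blockI[OF _ _ this] show ?thesis by (simp add: w1_def)
  qed
  have "rep ?M2 ?F (?R2 3) zs" using Cons.prems by (auto intro: rep_mono)
  moreover have "?R2 1 = ?F" "?R2 2 = R 2" "?F <= ?R2 4" using Cons.prems by auto
  ultimately obtain t R' M' where 2: "t <= 1 + 20 * length zs" "runs (While 3 (block w1)) (?R2, ?M2) t (R', M')"
   "R' 1 = ?F" "R' 2 = R 2" "R' 4 = ?R2 4 + length zs" "\<forall>q < ?R2 4. M' q = ?M2 q"
   "\<forall>j < length zs. M' (?R2 4 + j) = zs ! j"
   using Cons.IH[of ?R2 ?M2] by blast
  have rr: "runs (While 3 (block w1)) (R1, M1) (Suc (11 + t)) (R', M')"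
   using Cons.prems by (intro runs_While_step[OF _ r 2(2)]) simp
  have "M' (R1 4 + j) = (z # zs) ! j" if "j < length (z # zs)" for j
   using that 2(6,7) by (cases j) auto
  with rr 2 show ?case by (intro exI[of _ "Suc (11 + t)"] exI[of _ R'] exI[of _ M']) auto
 qed
 have l2: "\<exists>t R' M'. t <= 1 + 20 * n \<and> runs (While 4 (block w2)) (R1, M1) t (R', M') \<and>
   R' 2 = R 2 \<and> (\<forall>j < length ys. M' j = ys ! j)"
  if "R1 1 = ?F" "R1 2 = R 2" "R1 4 = n" "n <= length ys" "R1 3 = length ys - n"
   "\<And>j. j < R1 3 ==> M1 j = ys ! j" "\<And>j. j < length ys ==> M1 (?F + j) = ys ! j" for R1 M1 n
  using that
 proof (induction n arbitrary: R1 M1)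
  case 0
  then have "runs (While 4 (block w2)) (R1, M1) 1 (R1, M1)" by (intro runs_While_done) simp
  with 0 show ?case by (intro exI[of _ 1] exI[of _ R1] exI[of _ M1]) auto
 next
  case (Suc n)
  let ?R2 = "R1(0 := 1, 4 := n, 3 := R1 3 + 1)"
  let ?M2 = "M1(R1 3 := ys ! (R1 3))"
  have r: "runs (block w2) (R1, M1) 11 (?R2, ?M2)"
  proof -
   have "R1 3 < length ys" using Suc.prems by auto
   then have "fold bstep w2 (R1, M1) = (?R2, ?M2)" using Suc.prems(1-3) Suc.prems(7)[of "R1 3"]
    by (auto simp add: w2_def fun_eq_iff)
   from runs_blockI[OF _ _ this] show ?thesis by (simp add: w2_def)
  qed
  have "\<And>j. j < ?R2 3 ==> ?M2 j = ys ! j" using Suc.prems(6) by (auto simp: less_Suc_eq)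
  moreover have "\<And>j. j < length ys ==> ?M2 (?F + j) = ys ! j" using Suc.prems assms(2) by auto
  moreover have "?R2 1 = ?F" "?R2 2 = R 2" "?R2 4 = n" "n <= length ys" "?R2 3 = length ys - n"
   using Suc.prems by auto
  ultimately obtain t R' M' where 2: "t <= 1 + 20 * n" "runs (While 4 (block w2)) (?R2, ?M2) t (R', M')"
   "R' 2 = R 2" "\<forall>j < length ys. M' j = ys ! j"
   using Suc.IH[of ?R2 ?M2] by blast
  have "runs (While 4 (block w2)) (R1, M1) (Suc (11 + t)) (R', M')"
   using Suc.prems(3) by (intro runs_While_step[OF _ r 2(2)]) simp
  with 2 show ?case by (intro exI[of _ "Suc (11 + t)"] exI[of _ R'] exI[of _ M']) auto
 qed
 let ?R1 = "R(0 := 0, 4 := ?F)"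
 have r1: "runs (block b1) (R, M) 3 (?R1, M)"
  using runs_blockI[of b1 "(R, M)"] by (simp add: b1_def)
 obtain t2 R2 M2 where 2: "t2 <= 1 + 20 * length ys" "runs (While 3 (block w1)) (?R1, M) t2 (R2, M2)"
  "R2 1 = ?F" "R2 2 = R 2" "R2 4 = ?F + length ys" "\<forall>q < ?F. M2 q = M q" "\<forall>j < length ys. M2 (?F + j) = ys ! j"
  using l1[of ?R1 M ys] assms(1) by auto
 let ?R3 = "R2(4 := length ys, 3 := 0)"
 have r3: "runs (block b2) (R2, M2) 3 (?R3, M2)"
  using runs_blockI[of b2 "(R2, M2)"] 2 by (simp add: b2_def)
 obtain t4 R4 M4 where 4: "t4 <= 1 + 20 * length ys" "runs (While 4 (block w2)) (?R3, M2) t4 (R4, M4)"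
  "R4 2 = R 2" "\<forall>j < length ys. M4 j = ys ! j"
  using l2[of ?R3 "length ys" M2] 2 by auto
 have "runs (Seq (block b1) (Seq (While 3 (block w1)) (Seq (block b2) (While 4 (block w2))))) (R, M)
   (Suc (3 + Suc (t2 + Suc (3 + t4)))) (R4, M4)"
  by (intro runs_Seq[OF r1] runs_Seq[OF 2(2)] runs_Seq[OF r3] 4(2))
 then show ?thesis using 2(1) 4
  by (intro exI[of _ "Suc (3 + Suc (t2 + Suc (3 + t4)))"] exI[of _ R4] exI[of _ M4]) auto
qed

text \<open>The condition on the length protects the output itself: it is copied to the free pointer
  and from there written to the cells from 0 on. The free pointer exceeds the input length, so an
  output that is no longer than the input cannot overwrite its own copy.\<close>

theorem stage2_program:
 assumes "pt (f :: nat list => nat \<times> nat list)"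
 shows "\<exists>c k. \<forall>inp. length (snd (f inp)) <= length inp -->
  (\<exists>t R M. t <= k * (1 + input_size inp) ^ k \<and> runs c (init inp) t (R, M) \<and>
    R 0 = fst (f inp) \<and> (\<forall>j < length (snd (f inp)). M j = snd (f inp) ! j))"
proof -
 obtain T where T: "pbd T" "\<And>a. a \<ge> 2 ==> \<exists>c. computes a c f T"
  using assms by (auto simp: pt_def)
 obtain c where c: "computes 2 c f T" using T(2)[of 2] by auto
 have "pbd (%inp. 100 + 70 * sz inp + T inp)" by (intro pbd_add pbd_mult pbd_const pbd_sz T)
 then obtain k where k: "\<And>inp. 100 + 70 * sz inp + T inp <= k * sz inp ^ k"
  unfolding pbd_def by blast
 define b where "b = [Const 0 1, Add 3 2 0, Load 3 3, Load 2 2]"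
 define e where "e = [Const 0 0, Add 0 2 0]"
 obtain cw where cw: "\<And>R M ys. rep M (R 1) (R 3) (ys :: nat list) ==> length ys <= R 1 ==>
  \<exists>t R' M'. t <= 30 + 40 * length ys \<and> runs cw (R, M) t (R', M') \<and>
  R' 2 = R 2 \<and> (\<forall>j < length ys. M' j = ys ! j)"
  using runs_output_list by blast
 show ?thesis
 proof (rule exI[of _ "Seq prelude (Seq c (Seq (block b) (Seq cw (block e))))"], rule exI[of _ k], intro allI impI)
  fix inp assume len: "length (snd (f inp)) <= length inp"
  obtain t1 R1 M1 where 1: "t1 <= 10 + 30 * length inp" "runs prelude (init inp) t1 (R1, M1)"
   "length inp < R1 1" "rep M1 (R1 1) (R1 2) inp" using runs_prelude by blast
  obtain t2 R2 M2 where 2: "t2 <= T inp" "runs c (R1, M1) t2 (R2, M2)" "keeps 2 (R1, M1) (R2, M2)"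
   "rep M2 (R2 1) (R2 2) (f inp)" using computesE[OF c _ 1(4)] order_le_less_trans[OF zero_le 1(3)] by blast
  have F: "length inp < R2 1" using 1(3) 2(3) by (auto simp: keeps_def)
  let ?R3 = "R2(0 := 1, 3 := M2 (Suc (R2 2)), 2 := fst (f inp))"
  have r3: "runs (block b) (R2, M2) 7 (?R3, M2)"
  proof -
   have "fold bstep b (R2, M2) = (?R3, M2)"
    using 2(4) by (simp add: b_def fun_eq_iff rep_prod_def rep_nat_def)
   from runs_blockI[OF _ _ this] show ?thesis by (simp add: b_def)
  qed
  obtain t4 R4 M4 where 4: "t4 <= 30 + 40 * length (snd (f inp))" "runs cw (?R3, M2) t4 (R4, M4)"
   "R4 2 = fst (f inp)" "\<forall>j < length (snd (f inp)). M4 j = snd (f inp) ! j"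
   using cw[of M2 ?R3 "snd (f inp)"] 2(4) F len by (auto simp: rep_prod_def)
  have r5: "runs (block e) (R4, M4) 3 (R4(0 := fst (f inp)), M4)"
   using runs_blockI[of e "(R4, M4)"] 4 by (simp add: e_def)
  have rr: "runs (Seq prelude (Seq c (Seq (block b) (Seq cw (block e))))) (init inp)
   (Suc (t1 + Suc (t2 + Suc (7 + Suc (t4 + 3))))) (R4(0 := fst (f inp)), M4)"
   by (intro runs_Seq[OF 1(2)] runs_Seq[OF 2(2)] runs_Seq[OF r3] runs_Seq[OF 4(2)] r5)
  have "k * sz inp ^ k <= k * (1 + input_size inp) ^ k"
   by (intro mult_le_mono2 power_mono sz_input) auto
  then have "Suc (t1 + Suc (t2 + Suc (7 + Suc (t4 + 3)))) <= k * (1 + input_size inp) ^ k"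
   using k[of inp] 1(1) 2(1) 4(1) len length_le_sz[of inp] by linarith
  then show "\<exists>t R M. t <= k * (1 + input_size inp) ^ k \<and>
    runs (Seq prelude (Seq c (Seq (block b) (Seq cw (block e))))) (init inp) t (R, M) \<and>
    R 0 = fst (f inp) \<and> (\<forall>j < length (snd (f inp)). M j = snd (f inp) ! j)"
   using rr 4(4) by (metis fun_upd_same)
 qed
qed

text \<open>The result is random, so \<open>runs\<close> cannot describe this loop. A round takes
  three steps for \<open>While\<close>, \<open>Seq\<close> and \<open>Sample\<close> and 19 for the
  block of ten commands, in total 22; the last test takes one more.\<close>

lemma exec_sample_loop:
 assumes cs: "cs = [Store 1 5, Const 0 0, Add 6 1 0, Const 0 1, Add 1 1 0, Store 1 4, Add 1 1 0, Sub 3 3 0,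
   Const 0 0, Add 4 6 0]"
  and ss: "\<And>k R M. ss k (R, M) = fold bstep cs (R(5 := k), M)"
  and "fst s 3 = N"
 shows "exec D (22 * N + 1 + n) (While 3 (Seq (Sample 5) (block cs)) # K, s) =
  bind_pmf (replicate_pmf N D) (%ws. exec D n (K, fold ss ws s))"
 using assms(3)
proof (induction N arbitrary: s)
 case 0
 then show ?case by (cases s) (simp add: bind_return_pmf)
next
 case (Suc N)
 let ?W = "While 3 (Seq (Sample 5) (block cs))"
 obtain R M where s: "s = (R, M)" by force
 have "exec D (22 * Suc N + 1 + n) (?W # K, s) =
   exec D (Suc (Suc (Suc (19 + (22 * N + 1 + n))))) (?W # K, (R, M))"
  by (simp add: s add.assoc)
 also have "\<dots> = bind_pmf D (%k. exec D (19 + (22 * N + 1 + n)) (block cs # ?W # K, (R(5 := k), M)))"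
 proof -
  have "exec D (Suc (Suc (Suc m))) (?W # K, (R, M)) = bind_pmf D (%k. exec D m (block cs # ?W # K, (R(5 := k), M)))" for m
   using Suc.prems by (simp add: s bind_return_pmf bind_map_pmf del: fun_upd_apply)
  then show ?thesis .
 qed
 also have "\<dots> = bind_pmf D (%k. exec D (22 * N + 1 + n) (?W # K, ss k s))"
 proof (intro bind_pmf_cong refl)
  fix k
  have "runs (block cs) (R(5 := k), M) 19 (ss k (R, M))"
   using runs_blockI[of cs "(R(5 := k), M)" "ss k (R, M)"] by (simp add: cs ss)
  from runsD[OF this] show "exec D (19 + (22 * N + 1 + n)) (block cs # ?W # K, (R(5 := k), M)) =
    exec D (22 * N + 1 + n) (?W # K, ss k s)" unfolding s .
 qed
 also have "\<dots> = bind_pmf D (%k. bind_pmf (replicate_pmf N D) (%ws. exec D n (K, fold ss ws (ss k s))))"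
 proof (intro bind_pmf_cong refl Suc.IH)
  fix k show "fst (ss k s) 3 = N" using Suc.prems by (simp add: s ss cs)
 qed
 finally show ?case by (simp add: bind_assoc_pmf bind_return_pmf)
qed

text \<open>The number of samples is a function of the input, so the answers are distributed as
  \<open>replicate_pmf\<close>. They are consed to a list, which yields \<open>rev ws\<close>. The
  premise on \<open>t\<close> ranges over the support because the sizes of the answers enter the
  running time.\<close>

theorem stage1_program:
 assumes "pt (h :: nat list => nat)" "pt (f :: nat list \<times> nat list => nat)"
 shows "\<exists>c k. \<forall>inp (D :: nat pmf) t.
  (\<forall>ws \<in> set_pmf (replicate_pmf (h inp) D). k * sz (inp, ws) ^ k <= t) -->
  (\<exists>S. exec D t (start c inp) = map_pmf (%ws. ([], S ws)) (replicate_pmf (h inp) D) \<and>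
   (\<forall>ws \<in> set_pmf (replicate_pmf (h inp) D). fst (S ws) 0 = f (inp, rev ws) \<and> fst (S ws) 1 = 0))"
proof -
 obtain Th where Th: "pbd Th" "\<And>a. a \<ge> 2 ==> \<exists>c. computes a c h Th"
  using assms by (auto simp: pt_def)
 obtain Tf where Tf: "pbd Tf" "\<And>a. a \<ge> 2 ==> \<exists>c. computes a c f Tf"
  using assms unfolding pt_def by blast
 obtain ch where ch: "computes 3 ch h Th" using Th(2)[of 3] by auto
 obtain cf where cf: "computes 2 cf f Tf" using Tf(2)[of 2] by auto
 have "pbd (%p :: nat list \<times> nat list. 100 + 70 * sz p + Tf p + Th (fst p))"
  by (intro pbd_add pbd_mult pbd_const pbd_sz Tf pbd_comp[OF Th(1)] pt_sz pt_fst')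
 then obtain k where k: "\<And>p. 100 + 70 * sz p + Tf p + Th (fst p) <= k * sz p ^ k"
  unfolding pbd_def by blast
 define cs where "cs = [Store 1 5, Const 0 0, Add 6 1 0, Const 0 1, Add 1 1 0, Store 1 4, Add 1 1 0, Sub 3 3 0,
   Const 0 0, Add 4 6 0]"
 define ss where "ss = (%k s. fold bstep cs ((fst s)(5 := k), snd s))"
 define b1 where "b1 = [Const 0 0, Add 3 2 0]"
 define b2 where "b2 = [Const 4 0]"
 define b3 where "b3 = [Store 1 2, Const 0 0, Add 2 1 0, Const 0 1, Add 1 1 0, Store 1 4, Add 1 1 0]"
 define e where "e = [Const 1 0, Add 0 2 1]"
 let ?W = "While 3 (Seq (Sample 5) (block cs))"
 let ?P = "Seq prelude (Seq (block b1) (Seq ch (block b2)))"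
 let ?Q = "Seq (block b3) (Seq cf (block e))"
 show ?thesis
 proof (rule exI[of _ "Seq ?P (Seq ?W ?Q)"], rule exI[of _ k], intro allI impI)
  fix inp t and D :: "nat pmf" assume t: "\<forall>ws \<in> set_pmf (replicate_pmf (h inp) D). k * sz (inp, ws) ^ k <= t"
  obtain t1 R1 M1 where 1: "t1 <= 10 + 30 * length inp" "runs prelude (init inp) t1 (R1, M1)"
   "length inp < R1 1" "rep M1 (R1 1) (R1 2) inp" using runs_prelude by blast
  let ?R2 = "R1(0 := 0, 3 := R1 2)"
  have r2: "runs (block b1) (R1, M1) 3 (?R2, M1)"
   using runs_blockI[of b1 "(R1, M1)"] by (simp add: b1_def)
  have r2': "rep M1 (?R2 1) (?R2 3) inp" "0 < ?R2 1" using 1(3,4) by auto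
  obtain t3 R3 M3 where 3: "t3 <= Th inp" "runs ch (?R2, M1) t3 (R3, M3)" "keeps 3 (?R2, M1) (R3, M3)"
   "rep M3 (R3 1) (R3 3) (h inp)" "0 < R3 1" using computesE[OF ch r2'(2,1)] by blast
  have inp3: "rep M3 (R3 1) (R3 2) inp"
   using keeps_rep[OF 3(3) r2'(1)] 3(3) by (auto simp: keeps_def)
  let ?R4 = "R3(4 := 0)"
  have r4: "runs (block b2) (R3, M3) 1 (?R4, M3)"
   using runs_blockI[of b2 "(R3, M3)"] by (simp add: b2_def)
  define s4 where "s4 = (?R4, M3)"
  define tP where "tP = Suc (t1 + Suc (3 + Suc (t3 + 1)))"
  have rP: "runs ?P (init inp) tP s4"
   unfolding tP_def s4_def by (intro runs_Seq[OF 1(2)] runs_Seq[OF r2] runs_Seq[OF 3(2)] r4)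
  have s4: "fst s4 3 = h inp" using 3(4) by (simp add: s4_def rep_nat_def)
  have acc: "rep (snd s) (fst s 1) (fst s 2) inp \<and> rep (snd s) (fst s 1) (fst s 4) (rev ws) \<and> 0 < fst s 1"
   if "s = fold ss ws s4" for s ws
   using that
  proof (induction ws arbitrary: s rule: rev_induct)
   case Nil
   then show ?case using inp3 3(5) by (simp add: s4_def)
  next
   case (snoc y ws)
   obtain R M where s: "fold ss ws s4 = (R, M)" by force
   have IH: "rep M (R 1) (R 2) inp" "rep M (R 1) (R 4) (rev ws)" "0 < R 1"
    using snoc.IH[OF refl] s by auto
   have e: "fold ss (ws @ [y]) s4 = (R(5 := y, 0 := 0, 6 := R 1, 1 := R 1 + 2, 3 := R 3 - 1, 4 := R 1),
     M(R 1 := y, R 1 + 1 := R 4))"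
    using s IH(3) by (simp add: ss_def cs_def fun_eq_iff)
   have m: "rep (M(R 1 := y, R 1 + 1 := R 4)) (R 1 + 2) p v" if "rep M (R 1) p v" for p and v :: "nat list"
    by (rule rep_mono[OF that]) auto
   define M' where "M' = M(R 1 := y, R 1 + 1 := R 4)"
   have "M' (R 1) = y" "M' (Suc (R 1)) = R 4" by (auto simp: M'_def)
   then show ?case using m[OF IH(1)] m[OF IH(2)] IH(3)
    unfolding snoc.prems e M'_def[symmetric] by (auto simp: rep_nat_def)
  qed
  have post: "\<exists>u s'. u + 22 * length ws + tP + 3 <= k * sz (inp, ws) ^ k \<and> runs ?Q (fold ss ws s4) u s' \<and>
    fst s' 0 = f (inp, rev ws) \<and> fst s' 1 = 0" for ws
  proof -
   obtain R M where s: "fold ss ws s4 = (R, M)" by force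
   have a: "rep M (R 1) (R 2) inp" "rep M (R 1) (R 4) (rev ws)" "0 < R 1"
    using acc[OF s[symmetric]] by auto
   let ?F = "R 1"
   let ?R5 = "R(0 := 1, 2 := ?F, 1 := ?F + 2)"
   let ?M5 = "M(?F := R 2, ?F + 1 := R 4)"
   have r5: "runs (block b3) (R, M) 13 (?R5, ?M5)"
   proof -
    have "fold bstep b3 (R, M) = (?R5, ?M5)" using a by (simp add: b3_def fun_eq_iff)
    from runs_blockI[OF _ _ this] show ?thesis by (simp add: b3_def)
   qed
   have m: "rep ?M5 (?F + 2) p v" if "rep M (R 1) p v" for p and v :: "nat list"
    by (rule rep_mono[OF that]) auto
   have p5: "rep ?M5 (?R5 1) (?R5 2) (inp, rev ws)" "0 < ?R5 1"
    using m[OF a(1)] m[OF a(2)] a(3) by (auto simp: rep_prod_def)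
   obtain t6 R6 M6 where 6: "t6 <= Tf (inp, rev ws)" "runs cf (?R5, ?M5) t6 (R6, M6)"
    "rep M6 (R6 1) (R6 2) (f (inp, rev ws))" using computesE[OF cf p5(2,1)] by blast
   let ?R7 = "R6(1 := 0, 0 := f (inp, rev ws))"
   have r7: "runs (block e) (R6, M6) 3 (?R7, M6)"
    using runs_blockI[of e "(R6, M6)"] 6(3) by (simp add: e_def rep_nat_def)
   have rQ: "runs ?Q (fold ss ws s4) (Suc (13 + Suc (t6 + 3))) (?R7, M6)"
    unfolding s by (intro runs_Seq[OF r5] runs_Seq[OF 6(2)] r7)
   have "Suc (13 + Suc (t6 + 3)) + 22 * length ws + tP + 3 <= k * sz (inp, ws) ^ k"
    using k[of "(inp, rev ws)"] 6(1) 1(1) 3(1) length_le_sz[of inp] length_le_sz[of ws] unfolding tP_def by simp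
   with rQ show ?thesis by (intro exI[of _ "Suc (13 + Suc (t6 + 3))"] exI[of _ "(?R7, M6)"]) simp
  qed
  then obtain u S where uS: "\<And>ws. u ws + 22 * length ws + tP + 3 <= k * sz (inp, ws) ^ k"
   "\<And>ws. runs ?Q (fold ss ws s4) (u ws) (S ws)" "\<And>ws. fst (S ws) 0 = f (inp, rev ws) \<and> fst (S ws) 1 = 0"
   by metis
  have tN: "u ws + 22 * h inp + tP + 3 <= t" if "ws \<in> set_pmf (replicate_pmf (h inp) D)" for ws
   using t[rule_format, OF that] uS(1)[of ws] that by (simp add: set_replicate_pmf)
  obtain ws0 where "ws0 \<in> set_pmf (replicate_pmf (h inp) D)" using set_pmf_not_empty by fast
  \<comment> \<open>The final computation takes a different time \<open>u ws\<close> for each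
    sample. The fuel \<open>n\<close> left after the loop is the same for all samples and at least
    each \<open>u ws\<close>; surplus steps do nothing after halting.\<close>
  from tN[OF this] obtain n where n: "t = Suc (tP + Suc (22 * h inp + 1 + n))"
   using le_Suc_ex[of "22 * h inp + tP + 3" t] by force
  have un: "u ws <= n" if "ws \<in> set_pmf (replicate_pmf (h inp) D)" for ws
   using tN[OF that] n by simp
  have "exec D t (start (Seq ?P (Seq ?W ?Q)) inp) = exec D (tP + Suc (22 * h inp + 1 + n)) ([?P, Seq ?W ?Q], init inp)"
   by (cases "init inp") (simp add: start_init n bind_return_pmf)
  also have "\<dots> = exec D (Suc (22 * h inp + 1 + n)) ([Seq ?W ?Q], s4)" by (rule runsD[OF rP])
  also have "\<dots> = exec D (22 * h inp + 1 + n) ([?W, ?Q], s4)" by (cases s4) (simp add: bind_return_pmf)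
  also have "\<dots> = bind_pmf (replicate_pmf (h inp) D) (%ws. exec D n ([?Q], fold ss ws s4))"
   by (rule exec_sample_loop[OF cs_def _ s4]) (simp add: ss_def)
  also have "\<dots> = bind_pmf (replicate_pmf (h inp) D) (%ws. return_pmf ([], S ws))"
   by (intro bind_pmf_cong refl exec_runs[OF uS(2)] un)
  also have "\<dots> = map_pmf (%ws. ([], S ws)) (replicate_pmf (h inp) D)"
   by (simp add: map_pmf_def)
  finally show "\<exists>S. exec D t (start (Seq ?P (Seq ?W ?Q)) inp) = map_pmf (%ws. ([], S ws)) (replicate_pmf (h inp) D) \<and>
   (\<forall>ws \<in> set_pmf (replicate_pmf (h inp) D). fst (S ws) 0 = f (inp, rev ws) \<and> fst (S ws) 1 = 0)"
   using uS(3) by blast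
 qed
qed

section \<open>Analysis of the distributionally robust objective\<close>

section \<open>The worst distribution in an L-infinity ball\<close>

definition excess :: "('a => real) => real => 'a => real" where
 "excess f r A = max 0 (f A - r)"

lemma excess_nonneg: "0 <= excess f r A"
 by (simp add: excess_def)

lemma expectation_finite:
 assumes "finite S" "set_pmf q \<subseteq> S"
 shows "measure_pmf.expectation q C = (\<Sum>A\<in>S. pmf q A * (C A :: real))"
 using integral_measure_pmf[of S q C] assms by auto

text \<open>The movable mass is the sum of all \<open>min (f A) r\<close>. If some scenario reaches
  \<open>r\<close>, its term alone is \<open>r\<close>; otherwise nothing is cut off and the sum is
  1. The lower bound turns errors proportional to \<open>r\<close> into relative errors; the upper
  bound says that an equal share of the movable mass is at most \<open>r\<close>.\<close>

lemma excess_slack: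
 assumes "finite S" "\<And>A. A \<in> S ==> 0 <= f A" "sum f S = 1" "r <= 1" "0 < r"
 shows "r <= 1 - sum (excess f r) S" "1 - sum (excess f r) S <= r * card S"
proof -
 have e: "1 - sum (excess f r) S = (\<Sum>A\<in>S. min (f A) r)"
 proof -
  have "f A - excess f r A = min (f A) r" for A by (auto simp: excess_def)
  then show ?thesis using assms(3) by (metis (no_types, lifting) sum.cong sum_subtractf)
 qed
 show "1 - sum (excess f r) S <= r * card S"
  unfolding e using sum_bounded_above[of S "%A. min (f A) r" r] by (simp add: mult.commute)
 show "r <= 1 - sum (excess f r) S"
 proof (cases "\<exists>A\<in>S. r <= f A")
  case True
  then obtain A where A: "A \<in> S" "r <= f A" by auto
  have "r = min (f A) r" using A by simp
  also have "\<dots> <= (\<Sum>A\<in>S. min (f A) r)"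
   by (rule member_le_sum[OF A(1)]) (use assms in auto)
  finally show ?thesis unfolding e .
 next
  case False
  then have "(\<Sum>A\<in>S. min (f A) r) = 1" unfolding assms(3)[symmetric] by (intro sum.cong) auto
  then show ?thesis using e assms(4) by simp
 qed
qed

text \<open>A distribution in the ball keeps at least the excess mass on every scenario; whatever it
  has beyond that is charged the maximum cost.\<close>

lemma ball_expectation_le:
 assumes "finite S" "set_pmf q \<subseteq> S" "\<And>A. A \<in> S ==> \<bar>pmf p A - pmf q A\<bar> <= r"
  "\<And>A. A \<in> S ==> C A <= Cm"
 shows "measure_pmf.expectation q C <=
  (\<Sum>A\<in>S. excess (pmf p) r A * C A) + (1 - sum (excess (pmf p) r) S) * Cm"
proof -
 have "(\<Sum>A\<in>S. (pmf q A - excess (pmf p) r A) * C A) <= (\<Sum>A\<in>S. (pmf q A - excess (pmf p) r A) * Cm)"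
 proof (intro sum_mono mult_left_mono assms)
  fix A assume "A \<in> S"
  then show "0 <= pmf q A - excess (pmf p) r A"
   using assms(3)[of A] pmf_nonneg[of q A] by (auto simp: excess_def abs_le_iff)
 qed
 also have "\<dots> = (1 - sum (excess (pmf p) r) S) * Cm"
  using sum_pmf_eq_1[OF assms(1,2)] by (simp add: sum_distrib_right[symmetric] sum_subtractf)
 finally show ?thesis
  unfolding expectation_finite[OF assms(1,2)] by (simp add: left_diff_distrib sum_subtractf)
qed

text \<open>The mass of a scenario changes by the difference of \<open>min (pmf p A) r\<close> and
  the equal share. Both lie between 0 and \<open>r\<close>, so the ball is not left.\<close>

lemma ball_spread:
 assumes "finite S" "set_pmf p \<subseteq> S" "0 < r" "r <= 1"
 obtains q where "set_pmf q \<subseteq> S" "\<And>A. A \<in> S ==> \<bar>pmf p A - pmf q A\<bar> <= r"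
  "\<And>A. A \<in> S ==> pmf q A = excess (pmf p) r A + (1 - sum (excess (pmf p) r) S) / card S"
proof -
 let ?m = "1 - sum (excess (pmf p) r) S"
 define g where "g A = (if A \<in> S then excess (pmf p) r A + ?m / card S else 0)" for A
 have S: "S \<noteq> {}" using assms(2) set_pmf_not_empty by fast
 have c: "0 < card S" using S assms(1) by (simp add: card_gt_0_iff)
 note m = excess_slack[OF assms(1) _ sum_pmf_eq_1[OF assms(1,2)] assms(4,3)]
 have m0: "0 <= ?m / card S" "?m / card S <= r"
  using m assms(3) c by (auto simp: field_simps)
 have g: "0 <= g A" for A using m0 excess_nonneg[of "pmf p" r A] by (auto simp: g_def)
 have "sum g S = sum (excess (pmf p) r) S + card S * (?m / card S)"
  by (simp add: g_def sum.distrib)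
 then have g1: "sum g S = 1" using c by simp
 have "(\<integral>\<^sup>+ A. ennreal (g A) \<partial>count_space UNIV) = (\<Sum>A\<in>S. ennreal (g A))"
  by (rule nn_integral_count_space') (use assms(1) in \<open>auto simp: g_def\<close>)
 also have "\<dots> = 1" using g g1 by (subst sum_ennreal) auto
 finally have q: "pmf (embed_pmf g) A = g A" for A by (intro pmf_embed_pmf g)
 show ?thesis
 proof
  show "set_pmf (embed_pmf g) \<subseteq> S" by (auto simp: set_pmf_iff q) (auto simp: g_def split: if_splits)
  show "pmf (embed_pmf g) A = excess (pmf p) r A + ?m / card S" if "A \<in> S" for A
   using that by (simp add: q g_def)
  have "\<bar>a - (max 0 (a - r) + t)\<bar> <= r" if "0 <= t" "t <= r" "0 <= a" for a t
   using that assms(3) by (auto simp: max_def abs_le_iff)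
  from this[OF m0] show "\<bar>pmf p A - pmf (embed_pmf g) A\<bar> <= r" if "A \<in> S" for A
   using that by (simp add: q g_def excess_def)
 qed
qed

text \<open>Each of the two distributions has at most \<open>1 / r\<close> scenarios with mass above
  \<open>r\<close>, and elsewhere both excesses vanish. So the pointwise errors add up to a bound
  that is independent of the number of scenarios.\<close>

lemma excess_diff_sum:
 assumes "finite S" "\<And>A. A \<in> S ==> 0 <= f A" "sum f S = 1" "\<And>A. A \<in> S ==> 0 <= g A" "sum g S = 1"
  "\<And>A. A \<in> S ==> \<bar>f A - g A\<bar> <= \<eta>" "0 < r" "0 <= \<eta>"
 shows "(\<Sum>A\<in>S. \<bar>excess f r A - excess g r A\<bar>) <= 2 * \<eta> / r"
proof -
 have c: "r * card {A\<in>S. r < h A} <= 1" if "\<And>A. A \<in> S ==> 0 <= h A" "sum h S = 1" for h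
 proof -
  have "r * card {A\<in>S. r < h A} = (\<Sum>A | A \<in> S \<and> r < h A. r)" by simp
  also have "\<dots> <= (\<Sum>A | A \<in> S \<and> r < h A. h A)" by (intro sum_mono) auto
  also have "\<dots> <= sum h S" using assms(1) that by (intro sum_mono2) auto
  finally show ?thesis using that by simp
 qed
 let ?H = "{A\<in>S. r < f A} \<union> {A\<in>S. r < g A}"
 have "(\<Sum>A\<in>S. \<bar>excess f r A - excess g r A\<bar>) = (\<Sum>A\<in>?H. \<bar>excess f r A - excess g r A\<bar>)"
  by (rule sum.mono_neutral_right) (use assms(1) in \<open>auto simp: excess_def\<close>)
 also have "\<dots> <= (\<Sum>A\<in>?H. \<eta>)"
 proof (rule sum_mono)
  fix A assume "A \<in> ?H"
  then have "\<bar>f A - g A\<bar> <= \<eta>" using assms by auto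
  then show "\<bar>excess f r A - excess g r A\<bar> <= \<eta>" by (auto simp: excess_def)
 qed
 also have "\<dots> <= (card {A\<in>S. r < f A} + card {A\<in>S. r < g A}) * \<eta>"
  using card_Un_le[of "{A\<in>S. r < f A}" "{A\<in>S. r < g A}"] assms(8)
  by (simp add: mult_right_mono del: of_nat_add)
 also have "\<dots> <= (1 / r + 1 / r) * \<eta>"
  using c[of f] c[of g] assms by (intro mult_right_mono) (auto simp: field_simps)
 finally show ?thesis by simp
qed

text \<open>The value is \<open>\<kappa> * Cm\<close> plus the excess-weighted differences
  \<open>C A - \<kappa> * Cm\<close>. For \<open>\<kappa>\<close> at least 1/2 these are at most
  \<open>\<kappa> * Cm\<close> in absolute value, so the error is at most
  \<open>\<epsilon> * r * (\<kappa> * Cm)\<close>; since the movable mass is at least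
  \<open>r\<close>, this is an \<open>\<epsilon>\<close> fraction of the value. The case
  \<open>\<kappa> = 1\<close> is for the solution of the algorithm, \<open>\<kappa> = 1/2\<close>
  for the solution it is compared with.\<close>

lemma excess_robust:
 assumes S: "finite S" and f: "\<And>A. A \<in> S ==> 0 <= f A" "sum f S = 1"
  and g: "\<And>A. A \<in> S ==> 0 <= g A" "sum g S = 1"
  and fg: "\<And>A. A \<in> S ==> \<bar>f A - g A\<bar> <= \<eta>" and r: "0 < r" "r <= 1" and \<eta>: "0 <= \<eta>" "2 * \<eta> <= \<epsilon> * r\<^sup>2"
  and C: "\<And>A. A \<in> S ==> 0 <= C A \<and> C A <= Cm" "0 <= Cm" and \<kappa>: "1/2 <= \<kappa>" "\<kappa> <= 1"
 shows "(\<Sum>A\<in>S. excess f r A * C A) + \<kappa> * (1 - sum (excess f r) S) * Cm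
  <= (1 + \<epsilon>) * ((\<Sum>A\<in>S. excess g r A * C A) + \<kappa> * (1 - sum (excess g r) S) * Cm)"
proof -
 let ?G = "%f. (\<Sum>A\<in>S. excess f r A * C A) + \<kappa> * (1 - sum (excess f r) S) * Cm"
 have G: "?G h = \<kappa> * Cm + (\<Sum>A\<in>S. excess h r A * (C A - \<kappa> * Cm))" for h
  by (simp add: algebra_simps sum_subtractf sum_distrib_left sum_distrib_right)
 have "?G f - ?G g = (\<Sum>A\<in>S. (excess f r A - excess g r A) * (C A - \<kappa> * Cm))"
  unfolding G by (simp add: left_diff_distrib sum_subtractf)
 also have "\<dots> <= (\<Sum>A\<in>S. \<bar>excess f r A - excess g r A\<bar> * (\<kappa> * Cm))"
 proof (rule sum_mono)
  fix A assume A: "A \<in> S"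
  have "Cm <= 2 * (\<kappa> * Cm)" using \<kappa> C(2) mult_right_mono[of 1 "2 * \<kappa>" Cm] by simp
  then have "\<bar>C A - \<kappa> * Cm\<bar> <= \<kappa> * Cm" using C(1)[OF A] unfolding abs_le_iff by linarith
  then have "\<bar>(excess f r A - excess g r A) * (C A - \<kappa> * Cm)\<bar> <= \<bar>excess f r A - excess g r A\<bar> * (\<kappa> * Cm)"
   by (simp add: abs_mult mult_left_mono)
  then show "(excess f r A - excess g r A) * (C A - \<kappa> * Cm) <= \<bar>excess f r A - excess g r A\<bar> * (\<kappa> * Cm)"
   by linarith
 qed
 also have "\<dots> <= 2 * \<eta> / r * (\<kappa> * Cm)"
  unfolding sum_distrib_right[symmetric]
  using excess_diff_sum[OF S f g fg r(1) \<eta>(1)] \<kappa> C(2) by (intro mult_right_mono) auto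
 also have "\<dots> <= \<epsilon> * r * (\<kappa> * Cm)"
  using \<eta> r \<kappa> C(2) by (intro mult_right_mono) (auto simp: field_simps power2_eq_square)
 also have "\<dots> <= \<epsilon> * ?G g"
 proof -
  have "0 <= \<epsilon>"
  proof (rule ccontr)
   assume "\<not> 0 <= \<epsilon>"
   then have "\<epsilon> * r\<^sup>2 < 0" using r by (simp add: mult_neg_pos)
   with \<eta> show False by simp
  qed
  moreover have "r * (\<kappa> * Cm) <= (1 - sum (excess g r) S) * (\<kappa> * Cm)"
   using excess_slack(1)[OF S g r(2,1)] \<kappa> C(2) by (intro mult_right_mono) auto
  moreover have "0 <= (\<Sum>A\<in>S. excess g r A * C A)" using C by (intro sum_nonneg mult_nonneg_nonneg excess_nonneg) auto
  ultimately show ?thesis unfolding mult.assoc by (intro mult_left_mono) (auto simp: algebra_simps)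
 qed
 finally show ?thesis by (simp add: algebra_simps)
qed

section \<open>Reduction to finitely many weighted scenarios\<close>

lemma ball_bdd:
 fixes C :: "nat set => real"
 assumes "finite (ground P)"
 shows "bdd_above ((%q. measure_pmf.expectation q C) ` linf_ball P p r)"
proof (rule bdd_aboveI2)
 fix q assume "q \<in> linf_ball P p r"
 then have q: "set_pmf q \<subseteq> Pow (ground P)" by (auto simp: linf_ball_def distributions_def)
 have "measure_pmf.expectation q C = (\<Sum>A\<in>Pow (ground P). pmf q A * C A)"
  using assms by (intro expectation_finite q) auto
 also have "\<dots> <= (\<Sum>A\<in>Pow (ground P). 1 * \<bar>C A\<bar>)"
 proof (rule sum_mono)
  fix A show "pmf q A * C A <= 1 * \<bar>C A\<bar>"
   using mult_mono[of "pmf q A" 1 "C A" "\<bar>C A\<bar>"] mult_left_mono[of "C A" "\<bar>C A\<bar>" "pmf q A"]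
    mult_right_mono[of "pmf q A" 1 "\<bar>C A\<bar>"] pmf_le_1[of q A] pmf_nonneg[of q A] by linarith
 qed
 finally show "measure_pmf.expectation q C <= (\<Sum>A\<in>Pow (ground P). 1 * \<bar>C A\<bar>)" .
qed

lemma center_in_ball: "p \<in> distributions P ==> 0 <= r ==> p \<in> linf_ball P p r"
 by (auto simp: linf_ball_def)

lemma opt_geI:
 assumes "(x, z) \<in> solutions P" "0 < \<rho>"
  "\<And>x' z'. (x', z') \<in> solutions P ==> c <= \<rho> * objective P p r x' z'"
 shows "c <= \<rho> * opt P p r"
proof -
 have "c / \<rho> <= opt P p r"
  unfolding opt_def
  by (rule cINF_greatest) (use assms in \<open>auto simp: field_simps split: prod.splits\<close>)
 then show ?thesis using assms(2) by (simp add: field_simps)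
qed

text \<open>
 Complementary scenarios have at least the cost of the full scenario together, so spreading the
 movable mass uniformly already costs half as much as moving all of it to the full scenario.
\<close>

lemma objective_ge:
 fixes P :: "'z two_stage"
 assumes fin: "finite (ground P)" and p: "p \<in> distributions P" and r: "0 < r" "r <= 1"
  and nn: "\<And>x A z. x \<subseteq> actions P ==> A \<subseteq> ground P ==> feasible P x A z ==> 0 <= recourse_cost P A z"
  and join: "\<And>x A B z z'. x \<subseteq> actions P ==> A \<subseteq> ground P ==> B \<subseteq> ground P ==> feasible P x A z ==> feasible P x B z' ==>
    \<exists>y. feasible P x (A \<union> B) y \<and> recourse_cost P (A \<union> B) y <= recourse_cost P A z + recourse_cost P B z'"
  and mono: "\<And>x A z. x \<subseteq> actions P ==> A \<subseteq> ground P ==> feasible P x (ground P) z ==>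
    feasible P x A z \<and> recourse_cost P A z <= recourse_cost P (ground P) z"
  and xz: "(x, z) \<in> solutions P"
 shows "\<exists>z'. (x, z') \<in> solutions P \<and>
  (\<forall>A. A \<subseteq> ground P --> recourse_cost P A (z' A) <= recourse_cost P (ground P) (z' (ground P))) \<and>
  sum (cost1 P) x + (\<Sum>A\<in>Pow (ground P). excess (pmf p) r A * recourse_cost P A (z' A)) +
    1/2 * (1 - sum (excess (pmf p) r) (Pow (ground P))) * recourse_cost P (ground P) (z' (ground P))
   <= objective P p r x z"
proof -
 let ?U = "ground P" let ?S = "Pow ?U" let ?m = "1 - sum (excess (pmf p) r) ?S"
 let ?C = "%A. recourse_cost P A (z A)"
 have x: "x \<subseteq> actions P" and z: "\<And>A. A \<subseteq> ?U ==> feasible P x A (z A)"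
  using xz by (auto simp: solutions_def)
 have S: "finite ?S" using fin by simp
 have pS: "set_pmf p \<subseteq> ?S" using p by (simp add: distributions_def)
 let ?avg = "sum ?C ?S / card ?S"
 have cS: "0 < card ?S" using fin by (simp add: card_Pow)
 \<comment> \<open>Complementation permutes the scenarios, so on average a complementary pair costs
   twice the average scenario, and some pair costs no more than that.\<close>
 have "\<exists>A\<in>?S. ?C A + ?C (?U - A) <= 2 * ?avg"
 proof (rule ccontr)
  assume "\<not> ?thesis"
  then have "(\<Sum>A\<in>?S. 2 * ?avg) < (\<Sum>A\<in>?S. ?C A + ?C (?U - A))"
   by (intro sum_strict_mono S) (auto simp: not_le)
  also have "\<dots> = sum ?C ?S + (\<Sum>A\<in>?S. ?C (?U - A))" by (rule sum.distrib)
  also have "(\<Sum>A\<in>?S. ?C (?U - A)) = sum ?C ?S"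
   by (rule sum.reindex_bij_witness[of _ "%A. ?U - A" "%A. ?U - A"]) auto
  finally show False using cS by simp
 qed
 then obtain A where A: "A \<subseteq> ?U" "?C A + ?C (?U - A) <= 2 * ?avg" by auto
 from join[OF x A(1) _ z z, of "?U - A" ] A obtain y where
  y: "feasible P x (A \<union> (?U - A)) y" "recourse_cost P (A \<union> (?U - A)) y <= ?C A + ?C (?U - A)" by auto
 have "A \<union> (?U - A) = ?U" using A by auto
 with y A have y': "feasible P x ?U y" "recourse_cost P ?U y <= 2 * ?avg" by auto
 obtain y where y: "feasible P x ?U y" "recourse_cost P ?U y <= 2 * ?avg" "recourse_cost P ?U y <= ?C ?U"
 proof (cases "recourse_cost P ?U y <= ?C ?U")
  case True
  with y' show ?thesis by (intro that) auto
 next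
  case False
  with y' show ?thesis by (intro that[of "z ?U"] z order_refl) linarith+
 qed
 \<comment> \<open>The recourse \<open>y\<close> replaces \<open>z\<close> wherever it is no dearer.
   No scenario becomes more expensive, and the full scenario, which now uses \<open>y\<close>,
   becomes the most expensive one.\<close>
 define z' where "z' B = (if recourse_cost P B y <= ?C B then y else z B)" for B
 have yB: "feasible P x B y" "recourse_cost P B y <= recourse_cost P ?U y" if "B \<subseteq> ?U" for B
  using mono[OF x that y(1)] by auto
 obtain q where q: "set_pmf q \<subseteq> ?S" "\<And>A. A \<in> ?S ==> \<bar>pmf p A - pmf q A\<bar> <= r"
  "\<And>A. A \<in> ?S ==> pmf q A = excess (pmf p) r A + ?m / card ?S"
  by (rule ball_spread[OF S pS r]) (rule that; blast)
 have m0: "0 <= ?m"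
  using excess_slack(1)[OF S _ sum_pmf_eq_1[OF S pS] r(2,1)] r by auto
 show ?thesis
 proof (intro exI[of _ z'] conjI allI impI)
  show "(x, z') \<in> solutions P" using x z yB by (auto simp: solutions_def z'_def)
  show le: "recourse_cost P B (z' B) <= recourse_cost P ?U (z' ?U)" if "B \<subseteq> ?U" for B
   using yB[OF that] y(3) by (auto simp: z'_def)
  have U: "z' ?U = y" using y(3) by (simp add: z'_def)
  have "(\<Sum>B\<in>?S. excess (pmf p) r B * recourse_cost P B (z' B)) <= (\<Sum>B\<in>?S. excess (pmf p) r B * ?C B)"
   by (intro sum_mono mult_left_mono excess_nonneg) (auto simp: z'_def)
  moreover have "1/2 * ?m * recourse_cost P ?U y <= ?m * ?avg"
  proof -
   have "1/2 * m * c <= m * a" if "m * c <= m * (2 * a)" for m c a :: real using that by simp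
   from this[OF mult_left_mono[OF y(2) m0]] show ?thesis .
  qed
  moreover have "(\<Sum>B\<in>?S. excess (pmf p) r B * ?C B) + ?m * ?avg = measure_pmf.expectation q ?C"
  proof -
   have "measure_pmf.expectation q ?C = (\<Sum>B\<in>?S. excess (pmf p) r B * ?C B + ?m / card ?S * ?C B)"
    unfolding expectation_finite[OF S q(1)] by (intro sum.cong refl) (simp only: q(3) distrib_right)
   also have "\<dots> = (\<Sum>B\<in>?S. excess (pmf p) r B * ?C B) + ?m / card ?S * sum ?C ?S"
    unfolding sum.distrib sum_distrib_left ..
   finally show ?thesis by simp
  qed
  moreover have "measure_pmf.expectation q ?C <= (SUP q \<in> linf_ball P p r. measure_pmf.expectation q ?C)"
   using q(1,2) by (intro cSUP_upper ball_bdd fin) (auto simp: linf_ball_def distributions_def)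
  ultimately show "sum (cost1 P) x + (\<Sum>A\<in>?S. excess (pmf p) r A * recourse_cost P A (z' A)) +
    1/2 * ?m * recourse_cost P ?U (z' ?U) <= objective P p r x z"
   unfolding objective_def U by linarith
 qed
qed

text \<open>The estimation error is paid for twice, which explains the square: once when the true
  excesses in the cost of the algorithm are replaced by the estimated ones, and once on the way back
  in the cost of the solution compared with. The coefficients 1 and 1/2 of the movable mass come
  from \<open>ball_expectation_le\<close> and \<open>objective_ge\<close>.\<close>

lemma reduction:
 fixes P :: "'z two_stage"
 assumes fin: "finite (ground P)" and p: "p \<in> distributions P" and r: "0 < r" "r <= 1" and \<epsilon>: "0 < \<epsilon>"
  and c1: "\<And>a. a \<in> actions P ==> 0 <= cost1 P a"
  and nn: "\<And>x A z. x \<subseteq> actions P ==> A \<subseteq> ground P ==> feasible P x A z ==> 0 <= recourse_cost P A z"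
  and join: "\<And>x A B z z'. x \<subseteq> actions P ==> A \<subseteq> ground P ==> B \<subseteq> ground P ==> feasible P x A z ==> feasible P x B z' ==>
    \<exists>y. feasible P x (A \<union> B) y \<and> recourse_cost P (A \<union> B) y <= recourse_cost P A z + recourse_cost P B z'"
  and mono: "\<And>x A z. x \<subseteq> actions P ==> A \<subseteq> ground P ==> feasible P x (ground P) z ==>
    feasible P x A z \<and> recourse_cost P A z <= recourse_cost P (ground P) z"
  and f: "\<And>A. A \<subseteq> ground P ==> 0 <= f A" "sum f (Pow (ground P)) = 1"
   "\<And>A. A \<subseteq> ground P ==> \<bar>pmf p A - f A\<bar> <= \<epsilon> * r\<^sup>2 / 2"
  and xz: "(x, z) \<in> solutions P" and \<rho>: "0 < \<rho>"
  and Cm: "\<And>A. A \<subseteq> ground P ==> recourse_cost P A (z A) <= Cm"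
  and approx: "\<And>x' z'. (x', z') \<in> solutions P ==>
   sum (cost1 P) x + (\<Sum>A\<in>Pow (ground P). excess f r A * recourse_cost P A (z A)) +
    (1 - sum (excess f r) (Pow (ground P))) * Cm
   <= \<rho> * (sum (cost1 P) x' + (\<Sum>A\<in>Pow (ground P). excess f r A * recourse_cost P A (z' A)) +
    1/2 * (1 - sum (excess f r) (Pow (ground P))) * recourse_cost P (ground P) (z' (ground P)))"
 shows "objective P p r x z <= \<rho> * (1 + \<epsilon>)\<^sup>2 * opt P p r"
proof (rule opt_geI[OF xz])
 show "0 < \<rho> * (1 + \<epsilon>)\<^sup>2" using \<rho> \<epsilon> by simp
 fix x' z0 assume x'z0: "(x', z0) \<in> solutions P"
 let ?U = "ground P" let ?S = "Pow ?U" let ?m = "%f. 1 - sum (excess f r) ?S"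
 have "\<exists>z'. (x', z') \<in> solutions P \<and>
  (\<forall>A. A \<subseteq> ground P --> recourse_cost P A (z' A) <= recourse_cost P (ground P) (z' (ground P))) \<and>
  sum (cost1 P) x' + (\<Sum>A\<in>?S. excess (pmf p) r A * recourse_cost P A (z' A)) +
    1/2 * ?m (pmf p) * recourse_cost P ?U (z' ?U) <= objective P p r x' z0"
  by (rule objective_ge) (fact fin p r nn join mono x'z0)+
 then obtain z' where z': "(x', z') \<in> solutions P"
  "\<And>A. A \<subseteq> ground P ==> recourse_cost P A (z' A) <= recourse_cost P (ground P) (z' (ground P))"
  "sum (cost1 P) x' + (\<Sum>A\<in>?S. excess (pmf p) r A * recourse_cost P A (z' A)) +
    1/2 * ?m (pmf p) * recourse_cost P ?U (z' ?U) <= objective P p r x' z0"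
  by blast
 let ?C = "%A. recourse_cost P A (z A)" and ?C' = "%A. recourse_cost P A (z' A)"
 have S: "finite ?S" using fin by simp
 have pS: "set_pmf p \<subseteq> ?S" using p by (simp add: distributions_def)
 have C0: "0 <= ?C A" if "A \<subseteq> ?U" for A using xz that by (intro nn[of x]) (auto simp: solutions_def)
 have C'0: "0 <= ?C' A" if "A \<subseteq> ?U" for A using z'(1) that by (intro nn[of x']) (auto simp: solutions_def)
 have x0: "0 <= sum (cost1 P) y" if "(y, w) \<in> solutions P" for y w
  using that c1 by (intro sum_nonneg) (auto simp: solutions_def)
 have Cm0: "0 <= Cm" using C0[of "{}"] Cm[of "{}"] by simp
 have pn: "\<And>A. A \<in> ?S ==> 0 <= pmf p A" "sum (pmf p) ?S = 1" using sum_pmf_eq_1[OF S pS] by auto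
 have fn: "\<And>A. A \<in> ?S ==> 0 <= f A" "\<And>A. A \<in> ?S ==> \<bar>pmf p A - f A\<bar> <= \<epsilon> * r\<^sup>2 / 2"
  "\<And>A. A \<in> ?S ==> \<bar>f A - pmf p A\<bar> <= \<epsilon> * r\<^sup>2 / 2" using f by (auto simp: abs_minus_commute)
 have \<eta>: "0 <= \<epsilon> * r\<^sup>2 / 2" "2 * (\<epsilon> * r\<^sup>2 / 2) <= \<epsilon> * r\<^sup>2" using \<epsilon> by auto
 have "objective P p r x z <= sum (cost1 P) x + ((\<Sum>A\<in>?S. excess (pmf p) r A * ?C A) + ?m (pmf p) * Cm)"
  unfolding objective_def
 proof (intro add_left_mono cSUP_least)
  show "linf_ball P p r \<noteq> {}" using center_in_ball[OF p, of r] r by auto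
  fix q assume "q \<in> linf_ball P p r"
  then show "measure_pmf.expectation q ?C <= (\<Sum>A\<in>?S. excess (pmf p) r A * ?C A) + ?m (pmf p) * Cm"
   by (intro ball_expectation_le S) (auto simp: linf_ball_def distributions_def intro: Cm)
 qed
 also have "\<dots> <= sum (cost1 P) x + (1 + \<epsilon>) * ((\<Sum>A\<in>?S. excess f r A * ?C A) + ?m f * Cm)"
  using excess_robust[where f = "pmf p" and g = f and C = ?C and Cm = Cm and \<kappa> = 1,
    OF S pn fn(1) f(2) fn(2) r \<eta>] C0 Cm Cm0 by simp
 also have "\<dots> <= (1 + \<epsilon>) * (sum (cost1 P) x + (\<Sum>A\<in>?S. excess f r A * ?C A) + ?m f * Cm)"
  using x0[OF xz] \<epsilon> by (simp add: algebra_simps)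
 also have "\<dots> <= (1 + \<epsilon>) * (\<rho> * (sum (cost1 P) x' + (\<Sum>A\<in>?S. excess f r A * ?C' A) + 1/2 * ?m f * ?C' ?U))"
  using approx[OF z'(1)] \<epsilon> by (intro mult_left_mono) auto
 also have "\<dots> <= (1 + \<epsilon>) * (\<rho> * (sum (cost1 P) x' + (1 + \<epsilon>) * ((\<Sum>A\<in>?S. excess (pmf p) r A * ?C' A) + 1/2 * ?m (pmf p) * ?C' ?U)))"
  using excess_robust[where f = f and g = "pmf p" and C = ?C' and Cm = "?C' ?U" and \<kappa> = "1/2",
    OF S fn(1) f(2) pn fn(3) r \<eta>] C'0 z'(2) \<epsilon> \<rho>
  by (intro mult_left_mono) auto
 also have "\<dots> <= (1 + \<epsilon>) * (\<rho> * ((1 + \<epsilon>) * objective P p r x' z0))"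
 proof -
  have "sum (cost1 P) x' + (1 + \<epsilon>) * ((\<Sum>A\<in>?S. excess (pmf p) r A * ?C' A) + 1/2 * ?m (pmf p) * ?C' ?U)
    <= (1 + \<epsilon>) * (sum (cost1 P) x' + (\<Sum>A\<in>?S. excess (pmf p) r A * ?C' A) + 1/2 * ?m (pmf p) * ?C' ?U)"
   using x0[OF z'(1)] \<epsilon> by (simp add: algebra_simps)
  also have "\<dots> <= (1 + \<epsilon>) * objective P p r x' z0" using z'(3) \<epsilon> by (intro mult_left_mono) auto
  finally show ?thesis using \<epsilon> \<rho> by (intro mult_left_mono) auto
 qed
 finally show "objective P p r x z <= \<rho> * (1 + \<epsilon>)\<^sup>2 * objective P p r x' z0"
  by (simp add: power2_eq_square mult_ac)
qed

text \<open>A guarantee in every single scenario can be averaged over any distribution, so it yields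
  the bound for the whole ball without an estimate of the central distribution. This serves the
  instances in which no action gets more expensive.\<close>

lemma pointwise_reduction:
 assumes fin: "finite (ground P)" and p: "p \<in> distributions P" and r: "0 <= r"
  and xz: "({}, z) \<in> solutions P" and \<rho>: "0 < \<rho>"
  and approx: "\<And>x' z' A. (x', z') \<in> solutions P ==> A \<subseteq> ground P ==>
   recourse_cost P A (z A) <= \<rho> * (sum (cost1 P) x' + recourse_cost P A (z' A))"
 shows "objective P p r {} z <= \<rho> * opt P p r"
proof (rule opt_geI[OF xz \<rho>])
 fix x' z' assume x'z': "(x', z') \<in> solutions P"
 let ?S = "Pow (ground P)"
 have "(SUP q \<in> linf_ball P p r. measure_pmf.expectation q (%A. recourse_cost P A (z A))) <= \<rho> * objective P p r x' z'"
 proof (rule cSUP_least)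
  show "linf_ball P p r \<noteq> {}" using center_in_ball[OF p r] by auto
  fix q assume q: "q \<in> linf_ball P p r"
  then have qS: "set_pmf q \<subseteq> ?S" by (auto simp: linf_ball_def distributions_def)
  have S: "finite ?S" using fin by simp
  have "measure_pmf.expectation q (%A. recourse_cost P A (z A)) <=
    (\<Sum>A\<in>?S. pmf q A * (\<rho> * (sum (cost1 P) x' + recourse_cost P A (z' A))))"
   unfolding expectation_finite[OF S qS]
   by (intro sum_mono mult_left_mono approx[OF x'z']) auto
  also have "\<dots> = \<rho> * (sum (cost1 P) x' + measure_pmf.expectation q (%A. recourse_cost P A (z' A)))"
  proof -
   have "(\<Sum>A\<in>?S. pmf q A * (\<rho> * (sum (cost1 P) x' + recourse_cost P A (z' A)))) =
     (\<Sum>A\<in>?S. \<rho> * sum (cost1 P) x' * pmf q A + \<rho> * (pmf q A * recourse_cost P A (z' A)))"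
    by (intro sum.cong refl) (simp only: distrib_left mult_ac)
   also have "\<dots> = \<rho> * sum (cost1 P) x' * sum (pmf q) ?S + \<rho> * (\<Sum>A\<in>?S. pmf q A * recourse_cost P A (z' A))"
    unfolding sum.distrib sum_distrib_left ..
   finally show ?thesis
    unfolding expectation_finite[OF S qS] sum_pmf_eq_1[OF S qS] by (simp add: distrib_left)
  qed
  also have "\<dots> <= \<rho> * objective P p r x' z'"
   unfolding objective_def using \<rho> by (intro mult_left_mono add_left_mono cSUP_upper ball_bdd fin q) auto
  finally show "measure_pmf.expectation q (%A. recourse_cost P A (z A)) <= \<rho> * objective P p r x' z'" .
 qed
 then show "objective P p r {} z <= \<rho> * objective P p r x' z'" by (simp add: objective_def)
qed

section \<open>Sampling\<close>

definition cnt :: "nat => nat list => nat" where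
 "cnt a xs = length (filter (%k. k = a) xs)"

lemma cnt_rev [simp]: "cnt a (rev xs) = cnt a xs"
 by (simp add: cnt_def rev_filter[symmetric])

lemma map_replicate_pmf: "map_pmf (map f) (replicate_pmf n p) = replicate_pmf n (map_pmf f p)"
proof (induction n)
 case (Suc n)
 show ?case
  by (simp add: map_bind_pmf bind_map_pmf Suc[symmetric])
qed simp

lemma map_pmf_eq_bernoulli: "map_pmf (%x. x = a) D = bernoulli_pmf (pmf D a)"
proof (rule pmf_eqI)
 fix b
 have t: "pmf (map_pmf (%x. x = a) D) True = pmf D a"
  by (simp add: pmf_map vimage_def measure_pmf_single)
 have "pmf (map_pmf (%x. x = a) D) False = 1 - pmf (map_pmf (%x. x = a) D) True"
  by (rule pmf_False_conv_True)
 with t show "pmf (map_pmf (%x. x = a) D) b = pmf (bernoulli_pmf (pmf D a)) b"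
  by (cases b) (auto simp: pmf_le_1)
qed

lemma cnt_binomial: "map_pmf (cnt a) (replicate_pmf n D) = binomial_pmf n (pmf D a)"
proof -
 have "cnt a = (length \<circ> filter id) \<circ> map (%x. x = a)"
  by (simp add: cnt_def filter_map o_def fun_eq_iff)
 then have "map_pmf (cnt a) (replicate_pmf n D) = map_pmf (length \<circ> filter id) (map_pmf (map (%x. x = a)) (replicate_pmf n D))"
  by (simp add: pmf.map_comp)
 also have "\<dots> = binomial_pmf n (pmf D a)"
  by (subst binomial_pmf_altdef) (simp_all add: map_replicate_pmf map_pmf_eq_bernoulli pmf_le_1)
 finally show ?thesis .
qed

definition accurate :: "'z two_stage => nat set pmf => real => nat list => bool" where
 "accurate P p \<eta> ws \<longleftrightarrow>
   (\<forall>A. A \<subseteq> ground P --> \<bar>pmf p A - cnt (set_encode A) ws / length ws\<bar> <= \<eta>)"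

text \<open>\<open>set_encode\<close> is injective only on finite sets; the support of
  \<open>p\<close> consists of subsets of the finite ground set.\<close>

lemma pmf_map_set_encode:
 assumes "finite (ground P)" "p \<in> distributions P" "A \<subseteq> ground P"
 shows "pmf (map_pmf set_encode p) (set_encode A) = pmf p A"
proof -
 have "pmf (map_pmf set_encode p) (set_encode A) = measure p (set_encode -` {set_encode A})"
  by (simp add: pmf_map)
 also have "\<dots> = measure p (set_encode -` {set_encode A} \<inter> set_pmf p)" by (simp add: measure_Int_set_pmf)
 also have "set_encode -` {set_encode A} \<inter> set_pmf p = {A} \<inter> set_pmf p"
 proof -
  have "B = A" if "B \<in> set_pmf p" "set_encode B = set_encode A" for B
  proof -
   have "B \<subseteq> ground P" using that assms(2) by (auto simp: distributions_def)
   then show ?thesis using that assms(1,3) by (metis finite_subset set_encode_eq)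
  qed
  then show ?thesis by auto
 qed
 also have "measure p ({A} \<inter> set_pmf p) = pmf p A" by (simp add: measure_Int_set_pmf measure_pmf_single)
 finally show ?thesis .
qed

lemma prob_accurate:
 assumes "finite (ground P)" "p \<in> distributions P" "0 < n" "0 < \<eta>"
 shows "measure_pmf.prob (replicate_pmf n (map_pmf set_encode p)) {ws. accurate P p \<eta> ws}
  \<ge> 1 - 2 * 2 ^ card (ground P) * exp (- 2 * real n * \<eta>\<^sup>2)"
proof -
 let ?D = "map_pmf set_encode p" let ?Q = "replicate_pmf n ?D"
 let ?bad = "%A. {ws. \<eta> <= \<bar>cnt (set_encode A) ws / n - pmf p A\<bar>}"
 have b: "measure_pmf.prob ?Q (?bad A) <= 2 * exp (- 2 * real n * \<eta>\<^sup>2)" if A: "A \<subseteq> ground P" for A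
 proof -
  interpret binomial_distribution n "pmf p A" by standard (simp add: pmf_le_1)
  have "measure_pmf.prob ?Q (?bad A) =
   measure_pmf.prob (map_pmf (cnt (set_encode A)) ?Q) {x. \<eta> <= \<bar>x / n - pmf p A\<bar>}"
   by (simp add: vimage_def)
  also have "\<dots> <= 2 * exp (- 2 * real n * \<eta>\<^sup>2)"
   unfolding cnt_binomial pmf_map_set_encode[OF assms(1,2) A]
   using prob_abs_ge'[of \<eta>] assms(3,4) by simp
  finally show ?thesis .
 qed
 have "measure_pmf.prob ?Q (- {ws. accurate P p \<eta> ws}) <= measure_pmf.prob ?Q (\<Union>A\<in>Pow (ground P). ?bad A)"
 \<comment> \<open>\<open>accurate\<close> divides by \<open>length ws\<close>, which equals the
   number of samples only on the support.\<close>
 proof (subst measure_Int_set_pmf[symmetric], rule measure_pmf.finite_measure_mono)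
  show "- {ws. accurate P p \<eta> ws} \<inter> set_pmf ?Q \<subseteq> (\<Union>A\<in>Pow (ground P). ?bad A)"
   by (auto simp: accurate_def set_replicate_pmf abs_minus_commute not_le intro: less_imp_le)
 qed simp
 also have "\<dots> <= (\<Sum>A\<in>Pow (ground P). measure_pmf.prob ?Q (?bad A))"
  using assms(1) by (intro measure_pmf.finite_measure_subadditive_finite) auto
 also have "\<dots> <= (\<Sum>A\<in>Pow (ground P). 2 * exp (- 2 * real n * \<eta>\<^sup>2))"
  by (intro sum_mono b) auto
 also have "\<dots> = 2 * 2 ^ card (ground P) * exp (- 2 * real n * \<eta>\<^sup>2)"
  using assms(1) by (simp add: card_Pow)
 finally show ?thesis
  using measure_pmf.prob_compl[of "{ws. accurate P p \<eta> ws}" ?Q] by (simp add: Compl_eq_Diff_UNIV)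
qed

section \<open>Assembling an approximation algorithm\<close>

lemma set_encode_less: "A \<subseteq> {..<n} ==> set_encode A < 2 ^ n"
proof (induction n arbitrary: A)
 case (Suc n)
 have "set_encode (Suc -` A) < 2 ^ n" using Suc.prems by (intro Suc.IH) auto
 then show ?case unfolding set_encode_vimage_Suc by simp
qed simp

lemma sz_less_power: "m < 2 ^ n ==> sz (m::nat) <= n + 1"
 by (simp add: sz_nat_def floorlog_leI)

lemma time_bound_ge:
 assumes "real n <= real c * X ^ e" "c <= k" "e <= k"
  "X = 1 + real (input_size (stage1_input P r \<epsilon> \<delta>)) + inflation P / (of_rat \<epsilon> * of_rat r) + ln (1 / of_rat \<delta>)"
  "1 <= X"
 shows "n <= time_bound k P r \<epsilon> \<delta>"
proof -
 have "real c * X ^ e <= real k * X ^ k"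
  using assms by (intro mult_mono power_increasing) auto
 then have "real n <= real k * X ^ k" using assms(1) by linarith
 then show ?thesis unfolding time_bound_def assms(4)[symmetric] by (simp add: le_nat_floor)
qed

text \<open>Here machine programs and time bounds disappear: what remains for each problem are three
  polynomial-time functions for the number of samples, the first-stage mask and the recourse. The
  bounds on \<open>ground P\<close> and \<open>f1\<close> keep the codes of scenarios and of the
  first-stage decision within the input size, so that the input of the second stage has linear
  size.\<close>

theorem has_approx_algorithmI:
 fixes \<P> :: "'z two_stage set" and h :: "nat list => nat" and f1 :: "nat list \<times> nat list => nat"
  and f2 :: "nat list => nat \<times> nat list" and C e :: nat
 assumes pt: "pt h" "pt f1" "pt f2"
  and inf: "\<And>P. P \<in> \<P> ==> 0 <= inflation P"
  and N: "\<And>P r \<epsilon> \<delta>. P \<in> \<P> ==> 0 < r ==> r <= 1 ==> 0 < \<epsilon> ==> \<epsilon> < 1 ==> 0 < \<delta> ==> \<delta> < 1 ==>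
   real (h (stage1_input P r \<epsilon> \<delta>)) <=
    real C * (1 + real (input_size (stage1_input P r \<epsilon> \<delta>)) + inflation P / (of_rat \<epsilon> * of_rat r)) ^ e"
  and gr: "\<And>P r \<epsilon> \<delta>. P \<in> \<P> ==> ground P \<subseteq> {..<input_size (stage1_input P r \<epsilon> \<delta>)}"
  and f1: "\<And>P r \<epsilon> \<delta> ws. P \<in> \<P> ==> f1 (stage1_input P r \<epsilon> \<delta>, ws) < 2 ^ input_size (stage1_input P r \<epsilon> \<delta>)"
  and f2: "\<And>P r \<epsilon> \<delta> x a. P \<in> \<P> ==>
   length (snd (f2 (stage1_input P r \<epsilon> \<delta> @ [x, 0, a]))) <= length (stage1_input P r \<epsilon> \<delta>)"
  and tail: "\<And>P r \<epsilon> \<delta>. P \<in> \<P> ==> 0 < r ==> r <= 1 ==> 0 < \<epsilon> ==> \<epsilon> < 1 ==> 0 < \<delta> ==> \<delta> < 1 ==>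
   0 < h (stage1_input P r \<epsilon> \<delta>) ==>
   2 * 2 ^ card (ground P) * exp (- 2 * real (h (stage1_input P r \<epsilon> \<delta>)) * (of_rat \<epsilon> * (of_rat r)\<^sup>2 / 2)\<^sup>2) <= of_rat \<delta>"
  and good: "\<And>P r \<epsilon> \<delta> p ws s inp. P \<in> \<P> ==> 0 < r ==> r <= 1 ==> 0 < \<epsilon> ==> \<epsilon> < 1 ==> 0 < \<delta> ==> \<delta> < 1 ==>
   p \<in> distributions P ==> inp = stage1_input P r \<epsilon> \<delta> ==> length ws = h inp ==>
   set ws \<subseteq> set_encode ` Pow (ground P) ==>
   (0 < h inp --> accurate P p (of_rat \<epsilon> * (of_rat r)\<^sup>2 / 2) ws) ==>
   (\<And>A. A \<subseteq> ground P ==> fst (s A) 0 = fst (f2 (inp @ [f1 (inp, ws), 0, set_encode A])) \<and>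
     (\<forall>j < length (snd (f2 (inp @ [f1 (inp, ws), 0, set_encode A]))).
      snd (s A) j = snd (f2 (inp @ [f1 (inp, ws), 0, set_encode A])) ! j)) ==>
   (set_decode (f1 (inp, ws)), %A. recourse_of P (s A)) \<in> solutions P \<and>
   objective P p (of_rat r) (set_decode (f1 (inp, ws))) (%A. recourse_of P (s A))
    <= \<rho> P (of_rat \<epsilon>) * opt P p (of_rat r)"
 shows "has_approx_algorithm \<P> \<rho>"
proof -
 obtain c1 k1 where c1: "\<And>inp D t. (\<forall>ws \<in> set_pmf (replicate_pmf (h inp) D). k1 * sz (inp, ws) ^ k1 <= t) ==>
  (\<exists>S. exec D t (start c1 inp) = map_pmf (%ws. ([], S ws)) (replicate_pmf (h inp) D) \<and>
   (\<forall>ws \<in> set_pmf (replicate_pmf (h inp) D). fst (S ws) 0 = f1 (inp, rev ws) \<and> fst (S ws) 1 = 0))"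
  using stage1_program[OF pt(1,2)] by blast
 obtain c2 k2 where c2: "\<And>inp. length (snd (f2 inp)) <= length inp ==>
  (\<exists>t R M. t <= k2 * (1 + input_size inp) ^ k2 \<and> runs c2 (init inp) t (R, M) \<and>
    R 0 = fst (f2 inp) \<and> (\<forall>j < length (snd (f2 inp)). M j = snd (f2 inp) ! j))"
  using stage2_program[OF pt(3)] by blast
 \<comment> \<open>Dominates factors and exponents of both running times:
   \<open>k1 * (2 + C) ^ k1\<close> and \<open>(e + 1) * k1\<close> in the first stage,
   \<open>k2 * 4 ^ k2\<close> and \<open>k2\<close> in the second.\<close>
 define k where "k = k1 * (2 + C) ^ k1 + (e + 1) * k1 + k2 * 4 ^ k2 + k2"
 show ?thesis
  unfolding has_approx_algorithm_def
 proof (rule exI[of _ c1], rule exI[of _ c2], rule exI[of _ k], intro ballI allI impI, unfold Let_def)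
  fix P p and r \<epsilon> \<delta> :: rat
  assume P: "P \<in> \<P>" and p: "p \<in> distributions P"
   and "0 < r \<and> r <= 1 \<and> 0 < \<epsilon> \<and> \<epsilon> < 1 \<and> 0 < \<delta> \<and> \<delta> < 1"
  then have v: "0 < r" "r <= 1" "0 < \<epsilon>" "\<epsilon> < 1" "0 < \<delta>" "\<delta> < 1" by auto
  let ?t = "time_bound k P r \<epsilon> \<delta>"
  define inp where "inp = stage1_input P r \<epsilon> \<delta>"
  let ?I = "input_size inp" let ?D = "map_pmf set_encode p" let ?Q = "replicate_pmf (h inp) ?D"
  let ?\<eta> = "of_rat \<epsilon> * (of_rat r)\<^sup>2 / 2 :: real"
  define Y where "Y = 1 + real ?I + inflation P / (of_rat \<epsilon> * of_rat r)"
  define X where "X = Y + ln (1 / of_rat \<delta>)"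
  have X: "X = 1 + real (input_size (stage1_input P r \<epsilon> \<delta>)) + inflation P / (of_rat \<epsilon> * of_rat r) + ln (1 / of_rat \<delta>)"
   by (simp add: X_def Y_def inp_def)
  have ln0: "0 <= ln (1 / of_rat \<delta> :: real)" using v by (intro ln_ge_zero) auto
  have if0: "0 <= inflation P / (of_rat \<epsilon> * of_rat r)" using inf[OF P] v by simp
  have Y1: "1 + real ?I <= Y" "Y <= X" using if0 ln0 by (auto simp: Y_def X_def)
  then have X1: "1 <= X" "1 + real ?I <= X" by auto
  have fin: "finite (ground P)" by (rule finite_subset[OF gr[OF P, of r \<epsilon> \<delta>]]) simp
  have enc: "set_encode A < 2 ^ ?I" if "A \<subseteq> ground P" for A
   unfolding inp_def by (rule set_encode_less, rule subset_trans[OF that gr[OF P]])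
  have sup: "length ws = h inp \<and> set ws \<subseteq> set_encode ` Pow (ground P)" if "ws \<in> set_pmf ?Q" for ws
  proof -
   have "set ws \<subseteq> set_encode ` set_pmf p" "length ws = h inp" using that by (auto simp: set_replicate_pmf)
   moreover have "set_pmf p \<subseteq> Pow (ground P)" using p by (simp add: distributions_def)
   ultimately show ?thesis by blast
  qed
  have "\<forall>ws\<in>set_pmf ?Q. k1 * sz (inp, ws) ^ k1 <= ?t"
  proof
   fix ws assume "ws \<in> set_pmf ?Q"
   then have ws: "length ws = h inp" "set ws \<subseteq> set_encode ` Pow (ground P)" using sup by auto
   have "sz ws <= 1 + h inp * (?I + 1)"
    unfolding ws(1)[symmetric] using ws(2) enc by (intro sz_list_le sz_less_power) auto
   then have "sz (inp, ws) <= (1 + ?I) + (1 + h inp * (?I + 1))" using sz_input[of inp] by simp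
   then have "real (sz (inp, ws)) <= real ((1 + ?I) + (1 + h inp * (?I + 1)))" by (simp only: of_nat_le_iff)
   also have "\<dots> = (1 + real ?I) + 1 + real (h inp) * (1 + real ?I)" by (simp add: algebra_simps)
   also have "\<dots> <= X + X + (C * X ^ e) * X"
   proof -
    have "real (h inp) <= C * Y ^ e" using N[OF P v] by (simp add: Y_def inp_def)
    also have "\<dots> <= C * X ^ e" using Y1 by (intro mult_left_mono power_mono) auto
    finally have "real (h inp) * (1 + real ?I) <= (C * X ^ e) * X"
     using X1 by (intro mult_mono) auto
    then show ?thesis using X1 by linarith
   qed
   also have "\<dots> <= X ^ (e + 1) + X ^ (e + 1) + C * X ^ (e + 1)"
    using X1 power_increasing[of 1 "e + 1" X] by (simp add: mult_ac)
   also have "\<dots> = real (2 + C) * X ^ (e + 1)" by (simp add: algebra_simps)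
   finally have "real (sz (inp, ws)) ^ k1 <= (real (2 + C) * X ^ (e + 1)) ^ k1"
    by (intro power_mono) auto
   then have "real (k1 * sz (inp, ws) ^ k1) <= k1 * (real (2 + C) * X ^ (e + 1)) ^ k1"
    by (simp add: mult_left_mono)
   also have "\<dots> = real (k1 * (2 + C) ^ k1) * X ^ ((e + 1) * k1)"
    unfolding power_mult_distrib power_mult[symmetric] by simp
   finally show "k1 * sz (inp, ws) ^ k1 <= ?t"
    by (rule time_bound_ge[OF _ _ _ X X1(1)]) (auto simp: k_def)
  qed
  from c1[OF this] obtain S where S: "exec ?D ?t (start c1 inp) = map_pmf (%ws. ([], S ws)) ?Q"
   "\<And>ws. ws \<in> set_pmf ?Q ==> fst (S ws) 0 = f1 (inp, rev ws) \<and> fst (S ws) 1 = 0" by blast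
  have st2: "\<exists>s. computes_within ?t c2 (stage2_input P r \<epsilon> \<delta> ([], S ws) A) s \<and>
    fst s 0 = fst (f2 (inp @ [f1 (inp, rev ws), 0, set_encode A])) \<and>
    (\<forall>j < length (snd (f2 (inp @ [f1 (inp, rev ws), 0, set_encode A]))).
      snd s j = snd (f2 (inp @ [f1 (inp, rev ws), 0, set_encode A])) ! j)"
   if ws: "ws \<in> set_pmf ?Q" and A: "A \<subseteq> ground P" for ws A
  proof -
   let ?x = "f1 (inp, rev ws)"
   let ?j = "inp @ [?x, 0, set_encode A]"
   have j: "stage2_input P r \<epsilon> \<delta> ([], S ws) A = ?j"
    using S(2)[OF ws] by (simp add: stage2_input_def inp_def reg_def)
   have "length (snd (f2 ?j)) <= length ?j" using f2[OF P, of r \<epsilon> \<delta> ?x "set_encode A"] unfolding inp_def by simp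
   from c2[OF this] obtain t R M where 2: "t <= k2 * (1 + input_size ?j) ^ k2" "runs c2 (init ?j) t (R, M)"
    "R 0 = fst (f2 ?j)" "\<forall>j < length (snd (f2 ?j)). M j = snd (f2 ?j) ! j" by blast
   have "input_size ?j = ?I + sz ?x + 1 + sz (set_encode A)"
    by (simp add: input_size_def sz_nat_def floorlog_def)
   also have "\<dots> <= ?I + (?I + 1) + 1 + (?I + 1)"
    using sz_less_power[OF enc[OF A]] sz_less_power[OF f1[OF P], of r \<epsilon> \<delta> "rev ws"] unfolding inp_def by linarith
   finally have "real (1 + input_size ?j) <= 4 * (1 + real ?I)" by simp
   also have "\<dots> <= 4 * X" using X1 by simp
   finally have "real (1 + input_size ?j) ^ k2 <= (4 * X) ^ k2" by (intro power_mono) auto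
   then have "real (k2 * (1 + input_size ?j) ^ k2) <= k2 * (4 * X) ^ k2"
    unfolding of_nat_mult of_nat_power by (intro mult_left_mono) auto
   also have "\<dots> = real (k2 * 4 ^ k2) * X ^ k2" by (simp add: power_mult_distrib)
   finally have "k2 * (1 + input_size ?j) ^ k2 <= ?t"
    by (rule time_bound_ge[OF _ _ _ X X1(1)]) (auto simp: k_def)
   then have "computes_within ?t c2 ?j (R, M)" using 2(1) by (intro computes_within_runs[OF 2(2)]) simp
   with 2 show ?thesis unfolding j by (intro exI[of _ "(R, M)"]) auto
  qed
  have run: "stage1_run c1 ?t P p r \<epsilon> \<delta> = map_pmf (%ws. ([], S ws)) ?Q"
   using S(1) by (simp add: stage1_run_def inp_def)
  have "1 - of_rat \<delta> <= measure_pmf.prob ?Q {ws. 0 < h inp --> accurate P p ?\<eta> ws}"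
  proof (cases "0 < h inp")
   case True
   have "0 < ?\<eta>" using v by simp
   from prob_accurate[OF fin p True this] tail[OF P v] True show ?thesis by (simp add: inp_def)
  next
   case False
   have "(0::real) <= of_rat \<delta>" using v by simp
   with False show ?thesis by simp
  qed
  also have "\<dots> = measure_pmf.prob ?Q ({ws. 0 < h inp --> accurate P p ?\<eta> ws} \<inter> set_pmf ?Q)"
   by (simp add: measure_Int_set_pmf)
  also have "\<dots> <= measure_pmf.prob ?Q {ws. good_outcome c2 ?t (\<rho> P (of_rat \<epsilon>)) P p r \<epsilon> \<delta> ([], S ws)}"
  proof (rule measure_pmf.finite_measure_mono)
   show "{ws. 0 < h inp --> accurate P p ?\<eta> ws} \<inter> set_pmf ?Q \<subseteq>
    {ws. good_outcome c2 ?t (\<rho> P (of_rat \<epsilon>)) P p r \<epsilon> \<delta> ([], S ws)}"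
   proof (rule subsetI)
    fix ws assume "ws \<in> {ws. 0 < h inp --> accurate P p ?\<eta> ws} \<inter> set_pmf ?Q"
    then have ws: "ws \<in> set_pmf ?Q" and acc: "0 < h inp --> accurate P p ?\<eta> ws" by auto
    obtain s where s: "\<And>A. A \<subseteq> ground P ==> computes_within ?t c2 (stage2_input P r \<epsilon> \<delta> ([], S ws) A) (s A) \<and>
     fst (s A) 0 = fst (f2 (inp @ [f1 (inp, rev ws), 0, set_encode A])) \<and>
     (\<forall>j < length (snd (f2 (inp @ [f1 (inp, rev ws), 0, set_encode A]))).
      snd (s A) j = snd (f2 (inp @ [f1 (inp, rev ws), 0, set_encode A])) ! j)"
     using st2[OF ws] by metis
    \<comment> \<open>The first-stage function sees the samples in reverse order, which does not
      change the frequencies.\<close>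
    have "accurate P p ?\<eta> (rev ws) = accurate P p ?\<eta> ws" by (simp add: accurate_def)
    then have g: "(set_decode (f1 (inp, rev ws)), %A. recourse_of P (s A)) \<in> solutions P \<and>
     objective P p (of_rat r) (set_decode (f1 (inp, rev ws))) (%A. recourse_of P (s A))
     <= \<rho> P (of_rat \<epsilon>) * opt P p (of_rat r)"
     using sup[OF ws] s acc by (intro good[OF P v p inp_def]) auto
    have "reg ([], S ws) 0 = f1 (inp, rev ws)" using S(2)[OF ws] by (simp add: reg_def)
    moreover have "\<forall>A\<in>Pow (ground P). \<exists>s'. computes_within ?t c2 (stage2_input P r \<epsilon> \<delta> ([], S ws) A) s' \<and>
      recourse_of P (s A) = recourse_of P s'"
     using s by blast
    ultimately have "good_outcome c2 ?t (\<rho> P (of_rat \<epsilon>)) P p r \<epsilon> \<delta> ([], S ws)"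
     using g unfolding good_outcome_def by (intro exI[of _ "%A. recourse_of P (s A)"]) simp
    then show "ws \<in> {ws. good_outcome c2 ?t (\<rho> P (of_rat \<epsilon>)) P p r \<epsilon> \<delta> ([], S ws)}" by simp
   qed
  qed simp
  also have "\<dots> = measure_pmf.prob (stage1_run c1 ?t P p r \<epsilon> \<delta>) {cfg. good_outcome c2 ?t (\<rho> P (of_rat \<epsilon>)) P p r \<epsilon> \<delta> cfg}"
   by (simp add: run vimage_def)
  finally show "(\<forall>cfg\<in>set_pmf (stage1_run c1 ?t P p r \<epsilon> \<delta>). halted cfg \<and>
       (\<forall>A\<in>Pow (ground P). \<exists>s. computes_within ?t c2 (stage2_input P r \<epsilon> \<delta> cfg A) s)) \<and>
    1 - of_rat \<delta> <= measure_pmf.prob (stage1_run c1 ?t P p r \<epsilon> \<delta>) {cfg. good_outcome c2 ?t (\<rho> P (of_rat \<epsilon>)) P p r \<epsilon> \<delta> cfg}"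
   using st2 unfolding run by (auto simp: halted_def) blast
 qed
qed

section \<open>Decoding the input\<close>

definition rnum :: "nat list => nat => nat => nat" where
 "rnum inp off k = nthd 0 inp (off + 2 * k)"

definition rden :: "nat list => nat => nat => nat" where
 "rden inp off k = nthd 0 inp (off + 2 * k + 1)"

text \<open>Stands for \<open>[0..<m]\<close>, which cannot be formed from a number in binary. The
  tables to be traversed are no longer than the input, so nothing is cut off
  (\<open>rng_eq\<close>).\<close>

definition rng :: "nat list => nat => nat list" where
 "rng inp m = filter (%i. i < m) [0..<length inp]"

text \<open>Rationals are scaled to a common denominator without divisions.\<close>

definition scl :: "nat list => nat => nat => nat => nat" where
 "scl inp off m k = rnum inp off k * prod_list (map (%j. if j = k then 1 else rden inp off j) (rng inp m))"

definition dprod :: "nat list => nat => nat => nat" where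
 "dprod inp off m = prod_list (map (rden inp off) (rng inp m))"

lemma pt_rnum [pt_intros]: "pt a ==> pt b ==> pt c ==> pt (%x. rnum (a x) (b x) (c x))"
 by (rule pt_lift3) (unfold rnum_def, intro pt_intros)

lemma pt_rden [pt_intros]: "pt a ==> pt b ==> pt c ==> pt (%x. rden (a x) (b x) (c x))"
 by (rule pt_lift3) (unfold rden_def, intro pt_intros)

lemma pt_rng [pt_intros]: "pt a ==> pt b ==> pt (%x. rng (a x) (b x))"
 by (rule pt_lift2) (unfold rng_def, intro pt_intros)

lemma pt_scl [pt_intros]: "pt a ==> pt b ==> pt c ==> pt d ==> pt (%x. scl (a x) (b x) (c x) (d x))"
 by (rule pt_lift4) (unfold scl_def, intro pt_intros)

lemma pt_cnt [pt_intros]: "pt a ==> pt b ==> pt (%x. cnt (a x) (b x))"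
 by (rule pt_lift2) (unfold cnt_def, intro pt_intros)

lemma rng_eq: "m <= length inp ==> rng inp m = [0..<m]"
proof -
 assume "m <= length inp"
 then have "[0..<length inp] = [0..<m] @ [m..<length inp]"
  using upt_add_eq_append[of 0 m "length inp - m"] by simp
 then show ?thesis by (simp add: rng_def filter_id_conv)
qed

lemma prod_list_others:
 "distinct xs ==> k \<in> set xs ==>
  (f k :: nat) * prod_list (map (%j. if j = k then 1 else f j) xs) = prod_list (map f xs)"
proof (induction xs)
 case (Cons x xs)
 show ?case
 proof (cases "x = k")
  case True
  then have e: "map (%j. if j = k then 1 else f j) xs = map f xs" using Cons.prems by auto
  show ?thesis unfolding True list.map prod_list.Cons e by simp
 next
  case False
  with Cons show ?thesis by (simp add: mult.left_commute)
 qed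
qed simp

lemma scl_rden: "k < m ==> m <= length inp ==> rden inp off k * scl inp off m k = rnum inp off k * dprod inp off m"
 using prod_list_others[of "rng inp m" k "rden inp off"]
 by (simp add: scl_def dprod_def rng_eq mult.left_commute)

lemma length_rat_codes: "length (concat (map rat_code qs)) = 2 * length qs"
 by (induction qs) (auto simp: rat_code_def)

lemma nth_rat_codes:
 "k < length qs ==> (concat (map rat_code qs) @ post) ! (2 * k) = nat (fst (quotient_of (qs ! k)))"
 "k < length qs ==> (concat (map rat_code qs) @ post) ! Suc (2 * k) = nat (snd (quotient_of (qs ! k)))"
proof (induction qs arbitrary: k)
 case (Cons q qs)
 { case 1 then show ?case using Cons.IH(1)[of "k - 1"] by (cases k) (auto simp: rat_code_def) }
 { case 2 then show ?case using Cons.IH(2)[of "k - 1"] by (cases k) (auto simp: rat_code_def) }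
qed simp_all

lemma rat_table:
 assumes "inp = pre @ concat (map rat_code qs) @ post" "off = length pre" "k < length qs"
 shows "rnum inp off k = nat (fst (quotient_of (qs ! k)))" "rden inp off k = nat (snd (quotient_of (qs ! k)))"
proof -
 have l: "off + 2 * k + 1 < length inp" using assms by (simp add: length_rat_codes)
 show "rnum inp off k = nat (fst (quotient_of (qs ! k)))"
  using l nth_rat_codes(1)[OF assms(3), of post] by (simp add: rnum_def nthd_def assms(1,2) nth_append_right)
 show "rden inp off k = nat (snd (quotient_of (qs ! k)))"
  using l nth_rat_codes(2)[OF assms(3), of post] by (simp add: rden_def nthd_def assms(1,2) nth_append_right)
qed

lemma rat_table_value:
 assumes "inp = pre @ concat (map rat_code qs) @ post" "off = length pre" "k < length qs" "0 <= qs ! k"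
 shows "0 < rden inp off k" "of_rat (qs ! k) = (real (rnum inp off k) / real (rden inp off k) :: real)"
proof -
 obtain a b where ab: "quotient_of (qs ! k) = (a, b)" by force
 have b: "0 < b" using quotient_of_denom_pos[OF ab] .
 have q: "qs ! k = of_int a / of_int b" using quotient_of_div[OF ab] .
 have a: "0 <= a" using assms(4) b unfolding q by (simp add: zero_le_divide_iff)
 show "0 < rden inp off k" using b by (simp add: rat_table[OF assms(1-3)] ab)
 show "of_rat (qs ! k) = (real (rnum inp off k) / real (rden inp off k) :: real)"
  using a b unfolding q by (simp add: rat_table[OF assms(1-3)] ab of_rat_divide)
qed

lemma dprod_pos:
 assumes "\<And>k. k < m ==> 0 < rden inp off k" "m <= length inp"
 shows "0 < dprod inp off m"
proof -
 have "dprod inp off m \<noteq> 0"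
  unfolding dprod_def rng_eq[OF assms(2)] prod_list_zero_iff using assms(1) by fastforce
 then show ?thesis by simp
qed

text \<open>All scaled entries share the positive factor \<open>dprod\<close>, so comparisons and
  sums of the integers reflect those of the rationals.\<close>

lemma scl_real:
 assumes "inp = pre @ concat (map rat_code qs) @ post" "off = length pre" "k < m" "m <= length qs" "0 <= qs ! k"
 shows "real (scl inp off m k) = real (dprod inp off m) * of_rat (qs ! k)"
proof -
 have k: "k < length qs" using assms by simp
 note v = rat_table_value[OF assms(1,2) k assms(5)]
 have "m <= length inp" using assms by (simp add: length_rat_codes)
 from scl_rden[OF assms(3) this, of off] have
  "real (rden inp off k) * real (scl inp off m k) = real (rnum inp off k) * real (dprod inp off m)"
  by (metis of_nat_mult)
 then show ?thesis unfolding v(2) using v(1) by (simp add: field_simps)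
qed

section \<open>The number of samples\<close>

text \<open>For a fraction \<open>a / b\<close> that is at most 1, a power of two between the
  reciprocal and twice the reciprocal. It replaces \<open>1 / r\<close> and
  \<open>1 / \<epsilon>\<close> by integers without a division; as many rounds as \<open>b\<close>
  has bits suffice.\<close>

definition qceil :: "nat => nat => nat" where
 "qceil a b = fold (%_ q. if q * a < b then q + q else q) (bits b) 1"

text \<open>The same loop along an arbitrary list, so that its invariants can be proved by induction
  on the number of rounds.\<close>

definition dbl :: "nat => nat => 'a list => nat" where
 "dbl a b xs = fold (%_ q. if q * a < b then q + q else q) xs 1"

lemma dbl_snoc: "dbl a b (xs @ [x]) = (if dbl a b xs * a < b then dbl a b xs + dbl a b xs else dbl a b xs)"
 and dbl_Nil: "dbl a b [] = 1"
 by (auto simp: dbl_def)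

lemma dbl_upper: "dbl a b xs * a <= max a (2 * b)"
 by (induction xs rule: rev_induct) (auto simp: dbl_snoc dbl_Nil add_mult_distrib)

lemma dbl_lower: "b <= dbl a b xs * a \<or> dbl a b xs = 2 ^ length xs"
 by (induction xs rule: rev_induct) (auto simp: dbl_snoc dbl_Nil)

lemma dbl_le: "dbl a b xs <= 2 ^ length xs"
 by (induction xs rule: rev_induct) (auto simp: dbl_snoc dbl_Nil)

lemma qceil_conv: "qceil a b = dbl a b (bits b)"
 by (simp add: qceil_def dbl_def)

lemma qceil_bounds:
 assumes "0 < a" "a <= b"
 shows "b <= qceil a b * a" "qceil a b * a <= 2 * b"
proof -
 show "qceil a b * a <= 2 * b" using dbl_upper[of a b "bits b"] assms by (simp add: qceil_conv)
 show "b <= qceil a b * a"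
 proof (cases "b <= dbl a b (bits b) * a")
  case False
  then have "qceil a b = 2 ^ length (bits b)" using dbl_lower[of b a "bits b"] by (simp add: qceil_conv)
  then have "b < qceil a b" using less_pow_length_bits[of b] by simp
  then show ?thesis using assms(1) by (metis One_nat_def Suc_leI less_imp_le mult.right_neutral mult_le_mono)
 qed (simp add: qceil_conv)
qed

lemma pt_qceil [pt_intros]:
 assumes "pt f" "pt g"
 shows "pt (%x. qceil (f x) (g x))"
 unfolding qceil_def
proof (rule pt_fold[where h = "%x _ q. if q * f x < g x then q + q else q"])
 show "pbd (%x. 1 + sz (g x))" by (intro pbd_add pbd_const pt_sz assms)
 show "sz (fold (%_ q. if q * f x < g x then q + q else q) (take n (bits (g x))) 1) <= 1 + sz (g x)" for x n
 proof -
  have "dbl (f x) (g x) (take n (bits (g x))) < 2 ^ Suc (length (bits (g x)))"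
  proof -
   have "dbl (f x) (g x) (take n (bits (g x))) <= 2 ^ length (take n (bits (g x)))" by (rule dbl_le)
   also have "\<dots> <= 2 ^ length (bits (g x))" by (rule power_increasing) auto
   finally show ?thesis by (rule le_less_trans) simp
  qed
  then show ?thesis using sz_less_power by (force simp: dbl_def sz_nat_def length_bits)
 qed
 show "pt (%p. if snd (snd p) * f (fst p) < g (fst p) then snd (snd p) + snd (snd p) else snd (snd p))"
  by (intro pt_intros pt_compose[OF assms(1)] pt_compose[OF assms(2)])
qed (intro pt_intros assms)+

text \<open>
 The entries \<open>m\<close>, \<open>m + 1\<close>, \<open>m + 2\<close> of the table of rationals are the radius, the accuracy and the
 failure probability; \<open>n\<close> is the size of the ground set.
\<close>

definition nsamp :: "nat list => nat => nat => nat => nat" where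
 "nsamp inp off m n =
   (let qr = qceil (rnum inp off m) (rden inp off m);
     q = 2 * (qceil (rnum inp off (m + 1)) (rden inp off (m + 1)) * (qr * qr))
   in (n + 1 + length (bits (rden inp off (m + 2)))) * (q * q))"

lemma pt_nsamp [pt_intros]: "pt a ==> pt b ==> pt c ==> pt d ==> pt (%x. nsamp (a x) (b x) (c x) (d x))"
 by (rule pt_lift4) (unfold nsamp_def, intro pt_intros)

lemma floorlog_le_input_size: "i < length inp ==> floorlog 2 (inp ! i) <= input_size inp"
proof (induction inp arbitrary: i)
 case (Cons a inp)
 then show ?case by (cases i) (auto simp: input_size_def intro: le_SucI trans_le_add2)
qed simp

text \<open>The number of samples is \<open>L * Q\<^sup>2\<close>. As \<open>Q\<close> is at least
  the reciprocal of the accuracy \<open>\<eta>\<close>, the exponential is at most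
  \<open>exp (- L)\<close>, hence at most \<open>1 / 2 ^ L\<close>. Of \<open>L\<close>, the part
  \<open>n + 1\<close> cancels \<open>2 * 2 ^ n\<close>, and the bit length of the denominator of
  \<open>\<delta>\<close> leaves at most \<open>\<delta>\<close>. For the upper bound,
  \<open>L\<close> is at most \<open>2 * Y\<close> and \<open>Q\<close> at most
  \<open>16 * Y\<^sup>2\<close>, whence 512 = 2 * 16 * 16 and the degree 5.\<close>

lemma nsamp_properties:
 fixes r \<epsilon> \<delta> :: rat
 assumes inp: "inp = pre @ concat (map rat_code qs) @ post" "off = length pre" "m + 2 < length qs"
  and q: "qs ! m = r" "qs ! (m + 1) = \<epsilon>" "qs ! (m + 2) = \<delta>"
  and v: "0 < r" "r <= 1" "0 < \<epsilon>" "\<epsilon> < 1" "0 < \<delta>" "\<delta> < 1"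
 shows "0 < nsamp inp off m n"
  and "2 * 2 ^ n * exp (- 2 * real (nsamp inp off m n) * (of_rat \<epsilon> * (of_rat r)\<^sup>2 / 2)\<^sup>2) <= (of_rat \<delta> :: real)"
  and "n <= input_size inp ==> 1 <= \<Lambda> ==>
   real (nsamp inp off m n) <= real 512 * (1 + real (input_size inp) + \<Lambda> / (of_rat \<epsilon> * of_rat r)) ^ 5"
proof -
 define rr ee where "rr = (of_rat r :: real)" and "ee = (of_rat \<epsilon> :: real)"
 have rr: "0 < rr" "rr <= 1" "0 < ee" "ee < 1" using v by (auto simp: rr_def ee_def)
 have key: "1 <= real (qceil (rnum inp off k) (rden inp off k)) * of_rat (qs ! k) \<and>
   real (qceil (rnum inp off k) (rden inp off k)) * of_rat (qs ! k) <= 2"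
  if k: "k < length qs" "0 < qs ! k" "qs ! k <= 1" for k
 proof -
  note t = rat_table_value[OF inp(1,2) k(1) less_imp_le[OF k(2)]]
  let ?a = "rnum inp off k" and ?b = "rden inp off k"
  have "(0::real) < of_rat (qs ! k)" "of_rat (qs ! k) <= (1::real)" using k by auto
  then have "0 < ?a" "?a <= ?b" unfolding t(2) using t(1) by (auto simp: zero_less_divide_iff divide_le_eq_1)
  note b = qceil_bounds[OF this]
  have "real ?b <= real (qceil ?a ?b) * real ?a" "real (qceil ?a ?b) * real ?a <= 2 * real ?b"
   using b by (metis of_nat_le_iff of_nat_mult, metis of_nat_le_iff of_nat_mult of_nat_numeral)
  then show ?thesis unfolding t(2) using t(1) by (simp add: field_simps)
 qed
 define qr where "qr = real (qceil (rnum inp off m) (rden inp off m))"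
 define qe where "qe = real (qceil (rnum inp off (m + 1)) (rden inp off (m + 1)))"
 have qr: "1 <= qr * rr" "qr * rr <= 2" using key[of m] inp(3) q v by (auto simp: qr_def rr_def)
 have qe: "1 <= qe * ee" "qe * ee <= 2" using key[of "m+1"] inp(3) q v by (auto simp: qe_def ee_def)
 define Q where "Q = 2 * (qe * (qr * qr))"
 define L where "L = real (n + 1 + length (bits (rden inp off (m + 2))))"
 have N: "real (nsamp inp off m n) = L * (Q * Q)"
  by (simp only: nsamp_def Let_def Q_def L_def qr_def qe_def of_nat_mult of_nat_numeral)
 have L1: "1 <= L" by (simp add: L_def)
 define \<eta> where "\<eta> = ee * rr\<^sup>2 / 2"
 have Q\<eta>: "Q * \<eta> = (qe * ee) * (qr * rr)\<^sup>2" by (simp add: Q_def \<eta>_def power2_eq_square)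
 have Q1: "1 <= Q * \<eta>"
  unfolding Q\<eta> using mult_mono[of 1 "qe * ee" 1 "(qr * rr)\<^sup>2"] qe qr one_le_power[of "qr * rr" 2] by simp
 have "0 < \<eta>" using rr by (simp add: \<eta>_def)
 then have "0 < Q" using Q1 by (metis less_le_trans zero_less_mult_pos2 zero_less_one)
 then have "0 < real (nsamp inp off m n)" unfolding N using L1 by simp
 then show "0 < nsamp inp off m n" by simp
 have "2 * 2 ^ n * exp (- 2 * (L * (Q * Q)) * \<eta>\<^sup>2) <= of_rat \<delta>"
 proof -
  note t = rat_table_value[OF inp(1,2) inp(3), unfolded q(3), OF less_imp_le[OF v(5)]]
  let ?a = "rnum inp off (m + 2)" and ?b = "rden inp off (m + 2)"
  have "(0::real) < of_rat \<delta>" using v by simp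
  then have a: "1 <= ?a" unfolding t(2) using t(1) by (auto simp: zero_less_divide_iff)
  have d: "1 / 2 ^ length (bits ?b) <= (of_rat \<delta> :: real)"
  proof -
   have "real ?b <= 2 ^ length (bits ?b)"
    using less_pow_length_bits[of ?b] by (metis less_imp_le of_nat_le_iff of_nat_numeral of_nat_power)
   then have "1 / 2 ^ length (bits ?b) <= 1 / real ?b" using t(1) by (intro divide_left_mono) auto
   also have "\<dots> <= real ?a / real ?b" using a by (intro divide_right_mono) auto
   finally show ?thesis unfolding t(2) .
  qed
  have "L <= 2 * (L * (Q * Q)) * \<eta>\<^sup>2"
  proof -
   have "1 <= (Q * \<eta>)\<^sup>2" using Q1 by (rule one_le_power)
   then have "L * 1 <= L * (2 * (Q * \<eta>)\<^sup>2)" using L1 by (intro mult_left_mono) auto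
   then show ?thesis by (simp add: power2_eq_square mult_ac)
  qed
  then have "exp (- 2 * (L * (Q * Q)) * \<eta>\<^sup>2) <= exp (- L)" by simp
  also have "\<dots> = 1 / exp 1 ^ (n + 1 + length (bits ?b))"
   unfolding L_def exp_minus by (subst exp_of_nat_mult[symmetric]) (simp add: inverse_eq_divide)
  also have "\<dots> <= 1 / 2 ^ (n + 1 + length (bits ?b))"
   using exp_ge_add_one_self[of 1] by (intro divide_left_mono power_mono) auto
  finally have "2 * 2 ^ n * exp (- 2 * (L * (Q * Q)) * \<eta>\<^sup>2) <= 2 * 2 ^ n * (1 / 2 ^ (n + 1 + length (bits ?b)))"
   by (intro mult_left_mono) auto
  also have "\<dots> = 1 / 2 ^ length (bits ?b)" by (simp add: power_add)
  finally show ?thesis using d by linarith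
 qed
 then show "2 * 2 ^ n * exp (- 2 * real (nsamp inp off m n) * (of_rat \<epsilon> * (of_rat r)\<^sup>2 / 2)\<^sup>2) <= (of_rat \<delta> :: real)"
  by (simp only: N \<eta>_def rr_def ee_def)
 assume n: "n <= input_size inp" and \<Lambda>: "1 <= \<Lambda>"
 define Y where "Y = 1 + real (input_size inp) + \<Lambda> / (ee * rr)"
 have er: "0 < ee * rr" using rr by simp
 have "1 / (ee * rr) <= \<Lambda> / (ee * rr)" using \<Lambda> er by (intro divide_right_mono) auto
 then have y: "1 / (ee * rr) <= Y" "1 + real (input_size inp) <= Y" using er \<Lambda> by (auto simp: Y_def)
 have "off + 2 * (m + 2) + 1 < length inp" using inp by (simp add: length_rat_codes)
 then have "length (bits (rden inp off (m + 2))) <= input_size inp"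
  using floorlog_le_input_size by (simp add: length_bits rden_def nthd_def)
 then have L2: "L <= 2 * Y" using n y by (simp add: L_def)
 have "Q <= 16 * (1 / (ee * rr))\<^sup>2"
 proof -
  have "qr <= 2 / rr" "qe <= 2 / ee" using qr qe rr by (auto simp: field_simps)
  then have "Q <= 2 * ((2 / ee) * ((2 / rr) * (2 / rr)))"
   unfolding Q_def using rr by (intro mult_left_mono mult_mono) (auto simp: qr_def qe_def)
  also have "\<dots> = 16 * ee * (1 / (ee * rr))\<^sup>2" using rr by (simp add: field_simps power2_eq_square)
  also have "\<dots> <= 16 * 1 * (1 / (ee * rr))\<^sup>2" using rr by (intro mult_right_mono) auto
  finally show ?thesis by simp
 qed
 also have "\<dots> <= 16 * Y\<^sup>2" using y(1) er by (intro mult_left_mono power_mono) auto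
 finally have "Q * Q <= (16 * Y\<^sup>2) * (16 * Y\<^sup>2)" using \<open>0 < Q\<close> by (intro mult_mono) auto
 then have "L * (Q * Q) <= (2 * Y) * ((16 * Y\<^sup>2) * (16 * Y\<^sup>2))"
  by (rule mult_mono[OF L2]) (use L1 L2 in auto)
 also have "\<dots> = 512 * Y ^ 5" by (simp add: power2_eq_square eval_nat_numeral)
 finally show "real (nsamp inp off m n) <= real 512 * (1 + real (input_size inp) + \<Lambda> / (of_rat \<epsilon> * of_rat r)) ^ 5"
  by (simp only: N Y_def ee_def rr_def of_nat_numeral)
qed

section \<open>Weighted scenarios from samples\<close>

text \<open>Masses are measured in units of \<open>1 / (2 * length ws * rd)\<close>, where the
  radius is \<open>rn / rd\<close>; the truncated subtraction is the \<open>max 0\<close> of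
  \<open>excess\<close>. The factor 2 keeps integral the half with which the movable mass enters the
  lower bound on the objective.\<close>

definition heavy :: "nat => nat => nat list => (nat \<times> nat list) list" where
 "heavy rn rd ws = map (%a. (2 * (cnt a ws * rd - length ws * rn), dec a)) (dedup ws)"

definition rest :: "nat => nat => nat list => nat" where
 "rest rn rd ws = length ws * rd - sum_list (map (%a. cnt a ws * rd - length ws * rn) (dedup ws))"

lemma pt_heavy [pt_intros]: "pt a ==> pt b ==> pt c ==> pt (%x. heavy (a x) (b x) (c x))"
 by (rule pt_lift3) (unfold heavy_def, intro pt_intros)

lemma pt_rest [pt_intros]: "pt a ==> pt b ==> pt c ==> pt (%x. rest (a x) (b x) (c x))"
 by (rule pt_lift3) (unfold rest_def, intro pt_intros)

lemma sum_cnt: "(\<Sum>a\<in>set xs. cnt a xs) = length xs"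
proof (induction xs)
 case (Cons x xs)
 have "(\<Sum>a\<in>set (x # xs). cnt a (x # xs)) = (\<Sum>a\<in>insert x (set xs). cnt a xs + (if a = x then 1 else 0))"
  by (intro sum.cong) (auto simp: cnt_def)
 also have "\<dots> = (\<Sum>a\<in>insert x (set xs). cnt a xs) + 1" by (simp add: sum.distrib)
 also have "(\<Sum>a\<in>insert x (set xs). cnt a xs) = (\<Sum>a\<in>set xs. cnt a xs)"
 proof (cases "x \<in> set xs")
  case False
  then have "cnt x xs = 0" by (auto simp: cnt_def filter_empty_conv)
  with False show ?thesis by simp
 qed (simp add: insert_absorb)
 finally show ?case using Cons by simp
qed simp

lemma cnt_eq_0: "a \<notin> set xs ==> cnt a xs = 0"
 by (auto simp: cnt_def filter_empty_conv)

text \<open>A scenario without samples has count 0 and contributes nothing, so a sum over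
  exponentially many scenarios reduces to the sampled ones.\<close>

lemma sum_dedup_scenarios:
 fixes G :: "nat => nat set => real"
 assumes "finite U" "set ws \<subseteq> set_encode ` Pow U" "\<And>A. G 0 A = 0"
 shows "(\<Sum>a\<leftarrow>dedup ws. G (cnt a ws) (set_decode a)) = (\<Sum>A\<in>Pow U. G (cnt (set_encode A) ws) A)"
proof -
 have inj: "inj_on set_encode (Pow U)"
  using assms(1) by (intro inj_on_subset[OF inj_on_set_encode]) (auto intro: finite_subset)
 have "(\<Sum>a\<leftarrow>dedup ws. G (cnt a ws) (set_decode a)) = (\<Sum>a\<in>set ws. G (cnt a ws) (set_decode a))"
  by (simp add: sum_list_distinct_conv_sum_set)
 also have "\<dots> = (\<Sum>a\<in>set_encode ` Pow U. G (cnt a ws) (set_decode a))"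
  by (rule sum.mono_neutral_left) (use assms in \<open>auto simp: cnt_eq_0\<close>)
 also have "\<dots> = (\<Sum>A\<in>Pow U. G (cnt (set_encode A) ws) (set_decode (set_encode A)))"
  by (simp add: sum.reindex[OF inj])
 also have "\<dots> = (\<Sum>A\<in>Pow U. G (cnt (set_encode A) ws) A)"
  using assms(1) by (intro sum.cong refl) (simp add: finite_subset[of _ U])
 finally show ?thesis .
qed

text \<open>The last claim says that all weights together are at most the weight of the first stage.
  Facility location uses it to control the rounding of the first-stage radii.\<close>

lemma scenario_weights:
 fixes rn rd :: nat and G :: "nat set => real"
 assumes U: "finite U" "set ws \<subseteq> set_encode ` Pow U" and r: "0 < rd" "r = real rn / real rd" "0 < r" "r <= 1"
  and ws: "ws \<noteq> []"
 defines "f \<equiv> %A. real (cnt (set_encode A) ws) / real (length ws)" and "T \<equiv> real (length ws * rd)"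
 shows "(\<Sum>(w, es)\<leftarrow>heavy rn rd ws. real w * G (set es)) = 2 * T * (\<Sum>A\<in>Pow U. excess f r A * G A)"
  and "real (rest rn rd ws) = T * (1 - sum (excess f r) (Pow U))" and "sum f (Pow U) = 1"
  and "rest rn rd ws + sum_list (map fst (heavy rn rd ws)) <= 2 * (length ws * rd)"
proof -
 let ?N = "length ws"
 have T: "0 < T" using r ws by (simp add: T_def)
 have w: "real (cnt a ws * rd - ?N * rn) = T * max 0 (real (cnt a ws) / ?N - r)" for a
 proof -
  have "real (cnt a ws * rd - ?N * rn) = max 0 (real (cnt a ws * rd) - real (?N * rn))" by (cases "?N * rn <= cnt a ws * rd") (simp_all add: of_nat_diff max_def not_le flip: of_nat_mult)
  also have "real (cnt a ws * rd) - real (?N * rn) = T * (real (cnt a ws) / ?N - r)"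
   using r(1) ws by (simp add: T_def r(2) field_simps)
  also have "max 0 \<dots> = T * max 0 (real (cnt a ws) / ?N - r)"
   using T by (auto simp: max_def zero_le_mult_iff)
  finally show ?thesis .
 qed
 have gen: "(\<Sum>a\<leftarrow>dedup ws. real (cnt a ws * rd - ?N * rn) * H (set_decode a)) = T * (\<Sum>A\<in>Pow U. excess f r A * H A)" for H
 proof -
  have "(\<Sum>a\<leftarrow>dedup ws. real (cnt a ws * rd - ?N * rn) * H (set_decode a)) =
    (\<Sum>A\<in>Pow U. real (cnt (set_encode A) ws * rd - ?N * rn) * H A)"
   using sum_dedup_scenarios[OF U, of "%c A. real (c * rd - ?N * rn) * H A"] by simp
  also have "\<dots> = (\<Sum>A\<in>Pow U. T * (excess f r A * H A))"
   by (intro sum.cong refl) (simp only: w excess_def f_def mult.assoc)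
  finally show ?thesis by (simp add: sum_distrib_left)
 qed
 have "(\<Sum>(w, es)\<leftarrow>heavy rn rd ws. real w * G (set es)) = (\<Sum>a\<leftarrow>dedup ws. 2 * (real (cnt a ws * rd - ?N * rn) * G (set_decode a)))"
  by (simp add: heavy_def o_def mult.assoc del: of_nat_diff)
 also have "\<dots> = 2 * (\<Sum>a\<leftarrow>dedup ws. real (cnt a ws * rd - ?N * rn) * G (set_decode a))"
  by (simp add: sum_list_const_mult)
 finally show "(\<Sum>(w, es)\<leftarrow>heavy rn rd ws. real w * G (set es)) = 2 * T * (\<Sum>A\<in>Pow U. excess f r A * G A)"
  by (simp add: gen)
 show f1: "sum f (Pow U) = 1"
 proof -
  have "(\<Sum>A\<in>Pow U. real (cnt (set_encode A) ws)) = (\<Sum>a\<leftarrow>dedup ws. real (cnt a ws))"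
   using sum_dedup_scenarios[OF U, of "%c A. real c"] by simp
  also have "\<dots> = real ?N" unfolding sum_cnt[symmetric] by (simp add: sum_list_distinct_conv_sum_set)
  finally show ?thesis using ws by (simp add: f_def sum_divide_distrib[symmetric])
 qed
 let ?s = "sum_list (map (%a. cnt a ws * rd - ?N * rn) (dedup ws))"
 have s: "real ?s = T * sum (excess f r) (Pow U)"
  using gen[of "%_. 1"] by (simp add: sum_list_of_nat[symmetric] o_def)
 have sl: "r <= 1 - sum (excess f r) (Pow U)"
  using excess_slack(1)[of "Pow U" f r] U f1 r by (auto simp: f_def)
 then have "T * sum (excess f r) (Pow U) <= T * 1" using T r by (intro mult_left_mono) auto
 then have "real ?s <= real (?N * rd)" using s T_def by simp
 then have le: "?s <= ?N * rd" by (simp only: of_nat_le_iff)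
 show "real (rest rn rd ws) = T * (1 - sum (excess f r) (Pow U))"
  using le s by (simp add: rest_def of_nat_diff T_def right_diff_distrib)
 have "sum_list (map fst (heavy rn rd ws)) = 2 * ?s"
  by (simp add: heavy_def o_def sum_list_const_mult)
 then show "rest rn rd ws + sum_list (map fst (heavy rn rd ws)) <= 2 * (?N * rd)"
  using le unfolding rest_def by linarith
qed

text \<open>\<open>D\<close> is the common denominator to which the costs are scaled. In
  \<open>approx\<close> the second stage of the algorithm counts twice: the algorithm is charged the
  whole movable mass at the cost \<open>Cm\<close>, whereas the weight \<open>rest\<close> of the
  full scenario represents only half of that mass.\<close>

lemma scenario_reduction:
 fixes P :: "'z two_stage" and rn rd :: nat and D :: real
 assumes fin: "finite (ground P)" and p: "p \<in> distributions P" and \<epsilon>: "0 < \<epsilon>"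
  and r: "0 < rd" "r = real rn / real rd" "0 < r" "r <= 1"
  and c1: "\<And>a. a \<in> actions P ==> 0 <= cost1 P a"
  and nn: "\<And>x A z. x \<subseteq> actions P ==> A \<subseteq> ground P ==> feasible P x A z ==> 0 <= recourse_cost P A z"
  and join: "\<And>x A B z z'. x \<subseteq> actions P ==> A \<subseteq> ground P ==> B \<subseteq> ground P ==> feasible P x A z ==> feasible P x B z' ==>
    \<exists>y. feasible P x (A \<union> B) y \<and> recourse_cost P (A \<union> B) y <= recourse_cost P A z + recourse_cost P B z'"
  and mono: "\<And>x A z. x \<subseteq> actions P ==> A \<subseteq> ground P ==> feasible P x (ground P) z ==>
    feasible P x A z \<and> recourse_cost P A z <= recourse_cost P (ground P) z"
  and ws: "set ws \<subseteq> set_encode ` Pow (ground P)" "ws \<noteq> []" "accurate P p (\<epsilon> * r\<^sup>2 / 2) ws"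
  and xz: "(x, z) \<in> solutions P" and \<rho>: "0 < \<rho>" and D: "0 < D"
  and Cm: "\<And>A. A \<subseteq> ground P ==> recourse_cost P A (z A) <= Cm"
  and approx: "\<And>x' z'. (x', z') \<in> solutions P ==>
   real (2 * (length ws * rd)) * (D * sum (cost1 P) x) +
    2 * ((\<Sum>(w, es)\<leftarrow>heavy rn rd ws. real w * (D * recourse_cost P (set es) (z (set es)))) + real (rest rn rd ws) * (D * Cm))
   <= \<rho> * (real (2 * (length ws * rd)) * (D * sum (cost1 P) x') +
    ((\<Sum>(w, es)\<leftarrow>heavy rn rd ws. real w * (D * recourse_cost P (set es) (z' (set es)))) +
     real (rest rn rd ws) * (D * recourse_cost P (ground P) (z' (ground P)))))"
 shows "objective P p r x z <= \<rho> * (1 + \<epsilon>)\<^sup>2 * opt P p r"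
proof -
 let ?U = "ground P"
 define f where "f A = real (cnt (set_encode A) ws) / real (length ws)" for A
 define T where "T = real (length ws * rd)"
 note sw = scenario_weights[OF fin ws(1) r ws(2), folded f_def T_def]
 have TD: "0 < 2 * T * D" using r ws(2) D by (simp add: T_def)
 show ?thesis
 proof (rule reduction[where f = f and Cm = Cm])
  show "0 <= f A" for A by (simp add: f_def)
  show "sum f (Pow ?U) = 1" by (rule sw(3))
  show "\<bar>pmf p A - f A\<bar> <= \<epsilon> * r\<^sup>2 / 2" if "A \<subseteq> ?U" for A using ws(3) that by (simp add: accurate_def f_def)
  fix x' z' assume xz': "(x', z') \<in> solutions P"
  let ?S1 = "\<Sum>A\<in>Pow ?U. excess f r A * recourse_cost P A (z A)" and ?S2 = "\<Sum>A\<in>Pow ?U. excess f r A * recourse_cost P A (z' A)"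
  let ?m = "1 - sum (excess f r) (Pow ?U)"
  have S1: "0 <= ?S1" using xz by (intro sum_nonneg mult_nonneg_nonneg excess_nonneg nn[of x]) (auto simp: solutions_def)
  have h: "(\<Sum>(w, es)\<leftarrow>heavy rn rd ws. real w * (D * recourse_cost P (set es) (y (set es)))) =
    2 * T * D * (\<Sum>A\<in>Pow ?U. excess f r A * recourse_cost P A (y A))" for y
   using sw(1)[of "%A. D * recourse_cost P A (y A)"] by (simp add: sum_distrib_left mult_ac)
  have TT: "real (2 * (length ws * rd)) = 2 * T" by (simp add: T_def)
  from approx[OF xz'] have "2 * T * D * (sum (cost1 P) x + 2 * ?S1 + ?m * Cm)
   <= 2 * T * D * (\<rho> * (sum (cost1 P) x' + ?S2 + 1/2 * ?m * recourse_cost P ?U (z' ?U)))"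
   unfolding h sw(2) TT by (simp add: algebra_simps)
  then have "sum (cost1 P) x + 2 * ?S1 + ?m * Cm <= \<rho> * (sum (cost1 P) x' + ?S2 + 1/2 * ?m * recourse_cost P ?U (z' ?U))"
   using TD by (rule mult_left_le_imp_le)
  then show "sum (cost1 P) x + ?S1 + ?m * Cm <= \<rho> * (sum (cost1 P) x' + ?S2 + 1/2 * ?m * recourse_cost P ?U (z' ?U))"
   using S1 by linarith
 qed (fact fin p r(3,4) \<epsilon> c1 nn join mono xz \<rho> Cm)+
qed

section \<open>Covering problems\<close>

definition tot :: "nat list => nat set => nat" where
 "tot c S = (\<Sum>i\<in>S. c ! i)"

definition cov :: "nat list list => nat set => nat set" where
 "cov ms S = (\<Union>i\<in>S. set (ms ! i))"

definition unc :: "nat list list => nat list => nat list => nat list" where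
 "unc ms x es = filter (%e. \<not> list_ex (%i. e \<in> set (nthd [] ms i)) x) es"

lemma pt_unc [pt_intros]: "pt a ==> pt b ==> pt c ==> pt (%x. unc (a x) (b x) (c x))"
 by (rule pt_lift3) (unfold unc_def, intro pt_intros)

lemma set_unc: "set x \<subseteq> {..<length ms} ==> set (unc ms x es) = set es - cov ms (set x)"
 by (auto simp: unc_def list_ex_iff cov_def nthd_def)

lemma distinct_unc: "distinct es ==> distinct (unc ms x es)"
 by (simp add: unc_def)

lemma cov_Un: "cov ms (S \<union> T) = cov ms S \<union> cov ms T"
 by (auto simp: cov_def)

lemma tot_Un_le: "finite S ==> finite T ==> tot c (S \<union> T) <= tot c S + tot c T"
 unfolding tot_def using sum.union_inter[of S T "(!) c"] by linarith

lemma unc_cong: "set x = set y ==> unc ms x es = unc ms y es"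
 by (simp add: unc_def list_ex_iff)

section \<open>Decoding and the two programs common to the covering problems\<close>

definition sc_ns where "sc_ns inp = nthd (0::nat) inp 1"
definition sc_off where "sc_off inp = 2 + sc_ns inp"
definition sc_m where "sc_m inp = 2 * sc_ns inp"
definition sc_idx where "sc_idx inp = rng inp (sc_ns inp)"
definition sc_ms where "sc_ms inp = map (%i. dec (nthd 0 inp (2 + i))) (sc_idx inp)"
definition sc_c1 where "sc_c1 inp = map (%i. scl inp (sc_off inp) (sc_m inp) (2 * i)) (sc_idx inp)"
definition sc_c2 where "sc_c2 inp = map (%i. scl inp (sc_off inp) (sc_m inp) (2 * i + 1)) (sc_idx inp)"
text \<open>A set is a single number, so there may be more elements than input numbers, and a range
  along the input would be too short. But every element occupies a bit in the code of some set
  containing it, so a range along all bits of the input is long enough.\<close>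

definition sc_univ where
 "sc_univ inp = filter (%e. e < nthd 0 inp 0) [0..<length (concat (map bits inp))]"
definition sc_cheap where
 "sc_cheap inp \<longleftrightarrow> \<not> list_ex (%i. nthd 0 (sc_c1 inp) i < nthd 0 (sc_c2 inp) i) (sc_idx inp)"
definition sc_samples where
 "sc_samples inp = (if sc_cheap inp then 0 else nsamp inp (sc_off inp) (sc_m inp) (nthd 0 inp 0))"
definition sc_scen where
 "sc_scen inp ws = (let rn = rnum inp (sc_off inp) (sc_m inp); rd = rden inp (sc_off inp) (sc_m inp) in
   heavy rn rd ws @ [(rest rn rd ws, sc_univ inp)])"

text \<open>The arguments are the member lists of the sets, the first- and second-stage costs, the
  weight of the first stage and the weighted scenarios, the full one last. A \<open>cover2\<close>
  gets the sets, the second-stage costs and the elements still to be covered.\<close>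

type_synonym cover1 = "nat list list => nat list => nat list => nat => (nat \<times> nat list) list => nat list"
type_synonym cover2 = "nat list list => nat list => nat list => nat list"

definition sc_stage1 :: "cover1 => nat list \<times> nat list => nat" where
 "sc_stage1 a1 p = (let inp = fst p; ws = snd p in
   if sc_cheap inp then 0
   else mask (%i. i \<in> set (a1 (sc_ms inp) (sc_c1 inp) (sc_c2 inp)
     (2 * (length ws * rden inp (sc_off inp) (sc_m inp))) (sc_scen inp ws))) (sc_idx inp))"

text \<open>After the cost table, three rationals occupy six cells; then come the first-stage mask,
  the number kept for the second stage and the scenario. Hence the offsets 6 and 8.\<close>

definition sc_stage2 :: "cover2 => nat list => nat \<times> nat list" where
 "sc_stage2 a2 inp = (mask (%i. i \<in> set (a2 (sc_ms inp) (sc_c2 inp)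
   (unc (sc_ms inp) (dec (nthd 0 inp (sc_off inp + 2 * sc_m inp + 6)))
    (dec (nthd 0 inp (sc_off inp + 2 * sc_m inp + 8)))))) (sc_idx inp), [])"

lemma pt_sc_ns [pt_intros]: "pt a ==> pt (%x. sc_ns (a x))"
 by (rule pt_compose) (unfold sc_ns_def, intro pt_intros)
lemma pt_sc_off [pt_intros]: "pt a ==> pt (%x. sc_off (a x))"
 by (rule pt_compose) (unfold sc_off_def, intro pt_intros)
lemma pt_sc_m [pt_intros]: "pt a ==> pt (%x. sc_m (a x))"
 by (rule pt_compose) (unfold sc_m_def, intro pt_intros)
lemma pt_sc_idx [pt_intros]: "pt a ==> pt (%x. sc_idx (a x))"
 by (rule pt_compose) (unfold sc_idx_def, intro pt_intros)
lemma pt_sc_ms [pt_intros]: "pt a ==> pt (%x. sc_ms (a x))"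
 by (rule pt_compose) (unfold sc_ms_def, intro pt_intros)
lemma pt_sc_c1 [pt_intros]: "pt a ==> pt (%x. sc_c1 (a x))"
 by (rule pt_compose) (unfold sc_c1_def, intro pt_intros)
lemma pt_sc_c2 [pt_intros]: "pt a ==> pt (%x. sc_c2 (a x))"
 by (rule pt_compose) (unfold sc_c2_def, intro pt_intros)
lemma pt_sc_univ [pt_intros]: "pt a ==> pt (%x. sc_univ (a x))"
 by (rule pt_compose) (unfold sc_univ_def, intro pt_intros)
lemma pt_sc_cheap [pt_intros]: "pt a ==> pt (%x. sc_cheap (a x))"
 by (rule pt_compose) (unfold sc_cheap_def, intro pt_intros)
lemma pt_sc_samples [pt_intros]: "pt a ==> pt (%x. sc_samples (a x))"
 by (rule pt_compose) (unfold sc_samples_def, intro pt_intros)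
lemma pt_sc_scen [pt_intros]: "pt a ==> pt b ==> pt (%x. sc_scen (a x) (b x))"
 by (rule pt_lift2) (unfold sc_scen_def, intro pt_intros)

lemma pt_lift5:
 "pt (%p. g (fst p) (fst (snd p)) (fst (snd (snd p))) (fst (snd (snd (snd p)))) (snd (snd (snd (snd p))))) ==>
  pt a ==> pt b ==> pt c ==> pt d ==> pt e ==> pt (%x. g (a x) (b x) (c x) (d x) (e x))"
 using pt_compose[OF _ pt_Pair[OF _ pt_Pair[OF _ pt_Pair[OF _ pt_Pair]]],
   of "%p. g (fst p) (fst (snd p)) (fst (snd (snd p))) (fst (snd (snd (snd p)))) (snd (snd (snd (snd p))))" a b c d e]
 by simp

definition sc_qs where
 "sc_qs I r \<epsilon> \<delta> = concat (map (%i. [scost1 I i, scost2 I i]) [0..<nsets I]) @ [r, \<epsilon>, \<delta>]"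

lemma concat_pairs:
 "length (concat (map (%i. [f i, g i]) [0..<n])) = 2 * n"
 "i < n ==> (concat (map (%i. [f i, g i]) [0..<n]) @ ys) ! (2 * i) = f i"
 "i < n ==> (concat (map (%i. [f i, g i]) [0..<n]) @ ys) ! Suc (2 * i) = g i"
proof -
 show l: "length (concat (map (%i. [f i, g i]) [0..<n])) = 2 * n" for n by (induction n) auto
 show "i < n ==> (concat (map (%i. [f i, g i]) [0..<n]) @ ys) ! (2 * i) = f i"
  by (induction n arbitrary: ys) (auto simp: less_Suc_eq nth_append l)
 show "i < n ==> (concat (map (%i. [f i, g i]) [0..<n]) @ ys) ! Suc (2 * i) = g i"
  by (induction n arbitrary: ys) (auto simp: less_Suc_eq nth_append l)
qed

text \<open>The suffix \<open>post\<close> is empty in the first stage and consists of three numbers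
  in the second, so that one decoding argument serves both.\<close>

locale sc_input =
 fixes I :: set_cover_inst and r \<epsilon> \<delta> :: rat and inp post :: "nat list"
 assumes inp: "inp = stage1_input (set_cover_problem I) r \<epsilon> \<delta> @ post"
  and un: "(\<Union>i<nsets I. members I i) = {..<nelems I}"
  and costs: "valid_costs {..<nsets I} (scost1 I) (scost2 I)"
begin

abbreviation "ns \<equiv> nsets I"
abbreviation "n \<equiv> nelems I"
abbreviation "D \<equiv> dprod inp (2 + ns) (2 * ns)"

definition pre where "pre = [n, ns] @ map (%i. set_encode (members I i)) [0..<ns]"

lemma inp_eq: "inp = pre @ concat (map rat_code (sc_qs I r \<epsilon> \<delta>)) @ post"
proof -
 have "concat (map (%i. rat_code (scost1 I i) @ rat_code (scost2 I i)) xs) =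
   concat (map rat_code (concat (map (%i. [scost1 I i, scost2 I i]) xs)))" for xs
  by (induction xs) auto
 then show ?thesis
  by (simp add: inp stage1_input_def set_cover_problem_def pre_def sc_qs_def)
qed

lemma length_pre: "length pre = 2 + ns" by (simp add: pre_def)

lemma length_qs: "length (sc_qs I r \<epsilon> \<delta>) = 2 * ns + 3" by (simp add: sc_qs_def concat_pairs)

lemma length_inp: "length inp = 2 + ns + 2 * (2 * ns + 3) + length post"
 by (simp add: inp_eq length_pre length_rat_codes length_qs)

lemma qs_nth:
 "i < ns ==> sc_qs I r \<epsilon> \<delta> ! (2 * i) = scost1 I i" "i < ns ==> sc_qs I r \<epsilon> \<delta> ! Suc (2 * i) = scost2 I i"
 "sc_qs I r \<epsilon> \<delta> ! (2 * ns) = r" "sc_qs I r \<epsilon> \<delta> ! (2 * ns + 1) = \<epsilon>" "sc_qs I r \<epsilon> \<delta> ! (2 * ns + 2) = \<delta>"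
 by (simp_all add: sc_qs_def concat_pairs nth_append_right)

lemma ns [simp]: "sc_ns inp = ns" "sc_off inp = 2 + ns" "sc_m inp = 2 * ns" "nthd 0 inp 0 = n"
 by (simp_all add: sc_ns_def sc_off_def sc_m_def inp_eq pre_def nthd_def)

lemma idx [simp]: "sc_idx inp = [0..<ns]"
 by (simp add: sc_idx_def rng_eq length_inp)

lemma members_fin: "i < ns ==> finite (members I i) \<and> members I i \<subseteq> {..<n}"
 using un finite_subset[of "members I i" "{..<n}"] by blast

lemma ms: "sc_ms inp = map (%i. dec (set_encode (members I i))) [0..<ns]"
 unfolding sc_ms_def idx
proof (rule map_cong[OF refl])
 fix i assume "i \<in> set [0..<ns]"
 then have "nthd 0 inp (2 + i) = set_encode (members I i)"
  by (simp add: inp_eq pre_def nthd_def nth_append length_pre)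
 then show "dec (nthd 0 inp (2 + i)) = dec (set_encode (members I i))" by simp
qed

lemma length_ms [simp]: "length (sc_ms inp) = ns" by (simp add: ms)

lemma set_ms: "i < ns ==> set (sc_ms inp ! i) = members I i"
 using members_fin by (simp add: ms)

lemma cov_ms: "S \<subseteq> {..<ns} ==> cov (sc_ms inp) S = (\<Union>i\<in>S. members I i)"
 unfolding cov_def by (intro SUP_cong refl set_ms) auto

lemma length_c [simp]: "length (sc_c1 inp) = ns" "length (sc_c2 inp) = ns"
 by (simp_all add: sc_c1_def sc_c2_def)

lemma costs_nonneg: "i < ns ==> 0 <= scost1 I i" "i < ns ==> 0 <= scost2 I i"
 "i < ns ==> scost1 I i = 0 ==> scost2 I i = 0"
 using costs by (auto simp: valid_costs_def)

lemma c1_real: "i < ns ==> real (sc_c1 inp ! i) = D * of_rat (scost1 I i)"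
 using scl_real[OF inp_eq, of "2 + ns" "2 * i" "2 * ns"] costs_nonneg[of i] length_qs
 by (simp add: sc_c1_def length_pre qs_nth)

lemma c2_real: "i < ns ==> real (sc_c2 inp ! i) = D * of_rat (scost2 I i)"
 using scl_real[OF inp_eq, of "2 + ns" "2 * i + 1" "2 * ns"] costs_nonneg[of i] length_qs
 by (simp add: sc_c2_def length_pre qs_nth)

lemma D_pos: "0 < D"
proof (rule dprod_pos)
 fix k assume k: "k < 2 * ns"
 have "0 <= sc_qs I r \<epsilon> \<delta> ! k"
 proof (cases "even k")
  case True
  then obtain i where i: "k = 2 * i" by (auto elim: evenE)
  then show ?thesis using k costs_nonneg(1)[of i] qs_nth(1)[of i] by auto
 next
  case False
  then obtain i where i: "k = 2 * i + 1" by (auto elim: oddE)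
  then show ?thesis using k costs_nonneg(2)[of i] qs_nth(2)[of i] by auto
 qed
 with rat_table_value(1)[OF inp_eq, of "2 + ns" k] show "0 < rden inp (2 + ns) k"
  using k by (simp add: length_pre length_qs)
qed (simp add: length_inp)

lemma tot_c1: "S \<subseteq> {..<ns} ==> real (tot (sc_c1 inp) S) = D * (\<Sum>i\<in>S. of_rat (scost1 I i))"
 unfolding tot_def of_nat_sum sum_distrib_left by (intro sum.cong refl c1_real) auto

lemma tot_c2: "S \<subseteq> {..<ns} ==> real (tot (sc_c2 inp) S) = D * (\<Sum>i\<in>S. of_rat (scost2 I i))"
 unfolding tot_def of_nat_sum sum_distrib_left by (intro sum.cong refl c2_real) auto

lemma n_le: "n <= length (concat (map bits inp))" "n <= input_size inp"
proof -
 have l: "length (concat (map bits xs)) <= input_size xs" for xs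
  by (induction xs) (auto simp: input_size_def length_bits)
 have mem: "length (bits k) <= length (concat (map bits xs))" if "k \<in> set xs" for k xs
  using that by (induction xs) auto
 show "n <= length (concat (map bits inp))"
 proof (cases "n = 0")
  case False
  then have "n - 1 \<in> (\<Union>i<ns. members I i)" unfolding un by simp
  then obtain i where i: "i < ns" "n - 1 \<in> members I i" by auto
  let ?k = "set_encode (members I i)"
  have "n - 1 \<in> set_decode ?k" using i members_fin by simp
  then have "n - 1 < length (bits ?k)"
   unfolding nthd_bits[symmetric] by (simp add: nthd_def split: if_splits)
  moreover have "?k \<in> set inp" using i(1) by (auto simp: inp_eq pre_def)
  ultimately show ?thesis using mem[of ?k inp] by simp
 qed simp
 then show "n <= input_size inp" using l[of inp] by simp
qed

lemma univ [simp]: "sc_univ inp = [0..<n]"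
proof -
 have "[0..<length (concat (map bits inp))] = [0..<n] @ [n..<length (concat (map bits inp))]"
  using n_le(1) upt_add_eq_append[of 0 n "length (concat (map bits inp)) - n"] by simp
 then show ?thesis by (simp add: sc_univ_def filter_id_conv del: length_concat)
qed

lemma cheap_iff: "sc_cheap inp \<longleftrightarrow> (\<forall>i<ns. scost2 I i <= scost1 I i)"
proof -
 have "sc_c1 inp ! i < sc_c2 inp ! i \<longleftrightarrow> scost1 I i < scost2 I i" if "i < ns" for i
 proof -
  have "sc_c1 inp ! i < sc_c2 inp ! i \<longleftrightarrow> real (sc_c1 inp ! i) < real (sc_c2 inp ! i)" by simp
  also have "\<dots> \<longleftrightarrow> real_of_rat (scost1 I i) < real_of_rat (scost2 I i)"
   unfolding c1_real[OF that] c2_real[OF that] using D_pos by simp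
  finally show ?thesis by (simp add: of_rat_less)
 qed
 then show ?thesis by (auto simp: sc_cheap_def list_ex_iff nthd_def not_less)
qed

text \<open>An action that gets more expensive has a positive first-stage cost by
  \<open>valid_costs\<close>, so its ratio exists and is at least 1. This is what brings
  \<open>1 / (\<epsilon> * r)\<close> within the time bound once samples are drawn.\<close>

lemma not_cheap_inflation: "\<not> sc_cheap inp ==> 1 <= inflation (set_cover_problem I)"
proof -
 assume "\<not> sc_cheap inp"
 then obtain i where i: "i < ns" "scost1 I i < scost2 I i" by (auto simp: cheap_iff not_le)
 have "0 < scost1 I i" using i costs_nonneg[of i] by (metis less_le)
 then have "1 <= of_rat (scost2 I i) / (of_rat (scost1 I i) :: real)"
  using i by (simp add: of_rat_less_eq)
 also have "\<dots> <= inflation (set_cover_problem I)"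
  unfolding inflation_def using i by (intro Max_ge) (auto simp: set_cover_problem_def)
 finally show ?thesis .
qed

lemma radius:
 assumes "0 < r"
 shows "0 < rden inp (2 + ns) (2 * ns)"
  "of_rat r = real (rnum inp (2 + ns) (2 * ns)) / real (rden inp (2 + ns) (2 * ns))"
 using rat_table_value[OF inp_eq, of "2 + ns" "2 * ns"] assms
 by (simp_all add: length_pre length_qs qs_nth)

lemma extra:
 assumes "post = [x, y, a]"
 shows "nthd 0 inp (2 + ns + 2 * (2 * ns) + 6) = x" "nthd 0 inp (2 + ns + 2 * (2 * ns) + 8) = a"
proof -
 define l where "l = pre @ concat (map rat_code (sc_qs I r \<epsilon> \<delta>))"
 have e: "inp = l @ [x, y, a]" by (simp add: inp_eq assms l_def)
 have l: "length l = 2 + ns + 2 * (2 * ns) + 6"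
  by (simp add: l_def length_pre length_rat_codes length_qs)
 then have "2 + ns + 2 * (2 * ns) + 8 = Suc (Suc (length l))" by simp
 then show "nthd 0 inp (2 + ns + 2 * (2 * ns) + 6) = x" "nthd 0 inp (2 + ns + 2 * (2 * ns) + 8) = a"
  unfolding l[symmetric] by (simp_all add: nthd_def e nth_append)
qed

text \<open>The right-hand side does not mention \<open>inp\<close>: the two stages scale the costs
  from different inputs and have to obtain the same integers.\<close>

lemma scl_closed: "k < 2 * ns ==> scl inp (2 + ns) (2 * ns) k = nat (fst (quotient_of (sc_qs I r \<epsilon> \<delta> ! k))) *
  prod_list (map (%j. if j = k then 1 else nat (snd (quotient_of (sc_qs I r \<epsilon> \<delta> ! j)))) [0..<2 * ns])"
proof -
 assume k: "k < 2 * ns"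
 have rg: "rng inp (2 * ns) = [0..<2 * ns]" by (simp add: rng_eq length_inp)
 have e: "map (%j. if j = k then 1 else rden inp (2 + ns) j) [0..<2 * ns] =
   map (%j. if j = k then 1 else nat (snd (quotient_of (sc_qs I r \<epsilon> \<delta> ! j)))) [0..<2 * ns]"
  using rat_table(2)[OF inp_eq length_pre[symmetric]] length_qs by (intro map_cong) auto
 have "rnum inp (2 + ns) k = nat (fst (quotient_of (sc_qs I r \<epsilon> \<delta> ! k)))"
  using rat_table(1)[OF inp_eq length_pre[symmetric], of k] k length_qs by linarith
 then show ?thesis unfolding scl_def rg e by (simp only:)
qed

end

text \<open>Allows an approximation factor to be replaced by a larger one.\<close>

lemma opt_nonneg:
 fixes P :: "'z two_stage"
 assumes fin: "finite (ground P)" and p: "p \<in> distributions P" and r: "0 <= r"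
  and c1: "\<And>a. a \<in> actions P ==> 0 <= cost1 P a"
  and nn: "\<And>x A z. x \<subseteq> actions P ==> A \<subseteq> ground P ==> feasible P x A z ==> 0 <= recourse_cost P A z"
  and xz: "(x, z) \<in> solutions P"
 shows "0 <= opt P p r"
proof -
 have "0 <= 1 * opt P p r"
 proof (rule opt_geI[OF xz])
  fix x' z' assume s: "(x', z') \<in> solutions P"
  let ?C = "%A. recourse_cost P A (z' A)"
  have x0: "0 <= sum (cost1 P) x'" using s c1 by (intro sum_nonneg) (auto simp: solutions_def)
  have S: "finite (Pow (ground P))" "set_pmf p \<subseteq> Pow (ground P)" using fin p by (auto simp: distributions_def)
  have "0 <= measure_pmf.expectation p ?C"
   unfolding expectation_finite[OF S]
   using s by (intro sum_nonneg mult_nonneg_nonneg nn[of x']) (auto simp: solutions_def)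
  also have "\<dots> <= (SUP q \<in> linf_ball P p r. measure_pmf.expectation q ?C)"
   by (intro cSUP_upper ball_bdd fin center_in_ball p r)
  finally show "0 <= 1 * objective P p r x' z'"
   using x0 by (simp add: objective_def)
 qed simp
 then show ?thesis by simp
qed

text \<open>Reduces a covering problem to two list functions. The predicate \<open>ok\<close> is the
  structure of the set system that the analysis may use. In \<open>a1_approx\<close>, the number
  \<open>Cm\<close> has to bound the recourse cost in every scenario, sampled or not, although on
  the right only the full scenario with weight \<open>u\<close> stands against it. The premise
  \<open>a2_approx\<close> handles the instances whose first stage stays empty.\<close>

theorem set_cover_approx:
 fixes \<I> :: "set_cover_inst set" and a1 :: cover1 and a2 :: cover2 and ok :: "nat list list => nat => bool"
  and \<rho> :: "nat => real"
 assumes pt1: "pt (%p. a1 (fst p) (fst (snd p)) (fst (snd (snd p))) (fst (snd (snd (snd p)))) (snd (snd (snd (snd p)))))"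
  and pt2: "pt (%p. a2 (fst p) (fst (snd p)) (snd (snd p)))"
  and I: "\<And>I. I \<in> \<I> ==> (\<Union>i<nsets I. members I i) = {..<nelems I} \<and>
    valid_costs {..<nsets I} (scost1 I) (scost2 I) \<and>
    ok (map (%i. dec (set_encode (members I i))) [0..<nsets I]) (nelems I)"
  and rho: "\<And>n. 0 < \<rho> n"
  and rho': "\<And>I \<epsilon>. I \<in> \<I> ==> 0 < \<epsilon> ==> \<epsilon> < 1 ==> \<rho> (nelems I) * (1 + \<epsilon>)\<^sup>2 <= \<rho>' (set_cover_problem I) \<epsilon>"
  and a2: "\<And>ms n c2 es. ok ms n ==> length c2 = length ms ==> distinct es ==> set es \<subseteq> {..<n} ==>
    set (a2 ms c2 es) \<subseteq> {..<length ms} \<and> set es \<subseteq> cov ms (set (a2 ms c2 es))"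
  and a2_approx: "\<And>ms n c2 es S. ok ms n ==> length c2 = length ms ==> distinct es ==> set es \<subseteq> {..<n} ==>
    S \<subseteq> {..<length ms} ==> set es \<subseteq> cov ms S ==> real (tot c2 (set (a2 ms c2 es))) <= \<rho> n * real (tot c2 S)"
  and a1: "\<And>ms n c1 c2 B H u. ok ms n ==> length c1 = length ms ==> length c2 = length ms ==>
    set (a1 ms c1 c2 B (H @ [(u, [0..<n])])) \<subseteq> {..<length ms}"
  and a1_approx: "\<And>ms n c1 c2 B H u x. ok ms n ==> length c1 = length ms ==> length c2 = length ms ==>
    (\<And>w es. (w, es) \<in> set H ==> distinct es \<and> set es \<subseteq> {..<n}) ==>
    x = a1 ms c1 c2 B (H @ [(u, [0..<n])]) ==>
    \<exists>Cm. (\<forall>es. distinct es --> set es \<subseteq> {..<n} --> real (tot c2 (set (a2 ms c2 (unc ms x es)))) <= Cm) \<and>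
     (\<forall>x' z'. x' \<subseteq> {..<length ms} --> (\<forall>A\<subseteq>{..<n}. z' A \<subseteq> {..<length ms} \<and> A \<subseteq> cov ms (x' \<union> z' A)) -->
      real B * real (tot c1 (set x)) +
       2 * ((\<Sum>(w, es)\<leftarrow>H. real w * real (tot c2 (set (a2 ms c2 (unc ms x es))))) + real u * Cm)
      <= \<rho> n * (real B * real (tot c1 x') +
       ((\<Sum>(w, es)\<leftarrow>H. real w * real (tot c2 (z' (set es)))) + real u * real (tot c2 (z' {..<n})))))"
 shows "has_approx_algorithm (set_cover_problem ` \<I>) \<rho>'"
proof -
 have flds: "ground (set_cover_problem I) = {..<nelems I}" "actions (set_cover_problem I) = {..<nsets I}"
  "cost1 (set_cover_problem I) = (%i. of_rat (scost1 I i))" "cost2 (set_cover_problem I) = (%i. of_rat (scost2 I i))"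
  "feasible (set_cover_problem I) x A z \<longleftrightarrow> z \<subseteq> {..<nsets I} \<and> A \<subseteq> (\<Union>i \<in> x \<union> z. members I i)"
  "recourse_cost (set_cover_problem I) A z = (\<Sum>i\<in>z. of_rat (scost2 I i))"
  "recourse_of (set_cover_problem I) s = set_decode (fst s 0)" for I x A z s
  by (simp_all add: set_cover_problem_def split: prod.splits)
 let ?P = set_cover_problem
 have loc: "sc_input I r \<epsilon> \<delta> (stage1_input (?P I) r \<epsilon> \<delta> @ post) post" if "I \<in> \<I>" for I r \<epsilon> \<delta> post
  using I[OF that] by unfold_locales auto
 have c2_eq: "sc_c2 (stage1_input (?P I) r \<epsilon> \<delta> @ post) = sc_c2 (stage1_input (?P I) r \<epsilon> \<delta>)"
  if "I \<in> \<I>" for I r \<epsilon> \<delta> post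
 proof -
  interpret A: sc_input I r \<epsilon> \<delta> "stage1_input (?P I) r \<epsilon> \<delta> @ post" post by (rule loc[OF that])
  interpret B: sc_input I r \<epsilon> \<delta> "stage1_input (?P I) r \<epsilon> \<delta>" "[]" using loc[OF that, of _ _ _ "[]"] by simp
  have "scl (stage1_input (?P I) r \<epsilon> \<delta> @ post) (2 + nsets I) (2 * nsets I) (2 * i + 1) =
    scl (stage1_input (?P I) r \<epsilon> \<delta>) (2 + nsets I) (2 * nsets I) (2 * i + 1)" if "i < nsets I" for i
   using that by (subst A.scl_closed, simp, subst B.scl_closed) simp_all
  then show ?thesis unfolding sc_c2_def A.idx B.idx A.ns B.ns by (intro map_cong refl) simp
 qed
 show ?thesis
 proof (rule has_approx_algorithmI[where h = sc_samples and ?f1.0 = "sc_stage1 a1" and ?f2.0 = "sc_stage2 a2" and C = 512 and e = 5])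
  show "pt sc_samples" by (intro pt_sc_samples pt_id)
  show "pt (sc_stage1 a1)" unfolding sc_stage1_def by (intro pt_intros pt_lift5[OF pt1])
  show "pt (sc_stage2 a2)" unfolding sc_stage2_def by (intro pt_intros pt_lift3[OF pt2])
  fix P assume "P \<in> ?P ` \<I>"
  then obtain I where I: "I \<in> \<I>" and P: "P = ?P I" by auto
  show "0 <= inflation P" unfolding inflation_def by (rule Max_ge) (auto simp: P flds)
  fix r \<epsilon> \<delta> :: rat
  interpret sc_input I r \<epsilon> \<delta> "stage1_input (?P I) r \<epsilon> \<delta>" "[]" using loc[OF I, of _ _ _ "[]"] by simp
  let ?inp = "stage1_input (?P I) r \<epsilon> \<delta>"
  show "ground P \<subseteq> {..<input_size (stage1_input P r \<epsilon> \<delta>)}" using n_le(2) by (auto simp: P flds)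
  show "sc_stage1 a1 (stage1_input P r \<epsilon> \<delta>, ws) < 2 ^ input_size (stage1_input P r \<epsilon> \<delta>)" for ws
  proof -
   have "set_encode {i. i < ns \<and> Q i} < 2 ^ input_size ?inp" for Q
    using length_le_input_size[of ?inp] length_inp by (intro set_encode_less) auto
   then show ?thesis by (simp add: sc_stage1_def Let_def P mask_upt)
  qed
  show "length (snd (sc_stage2 a2 (stage1_input P r \<epsilon> \<delta> @ [x, 0, a]))) <= length (stage1_input P r \<epsilon> \<delta>)" for x a
   by (simp add: sc_stage2_def)
  assume v: "0 < r" "r <= 1" "0 < \<epsilon>" "\<epsilon> < 1" "0 < \<delta>" "\<delta> < 1"
  have ns2: "2 * ns + 2 < length (sc_qs I r \<epsilon> \<delta>)" by (simp add: length_qs)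
  note np = nsamp_properties[OF inp_eq length_pre[symmetric] ns2 qs_nth(3-5) v, of n]
  show "real (sc_samples (stage1_input P r \<epsilon> \<delta>)) <= real 512 *
    (1 + real (input_size (stage1_input P r \<epsilon> \<delta>)) + inflation P / (of_rat \<epsilon> * of_rat r)) ^ 5"
  proof (cases "sc_cheap ?inp")
   case True
   have "0 <= inflation P / (of_rat \<epsilon> * of_rat r)" using \<open>0 <= inflation P\<close> v by simp
   with True show ?thesis by (simp add: sc_samples_def P)
  next
   case False
   from np(3)[OF n_le(2) not_cheap_inflation[OF False]] False show ?thesis by (simp add: sc_samples_def P)
  qed
  show "2 * 2 ^ card (ground P) * exp (- 2 * real (sc_samples (stage1_input P r \<epsilon> \<delta>)) * (of_rat \<epsilon> * (of_rat r)\<^sup>2 / 2)\<^sup>2)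
    <= of_rat \<delta>" if "0 < sc_samples (stage1_input P r \<epsilon> \<delta>)"
   using that np(2) by (simp add: sc_samples_def P flds split: if_splits)
  fix p ws inp and s :: "nat set => state"
  assume p: "p \<in> distributions P" and inp: "inp = stage1_input P r \<epsilon> \<delta>" and len: "length ws = sc_samples inp"
   and ws: "set ws \<subseteq> set_encode ` Pow (ground P)"
   and acc: "0 < sc_samples inp --> accurate P p (of_rat \<epsilon> * (of_rat r)\<^sup>2 / 2) ws"
   and s: "\<And>A. A \<subseteq> ground P ==> fst (s A) 0 = fst (sc_stage2 a2 (inp @ [sc_stage1 a1 (inp, ws), 0, set_encode A])) \<and>
     (\<forall>j < length (snd (sc_stage2 a2 (inp @ [sc_stage1 a1 (inp, ws), 0, set_encode A]))).
      snd (s A) j = snd (sc_stage2 a2 (inp @ [sc_stage1 a1 (inp, ws), 0, set_encode A])) ! j)"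
  have inp': "inp = ?inp" by (simp add: inp P)
  let ?X = "sc_stage1 a1 (inp, ws)" let ?ms = "sc_ms ?inp" let ?c1 = "sc_c1 ?inp" let ?c2 = "sc_c2 ?inp"
  let ?r = "of_rat r :: real" let ?e = "of_rat \<epsilon> :: real"
  let ?z = "%A. recourse_of P (s A)"
  have ok: "ok ?ms n" using assms(3)[OF I] by (simp add: ms)
  have X: "set_decode ?X \<subseteq> {..<ns}"
   by (auto simp: inp' sc_stage1_def Let_def set_decode_mask)
  have decA: "set (dec (set_encode A)) = A" if "A \<subseteq> {..<n}" for A
   using that finite_subset[of A "{..<n}"] by simp
  have unc: "distinct (unc ?ms (dec ?X) es) \<and> set (unc ?ms (dec ?X) es) = set es - cov ?ms (set_decode ?X)"
   if "distinct es" for es using that X by (simp add: distinct_unc set_unc)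
  have z: "?z A = set (a2 ?ms ?c2 (unc ?ms (dec ?X) (dec (set_encode A))))" if "A \<subseteq> {..<n}" for A
  proof -
   interpret S2: sc_input I r \<epsilon> \<delta> "?inp @ [?X, 0, set_encode A]" "[?X, 0, set_encode A]" by (rule loc[OF I])
   have "set (a2 ?ms ?c2 (unc ?ms (dec ?X) (dec (set_encode A)))) \<subseteq> {..<ns}"
    using a2[OF ok, of ?c2 "unc ?ms (dec ?X) (dec (set_encode A))"] unc[of "dec (set_encode A)"] decA[OF that] that by auto
   moreover have "fst (s A) 0 = mask (%i. i \<in> set (a2 ?ms ?c2 (unc ?ms (dec ?X) (dec (set_encode A))))) [0..<ns]"
   proof -
    have m: "sc_ms (?inp @ [?X, 0, set_encode A]) = ?ms" unfolding S2.ms ms ..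
    have "sc_stage2 a2 (?inp @ [?X, 0, set_encode A]) =
      (mask (%i. i \<in> set (a2 ?ms ?c2 (unc ?ms (dec ?X) (dec (set_encode A))))) [0..<ns], [])"
     unfolding sc_stage2_def S2.ns S2.extra[OF refl] S2.idx c2_eq[OF I] m ..
    moreover have "A \<subseteq> ground P" using that by (simp add: P flds)
    ultimately show ?thesis using s[of A] unfolding inp' by (metis fst_conv)
   qed
   ultimately show ?thesis by (auto simp: P flds set_decode_mask)
  qed
  have z2: "?z A \<subseteq> {..<ns}" "A \<subseteq> cov ?ms (set_decode ?X \<union> ?z A)" if "A \<subseteq> {..<n}" for A
  proof -
   let ?es = "unc ?ms (dec ?X) (dec (set_encode A))"
   have e: "distinct ?es" "set ?es = A - cov ?ms (set_decode ?X)"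
    using unc[of "dec (set_encode A)"] decA[OF that] by auto
   then have "set ?es \<subseteq> {..<n}" using that by blast
   from a2[OF ok _ e(1) this, of ?c2] have "set (a2 ?ms ?c2 ?es) \<subseteq> {..<ns}" "set ?es \<subseteq> cov ?ms (set (a2 ?ms ?c2 ?es))"
    by simp_all
   then show "?z A \<subseteq> {..<ns}" "A \<subseteq> cov ?ms (set_decode ?X \<union> ?z A)"
    unfolding z[OF that] cov_Un e(2) by blast+
  qed
  have sol: "(set_decode ?X, ?z) \<in> solutions P"
   using X z2 cov_ms[of "set_decode ?X \<union> ?z _"] by (auto simp: solutions_def P flds)
  have sol': "x' \<subseteq> {..<ns} \<and> (\<forall>A\<subseteq>{..<n}. z' A \<subseteq> {..<ns} \<and> A \<subseteq> cov ?ms (x' \<union> z' A))"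
   if "(x', z') \<in> solutions P" for x' z'
  proof -
   have a: "x' \<subseteq> {..<ns}" "\<And>A. A \<subseteq> {..<n} ==> z' A \<subseteq> {..<ns} \<and> A \<subseteq> (\<Union>i\<in>x' \<union> z' A. members I i)"
    using that by (auto simp: solutions_def P flds)
   then have "cov ?ms (x' \<union> z' A) = (\<Union>i\<in>x' \<union> z' A. members I i)" if "A \<subseteq> {..<n}" for A
    using that a(2)[OF that] by (intro cov_ms) auto
   with a show ?thesis by simp
  qed
  have c0: "\<And>a. a \<in> actions P ==> 0 <= cost1 P a" using costs_nonneg by (auto simp: P flds)
  have nn: "\<And>x A z. x \<subseteq> actions P ==> A \<subseteq> ground P ==> feasible P x A z ==> 0 <= recourse_cost P A z"
   using costs_nonneg by (auto simp: P flds intro!: sum_nonneg)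
  have rr: "0 < ?r" "?r <= 1" "0 < ?e" "?e < 1" using v by auto
  have fin: "finite (ground P)" by (simp add: P flds)
  have opt0: "0 <= opt P p ?r" by (rule opt_nonneg[OF fin p _ c0 nn sol]) (use rr in auto)
  have Dp: "0 < real D" using D_pos by simp
  have "\<rho> n * (1 + ?e)\<^sup>2 * opt P p ?r <= \<rho>' P ?e * opt P p ?r"
   unfolding P using rho'[OF I rr(3,4)] opt0 by (intro mult_right_mono) (auto simp: P)
  moreover have "objective P p ?r (set_decode ?X) ?z <= \<rho> n * (1 + ?e)\<^sup>2 * opt P p ?r"
  proof (cases "sc_cheap ?inp")
   case True
   then have X0: "?X = 0" by (simp add: inp' sc_stage1_def Let_def)
   have "objective P p ?r {} ?z <= \<rho> n * opt P p ?r"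
   proof (rule pointwise_reduction[OF fin p])
    show "({}, ?z) \<in> solutions P" using sol X0 by simp
    fix x' z' A assume xz: "(x', z') \<in> solutions P" and "A \<subseteq> ground P"
    then have A: "A \<subseteq> {..<n}" by (simp add: P flds)
    from sol'[OF xz] A have S: "x' \<subseteq> {..<ns}" "z' A \<subseteq> {..<ns}" "A \<subseteq> cov ?ms (x' \<union> z' A)" by auto
    have fS: "finite x'" "finite (z' A)" using S finite_subset by blast+
    let ?es = "unc ?ms (dec ?X) (dec (set_encode A))"
    have "real D * recourse_cost P A (?z A) = real (tot ?c2 (?z A))"
     using tot_c2[OF z2(1)[OF A]] by (simp add: P flds)
    \<comment> \<open>The other solution may postpone its first-stage sets to the second stage,
      since no set gets more expensive here; so it suffices to compare with covers bought in the
      second stage.\<close>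
    also have "\<dots> <= \<rho> n * real (tot ?c2 (x' \<union> z' A))"
     unfolding z[OF A] using unc[of "dec (set_encode A)"] decA[OF A] A S
     by (intro a2_approx[OF ok]) auto
    also have "\<dots> <= \<rho> n * (real (tot ?c1 x') + real (tot ?c2 (z' A)))"
    proof -
     have "tot ?c2 (x' \<union> z' A) <= tot ?c2 x' + tot ?c2 (z' A)" by (rule tot_Un_le[OF fS])
     moreover have "real (tot ?c2 x') <= real (tot ?c1 x')"
      unfolding tot_c1[OF S(1)] tot_c2[OF S(1)] using True S(1)
      by (intro mult_left_mono sum_mono) (auto simp: cheap_iff of_rat_less_eq)
     ultimately show ?thesis using rho[of n] by (intro mult_left_mono) auto
    qed
    also have "\<dots> = real D * (\<rho> n * (sum (cost1 P) x' + recourse_cost P A (z' A)))"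
     unfolding tot_c1[OF S(1)] tot_c2[OF S(2)] by (simp add: P flds algebra_simps)
    finally show "recourse_cost P A (?z A) <= \<rho> n * (sum (cost1 P) x' + recourse_cost P A (z' A))"
     using Dp by (rule mult_left_le_imp_le)
   qed (use rr rho in auto)
   also have "\<dots> <= \<rho> n * (1 + ?e)\<^sup>2 * opt P p ?r"
    using rho[of n] opt0 rr by (intro mult_right_mono) (auto simp: power2_eq_square algebra_simps)
   finally show ?thesis using X0 by simp
  next
   case False
   have N0: "0 < sc_samples inp" using False np(1) by (simp add: inp' sc_samples_def)
   define rn rd where "rn = rnum ?inp (2 + ns) (2 * ns)" and "rd = rden ?inp (2 + ns) (2 * ns)"
   let ?H = "heavy rn rd ws" and ?u = "rest rn rd ws" and ?B = "2 * (length ws * rd)"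
   define x where "x = a1 ?ms ?c1 ?c2 ?B (?H @ [(?u, [0..<n])])"
   have xns: "set x \<subseteq> {..<ns}" using a1[OF ok, of ?c1 ?c2 ?B ?H ?u] by (simp add: x_def)
   have Xx: "set_decode ?X = set x"
    using False xns by (auto simp: inp' sc_stage1_def Let_def set_decode_mask sc_scen_def x_def rn_def rd_def)
   have H: "distinct es \<and> set es \<subseteq> {..<n}" if "(w, es) \<in> set ?H" for w es
   proof -
    from that obtain a where a: "a \<in> set ws" "es = dec a" by (auto simp: heavy_def)
    then obtain A where "A \<subseteq> {..<n}" "a = set_encode A" using ws by (auto simp: P flds)
    with a decA[of A] show ?thesis by simp
   qed
   have ux: "unc ?ms (dec ?X) es = unc ?ms x es" for es using Xx by (intro unc_cong) simp
   have lc: "length ?c1 = length ?ms" "length ?c2 = length ?ms" by simp_all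
   have ex: "\<exists>Cm. (\<forall>es. distinct es --> set es \<subseteq> {..<n} --> real (tot ?c2 (set (a2 ?ms ?c2 (unc ?ms x es)))) <= Cm) \<and>
     (\<forall>x' z'. x' \<subseteq> {..<length ?ms} --> (\<forall>A\<subseteq>{..<n}. z' A \<subseteq> {..<length ?ms} \<and> A \<subseteq> cov ?ms (x' \<union> z' A)) -->
      real ?B * real (tot ?c1 (set x)) +
       2 * ((\<Sum>(w, es)\<leftarrow>?H. real w * real (tot ?c2 (set (a2 ?ms ?c2 (unc ?ms x es))))) + real ?u * Cm)
      <= \<rho> n * (real ?B * real (tot ?c1 x') +
       ((\<Sum>(w, es)\<leftarrow>?H. real w * real (tot ?c2 (z' (set es)))) + real ?u * real (tot ?c2 (z' {..<n})))))"
    by (rule a1_approx[OF ok lc _ x_def]) (rule H)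
   obtain Cm where Cm: "\<And>es. distinct es ==> set es \<subseteq> {..<n} ==> real (tot ?c2 (set (a2 ?ms ?c2 (unc ?ms x es)))) <= Cm"
    "\<And>x' z'. x' \<subseteq> {..<ns} ==> (\<forall>A\<subseteq>{..<n}. z' A \<subseteq> {..<ns} \<and> A \<subseteq> cov ?ms (x' \<union> z' A)) ==>
      real ?B * real (tot ?c1 (set x)) +
       2 * ((\<Sum>(w, es)\<leftarrow>?H. real w * real (tot ?c2 (set (a2 ?ms ?c2 (unc ?ms x es))))) + real ?u * Cm)
      <= \<rho> n * (real ?B * real (tot ?c1 x') +
       ((\<Sum>(w, es)\<leftarrow>?H. real w * real (tot ?c2 (z' (set es)))) + real ?u * real (tot ?c2 (z' {..<n}))))"
    using ex unfolding length_ms by blast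
   have costz: "real D * recourse_cost P A (y A) = real (tot ?c2 (y A))" if "y A \<subseteq> {..<ns}" for y A
    using tot_c2[OF that] by (simp add: P flds)
   have cost1: "real D * sum (cost1 P) y = real (tot ?c1 y)" if "y \<subseteq> {..<ns}" for y
    using tot_c1[OF that] by (simp add: P flds)
   show ?thesis
   proof (rule scenario_reduction[where rn = rn and rd = rd and ws = ws and D = "real D" and Cm = "Cm / real D"])
    show "0 < rd" "?r = real rn / real rd" using radius[OF v(1)] by (auto simp: rn_def rd_def)
    show "ws \<noteq> []" using N0 len by auto
    show "accurate P p (?e * ?r\<^sup>2 / 2) ws" using acc N0 by simp
    show "0 < real D" by (rule Dp)
    show "recourse_cost P A (?z A) <= Cm / real D" if "A \<subseteq> ground P" for A
    proof -
     have A: "A \<subseteq> {..<n}" using that by (simp add: P flds)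
     have "real D * recourse_cost P A (?z A) = real (tot ?c2 (?z A))" using costz[of ?z A] z2[OF A] by simp
     also have "\<dots> <= Cm" unfolding z[OF A] ux using Cm(1)[of "dec (set_encode A)"] decA[OF A] A by simp
     finally show ?thesis using Dp by (simp add: field_simps)
    qed
    fix x' z' assume "(x', z') \<in> solutions P"
    note S = sol'[OF this]
    have sums: "(\<Sum>(w, es)\<leftarrow>?H. real w * (real D * recourse_cost P (set es) (y (set es)))) =
      (\<Sum>(w, es)\<leftarrow>?H. real w * real (tot ?c2 (y (set es))))" if "\<And>A. A \<subseteq> {..<n} ==> y A \<subseteq> {..<ns}" for y
    proof (intro arg_cong[where f = sum_list] map_cong refl, clarify)
     fix w es assume "(w, es) \<in> set ?H"
     then show "real w * (real D * recourse_cost P (set es) (y (set es))) = real w * real (tot ?c2 (y (set es)))"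
      using H that by (subst costz) auto
    qed
    have zH: "(\<Sum>(w, es)\<leftarrow>?H. real w * real (tot ?c2 (?z (set es)))) =
      (\<Sum>(w, es)\<leftarrow>?H. real w * real (tot ?c2 (set (a2 ?ms ?c2 (unc ?ms x es)))))"
    proof (intro arg_cong[where f = sum_list] map_cong refl, clarify)
     fix w es assume wes: "(w, es) \<in> set ?H"
     \<comment> \<open>Heavy scenarios are stored as values of \<open>dec\<close>, so the second
       stage decodes the very same list from the code of the scenario.\<close>
     then have "dec (set_encode (set es)) = es" by (auto simp: heavy_def)
     then show "real w * real (tot ?c2 (?z (set es))) = real w * real (tot ?c2 (set (a2 ?ms ?c2 (unc ?ms x es))))"
      using z[of "set es"] H[OF wes] by (simp add: ux)
    qed
    have gr: "real D * recourse_cost P (ground P) (z' (ground P)) = real (tot ?c2 (z' {..<n}))"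
     using S costz[of z' "{..<n}"] by (simp add: P flds)
    have s1: "(\<Sum>(w, es)\<leftarrow>?H. real w * (real D * recourse_cost P (set es) (?z (set es)))) =
      (\<Sum>(w, es)\<leftarrow>?H. real w * real (tot ?c2 (?z (set es))))" by (rule sums) (rule z2(1))
    have s2: "(\<Sum>(w, es)\<leftarrow>?H. real w * (real D * recourse_cost P (set es) (z' (set es)))) =
      (\<Sum>(w, es)\<leftarrow>?H. real w * real (tot ?c2 (z' (set es))))" by (rule sums) (use S in simp)
    have DC: "real D * (Cm / real D) = Cm" using Dp by simp
    show "real ?B * (real D * sum (cost1 P) (set_decode ?X)) +
     2 * ((\<Sum>(w, es)\<leftarrow>?H. real w * (real D * recourse_cost P (set es) (?z (set es)))) + real ?u * (real D * (Cm / real D)))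
     <= \<rho> n * (real ?B * (real D * sum (cost1 P) x') +
     ((\<Sum>(w, es)\<leftarrow>?H. real w * (real D * recourse_cost P (set es) (z' (set es)))) +
      real ?u * (real D * recourse_cost P (ground P) (z' (ground P)))))"
     unfolding s1 zH s2 gr DC cost1[OF S[THEN conjunct1]] Xx cost1[OF xns]
     by (rule Cm(2)[OF S[THEN conjunct1] S[THEN conjunct2]])
   next
    show "\<exists>y. feasible P x (A \<union> B) y \<and> recourse_cost P (A \<union> B) y <= recourse_cost P A z + recourse_cost P B z'"
     if "feasible P x A z" "feasible P x B z'" for x A B z z'
    proof (intro exI[of _ "z \<union> z'"] conjI)
     have f: "z \<subseteq> {..<ns}" "z' \<subseteq> {..<ns}" using that by (auto simp: P flds)
     show "feasible P x (A \<union> B) (z \<union> z')" using that by (auto simp: P flds)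
     have "(\<Sum>i\<in>z \<union> z'. real_of_rat (scost2 I i)) <= (\<Sum>i\<in>z. of_rat (scost2 I i)) + (\<Sum>i\<in>z'. of_rat (scost2 I i))"
      using f finite_subset[OF f(1)] finite_subset[OF f(2)] costs_nonneg
       sum.union_inter[of z z' "%i. real_of_rat (scost2 I i)"] sum_nonneg[of "z \<inter> z'" "%i. real_of_rat (scost2 I i)"] by force
     then show "recourse_cost P (A \<union> B) (z \<union> z') <= recourse_cost P A z + recourse_cost P B z'" by (simp add: P flds)
    qed
    show "feasible P x A z \<and> recourse_cost P A z <= recourse_cost P (ground P) z"
     if "A \<subseteq> ground P" "feasible P x (ground P) z" for x A z using that by (auto simp: P flds)
   qed (use fin p rr c0 nn ws sol rho in auto)
  qed
  ultimately show "(set_decode ?X, ?z) \<in> solutions P \<and>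
   objective P p ?r (set_decode ?X) ?z <= \<rho>' P ?e * opt P p ?r" using sol by linarith
 qed
qed

section \<open>Edge cover\<close>

definition sets_of :: "nat list list => nat => nat list" where
 "sets_of ms e = filter (%i. e \<in> set (nthd [] ms i)) [0..<length ms]"

lemma pt_sets_of [pt_intros]: "pt a ==> pt b ==> pt (%x. sets_of (a x) (b x))"
 by (rule pt_lift2) (unfold sets_of_def, intro pt_intros)

lemma set_sets_of: "set (sets_of ms e) = {i. i < length ms \<and> e \<in> set (ms ! i)}"
 by (auto simp: sets_of_def nthd_def)

definition cheapest :: "nat list list => nat list => nat => nat" where
 "cheapest ms c e = best (%i j. nthd 0 c i < nthd 0 c j) 0 (sets_of ms e)"

lemma pt_cheapest [pt_intros]: "pt a ==> pt b ==> pt c ==> pt (%x. cheapest (a x) (b x) (c x))"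
 by (rule pt_lift3) (unfold cheapest_def, intro pt_intros)

lemma cheapest_in:
 assumes "i < length ms" "e \<in> set (ms ! i)" "length c = length ms"
 shows "cheapest ms c e < length ms" "e \<in> set (ms ! cheapest ms c e)" "c ! cheapest ms c e <= c ! i"
proof -
 have i: "i \<in> set (sets_of ms e)" using assms by (simp add: set_sets_of)
 then have "cheapest ms c e \<in> set (sets_of ms e)"
  unfolding cheapest_def by (intro best_in) auto
 then show *: "cheapest ms c e < length ms" "e \<in> set (ms ! cheapest ms c e)" by (auto simp: set_sets_of)
 show "c ! cheapest ms c e <= c ! i"
  using best_key_min[OF i, of "nthd 0 c" 0] * assms by (simp add: cheapest_def nthd_def)
qed

definition weight_of :: "(nat \<times> nat list) list => nat => nat" where
 "weight_of scs e = sum_list (map fst (filter (%p. e \<in> set (snd p)) scs))"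

text \<open>Each element decides on its own: it is bought in the first stage if its weighted
  first-stage price is below its price in the second stage, summed over the scenarios that contain
  it. Ignoring that an edge serves two vertices loses a factor 2.\<close>

definition ec1 :: cover1 where
 "ec1 ms c1 c2 B scs = map (cheapest ms c1) (filter (%e.
   B * nthd 0 c1 (cheapest ms c1 e) < weight_of scs e * nthd 0 c2 (cheapest ms c2 e)) (dedup (concat ms)))"

definition ec2 :: cover2 where
 "ec2 ms c2 es = map (cheapest ms c2) es"

lemma pt_weight_of [pt_intros]: "pt a ==> pt b ==> pt (%x. weight_of (a x) (b x))"
 by (rule pt_lift2) (unfold weight_of_def, intro pt_intros)

definition covers_univ :: "nat list list => nat => bool" where
 "covers_univ ms n \<longleftrightarrow> (\<Union>i<length ms. set (ms ! i)) = {..<n}"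

lemma covers_univE:
 assumes "covers_univ ms n" "e < n"
 obtains i where "i < length ms" "e \<in> set (ms ! i)"
proof -
 from assms have "e \<in> (\<Union>i<length ms. set (ms ! i))" by (simp add: covers_univ_def)
 then show ?thesis using that by blast
qed

lemma set_concat_univ: "covers_univ ms n ==> set (concat ms) = {..<n}"
proof -
 have "set ms = (!) ms ` {..<length ms}" by (auto simp: set_conv_nth)
 then show "covers_univ ms n ==> set (concat ms) = {..<n}" by (simp add: covers_univ_def)
qed

lemma scenario_sum: "(\<Sum>(w, es)\<leftarrow>scs. w * (f es :: 'a::comm_semiring_1)) = (\<Sum>k<length scs. fst (scs ! k) * f (snd (scs ! k)))"
 by (simp add: sum_list_sum_nth case_prod_beta lessThan_atLeast0)

lemma scenario_sum_real: "(\<Sum>(w, es)\<leftarrow>scs. real w * real (f es)) = real (\<Sum>(w, es)\<leftarrow>scs. w * f es)"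
 by (induction scs) auto

lemma double_bound: "a + (s' + m) <= 2 * L ==> s <= s' ==> 0 <= a ==> a + 2 * (s + m) <= 4 * (L :: real)"
 by simp

lemma tot_image_le: "finite E ==> tot c (g ` E) <= (\<Sum>e\<in>E. c ! g e)"
 unfolding tot_def using sum_image_le[of E "(!) c" g] by simp

text \<open>Double counting: if every element pays for all sets of \<open>S\<close> containing it, a
  set is paid for at most \<open>k\<close> times.\<close>

lemma sum_charges:
 assumes "finite E" "finite S" "\<And>i. i \<in> S ==> card (set (ms ! i)) <= k"
 shows "(\<Sum>e\<in>E. \<Sum>i | i \<in> S \<and> e \<in> set (ms ! i). c ! i) <= k * tot c S"
proof -
 have "(\<Sum>e\<in>E. \<Sum>i | i \<in> S \<and> e \<in> set (ms ! i). c ! i) = (\<Sum>i\<in>S. \<Sum>e | e \<in> E \<and> e \<in> set (ms ! i). c ! i)"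
  using assms by (intro sum.swap_restrict) auto
 also have "\<dots> <= (\<Sum>i\<in>S. k * c ! i)"
 proof (rule sum_mono)
  fix i assume "i \<in> S"
  have "card {e \<in> E. e \<in> set (ms ! i)} <= card (set (ms ! i))" by (rule card_mono) auto
  also have "\<dots> <= k" using assms \<open>i \<in> S\<close> by simp
  finally show "(\<Sum>e | e \<in> E \<and> e \<in> set (ms ! i). c ! i) <= k * c ! i" by simp
 qed
 finally show ?thesis by (simp add: tot_def sum_distrib_left)
qed

lemma cheapest_le_charge:
 assumes "e \<in> cov ms S" "S \<subseteq> {..<length ms}" "length c = length ms"
 shows "c ! cheapest ms c e <= (\<Sum>i | i \<in> S \<and> e \<in> set (ms ! i). c ! i)"
proof -
 obtain i where i: "i \<in> S" "e \<in> set (ms ! i)" using assms(1) by (auto simp: cov_def)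
 have "c ! cheapest ms c e <= c ! i" using i assms by (intro cheapest_in) auto
 also have "\<dots> <= (\<Sum>i | i \<in> S \<and> e \<in> set (ms ! i). c ! i)"
  using i finite_subset[OF assms(2)] by (intro member_le_sum) auto
 finally show ?thesis .
qed

lemma ec2_cost_le:
 assumes "distinct es" "set es \<subseteq> E" "finite E"
 shows "tot c2 (set (ec2 ms c2 es)) <= (\<Sum>e\<in>E. c2 ! cheapest ms c2 e)"
proof -
 have "tot c2 (set (ec2 ms c2 es)) <= (\<Sum>e\<in>set es. c2 ! cheapest ms c2 e)"
  unfolding ec2_def set_map by (rule tot_image_le) simp
 also have "\<dots> <= (\<Sum>e\<in>E. c2 ! cheapest ms c2 e)" using assms by (intro sum_mono2) auto
 finally show ?thesis .
qed

definition ok_ec :: "nat list list => nat => bool" where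
 "ok_ec ms n \<longleftrightarrow> covers_univ ms n \<and> (\<forall>i<length ms. card (set (ms ! i)) <= 2)"

lemma ec1_subset:
 assumes "covers_univ ms n" "length c1 = length ms"
 shows "set (ec1 ms c1 c2 B scs) \<subseteq> {..<length ms}"
proof -
 have "cheapest ms c1 e < length ms" if "e \<in> {..<n}" for e
 proof -
  have "e < n" using that by simp
  then obtain i where "i < length ms" "e \<in> set (ms ! i)" by (rule covers_univE[OF assms(1)])
  then show ?thesis using cheapest_in(1) assms(2) by blast
 qed
 then show ?thesis unfolding ec1_def set_map set_filter set_dedup set_concat_univ[OF assms(1)] by blast
qed

text \<open>Every element accounts for the minimum of \<open>B * ?m1 e\<close> and
  \<open>?W e * ?m2 e\<close>. Any solution covers it in the first stage or in all scenarios that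
  contain it, and so spends at least this on it; each set is charged by at most two elements. The
  second stage is measured by a sum over elements, which is an upper bound for \<open>ec2\<close>
  and monotone in the scenario.\<close>

lemma ec1_approx:
 assumes ok: "ok_ec ms n" and len: "length c1 = length ms" "length c2 = length ms"
  and H: "\<And>w es. (w, es) \<in> set scs ==> distinct es \<and> set es \<subseteq> {..<n}"
  and x: "x = ec1 ms c1 c2 B scs" and x': "x' \<subseteq> {..<length ms}"
  and z': "\<And>A. A \<subseteq> {..<n} ==> z' A \<subseteq> {..<length ms} \<and> A \<subseteq> cov ms (x' \<union> z' A)"
 shows "B * tot c1 (set x) + (\<Sum>(w, es)\<leftarrow>scs. w * (\<Sum>e\<in>set es - cov ms (set x). c2 ! cheapest ms c2 e))
  <= 2 * (B * tot c1 x' + (\<Sum>(w, es)\<leftarrow>scs. w * tot c2 (z' (set es))))"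
proof -
 let ?m1 = "%e. c1 ! cheapest ms c1 e" and ?m2 = "%e. c2 ! cheapest ms c2 e" and ?W = "weight_of scs"
 let ?K = "length scs" let ?w = "%k. fst (scs ! k)" and ?es = "%k. set (snd (scs ! k))"
 have cu: "covers_univ ms n" and c2: "\<And>i. i < length ms ==> card (set (ms ! i)) <= 2" using ok by (auto simp: ok_ec_def)
 have nth: "nthd 0 c1 (cheapest ms c1 e) = ?m1 e \<and> nthd 0 c2 (cheapest ms c2 e) = ?m2 e \<and>
   cheapest ms c1 e < length ms \<and> e \<in> set (ms ! cheapest ms c1 e)" if "e < n" for e
  using covers_univE[OF cu that] cheapest_in len by (metis nthd_def)
 define X where "X = {e. e < n \<and> B * ?m1 e < ?W e * ?m2 e}"
 have sx: "set x = cheapest ms c1 ` X"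
  unfolding x ec1_def set_map set_filter set_dedup set_concat_univ[OF cu] X_def using nth by (intro image_cong) auto
 have Xc: "X \<subseteq> cov ms (set x)" using nth by (auto simp: sx cov_def X_def)
 have esn: "?es k \<subseteq> {..<n}" if "k < ?K" for k using H[of "?w k" "snd (scs ! k)"] that by (simp add: nth_mem)
 have W: "?W e * y = (\<Sum>k | k < ?K \<and> e \<in> ?es k. ?w k * y)" for e y
 proof -
  have "?W e = (\<Sum>p\<leftarrow>scs. if e \<in> set (snd p) then fst p else 0)" unfolding weight_of_def by (induction scs) auto
  also have "\<dots> = (\<Sum>k<?K. if e \<in> ?es k then ?w k else 0)" by (simp add: sum_list_sum_nth lessThan_atLeast0)
  also have "\<dots> = (\<Sum>k | k < ?K \<and> e \<in> ?es k. ?w k)"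
   by (simp add: sum.inter_filter[symmetric] lessThan_def)
  finally show ?thesis by (simp add: sum_distrib_right)
 qed
 have swap: "(\<Sum>k<?K. ?w k * (\<Sum>e\<in>?es k \<inter> Y. F k e)) = (\<Sum>e\<in>Y. \<Sum>k | k < ?K \<and> e \<in> ?es k. ?w k * F k e)"
  if "finite Y" for Y and F :: "nat => nat => nat"
 proof -
  have "(\<Sum>k<?K. ?w k * (\<Sum>e\<in>?es k \<inter> Y. F k e)) = (\<Sum>k<?K. \<Sum>e | e \<in> Y \<and> e \<in> ?es k. ?w k * F k e)"
   by (intro sum.cong refl) (auto simp: sum_distrib_left intro!: sum.cong)
  also have "\<dots> = (\<Sum>e\<in>Y. \<Sum>k | k \<in> {..<?K} \<and> e \<in> ?es k. ?w k * F k e)"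
   using that by (intro sum.swap_restrict) auto
  finally show ?thesis by simp
 qed
 let ?C = "cov ms (set x)"
 have "B * tot c1 (set x) <= (\<Sum>e\<in>X. B * ?m1 e)"
  unfolding sx sum_distrib_left[symmetric] by (intro mult_left_mono tot_image_le) (auto simp: X_def)
 also have "\<dots> <= (\<Sum>e\<in>X. min (B * ?m1 e) (?W e * ?m2 e))" by (intro sum_mono) (auto simp: X_def)
 finally have 1: "B * tot c1 (set x) <= (\<Sum>e\<in>X. min (B * ?m1 e) (?W e * ?m2 e))" .
 have "(\<Sum>(w, es)\<leftarrow>scs. w * (\<Sum>e\<in>set es - ?C. ?m2 e)) = (\<Sum>k<?K. ?w k * (\<Sum>e\<in>?es k \<inter> ({..<n} - ?C). ?m2 e))"
  unfolding scenario_sum using esn by (intro sum.cong refl arg_cong2[where f = "(*)"]) (auto simp: of_nat_id)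
 also have "\<dots> = (\<Sum>e\<in>{..<n} - ?C. ?W e * ?m2 e)" unfolding W by (rule swap) simp
 also have "\<dots> <= (\<Sum>e\<in>{..<n} - ?C. min (B * ?m1 e) (?W e * ?m2 e))"
  using Xc by (intro sum_mono) (auto simp: X_def not_less)
 finally have 2: "(\<Sum>(w, es)\<leftarrow>scs. w * (\<Sum>e\<in>set es - ?C. ?m2 e)) <= (\<Sum>e\<in>{..<n} - ?C. min (B * ?m1 e) (?W e * ?m2 e))" .
 \<comment> \<open>The elements of \<open>X\<close> are covered by \<open>x\<close>, so the elements
   paying in the first stage and those left to the second stage are disjoint, and no minimum is
   counted twice.\<close>
 have "(\<Sum>e\<in>X. min (B * ?m1 e) (?W e * ?m2 e)) + (\<Sum>e\<in>{..<n} - ?C. min (B * ?m1 e) (?W e * ?m2 e))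
   = (\<Sum>e\<in>X \<union> ({..<n} - ?C). min (B * ?m1 e) (?W e * ?m2 e))"
  using Xc by (intro sum.union_disjoint[symmetric]) (auto simp: X_def)
 also have "\<dots> <= (\<Sum>e<n. min (B * ?m1 e) (?W e * ?m2 e))" by (intro sum_mono2) (auto simp: X_def)
 also have "\<dots> <= (\<Sum>e<n. B * (\<Sum>i | i \<in> x' \<and> e \<in> set (ms ! i). c1 ! i) +
   (\<Sum>k | k < ?K \<and> e \<in> ?es k. ?w k * (\<Sum>i | i \<in> z' (?es k) \<and> e \<in> set (ms ! i). c2 ! i)))"
 proof (rule sum_mono)
  fix e assume "e \<in> {..<n}"
  show "min (B * ?m1 e) (?W e * ?m2 e) <= B * (\<Sum>i | i \<in> x' \<and> e \<in> set (ms ! i). c1 ! i) +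
   (\<Sum>k | k < ?K \<and> e \<in> ?es k. ?w k * (\<Sum>i | i \<in> z' (?es k) \<and> e \<in> set (ms ! i). c2 ! i))"
  proof (cases "e \<in> cov ms x'")
   case True
   have "min (B * ?m1 e) (?W e * ?m2 e) <= B * ?m1 e" by simp
   also have "\<dots> <= B * (\<Sum>i | i \<in> x' \<and> e \<in> set (ms ! i). c1 ! i)"
    by (intro mult_left_mono cheapest_le_charge[OF True x' len(1)]) auto
   finally show ?thesis by simp
  next
   case False
   have "min (B * ?m1 e) (?W e * ?m2 e) <= (\<Sum>k | k < ?K \<and> e \<in> ?es k. ?w k * ?m2 e)" unfolding W[symmetric] by simp
   also have "\<dots> <= (\<Sum>k | k < ?K \<and> e \<in> ?es k. ?w k * (\<Sum>i | i \<in> z' (?es k) \<and> e \<in> set (ms ! i). c2 ! i))"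
   proof (intro sum_mono mult_left_mono)
    fix k assume "k \<in> {k. k < ?K \<and> e \<in> ?es k}"
    then have "e \<in> cov ms (z' (?es k))" "z' (?es k) \<subseteq> {..<length ms}" using z'[OF esn, of k] False by (auto simp: cov_Un)
    then show "?m2 e <= (\<Sum>i | i \<in> z' (?es k) \<and> e \<in> set (ms ! i). c2 ! i)" by (rule cheapest_le_charge[OF _ _ len(2)])
   qed simp
   finally show ?thesis by simp
  qed
 qed
 also have "\<dots> = B * (\<Sum>e<n. \<Sum>i | i \<in> x' \<and> e \<in> set (ms ! i). c1 ! i) +
   (\<Sum>k<?K. ?w k * (\<Sum>e\<in>?es k \<inter> {..<n}. \<Sum>i | i \<in> z' (?es k) \<and> e \<in> set (ms ! i). c2 ! i))"
  by (simp only: sum.distrib sum_distrib_left[symmetric] swap finite_lessThan)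
 also have "\<dots> <= B * (2 * tot c1 x') + (\<Sum>k<?K. ?w k * (2 * tot c2 (z' (?es k))))"
 proof (intro add_mono mult_left_mono sum_mono)
  show "(\<Sum>e<n. \<Sum>i | i \<in> x' \<and> e \<in> set (ms ! i). c1 ! i) <= 2 * tot c1 x'"
   using x' c2 finite_subset[OF x'] by (intro sum_charges) auto
  fix k assume "k \<in> {..<?K}"
  then have "z' (?es k) \<subseteq> {..<length ms}" using z'[OF esn, of k] by auto
  then show "(\<Sum>e\<in>?es k \<inter> {..<n}. \<Sum>i | i \<in> z' (?es k) \<and> e \<in> set (ms ! i). c2 ! i) <= 2 * tot c2 (z' (?es k))"
   using c2 finite_subset[of "z' (?es k)" "{..<length ms}"] by (intro sum_charges) auto
 qed auto
 also have "\<dots> = 2 * (B * tot c1 x' + (\<Sum>(w, es)\<leftarrow>scs. w * tot c2 (z' (set es))))"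
  unfolding scenario_sum by (simp add: sum_distrib_left of_nat_id mult_ac)
 finally show ?thesis using 1 2 by linarith
qed

theorem edge_cover_approx: "has_approx_algorithm edge_cover_problems (%P \<epsilon>. 6 + 24 * \<epsilon>)"
proof -
 let ?\<I> = "{edge_cover_inst n es f g | n es f g. simple_graph n es \<and> \<Union>(set es) = {..<n} \<and> valid_costs {..<length es} f g}"
 have "has_approx_algorithm (set_cover_problem ` ?\<I>) (%P \<epsilon>. 6 + 24 * \<epsilon>)"
 proof (rule set_cover_approx[where ?a1.0 = ec1 and ?a2.0 = ec2 and ok = ok_ec and \<rho> = "%_. 4"])
  show "pt (%p. ec1 (fst p) (fst (snd p)) (fst (snd (snd p))) (fst (snd (snd (snd p)))) (snd (snd (snd (snd p)))))"
   unfolding ec1_def by (intro pt_intros)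
  show "pt (%p. ec2 (fst p) (fst (snd p)) (snd (snd p)))"
   unfolding ec2_def by (intro pt_intros)
  fix I assume "I \<in> ?\<I>"
  then obtain n es f g where I: "I = edge_cover_inst n es f g" and g: "simple_graph n es" "\<Union>(set es) = {..<n}"
   "valid_costs {..<length es} f g" by auto
  have u: "(\<Union>i<length es. es ! i) = {..<n}" using g(2) by (auto simp: set_conv_nth)
  have fin: "finite (es ! i) \<and> card (es ! i) = 2" if "i < length es" for i
   using g(1) that by (auto simp: simple_graph_def intro: card_ge_0_finite)
  let ?ms = "map (%i. dec (set_encode (es ! i))) [0..<length es]"
  have s: "set (?ms ! i) = es ! i" if "i < length es" for i using fin[OF that] that by simp
  have "(\<Union>i<length ?ms. set (?ms ! i)) = (\<Union>i<length es. es ! i)" using s by (intro SUP_cong) auto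
  then have "ok_ec ?ms n" using u s fin by (auto simp: ok_ec_def covers_univ_def)
  then show "(\<Union>i<nsets I. members I i) = {..<nelems I} \<and> valid_costs {..<nsets I} (scost1 I) (scost2 I) \<and>
    ok_ec (map (%i. dec (set_encode (members I i))) [0..<nsets I]) (nelems I)"
   using u g(3) by (simp add: I edge_cover_inst_def)
 next
  fix \<epsilon> :: real assume "0 < \<epsilon>" "\<epsilon> < 1"
  then have "\<epsilon> * \<epsilon> <= 1 * \<epsilon>" by (intro mult_right_mono) auto
  moreover have "4 * (1 + \<epsilon>)\<^sup>2 = 4 + 8 * \<epsilon> + 4 * (\<epsilon> * \<epsilon>)" by (simp add: power2_eq_square algebra_simps)
  ultimately show "4 * (1 + \<epsilon>)\<^sup>2 <= 6 + 24 * \<epsilon>" using \<open>0 < \<epsilon>\<close> by linarith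
 next
  fix ms n and c2 es :: "nat list" assume ok: "ok_ec ms n" and len: "length c2 = length ms" and es: "distinct es" "set es \<subseteq> {..<n}"
  have cu: "covers_univ ms n" using ok by (simp add: ok_ec_def)
  have "cheapest ms c2 e < length ms \<and> e \<in> set (ms ! cheapest ms c2 e)" if "e \<in> set es" for e
   using that es(2) covers_univE[OF cu, of e] cheapest_in(1,2)[of _ ms e c2] len by blast
  then show "set (ec2 ms c2 es) \<subseteq> {..<length ms} \<and> set es \<subseteq> cov ms (set (ec2 ms c2 es))"
   by (auto simp: ec2_def cov_def)
  fix S assume S: "S \<subseteq> {..<length ms}" "set es \<subseteq> cov ms S"
  have "tot c2 (set (ec2 ms c2 es)) <= (\<Sum>e\<in>set es. c2 ! cheapest ms c2 e)" using es by (intro ec2_cost_le) auto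
  also have "\<dots> <= (\<Sum>e\<in>set es. \<Sum>i | i \<in> S \<and> e \<in> set (ms ! i). c2 ! i)"
   using S len by (intro sum_mono cheapest_le_charge) auto
  also have "\<dots> <= 2 * tot c2 S" using S ok finite_subset[OF S(1)] by (intro sum_charges) (auto simp: ok_ec_def)
  finally show "real (tot c2 (set (ec2 ms c2 es))) <= 4 * real (tot c2 S)" by simp
 next
  fix ms n B u and c1 c2 :: "nat list" and H :: "(nat \<times> nat list) list" assume ok: "ok_ec ms n" and len: "length c1 = length ms" "length c2 = length ms"
  have cu: "covers_univ ms n" using ok by (simp add: ok_ec_def)
  from ec1_subset[OF cu len(1)] show "set (ec1 ms c1 c2 B (H @ [(u, [0..<n])])) \<subseteq> {..<length ms}" .
 next
  fix ms n B u x and c1 c2 :: "nat list" and H :: "(nat \<times> nat list) list" assume ok: "ok_ec ms n" and len: "length c1 = length ms" "length c2 = length ms"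
   and H: "\<And>w es. (w, es) \<in> set H ==> distinct es \<and> set es \<subseteq> {..<n}" and x: "x = ec1 ms c1 c2 B (H @ [(u, [0..<n])])"
  have cu: "covers_univ ms n" using ok by (simp add: ok_ec_def)
  have xs: "set x \<subseteq> {..<length ms}"
   unfolding x by (rule ec1_subset[OF cu len(1)])
  let ?M = "%es. \<Sum>e\<in>set es - cov ms (set x). c2 ! cheapest ms c2 e"
  have M: "tot c2 (set (ec2 ms c2 (unc ms x es))) <= ?M es'" if "distinct es" "set es \<subseteq> set es'" for es es'
   using that set_unc[OF xs, of es] distinct_unc[OF that(1)] by (intro ec2_cost_le) auto
  have cm: "real (tot c2 (set (ec2 ms c2 (unc ms x es)))) <= real (?M [0..<n])" if "distinct es" "set es \<subseteq> {..<n}" for es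
   unfolding of_nat_le_iff by (rule M[OF that(1)]) (use that(2) in auto)
  show "\<exists>Cm. (\<forall>es. distinct es --> set es \<subseteq> {..<n} --> real (tot c2 (set (ec2 ms c2 (unc ms x es)))) <= Cm) \<and>
     (\<forall>x' z'. x' \<subseteq> {..<length ms} --> (\<forall>A\<subseteq>{..<n}. z' A \<subseteq> {..<length ms} \<and> A \<subseteq> cov ms (x' \<union> z' A)) -->
      real B * real (tot c1 (set x)) +
       2 * ((\<Sum>(w, es)\<leftarrow>H. real w * real (tot c2 (set (ec2 ms c2 (unc ms x es))))) + real u * Cm)
      <= 4 * (real B * real (tot c1 x') +
       ((\<Sum>(w, es)\<leftarrow>H. real w * real (tot c2 (z' (set es)))) + real u * real (tot c2 (z' {..<n})))))"
  \<comment> \<open>Costs per element only grow with the scenario, so the value of the full scenario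
    bounds all recourse costs.\<close>
  proof (intro exI[of _ "real (?M [0..<n])"] conjI allI impI cm)
   fix x' z' assume x': "x' \<subseteq> {..<length ms}" and z': "\<forall>A\<subseteq>{..<n}. z' A \<subseteq> {..<length ms} \<and> A \<subseteq> cov ms (x' \<union> z' A)"
   have "B * tot c1 (set x) + (\<Sum>(w, es)\<leftarrow>H @ [(u, [0..<n])]. w * ?M es)
    <= 2 * (B * tot c1 x' + (\<Sum>(w, es)\<leftarrow>H @ [(u, [0..<n])]. w * tot c2 (z' (set es))))"
    by (rule ec1_approx[OF ok len _ x x']) (use H z' in auto)
   then have "B * tot c1 (set x) + ((\<Sum>(w, es)\<leftarrow>H. w * ?M es) + u * ?M [0..<n])
    <= 2 * (B * tot c1 x' + ((\<Sum>(w, es)\<leftarrow>H. w * tot c2 (z' (set es))) + u * tot c2 (z' {..<n})))"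
    by (simp add: atLeast0LessThan)
   then have "real (B * tot c1 (set x) + ((\<Sum>(w, es)\<leftarrow>H. w * ?M es) + u * ?M [0..<n]))
    <= real (2 * (B * tot c1 x' + ((\<Sum>(w, es)\<leftarrow>H. w * tot c2 (z' (set es))) + u * tot c2 (z' {..<n}))))"
    by (simp only: of_nat_le_iff)
   then have le: "real B * real (tot c1 (set x)) + ((\<Sum>(w, es)\<leftarrow>H. real w * real (?M es)) + real u * real (?M [0..<n]))
    <= 2 * (real B * real (tot c1 x') + ((\<Sum>(w, es)\<leftarrow>H. real w * real (tot c2 (z' (set es)))) + real u * real (tot c2 (z' {..<n}))))"
    by (simp only: of_nat_add of_nat_mult of_nat_numeral scenario_sum_real)
   have "(\<Sum>(w, es)\<leftarrow>H. real w * real (tot c2 (set (ec2 ms c2 (unc ms x es))))) <= (\<Sum>(w, es)\<leftarrow>H. real w * real (?M es))"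
   proof (rule sum_list_mono, clarify)
    fix w es assume "(w, es) \<in> set H"
    then have "tot c2 (set (ec2 ms c2 (unc ms x es))) <= ?M es" using H by (intro M) auto
    then show "real w * real (tot c2 (set (ec2 ms c2 (unc ms x es)))) <= real w * real (?M es)"
     by (intro mult_left_mono) (simp_all only: of_nat_le_iff of_nat_0_le_iff)
   qed
   moreover have "0 <= real B * real (tot c1 (set x))" by simp
   ultimately show "real B * real (tot c1 (set x)) +
       2 * ((\<Sum>(w, es)\<leftarrow>H. real w * real (tot c2 (set (ec2 ms c2 (unc ms x es))))) + real u * real (?M [0..<n]))
      <= 4 * (real B * real (tot c1 x') +
       ((\<Sum>(w, es)\<leftarrow>H. real w * real (tot c2 (z' (set es)))) + real u * real (tot c2 (z' {..<n}))))"
    using double_bound[OF le] by blast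
  qed
 qed auto
 moreover have "edge_cover_problems = set_cover_problem ` ?\<I>" unfolding edge_cover_problems_def by blast
 ultimately show ?thesis by simp
qed

section \<open>Vertex cover\<close>

text \<open>One local-ratio step: the least residual cost among the slots that serve the current
  element is subtracted from all of them. A slot is a set together with a stage, 0 for the first
  stage and \<open>Suc k\<close> for scenario \<open>k\<close>.\<close>

definition lr_step :: "(nat \<times> nat) list => ((nat \<times> nat) \<times> nat) list => ((nat \<times> nat) \<times> nat) list" where
 "lr_step el st = map (%p. if fst p \<in> set el
   then (fst p, snd p - best (%a b. a < b) 0 (map snd (filter (%q. fst q \<in> set el) st))) else p) st"

definition lr :: "(nat \<times> nat) list list => ((nat \<times> nat) \<times> nat) list => ((nat \<times> nat) \<times> nat) list" where
 "lr els st = fold lr_step els st"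

lemma pt_lr_step [pt_intros]: "pt a ==> pt b ==> pt (%x. lr_step (a x) (b x))"
 by (rule pt_lift2) (unfold lr_step_def, intro pt_intros)

lemma sz_lr_step: "sz (lr_step el st) <= sz st"
proof -
 have *: "sz (map f xs) <= sz xs" if "\<And>p. sz (f p) <= sz p" for f :: "(nat \<times> nat) \<times> nat => (nat \<times> nat) \<times> nat" and xs
  by (induction xs) (auto intro: add_mono that)
 show ?thesis unfolding lr_step_def by (rule *) (auto simp: sz_prod_def intro: sz_nat_mono)
qed

lemma pt_lr [pt_intros]:
 assumes "pt a" "pt b"
 shows "pt (%x. lr (a x) (b x))"
 unfolding lr_def
proof (rule pt_fold[where h = "%x. lr_step"])
 show "pbd (%x. sz (b x))" by (rule pt_sz[OF assms(2)])
 have "sz (fold lr_step els st) <= sz st" for els st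
 proof (induction els arbitrary: st)
  case (Cons el els)
  show ?case using order_trans[OF Cons sz_lr_step] by simp
 qed simp
 then show "sz (fold lr_step (take n (a x)) (b x)) <= sz (b x)" for x n .
qed (intro pt_intros assms)+

text \<open>\<open>y p\<close> is the amount subtracted when \<open>p\<close> is processed, a dual
  solution: a residual and the duals charged to the slot add up to its cost. Each processed element
  has a slot of residual 0, because the subtracted minimum is attained and residuals never grow
  again.\<close>

lemma lr_dual:
 assumes "distinct ps"
 shows "\<exists>G y. lr (map f ps) (map (%s. (s, g s)) ids) = map (%s. (s, G s)) ids \<and>
  (\<forall>s\<in>set ids. G s + (\<Sum>p | p \<in> set ps \<and> s \<in> set (f p). y p) = (g s :: nat)) \<and>
  (\<forall>p\<in>set ps. (\<exists>s\<in>set (f p). s \<in> set ids) --> (\<exists>s\<in>set (f p). s \<in> set ids \<and> G s = 0))"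
 using assms
proof (induction ps rule: rev_induct)
 case Nil
 show ?case by (intro exI[of _ g] exI[of _ "%_. 0"]) (simp add: lr_def)
next
 case (snoc q ps)
 have "distinct ps" using snoc.prems by simp
 from snoc.IH[OF this] obtain G y where IH: "lr (map f ps) (map (%s. (s, g s)) ids) = map (%s. (s, G s)) ids"
  "\<And>s. s \<in> set ids ==> G s + (\<Sum>p | p \<in> set ps \<and> s \<in> set (f p). y p) = g s"
  "\<And>p. p \<in> set ps ==> (\<exists>s\<in>set (f p). s \<in> set ids) ==> (\<exists>s\<in>set (f p). s \<in> set ids \<and> G s = 0)"
  by blast
 have q: "q \<notin> set ps" using snoc.prems by simp
 define L where "L = map G (filter (%s. s \<in> set (f q)) ids)"
 define d where "d = best (%a b. a < b) 0 L"
 define G' where "G' s = (if s \<in> set (f q) then G s - d else G s)" for s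
 have d: "d <= G s" if "s \<in> set ids" "s \<in> set (f q)" for s
  unfolding d_def using best_key_min[of "G s" L "%a. a" 0] that by (simp add: L_def)
 have "lr (map f (ps @ [q])) (map (%s. (s, g s)) ids) = lr_step (f q) (map (%s. (s, G s)) ids)"
  using IH(1) by (simp add: lr_def)
 also have "\<dots> = map (%s. (s, G' s)) ids"
  by (auto simp: lr_step_def G'_def d_def L_def filter_map o_def cong: filter_cong)
 finally have 1: "lr (map f (ps @ [q])) (map (%s. (s, g s)) ids) = map (%s. (s, G' s)) ids" .
 have 2: "G' s + (\<Sum>p | p \<in> set (ps @ [q]) \<and> s \<in> set (f p). (y(q := d)) p) = g s" if s: "s \<in> set ids" for s
 proof -
  have e: "(\<Sum>p | p \<in> set ps \<and> s \<in> set (f p). (y(q := d)) p) = (\<Sum>p | p \<in> set ps \<and> s \<in> set (f p). y p)"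
   using q by (intro sum.cong) auto
  show ?thesis
  proof (cases "s \<in> set (f q)")
   case True
   then have "{p. p \<in> set (ps @ [q]) \<and> s \<in> set (f p)} = insert q {p. p \<in> set ps \<and> s \<in> set (f p)}" by auto
   then show ?thesis using q e IH(2)[OF s] d[OF s True] True by (simp add: G'_def)
  next
   case False
   then have "{p. p \<in> set (ps @ [q]) \<and> s \<in> set (f p)} = {p. p \<in> set ps \<and> s \<in> set (f p)}" by auto
   then show ?thesis using e IH(2)[OF s] False by (simp add: G'_def)
  qed
 qed
 have 3: "\<exists>s\<in>set (f p). s \<in> set ids \<and> G' s = 0" if p: "p \<in> set (ps @ [q])" "\<exists>s\<in>set (f p). s \<in> set ids" for p
 proof (cases "p = q")
  case True
  then have "L \<noteq> []" using p(2) by (auto simp: L_def filter_empty_conv)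
  then have "d \<in> set L" unfolding d_def by (rule best_in)
  then obtain s where "s \<in> set ids" "s \<in> set (f q)" "G s = d" by (auto simp: L_def)
  then show ?thesis using True by (auto simp: G'_def)
 next
  case False
  then obtain s where "s \<in> set (f p)" "s \<in> set ids" "G s = 0" using IH(3)[of p] p by auto
  then show ?thesis by (auto simp: G'_def)
 qed
 show ?case using 1 2 3 by (intro exI[of _ G'] exI[of _ "y(q := d)"]) blast
qed

definition vc2 :: cover2 where
 "vc2 ms c2 es = map (%p. fst (fst p)) (filter (%p. snd p = 0)
   (lr (map (%e. map (%i. (i, 0)) (sets_of ms e)) es)
    (map (%s. (s, nthd 0 c2 (fst s))) (map (%i. (i, 0)) [0..<length ms]))))"

text \<open>The elements are pairs \<open>(k, e)\<close>, which can be served by the first-stage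
  slots of the sets containing \<open>e\<close> and by the slots of these sets in scenario
  \<open>k\<close>. Only the tight first-stage slots are returned; the tight slots of the scenarios
  appear in the analysis as the sets \<open>Z k\<close>.\<close>

definition vc1 :: cover1 where
 "vc1 ms c1 c2 B scs = map (%p. fst (fst p)) (filter (%p. snd p = 0 \<and> snd (fst p) = 0)
   (lr (map (%p. map (%i. (i, 0)) (sets_of ms (snd p)) @ map (%i. (i, Suc (fst p))) (sets_of ms (snd p)))
      (concat (map (%k. map (%e. (k, e)) (snd (nthd (0, []) scs k))) [0..<length scs])))
    (map (%s. (s, if snd s = 0 then B * nthd 0 c1 (fst s) else fst (nthd (0, []) scs (snd s - 1)) * nthd 0 c2 (fst s)))
     (map (%i. (i, 0)) [0..<length ms] @
     concat (map (%k. map (%i. (i, Suc k)) [0..<length ms]) [0..<length scs])))))"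

definition ok_vc :: "nat list list => nat => bool" where
 "ok_vc ms n \<longleftrightarrow> covers_univ ms n \<and> (\<forall>e<n. card {i. i < length ms \<and> e \<in> set (ms ! i)} <= 2)"

lemma vc2_props:
 assumes ok: "ok_vc ms n" and len: "length c2 = length ms" and es: "distinct es" "set es \<subseteq> {..<n}"
 shows "set (vc2 ms c2 es) \<subseteq> {..<length ms}" "set es \<subseteq> cov ms (set (vc2 ms c2 es))"
  and "S \<subseteq> {..<length ms} ==> set es \<subseteq> cov ms S ==> tot c2 (set (vc2 ms c2 es)) <= 2 * tot c2 S"
proof -
 let ?f = "%e. map (%i. (i, 0::nat)) (sets_of ms e)" and ?g = "%s :: nat \<times> nat. nthd 0 c2 (fst s)"
 let ?ids = "map (%i. (i, 0::nat)) [0..<length ms]"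
 obtain G y where G: "lr (map ?f es) (map (%s. (s, ?g s)) ?ids) = map (%s. (s, G s)) ?ids"
  and Gy: "\<And>s. s \<in> set ?ids ==> G s + (\<Sum>p | p \<in> set es \<and> s \<in> set (?f p). y p) = ?g s"
  and tight: "\<And>p. p \<in> set es ==> (\<exists>s\<in>set (?f p). s \<in> set ?ids) ==> (\<exists>s\<in>set (?f p). s \<in> set ?ids \<and> G s = 0)"
  using lr_dual[OF es(1), of ?f ?g ?ids] by blast
 have sx: "set (vc2 ms c2 es) = {i. i < length ms \<and> G (i, 0) = 0}"
  unfolding vc2_def G by force
 have dual: "G (i, 0) + (\<Sum>e | e \<in> set es \<and> e \<in> set (ms ! i). y e) = c2 ! i" if "i < length ms" for i
 proof -
  have "{p. p \<in> set es \<and> (i, 0) \<in> set (?f p)} = {e. e \<in> set es \<and> e \<in> set (ms ! i)}"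
   using that by (auto simp: set_sets_of)
  then show ?thesis using Gy[of "(i, 0)"] that len by (simp add: nthd_def)
 qed
 show "set (vc2 ms c2 es) \<subseteq> {..<length ms}" by (auto simp: sx)
 show "set es \<subseteq> cov ms (set (vc2 ms c2 es))"
 proof
  fix e assume e: "e \<in> set es"
  then obtain i where "i < length ms" "e \<in> set (ms ! i)"
   using ok es(2) covers_univE[of ms n e] unfolding ok_vc_def by blast
  then have "\<exists>s\<in>set (?f e). s \<in> set ?ids" by (intro bexI[of _ "(i, 0)"]) (auto simp: set_sets_of)
  from tight[OF e this] show "e \<in> cov ms (set (vc2 ms c2 es))" by (auto simp: set_sets_of sx cov_def)
 qed
 assume S: "S \<subseteq> {..<length ms}" "set es \<subseteq> cov ms S"
 have fS: "finite S" using S(1) finite_subset by blast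
 have "tot c2 (set (vc2 ms c2 es)) = (\<Sum>i | i < length ms \<and> G (i, 0) = 0. \<Sum>e | e \<in> set es \<and> e \<in> set (ms ! i). y e)"
  unfolding tot_def sx using dual by (intro sum.cong) force+
 also have "\<dots> <= (\<Sum>i<length ms. \<Sum>e | e \<in> set es \<and> e \<in> set (ms ! i). y e)" by (intro sum_mono2) auto
 also have "\<dots> = (\<Sum>e\<in>set es. \<Sum>i | i \<in> {..<length ms} \<and> e \<in> set (ms ! i). y e)"
  by (intro sum.swap_restrict) auto
 also have "\<dots> <= (\<Sum>e\<in>set es. 2 * y e)"
  using ok es(2) by (intro sum_mono) (auto simp: ok_vc_def)
 also have "\<dots> = 2 * (\<Sum>e\<in>set es. y e)" by (simp add: sum_distrib_left)
 also have "(\<Sum>e\<in>set es. y e) <= (\<Sum>e\<in>set es. \<Sum>i | i \<in> S \<and> e \<in> set (ms ! i). y e)"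
 proof (rule sum_mono)
  fix e assume "e \<in> set es"
  then obtain i where "i \<in> S" "e \<in> set (ms ! i)" using S(2) by (auto simp: cov_def)
  then show "y e <= (\<Sum>i | i \<in> S \<and> e \<in> set (ms ! i). y e)"
   using fS member_le_sum[of i "{i. i \<in> S \<and> e \<in> set (ms ! i)}" "%_. y e"] by auto
 qed
 also have "\<dots> = (\<Sum>i\<in>S. \<Sum>e | e \<in> set es \<and> e \<in> set (ms ! i). y e)"
  using fS by (intro sum.swap_restrict) auto
 also have "\<dots> <= tot c2 S"
  unfolding tot_def
 proof (rule sum_mono)
  fix i assume "i \<in> S"
  then have "i < length ms" using S(1) by auto
  from dual[OF this] show "(\<Sum>e | e \<in> set es \<and> e \<in> set (ms ! i). y e) <= c2 ! i" by linarith
 qed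
 finally show "tot c2 (set (vc2 ms c2 es)) <= 2 * tot c2 S" by simp
qed

lemma map_fst_lr: "map fst (lr els st) = map fst st"
proof (induction els arbitrary: st)
 case (Cons el els)
 have "map fst (lr_step el st) = map fst st" by (auto simp: lr_step_def)
 with Cons show ?case by (simp add: lr_def)
qed (simp add: lr_def)

lemma lr_ids: "set (map (%p. fst (fst p)) (filter Q (lr els (map (%s. (s, g s)) ids)))) \<subseteq> fst ` set ids"
proof
 fix i assume "i \<in> set (map (%p. fst (fst p)) (filter Q (lr els (map (%s. (s, g s)) ids))))"
 then obtain p where p: "p \<in> set (lr els (map (%s. (s, g s)) ids))" "i = fst (fst p)" by auto
 have "fst p \<in> set (map fst (lr els (map (%s. (s, g s)) ids)))" using p(1) by simp
 then have "fst p \<in> set ids" unfolding map_fst_lr by (simp add: image_image)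
 then show "i \<in> fst ` set ids" using p(2) by simp
qed

lemma vc1_subset: "set (vc1 ms c1 c2 B scs) \<subseteq> {..<length ms}"
 unfolding vc1_def by (rule subset_trans[OF lr_ids]) auto

text \<open>\<open>Z k\<close> consists of the sets outside \<open>x\<close> that are tight in
  scenario \<open>k\<close>; together with \<open>x\<close> they cover the scenario. The endpoints
  of an edge in \<open>x\<close> and in \<open>Z k\<close> are distinct and at most two, so its dual
  is counted at most 4 * 2 = 8 times. The weight 4 is 2 for the doubled second stage times 2 because
  the second stage recomputes a 2-approximate cover instead of using \<open>Z k\<close>.\<close>

lemma vc1_props:
 assumes ok: "ok_vc ms n" and len: "length c1 = length ms" "length c2 = length ms"
  and H: "\<forall>p\<in>set scs. distinct (snd p) \<and> set (snd p) \<subseteq> {..<n}"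
  and x: "x = vc1 ms c1 c2 B scs"
 shows "set x \<subseteq> {..<length ms}"
  and "\<exists>Z. (\<forall>k<length scs. Z k \<subseteq> {..<length ms} \<and> set (snd (scs ! k)) - cov ms (set x) \<subseteq> cov ms (Z k)) \<and>
   (\<forall>x' z'. x' \<subseteq> {..<length ms} --> (\<forall>A\<subseteq>{..<n}. z' A \<subseteq> {..<length ms} \<and> A \<subseteq> cov ms (x' \<union> z' A)) -->
    B * tot c1 (set x) + 4 * (\<Sum>k<length scs. fst (scs ! k) * tot c2 (Z k)) <=
    8 * (B * tot c1 x' + (\<Sum>k<length scs. fst (scs ! k) * tot c2 (z' (set (snd (scs ! k)))))))"
proof -
 let ?K = "length scs" let ?es = "%k. set (snd (scs ! k))" let ?m = "length ms"
 let ?f = "%p :: nat \<times> nat. map (%i. (i, 0)) (sets_of ms (snd p)) @ map (%i. (i, Suc (fst p))) (sets_of ms (snd p))"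
 let ?g = "%s :: nat \<times> nat. if snd s = 0 then B * nthd 0 c1 (fst s) else fst (nthd (0, []) scs (snd s - 1)) * nthd 0 c2 (fst s)"
 let ?ids = "map (%i. (i, 0)) [0..<?m] @ concat (map (%k. map (%i. (i, Suc k)) [0..<?m]) [0..<?K])"
 define ps where "ps = concat (map (%k. map (%e. (k, e)) (snd (nthd (0, []) scs k))) [0..<?K])"
 have es: "distinct (snd (scs ! k)) \<and> ?es k \<subseteq> {..<n}" if "k < ?K" for k
  using H that by (simp add: nth_mem)
 have ps: "set ps = {(k, e). k < ?K \<and> e \<in> ?es k}" by (auto simp: ps_def nthd_def)
 have fps: "finite {(k, e). k < ?K \<and> e \<in> ?es k}" unfolding ps[symmetric] by simp
 have dps: "distinct ps"
 proof -
  have "distinct (concat (map (%k. map (%e. (k, e)) (snd (nthd (0, []) scs k))) [0..<j]))" if "j <= ?K" for j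
   using that by (induction j) (auto simp: distinct_map inj_on_def nthd_def es)
  then show ?thesis by (simp add: ps_def)
 qed
 obtain G y where G: "lr (map ?f ps) (map (%s. (s, ?g s)) ?ids) = map (%s. (s, G s)) ?ids"
  and Gy: "\<And>s. s \<in> set ?ids ==> G s + (\<Sum>p | p \<in> set ps \<and> s \<in> set (?f p). y p) = ?g s"
  and tight: "\<And>p. p \<in> set ps ==> (\<exists>s\<in>set (?f p). s \<in> set ?ids) ==> (\<exists>s\<in>set (?f p). s \<in> set ?ids \<and> G s = 0)"
  using lr_dual[OF dps, of ?f ?g ?ids] by blast
 have sx: "set x = {i. i < ?m \<and> G (i, 0) = 0}"
  unfolding x vc1_def ps_def[symmetric] G by force
 show xm: "set x \<subseteq> {..<?m}" by (auto simp: sx)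
 define Z where "Z k = {i. i < ?m \<and> i \<notin> set x \<and> G (i, Suc k) = 0}" for k
 have dual0: "G (i, 0) + (\<Sum>p | p \<in> set ps \<and> snd p \<in> set (ms ! i). y p) = B * c1 ! i" if "i < ?m" for i
 proof -
  have "{p. p \<in> set ps \<and> (i, 0) \<in> set (?f p)} = {p. p \<in> set ps \<and> snd p \<in> set (ms ! i)}"
   using that by (auto simp: set_sets_of)
  then show ?thesis using Gy[of "(i, 0)"] that len by (simp add: nthd_def)
 qed
 have dualS: "G (i, Suc k) + (\<Sum>e | e \<in> ?es k \<and> e \<in> set (ms ! i). y (k, e)) = fst (scs ! k) * c2 ! i"
  if "i < ?m" "k < ?K" for i k
 proof -
  have "{p. p \<in> set ps \<and> (i, Suc k) \<in> set (?f p)} = Pair k ` {e. e \<in> ?es k \<and> e \<in> set (ms ! i)}"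
   using that by (auto simp: set_sets_of ps)
  moreover have "(\<Sum>p\<in>Pair k ` {e. e \<in> ?es k \<and> e \<in> set (ms ! i)}. y p) = (\<Sum>e | e \<in> ?es k \<and> e \<in> set (ms ! i). y (k, e))"
   by (subst sum.reindex) (auto simp: inj_on_def)
  moreover have "(i, Suc k) \<in> set ?ids"
   using that by (simp, intro disjI2 bexI[of _ k]) auto
  ultimately show ?thesis using Gy[of "(i, Suc k)"] that len by (simp add: nthd_def)
 qed
 have split: "(\<Sum>p | p \<in> set ps \<and> snd p \<in> Q. y p) = (\<Sum>k<?K. \<Sum>e | e \<in> ?es k \<and> e \<in> Q. y (k, e))" for Q
 proof -
  have "{p. p \<in> set ps \<and> snd p \<in> Q} = Sigma {..<?K} (%k. {e. e \<in> ?es k \<and> e \<in> Q})" by (auto simp: ps)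
  then show ?thesis by (simp add: sum.Sigma)
 qed
 show "\<exists>Z. (\<forall>k<?K. Z k \<subseteq> {..<?m} \<and> ?es k - cov ms (set x) \<subseteq> cov ms (Z k)) \<and>
   (\<forall>x' z'. x' \<subseteq> {..<?m} --> (\<forall>A\<subseteq>{..<n}. z' A \<subseteq> {..<?m} \<and> A \<subseteq> cov ms (x' \<union> z' A)) -->
    B * tot c1 (set x) + 4 * (\<Sum>k<?K. fst (scs ! k) * tot c2 (Z k)) <=
    8 * (B * tot c1 x' + (\<Sum>k<?K. fst (scs ! k) * tot c2 (z' (?es k)))))"
 proof (intro exI[of _ Z] conjI allI impI)
  fix k assume k: "k < ?K"
  show "Z k \<subseteq> {..<?m}" by (auto simp: Z_def)
  show "?es k - cov ms (set x) \<subseteq> cov ms (Z k)"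
  proof
   fix e assume e: "e \<in> ?es k - cov ms (set x)"
   then have "e < n" using es[OF k] by auto
   then obtain i where i: "i < ?m" "e \<in> set (ms ! i)" using ok covers_univE[of ms n e] unfolding ok_vc_def by blast
   have "\<exists>s\<in>set (?f (k, e)). s \<in> set ?ids" using i by (intro bexI[of _ "(i, 0)"]) (auto simp: set_sets_of)
   moreover have "(k, e) \<in> set ps" using e k by (simp add: ps)
   ultimately obtain s where "s \<in> set (?f (k, e))" "G s = 0" using tight by blast
   then obtain j where j: "j < ?m" "e \<in> set (ms ! j)" "s = (j, 0) \<or> s = (j, Suc k)" "G s = 0"
    by (auto simp: set_sets_of)
   have "j \<notin> set x" using e j(1,2) xm by (auto simp: cov_def)
   then have "j \<in> Z k" using j by (auto simp: Z_def sx)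
   then show "e \<in> cov ms (Z k)" using j(2) by (auto simp: cov_def)
  qed
 next
  fix x' z' assume x': "x' \<subseteq> {..<?m}" and z': "\<forall>A\<subseteq>{..<n}. z' A \<subseteq> {..<?m} \<and> A \<subseteq> cov ms (x' \<union> z' A)"
  have fx': "finite x'" using x' finite_subset by blast
  let ?Y = "\<Sum>k<?K. \<Sum>e\<in>?es k. y (k, e)"
  have "B * tot c1 (set x) = (\<Sum>i\<in>set x. \<Sum>k<?K. \<Sum>e | e \<in> ?es k \<and> e \<in> set (ms ! i). y (k, e))"
   unfolding tot_def sum_distrib_left split[symmetric]
  proof (intro sum.cong refl)
   fix i assume "i \<in> set x"
   then show "B * c1 ! i = (\<Sum>p | p \<in> set ps \<and> snd p \<in> set (ms ! i). y p)" using dual0[of i] by (simp add: sx)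
  qed
  also have "\<dots> = (\<Sum>k<?K. \<Sum>i\<in>set x. \<Sum>e | e \<in> ?es k \<and> e \<in> set (ms ! i). y (k, e))" by (rule sum.swap)
  also have "\<dots> = (\<Sum>k<?K. \<Sum>e\<in>?es k. \<Sum>i | i \<in> set x \<and> e \<in> set (ms ! i). y (k, e))"
   by (intro sum.cong refl sum.swap_restrict) auto
  finally have a: "B * tot c1 (set x) = (\<Sum>k<?K. \<Sum>e\<in>?es k. card {i. i \<in> set x \<and> e \<in> set (ms ! i)} * y (k, e))" by simp
  have fZ: "finite (Z k)" for k by (simp add: Z_def)
  have "(\<Sum>k<?K. fst (scs ! k) * tot c2 (Z k)) = (\<Sum>k<?K. \<Sum>i\<in>Z k. \<Sum>e | e \<in> ?es k \<and> e \<in> set (ms ! i). y (k, e))"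
   unfolding tot_def sum_distrib_left
  proof (intro sum.cong refl)
   fix k i assume "k \<in> {..<?K}" "i \<in> Z k"
   then show "fst (scs ! k) * c2 ! i = (\<Sum>e | e \<in> ?es k \<and> e \<in> set (ms ! i). y (k, e))"
    using dualS[of i k] by (simp add: Z_def)
  qed
  also have "\<dots> = (\<Sum>k<?K. \<Sum>e\<in>?es k. \<Sum>i | i \<in> Z k \<and> e \<in> set (ms ! i). y (k, e))"
   by (intro sum.cong refl sum.swap_restrict) (auto simp: fZ)
  finally have b: "(\<Sum>k<?K. fst (scs ! k) * tot c2 (Z k)) = (\<Sum>k<?K. \<Sum>e\<in>?es k. card {i. i \<in> Z k \<and> e \<in> set (ms ! i)} * y (k, e))" by simp
  have "B * tot c1 (set x) + 4 * (\<Sum>k<?K. fst (scs ! k) * tot c2 (Z k)) =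
    (\<Sum>k<?K. \<Sum>e\<in>?es k. (card {i. i \<in> set x \<and> e \<in> set (ms ! i)} + 4 * card {i. i \<in> Z k \<and> e \<in> set (ms ! i)}) * y (k, e))"
   unfolding a b by (simp add: sum_distrib_left sum.distrib add_mult_distrib mult.assoc)
  also have "\<dots> <= (\<Sum>k<?K. \<Sum>e\<in>?es k. 8 * y (k, e))"
  proof (intro sum_mono mult_right_mono)
   fix k e assume "k \<in> {..<?K}" "e \<in> ?es k"
   then have "e < n" using es[of k] by auto
   then have c: "card {i. i < ?m \<and> e \<in> set (ms ! i)} <= 2" using ok by (simp add: ok_vc_def)
   have "card {i. i \<in> set x \<and> e \<in> set (ms ! i)} + card {i. i \<in> Z k \<and> e \<in> set (ms ! i)} =
    card ({i. i \<in> set x \<and> e \<in> set (ms ! i)} \<union> {i. i \<in> Z k \<and> e \<in> set (ms ! i)})"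
    using fZ by (intro card_Un_disjoint[symmetric]) (auto simp: Z_def)
   also have "\<dots> <= card {i. i < ?m \<and> e \<in> set (ms ! i)}" using xm by (intro card_mono) (auto simp: Z_def)
   finally show "card {i. i \<in> set x \<and> e \<in> set (ms ! i)} + 4 * card {i. i \<in> Z k \<and> e \<in> set (ms ! i)} <= 8" using c by linarith
  qed simp
  also have "\<dots> = 8 * ?Y" by (simp add: sum_distrib_left)
  also have "?Y <= B * tot c1 x' + (\<Sum>k<?K. fst (scs ! k) * tot c2 (z' (?es k)))"
  proof -
   have "?Y <= (\<Sum>k<?K. \<Sum>e\<in>?es k. (\<Sum>i | i \<in> x' \<and> e \<in> set (ms ! i). y (k, e)) + (\<Sum>i | i \<in> z' (?es k) \<and> e \<in> set (ms ! i). y (k, e)))"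
   proof (intro sum_mono)
    fix k e assume k: "k \<in> {..<?K}" and e: "e \<in> ?es k"
    have z: "z' (?es k) \<subseteq> {..<?m}" "?es k \<subseteq> cov ms (x' \<union> z' (?es k))" using z' es[of k] k by auto
    have fz: "finite (z' (?es k))" using z(1) finite_subset by blast
    from z(2) e obtain i where i: "i \<in> x' \<or> i \<in> z' (?es k)" "e \<in> set (ms ! i)" by (auto simp: cov_def)
    then show "y (k, e) <= (\<Sum>i | i \<in> x' \<and> e \<in> set (ms ! i). y (k, e)) + (\<Sum>i | i \<in> z' (?es k) \<and> e \<in> set (ms ! i). y (k, e))"
     using member_le_sum[of i "{i. i \<in> x' \<and> e \<in> set (ms ! i)}" "%_. y (k, e)"]
      member_le_sum[of i "{i. i \<in> z' (?es k) \<and> e \<in> set (ms ! i)}" "%_. y (k, e)"] fx' fz by (auto intro: trans_le_add1 trans_le_add2)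
   qed
   also have "\<dots> = (\<Sum>k<?K. \<Sum>e\<in>?es k. \<Sum>i | i \<in> x' \<and> e \<in> set (ms ! i). y (k, e)) +
     (\<Sum>k<?K. \<Sum>e\<in>?es k. \<Sum>i | i \<in> z' (?es k) \<and> e \<in> set (ms ! i). y (k, e))" by (simp only: sum.distrib)
   also have "(\<Sum>k<?K. \<Sum>e\<in>?es k. \<Sum>i | i \<in> x' \<and> e \<in> set (ms ! i). y (k, e)) =
     (\<Sum>k<?K. \<Sum>i\<in>x'. \<Sum>e | e \<in> ?es k \<and> e \<in> set (ms ! i). y (k, e))"
    by (intro sum.cong refl sum.swap_restrict) (auto simp: fx')
   also have "\<dots> = (\<Sum>i\<in>x'. \<Sum>k<?K. \<Sum>e | e \<in> ?es k \<and> e \<in> set (ms ! i). y (k, e))" by (rule sum.swap)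
   also have "\<dots> <= B * tot c1 x'"
    unfolding tot_def sum_distrib_left split[symmetric]
   proof (rule sum_mono)
    fix i assume "i \<in> x'"
    then have "i < ?m" using x' by auto
    from dual0[OF this] show "(\<Sum>p | p \<in> set ps \<and> snd p \<in> set (ms ! i). y p) <= B * c1 ! i" by linarith
   qed
   also have "(\<Sum>k<?K. \<Sum>e\<in>?es k. \<Sum>i | i \<in> z' (?es k) \<and> e \<in> set (ms ! i). y (k, e)) <=
     (\<Sum>k<?K. fst (scs ! k) * tot c2 (z' (?es k)))"
   proof (rule sum_mono)
    fix k assume k: "k \<in> {..<?K}"
    have z: "z' (?es k) \<subseteq> {..<?m}" using z' es[of k] k by auto
    then have "finite (z' (?es k))" using finite_subset by blast
    then have "(\<Sum>e\<in>?es k. \<Sum>i | i \<in> z' (?es k) \<and> e \<in> set (ms ! i). y (k, e)) =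
      (\<Sum>i\<in>z' (?es k). \<Sum>e | e \<in> ?es k \<and> e \<in> set (ms ! i). y (k, e))" by (intro sum.swap_restrict) auto
    also have "\<dots> <= fst (scs ! k) * tot c2 (z' (?es k))"
     unfolding tot_def sum_distrib_left
    proof (rule sum_mono)
     fix i assume "i \<in> z' (?es k)"
     then have "i < ?m" "k < ?K" using z k by auto
     from dualS[OF this] show "(\<Sum>e | e \<in> ?es k \<and> e \<in> set (ms ! i). y (k, e)) <= fst (scs ! k) * c2 ! i" by linarith
    qed
    finally show "(\<Sum>e\<in>?es k. \<Sum>i | i \<in> z' (?es k) \<and> e \<in> set (ms ! i). y (k, e)) <= fst (scs ! k) * tot c2 (z' (?es k))" .
   qed
   finally show ?thesis by simp
  qed
  finally show "B * tot c1 (set x) + 4 * (\<Sum>k<?K. fst (scs ! k) * tot c2 (Z k)) <=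
    8 * (B * tot c1 x' + (\<Sum>k<?K. fst (scs ! k) * tot c2 (z' (?es k))))" by simp
 qed
qed

lemma vc1_approx:
 assumes ok: "ok_vc ms n" and len: "length c1 = length ms" "length c2 = length ms"
  and H: "\<And>w es. (w, es) \<in> set H ==> distinct es \<and> set es \<subseteq> {..<n}"
  and x: "x = vc1 ms c1 c2 B (H @ [(u, [0..<n])])"
 shows "\<exists>Cm. (\<forall>es. distinct es --> set es \<subseteq> {..<n} --> real (tot c2 (set (vc2 ms c2 (unc ms x es)))) <= Cm) \<and>
   (\<forall>x' z'. x' \<subseteq> {..<length ms} --> (\<forall>A\<subseteq>{..<n}. z' A \<subseteq> {..<length ms} \<and> A \<subseteq> cov ms (x' \<union> z' A)) -->
    real B * real (tot c1 (set x)) +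
     2 * ((\<Sum>(w, es)\<leftarrow>H. real w * real (tot c2 (set (vc2 ms c2 (unc ms x es))))) + real u * Cm)
    <= 8 * (real B * real (tot c1 x') +
     ((\<Sum>(w, es)\<leftarrow>H. real w * real (tot c2 (z' (set es)))) + real u * real (tot c2 (z' {..<n})))))"
proof -
 let ?scs = "H @ [(u, [0..<n])]" let ?K = "length H"
 have H': "\<forall>p\<in>set ?scs. distinct (snd p) \<and> set (snd p) \<subseteq> {..<n}" using H by force
 have xm: "set x \<subseteq> {..<length ms}" by (rule vc1_props(1)[OF ok len H' x])
 from vc1_props(2)[OF ok len H' x] obtain Z where
  Z0: "\<forall>k<length ?scs. Z k \<subseteq> {..<length ms} \<and> set (snd (?scs ! k)) - cov ms (set x) \<subseteq> cov ms (Z k)"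
  and le0: "\<forall>x' z'. x' \<subseteq> {..<length ms} --> (\<forall>A\<subseteq>{..<n}. z' A \<subseteq> {..<length ms} \<and> A \<subseteq> cov ms (x' \<union> z' A)) -->
    B * tot c1 (set x) + 4 * (\<Sum>k<length ?scs. fst (?scs ! k) * tot c2 (Z k)) <=
    8 * (B * tot c1 x' + (\<Sum>k<length ?scs. fst (?scs ! k) * tot c2 (z' (set (snd (?scs ! k))))))"
  by (elim exE conjE) (rule that)
 note Z = Z0[rule_format] and le = le0[THEN spec, THEN spec, THEN mp, THEN mp]
 have ub: "tot c2 (set (vc2 ms c2 (unc ms x es))) <= 2 * tot c2 (Z k)"
  if "distinct es" "set es \<subseteq> {..<n}" "k < length ?scs" "set es \<subseteq> set (snd (?scs ! k))" for es k
  using that Z[OF that(3)] set_unc[OF xm, of es] distinct_unc[OF that(1)]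
  by (intro vc2_props(3)[OF ok len(2)]) auto
 show ?thesis
 \<comment> \<open>\<open>Z ?K\<close> covers what \<open>x\<close> leaves of the full scenario and
   hence of any scenario; the factor 2 is that of \<open>vc2\<close>.\<close>
 proof (intro exI[of _ "2 * real (tot c2 (Z ?K))"] conjI allI impI)
  fix es assume "distinct es" "set es \<subseteq> {..<n}"
  then have "tot c2 (set (vc2 ms c2 (unc ms x es))) <= 2 * tot c2 (Z ?K)" by (intro ub) auto
  then show "real (tot c2 (set (vc2 ms c2 (unc ms x es)))) <= 2 * real (tot c2 (Z ?K))" by linarith
 next
  fix x' z' assume x': "x' \<subseteq> {..<length ms}" and z': "\<forall>A\<subseteq>{..<n}. z' A \<subseteq> {..<length ms} \<and> A \<subseteq> cov ms (x' \<union> z' A)"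
  have sums: "(\<Sum>k<length ?scs. fst (?scs ! k) * F k (snd (?scs ! k))) = (\<Sum>k<?K. fst (H ! k) * F k (snd (H ! k))) + u * F ?K [0..<n]"
   for F :: "nat => nat list => nat"
   by (simp add: nth_append)
  have sH: "(\<Sum>(w, es)\<leftarrow>H. real w * real (F es)) = real (\<Sum>k<?K. fst (H ! k) * F (snd (H ! k)))" for F
   unfolding scenario_sum_real scenario_sum by simp
  have n1: "(\<Sum>k<?K. fst (H ! k) * tot c2 (set (vc2 ms c2 (unc ms x (snd (H ! k)))))) <= 2 * (\<Sum>k<?K. fst (H ! k) * tot c2 (Z k))"
   unfolding sum_distrib_left
  proof (rule sum_mono)
   fix k assume k: "k \<in> {..<?K}"
   then have "distinct (snd (H ! k)) \<and> set (snd (H ! k)) \<subseteq> {..<n}" using H[of "fst (H ! k)" "snd (H ! k)"] by (simp add: nth_mem)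
   then have "tot c2 (set (vc2 ms c2 (unc ms x (snd (H ! k))))) <= 2 * tot c2 (Z k)"
    using k by (intro ub) (auto simp: nth_append)
   then show "fst (H ! k) * tot c2 (set (vc2 ms c2 (unc ms x (snd (H ! k))))) <= 2 * (fst (H ! k) * tot c2 (Z k))"
    using mult_le_mono2 by (metis mult.left_commute)
  qed
  have "B * tot c1 (set x) + 4 * ((\<Sum>k<?K. fst (H ! k) * tot c2 (Z k)) + u * tot c2 (Z ?K)) <=
    8 * (B * tot c1 x' + ((\<Sum>k<?K. fst (H ! k) * tot c2 (z' (set (snd (H ! k))))) + u * tot c2 (z' {..<n})))"
   using le[OF x' z'] sums[of "%k _. tot c2 (Z k)"] sums[of "%k es. tot c2 (z' (set es))"] by (simp add: atLeast0LessThan)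
  with n1 have "B * tot c1 (set x) + 2 * ((\<Sum>k<?K. fst (H ! k) * tot c2 (set (vc2 ms c2 (unc ms x (snd (H ! k)))))) + u * (2 * tot c2 (Z ?K))) <=
    8 * (B * tot c1 x' + ((\<Sum>k<?K. fst (H ! k) * tot c2 (z' (set (snd (H ! k))))) + u * tot c2 (z' {..<n})))"
   by (simp add: algebra_simps)
  then have "real (B * tot c1 (set x) + 2 * ((\<Sum>k<?K. fst (H ! k) * tot c2 (set (vc2 ms c2 (unc ms x (snd (H ! k)))))) + u * (2 * tot c2 (Z ?K)))) <=
    real (8 * (B * tot c1 x' + ((\<Sum>k<?K. fst (H ! k) * tot c2 (z' (set (snd (H ! k))))) + u * tot c2 (z' {..<n}))))"
   by (simp only: of_nat_le_iff)
  then show "real B * real (tot c1 (set x)) +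
     2 * ((\<Sum>(w, es)\<leftarrow>H. real w * real (tot c2 (set (vc2 ms c2 (unc ms x es))))) + real u * (2 * real (tot c2 (Z ?K))))
    <= 8 * (real B * real (tot c1 x') +
     ((\<Sum>(w, es)\<leftarrow>H. real w * real (tot c2 (z' (set es)))) + real u * real (tot c2 (z' {..<n}))))"
   by (simp only: sH of_nat_add of_nat_mult of_nat_numeral)
 qed
qed

theorem vertex_cover_approx: "has_approx_algorithm vertex_cover_problems (%P \<epsilon>. 8 + 24 * \<epsilon>)"
proof -
 let ?\<I> = "{vertex_cover_inst n es f g | n es f g. simple_graph n es \<and> valid_costs {..<n} f g}"
 have "has_approx_algorithm (set_cover_problem ` ?\<I>) (%P \<epsilon>. 8 + 24 * \<epsilon>)"
 proof (rule set_cover_approx[where ?a1.0 = vc1 and ?a2.0 = vc2 and ok = ok_vc and \<rho> = "%_. 8"])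
  show "pt (%p. vc1 (fst p) (fst (snd p)) (fst (snd (snd p))) (fst (snd (snd (snd p)))) (snd (snd (snd (snd p)))))"
   unfolding vc1_def by (intro pt_intros)
  show "pt (%p. vc2 (fst p) (fst (snd p)) (snd (snd p)))"
   unfolding vc2_def by (intro pt_intros)
  fix I assume "I \<in> ?\<I>"
  then obtain n es f g where I: "I = vertex_cover_inst n es f g" and g: "simple_graph n es" "valid_costs {..<n} f g" by auto
  let ?M = "%v. {i. i < length es \<and> v \<in> es ! i}"
  have e: "es ! i \<subseteq> {..<n} \<and> card (es ! i) = 2" if "i < length es" for i using g(1) that by (simp add: simple_graph_def)
  have u: "(\<Union>v<n. ?M v) = {..<length es}"
  proof (intro equalityI subsetI)
   fix i assume "i \<in> {..<length es}"
   then have i: "i < length es" by simp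
   then obtain v where "v \<in> es ! i" using e[OF i] by (metis card.empty ex_in_conv zero_neq_numeral)
   then show "i \<in> (\<Union>v<n. ?M v)" using e[OF i] i by blast
  qed auto
  let ?ms = "map (%v. dec (set_encode (?M v))) [0..<n]"
  have s: "set (?ms ! v) = ?M v" if "v < n" for v using that by simp
  have "(\<Union>v<length ?ms. set (?ms ! v)) = (\<Union>v<n. ?M v)" using s by (intro SUP_cong) auto
  moreover have "card {v. v < length ?ms \<and> i \<in> set (?ms ! v)} <= 2" if "i < length es" for i
  proof -
   have "{v. v < length ?ms \<and> i \<in> set (?ms ! v)} = es ! i" using e[OF that] that by auto
   then show ?thesis using e[OF that] by simp
  qed
  ultimately have "ok_vc ?ms (length es)" using u by (auto simp: ok_vc_def covers_univ_def)
  then show "(\<Union>i<nsets I. members I i) = {..<nelems I} \<and> valid_costs {..<nsets I} (scost1 I) (scost2 I) \<and>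
    ok_vc (map (%i. dec (set_encode (members I i))) [0..<nsets I]) (nelems I)"
   using u g(2) by (simp add: I vertex_cover_inst_def)
 next
  fix \<epsilon> :: real assume "0 < \<epsilon>" "\<epsilon> < 1"
  then have "\<epsilon> * \<epsilon> <= 1 * \<epsilon>" by (intro mult_right_mono) auto
  moreover have "8 * (1 + \<epsilon>)\<^sup>2 = 8 + 16 * \<epsilon> + 8 * (\<epsilon> * \<epsilon>)" by (simp add: power2_eq_square algebra_simps)
  ultimately show "8 * (1 + \<epsilon>)\<^sup>2 <= 8 + 24 * \<epsilon>" using \<open>0 < \<epsilon>\<close> by linarith
 next
  fix ms n and c2 es :: "nat list" assume *: "ok_vc ms n" "length c2 = length ms" "distinct es" "set es \<subseteq> {..<n}"
  show "set (vc2 ms c2 es) \<subseteq> {..<length ms} \<and> set es \<subseteq> cov ms (set (vc2 ms c2 es))"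
   using vc2_props(1,2)[OF *] by simp
  fix S assume "S \<subseteq> {..<length ms}" "set es \<subseteq> cov ms S"
  from vc2_props(3)[OF * this] show "real (tot c2 (set (vc2 ms c2 es))) <= 8 * real (tot c2 S)" by linarith
 next
  fix ms n B u and c1 c2 :: "nat list" and H :: "(nat \<times> nat list) list"
  show "set (vc1 ms c1 c2 B (H @ [(u, [0..<n])])) \<subseteq> {..<length ms}" by (rule vc1_subset)
 next
  fix ms n B u x and c1 c2 :: "nat list" and H :: "(nat \<times> nat list) list"
  assume *: "ok_vc ms n" "length c1 = length ms" "length c2 = length ms"
   and H: "\<And>w es. (w, es) \<in> set H ==> distinct es \<and> set es \<subseteq> {..<n}" and x: "x = vc1 ms c1 c2 B (H @ [(u, [0..<n])])"
  show "\<exists>Cm. (\<forall>es. distinct es --> set es \<subseteq> {..<n} --> real (tot c2 (set (vc2 ms c2 (unc ms x es)))) <= Cm) \<and>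
   (\<forall>x' z'. x' \<subseteq> {..<length ms} --> (\<forall>A\<subseteq>{..<n}. z' A \<subseteq> {..<length ms} \<and> A \<subseteq> cov ms (x' \<union> z' A)) -->
    real B * real (tot c1 (set x)) +
     2 * ((\<Sum>(w, es)\<leftarrow>H. real w * real (tot c2 (set (vc2 ms c2 (unc ms x es))))) + real u * Cm)
    <= 8 * (real B * real (tot c1 x') +
     ((\<Sum>(w, es)\<leftarrow>H. real w * real (tot c2 (z' (set es)))) + real u * real (tot c2 (z' {..<n})))))"
   by (rule vc1_approx[OF * _ x]) (rule H)
 qed auto
 moreover have "vertex_cover_problems = set_cover_problem ` ?\<I>" unfolding vertex_cover_problems_def by blast
 ultimately show ?thesis by simp
qed

section \<open>Set cover\<close>

text \<open>
 Greedy multicover: the state is the history of picked candidates, an element that has been covered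
 \<open>j\<close> times has weight \<open>P div 2 ^ j\<close>, and the next pick minimizes cost per covered weight.  A
 candidate consists of its cost, a label and the elements that it covers.
\<close>

type_synonym cand = "nat \<times> (nat \<times> nat) \<times> (nat \<times> nat) list"

definition wt :: "nat => cand list => nat \<times> nat => nat" where
 "wt P h e = fold (%c w. if e \<in> set (snd (snd c)) then w div 2 else w) h P"

definition covn :: "cand list => nat \<times> nat => nat" where
 "covn h e = length (filter (%c. e \<in> set (snd (snd c))) h)"

definition score :: "nat => cand list => (nat \<times> nat) list => cand => nat" where
 "score P h E c = sum_list (map (wt P h) (filter (%e. e \<in> set (snd (snd c))) E))"

definition mc_step :: "nat => (nat \<times> nat) list => cand list => cand list => cand list" where
 "mc_step P E Cs h = (let good = filter (%c. 0 < score P h E c) Cs in if good = [] then h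
   else best (%c d. fst c * score P h E d < fst d * score P h E c) (0, ((0, 0), [])) good # h)"

definition mc :: "nat => (nat \<times> nat) list => cand list => (nat \<times> nat) list => cand list" where
 "mc P E Cs fuel = fold (%_ h. mc_step P E Cs h) fuel []"

lemma pt_wt [pt_intros]:
 assumes "pt a" "pt b" "pt c"
 shows "pt (%x. wt (a x) (b x) (c x))"
 unfolding wt_def
proof (rule pt_fold[where h = "%x d w. if c x \<in> set (snd (snd d)) then w div 2 else w :: nat"])
 show "pbd (%x. sz (a x))" by (rule pt_sz[OF assms(1)])
 have "fold (%d w. if e \<in> set (snd (snd d)) then w div 2 else w) h P <= P" for e and h :: "cand list" and P :: nat
 proof (induction h arbitrary: P)
  case (Cons d h)
  show ?case using Cons[of "if e \<in> set (snd (snd d)) then P div 2 else P"] by (auto split: if_splits)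
 qed simp
 then show "sz (fold (%d w. if c x \<in> set (snd (snd d)) then w div 2 else w) (take n (b x)) (a x)) <= sz (a x)" for x n
  by (rule sz_nat_mono)
 show "pt (%p. if c (fst p) \<in> set (snd (snd (fst (snd p)))) then snd (snd p) div 2 else snd (snd p) :: nat)"
  by (intro pt_intros pt_compose[OF assms(3)])
qed (intro assms)+

lemma pt_score [pt_intros]: "pt a ==> pt b ==> pt c ==> pt d ==> pt (%x. score (a x) (b x) (c x) (d x))"
 by (rule pt_lift4) (unfold score_def, intro pt_intros)

lemma pt_mc_step [pt_intros]: "pt a ==> pt b ==> pt c ==> pt d ==> pt (%x. mc_step (a x) (b x) (c x) (d x))"
 by (rule pt_lift4) (unfold mc_step_def, intro pt_intros)

lemma mc_step_cases: "mc_step P E Cs h = h \<or> (\<exists>c\<in>set Cs. mc_step P E Cs h = c # h)"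
proof (cases "filter (%c. 0 < score P h E c) Cs = []")
 case False
 from best_in[OF this] show ?thesis using False by (auto simp: mc_step_def Let_def)
qed (simp add: mc_step_def)

lemma sz_mc: "sz (mc P E Cs fuel) <= 1 + length fuel * sz Cs"
proof (induction fuel rule: rev_induct)
 case (snoc a fuel)
 let ?h = "mc P E Cs fuel"
 have e: "mc P E Cs (fuel @ [a]) = mc_step P E Cs ?h" by (simp add: mc_def)
 have "sz (mc_step P E Cs ?h) <= sz ?h + sz Cs"
 proof (cases "mc_step P E Cs ?h = ?h")
  case False
  then obtain c where c: "c \<in> set Cs" "mc_step P E Cs ?h = c # ?h" using mc_step_cases by blast
  show ?thesis unfolding c(2) using sz_mem[OF c(1)] by simp
 qed simp
 then show ?case using snoc unfolding e by simp
qed (simp add: mc_def)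

lemma pt_mc [pt_intros]:
 assumes "pt a" "pt b" "pt c" "pt d"
 shows "pt (%x. mc (a x) (b x) (c x) (d x))"
 unfolding mc_def
proof (rule pt_fold[where h = "%x _ s. mc_step (a x) (b x) (c x) s"])
 show "pbd (%x. 1 + sz (d x) * sz (c x))" by (intro pbd_add pbd_const pbd_mult pt_sz assms)
 show "sz (fold (%_. mc_step (a x) (b x) (c x)) (take n (d x)) []) <= 1 + sz (d x) * sz (c x)" for x n
 proof -
  have "sz (mc (a x) (b x) (c x) (take n (d x))) <= 1 + length (take n (d x)) * sz (c x)" by (rule sz_mc)
  also have "\<dots> <= 1 + sz (d x) * sz (c x)" using length_le_sz[of "d x"] by (intro add_mono mult_le_mono) auto
  finally show ?thesis by (simp add: mc_def)
 qed
 show "pt (%p. mc_step (a (fst p)) (b (fst p)) (c (fst p)) (snd (snd p)))"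
  by (intro pt_intros pt_compose[OF assms(1)] pt_compose[OF assms(2)] pt_compose[OF assms(3)])
qed (intro pt_intros assms)+

lemma wt_conv: "wt P h e = P div 2 ^ covn h e"
proof (induction h arbitrary: P)
 case (Cons c h)
 have "wt P (c # h) e = wt (if e \<in> set (snd (snd c)) then P div 2 else P) h e" by (simp add: wt_def)
 then show ?case using Cons by (auto simp: covn_def div_mult2_eq)
qed (simp add: wt_def covn_def)

lemma wt_Cons: "wt P (c # h) e = (if e \<in> set (snd (snd c)) then wt P h e div 2 else wt P h e)"
 by (simp add: wt_conv covn_def div_mult2_eq[symmetric] mult.commute)

lemma score_sum: "distinct E ==> score P h E c = (\<Sum>e | e \<in> set E \<and> e \<in> set (snd (snd c)). wt P h e)"
 by (simp add: score_def sum_list_distinct_conv_sum_set)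

abbreviation cost :: "cand list => nat" where "cost h \<equiv> sum_list (map fst h)"

lemma sum_score_ge:
 assumes "distinct E" "\<And>e. e \<in> set E ==> \<kappa> <= covn X e"
 shows "\<kappa> * (\<Sum>e\<in>set E. wt P h e) <= (\<Sum>c\<leftarrow>X. score P h E c)"
proof -
 have "(\<Sum>c\<leftarrow>X. score P h E c) = (\<Sum>e\<in>set E. covn X e * wt P h e)"
 proof (induction X)
  case (Cons c X)
  have "score P h E c = (\<Sum>e\<in>set E. if e \<in> set (snd (snd c)) then wt P h e else 0)"
   unfolding score_sum[OF assms(1)] by (simp add: sum.inter_filter)
  then show ?case using Cons unfolding covn_def
   by (simp add: sum.distrib[symmetric]) (rule sum.cong, auto)
 qed (simp add: covn_def)
 also have "\<dots> \<ge> (\<Sum>e\<in>set E. \<kappa> * wt P h e)" using assms(2) by (intro sum_mono mult_right_mono) auto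
 finally show ?thesis by (simp add: sum_distrib_left)
qed

text \<open>Averaging: \<open>X\<close> covers every element \<open>\<kappa>\<close> times, so the
  scores of its members sum up to at least \<open>\<kappa>\<close> times the potential. Hence the
  least ratio of cost to score is at most \<open>cost X\<close> divided by \<open>\<kappa>\<close>
  times the potential.\<close>

lemma mc_step_pick:
 assumes E: "distinct E" and X: "set X \<subseteq> set Cs" "\<And>e. e \<in> set E ==> \<kappa> <= covn X e" "1 <= \<kappa>"
  and pos: "0 < (\<Sum>e\<in>set E. wt P h e)"
 obtains c where "c \<in> set Cs" "mc_step P E Cs h = c # h" "0 < score P h E c"
  "\<kappa> * fst c * (\<Sum>e\<in>set E. wt P h e) <= cost X * score P h E c"
proof -
 let ?s = "score P h E" let ?\<Phi> = "\<Sum>e\<in>set E. wt P h e"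
 let ?good = "filter (%c. 0 < ?s c) Cs"
 let ?lt = "%c d. fst c * ?s d < fst d * ?s c"
 define c where "c = best ?lt (0, ((0, 0), [])) ?good"
 have "0 < (\<Sum>c\<leftarrow>X. ?s c)" using sum_score_ge[OF E X(2), of P h] X(3) pos
  by (metis le_trans less_le_trans mult_1 mult_le_mono1)
 then obtain d where "d \<in> set X" "0 < ?s d" by (metis (no_types, lifting) bot_nat_0.not_eq_extremum imageE list.set_map sum_list_eq_0_iff)
 then have ne: "?good \<noteq> []" using X(1) by (auto simp: filter_empty_conv)
 have c: "c \<in> set Cs" "0 < ?s c" using best_in[OF ne] by (auto simp: c_def)
 have step: "mc_step P E Cs h = c # h" using ne by (simp add: mc_step_def c_def)
 have min: "fst c * ?s d <= fst d * ?s c" if "d \<in> set Cs" for d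
 proof (cases "0 < ?s d")
  case True
  have "\<not> ?lt d c"
   unfolding c_def
  proof (rule best_min[where S = "{c. 0 < ?s c}"])
   \<comment> \<open>Comparison of ratios by cross-multiplication is consistent because the positive
     score of \<open>y\<close> can be cancelled.\<close>
   fix x y z assume a: "x \<in> {c. 0 < ?s c}" "y \<in> {c. 0 < ?s c}" "z \<in> {c. 0 < ?s c}" "?lt x y" "\<not> ?lt z y"
   have "(fst x * ?s z) * ?s y = (fst x * ?s y) * ?s z" by simp
   also have "\<dots> <= (fst y * ?s x) * ?s z" using a(4) by (intro mult_right_mono) auto
   also have "\<dots> = (fst y * ?s z) * ?s x" by simp
   also have "\<dots> <= (fst z * ?s y) * ?s x" using a(5) by (intro mult_right_mono) auto
   also have "\<dots> = (fst z * ?s x) * ?s y" by simp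
   finally have "fst x * ?s z <= fst z * ?s x" using a(2) by simp
   then show "\<not> ?lt z x" by simp
  qed (use that True in auto)
  then show ?thesis by simp
 qed simp
 have "(\<Sum>d\<leftarrow>X. fst c * ?s d) <= (\<Sum>d\<leftarrow>X. fst d * ?s c)" using min X(1) by (intro sum_list_mono) auto
 then have u: "fst c * (\<Sum>d\<leftarrow>X. ?s d) <= cost X * ?s c" by (simp add: sum_list_const_mult sum_list_mult_const)
 have "fst c * (\<kappa> * ?\<Phi>) <= fst c * (\<Sum>d\<leftarrow>X. ?s d)" by (intro mult_left_mono sum_score_ge[OF E X(2)]) auto
 from le_trans[OF this u] have "\<kappa> * fst c * ?\<Phi> <= cost X * ?s c" by (simp only: mult_ac)
 with c step that show ?thesis by blast
qed

text \<open>Covering an element replaces its weight \<open>w\<close> by \<open>w div 2\<close>, so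
  the potential drops by at least half of the score.\<close>

lemma potential_drop:
 assumes "distinct E"
 shows "2 * (\<Sum>e\<in>set E. wt P (c # h) e) + score P h E c <= 2 * (\<Sum>e\<in>set E. wt P h e)"
proof -
 have "score P h E c = (\<Sum>e\<in>set E. if e \<in> set (snd (snd c)) then wt P h e else 0)"
  unfolding score_sum[OF assms(1)] by (simp add: sum.inter_filter)
 then have "2 * (\<Sum>e\<in>set E. wt P (c # h) e) + score P h E c =
  (\<Sum>e\<in>set E. 2 * wt P (c # h) e + (if e \<in> set (snd (snd c)) then wt P h e else 0))"
  by (simp add: sum.distrib sum_distrib_left)
 also have "\<dots> <= (\<Sum>e\<in>set E. 2 * wt P h e)" by (intro sum_mono) (auto simp: wt_Cons)
 finally show ?thesis by (simp add: sum_distrib_left)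
qed

lemma mc_subset: "set (mc P E Cs fuel) \<subseteq> set Cs"
proof (induction fuel rule: rev_induct)
 case (snoc a fuel)
 then show ?case using mc_step_cases[of P E Cs "mc P E Cs fuel"] by (auto simp: mc_def)
qed (simp add: mc_def)

text \<open>A pick costs at most \<open>cost X / \<kappa>\<close> times score over potential, and
  the score is at most twice the drop of the potential. By \<open>1 - q / p <= ln (p / q)\<close>
  this telescopes to the logarithm of the initial potential. The pick that brings the potential down
  to 0 has no such logarithm and pays for the extra 1. Since \<open>X\<close> is a list with
  repetitions, \<open>X\<close> over \<open>\<kappa>\<close> acts as a fractional cover.\<close>

lemma mc_cost:
 assumes E: "distinct E" and X: "set X \<subseteq> set Cs" "\<And>e. e \<in> set E ==> \<kappa> <= covn X e" "1 <= \<kappa>"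
 shows "real \<kappa> * real (cost (mc P E Cs fuel)) <= 2 * real (cost X) * (ln (real (length E * P)) + 1)"
proof -
 let ?\<Phi> = "%h. \<Sum>e\<in>set E. wt P h e" let ?L = "ln (real (length E * P))" let ?C = "2 * real (cost X)"
 have \<Phi>0: "?\<Phi> [] = length E * P" using E by (simp add: wt_def distinct_card)
 have cast: "real s <= 2 * (real p - real q)" if "2 * q + s <= 2 * p" for p q s :: nat
 proof -
  have "real (2 * q + s) <= real (2 * p)" using that by (simp only: of_nat_le_iff)
  then show ?thesis by simp
 qed
 have cast2: "real a * real b * real p <= real d * real s" if "a * b * p <= d * s" for a b d p s :: nat
  using that by (simp only: of_nat_mult[symmetric] of_nat_le_iff)
 have L0: "0 <= ?L"
 proof (cases "length E * P = 0")
  case True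
  then show ?thesis by (simp only: of_nat_0) simp
 next
  case False
  then have "1 <= length E * P" by linarith
  then have "1 <= real (length E * P)" by (simp only: of_nat_1[symmetric, where 'a = real] of_nat_le_iff)
  then show ?thesis by (rule ln_ge_zero)
 qed
 have "(0 < ?\<Phi> h --> real \<kappa> * real (cost h) <= ?C * (?L - ln (real (?\<Phi> h)))) \<and>
   real \<kappa> * real (cost h) <= ?C * (?L + 1)" if "h = mc P E Cs fuel" for h
  using that
 proof (induction fuel arbitrary: h rule: rev_induct)
  case Nil
  then show ?case using \<Phi>0 L0 by (simp add: mc_def)
 next
  case (snoc a fuel)
  let ?h = "mc P E Cs fuel"
  have h: "h = mc_step P E Cs ?h" using snoc.prems by (simp add: mc_def)
  note IH = snoc.IH[OF refl]
  show ?case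
  proof (cases "0 < ?\<Phi> ?h")
   case False
   then have "\<And>e. e \<in> set E ==> wt P ?h e = 0" by simp
   then have "score P ?h E c = 0" for c using E by (simp add: score_sum)
   then have "h = ?h" unfolding h by (simp add: mc_step_def)
   then show ?thesis using IH by simp
  next
   case True
   obtain c where c: "h = c # ?h" "\<kappa> * fst c * ?\<Phi> ?h <= cost X * score P ?h E c"
    using mc_step_pick[OF E X True] h by metis
   define p0 q0 where pq: "p0 = ?\<Phi> ?h" "q0 = ?\<Phi> h"
   let ?p = "real p0" and ?q = "real q0"
   have p: "1 <= ?p" using True unfolding pq(1)[symmetric] by simp
   have "2 * q0 + score P ?h E c <= 2 * p0" unfolding pq c(1) by (rule potential_drop[OF E])
   then have "real (score P ?h E c) <= 2 * (?p - ?q)" by (rule cast)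
   then have "real (cost X) * real (score P ?h E c) <= real (cost X) * (2 * (?p - ?q))" by (intro mult_left_mono) auto
   moreover have "real \<kappa> * real (fst c) * ?p <= real (cost X) * real (score P ?h E c)"
    using c(2) unfolding pq(1)[symmetric] by (rule cast2)
   ultimately have "real \<kappa> * real (fst c) * ?p <= ?C * (?p - ?q)" by linarith
   then have kc: "real \<kappa> * real (fst c) <= ?C * (1 - ?q / ?p)" using p by (simp add: field_simps)
   have IHp: "real \<kappa> * real (cost ?h) <= ?C * (?L - ln ?p)" using IH True unfolding pq(1)[symmetric] by blast
   have co: "real \<kappa> * real (cost h) = real \<kappa> * real (cost ?h) + real \<kappa> * real (fst c)"
    unfolding c(1) by (simp add: algebra_simps)
   have C0: "0 <= ?C" by simp
   have "?C * (1 - ?q / ?p) <= ?C * 1" using p by (intro mult_left_mono C0) auto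
   moreover note IHp
   moreover have "?C * (?L - ln ?p) <= ?C * ?L" using p by (intro mult_left_mono C0) (simp add: ln_ge_zero)
   ultimately have 2: "real \<kappa> * real (cost h) <= ?C * (?L + 1)" using kc co by (simp only: distrib_left)
   have 1: "real \<kappa> * real (cost h) <= ?C * (?L - ln ?q)" if "0 < q0"
   proof -
    have q0: "0 < ?q" using that by simp
    have "1 - ?q / ?p <= - ln (?q / ?p)" using ln_le_minus_one[of "?q / ?p"] p q0 by simp
    also have "\<dots> = ln ?p - ln ?q" using p q0 by (simp add: ln_div)
    finally have "?C * (1 - ?q / ?p) <= ?C * (ln ?p - ln ?q)" by (intro mult_left_mono C0)
    then have "real \<kappa> * real (cost h) <= ?C * (?L - ln ?p) + ?C * (ln ?p - ln ?q)"
     using kc co IHp by linarith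
    then show ?thesis by (simp add: right_diff_distrib)
   qed
   show ?thesis using 1 2 unfolding pq(2) by blast
  qed
 qed
 then show ?thesis by blast
qed

text \<open>The weight of an element is positive only while it has been covered fewer than
  \<open>K\<close> times. Every pick covers such an element, so the sum of the coverages truncated
  at \<open>K\<close> grows in each round until the potential is 0.\<close>

lemma mc_covers:
 assumes E: "distinct E" and X: "set X \<subseteq> set Cs" "\<And>e. e \<in> set E ==> 1 <= covn X e"
  and P: "P < 2 ^ K" and fuel: "length E * K <= length fuel" and e: "e \<in> set E"
 shows "wt P (mc P E Cs fuel) e = 0"
proof -
 let ?\<Phi> = "%h. \<Sum>e\<in>set E. wt P h e" let ?M = "%h. \<Sum>e\<in>set E. min (covn h e) K"
 have act: "covn h e < K" if "0 < wt P h e" for h e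
 proof (rule ccontr)
  assume "\<not> covn h e < K"
  then have "(2::nat) ^ K <= 2 ^ covn h e" by (intro power_increasing) auto
  then have "P < 2 ^ covn h e" using P by linarith
  then show False using that by (simp add: wt_conv)
 qed
 have inv: "?\<Phi> (mc P E Cs fuel) = 0 \<or> length fuel <= ?M (mc P E Cs fuel)" for fuel
 proof (induction fuel rule: rev_induct)
  case (snoc a fuel)
  let ?h = "mc P E Cs fuel"
  have h: "mc P E Cs (fuel @ [a]) = mc_step P E Cs ?h" by (simp add: mc_def)
  show ?case
  proof (cases "0 < ?\<Phi> ?h")
   case False
   then have "\<And>e. e \<in> set E ==> wt P ?h e = 0" by simp
   then have "score P ?h E c = 0" for c using E by (simp add: score_sum)
   then have "mc_step P E Cs ?h = ?h" by (simp add: mc_step_def)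
   then show ?thesis using False h by simp
  next
   case True
   obtain c where c: "mc_step P E Cs ?h = c # ?h" "0 < score P ?h E c"
    using mc_step_pick[OF E X(1,2) order_refl True] by metis
   then obtain e0 where e0: "e0 \<in> set E" "e0 \<in> set (snd (snd c))" "0 < wt P ?h e0"
    unfolding score_sum[OF E] by (metis (mono_tags, lifting) mem_Collect_eq neq0_conv sum.neutral)
   have "?M ?h < ?M (c # ?h)"
   proof (rule sum_strict_mono_ex1)
    show "\<forall>e\<in>set E. min (covn ?h e) K <= min (covn (c # ?h) e) K" by (auto simp: covn_def)
    show "\<exists>e\<in>set E. min (covn ?h e) K < min (covn (c # ?h) e) K"
     using e0 act[OF e0(3)] by (intro bexI[of _ e0]) (auto simp: covn_def)
   qed simp
   moreover have "length fuel <= ?M ?h" using snoc.IH True by auto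
   ultimately show ?thesis unfolding h c(1) by simp
  qed
 qed simp
 let ?h = "mc P E Cs fuel"
 show ?thesis
 proof (rule ccontr)
  assume ne: "wt P ?h e \<noteq> 0"
  then have "length fuel <= ?M ?h" using inv[of fuel] e by auto
  moreover have "?M ?h < (\<Sum>e\<in>set E. K)"
  proof (rule sum_strict_mono_ex1)
   show "\<exists>e\<in>set E. min (covn ?h e) K < K" using ne e act[of ?h e] by (intro bexI[of _ e]) auto
  qed auto
  moreover have "(\<Sum>e\<in>set E. K) = length E * K" using E by (simp add: distinct_card)
  ultimately show False using fuel by simp
 qed
qed

text \<open>With \<open>P = 1\<close> the weight of an element vanishes as soon as it is covered
  once: this is the ordinary greedy algorithm, with one round per element.\<close>

definition sc2 :: cover2 where
 "sc2 ms c es = map (%d. snd (fst (snd d))) (mc 1 (map (%e. (0, e)) es)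
   (map (%i. (nthd 0 c i, ((0, i), map (%e. (0, e)) (nthd [] ms i)))) [0..<length ms]) (map (%e. (0, e)) es))"

text \<open>The last claim compares greedy with a list covering each demanded element
  \<open>\<kappa>\<close> times, at cost divided by \<open>\<kappa>\<close>, hence with a fractional
  cover. The logarithm is that of the number of elements, however many scenarios there are.\<close>

lemma sc2_props:
 assumes cu: "covers_univ ms n" and len: "length c = length ms" and es: "distinct es" "set es \<subseteq> {..<n}"
 shows "set (sc2 ms c es) \<subseteq> {..<length ms}" "set es \<subseteq> cov ms (set (sc2 ms c es))"
  and "set X \<subseteq> {..<length ms} ==> 1 <= \<kappa> ==> (\<And>e. e \<in> set es ==> \<kappa> <= length (filter (%i. e \<in> set (ms ! i)) X)) ==>
   real \<kappa> * real (tot c (set (sc2 ms c es))) <= 2 * (ln (real n + 1) + 1) * real (\<Sum>i\<leftarrow>X. c ! i)"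
proof -
 let ?cd = "%i. (nthd 0 c i, ((0::nat, i), map (%e. (0::nat, e)) (nthd [] ms i)))"
 let ?Cs = "map ?cd [0..<length ms]" let ?E = "map (%e. (0::nat, e)) es"
 define h where "h = mc 1 ?E ?Cs ?E"
 have r: "sc2 ms c es = map (%d. snd (fst (snd d))) h" by (simp add: sc2_def h_def)
 have E: "distinct ?E" using es(1) by (simp add: distinct_map inj_on_def)
 have hC: "set h \<subseteq> ?cd ` {..<length ms}" using mc_subset[of 1 ?E ?Cs ?E] by (auto simp: h_def)
 show "set (sc2 ms c es) \<subseteq> {..<length ms}" using hC by (auto simp: r)
 have cX: "covn (map ?cd X) (0, e) = length (filter (%i. e \<in> set (ms ! i)) X)" if "set X \<subseteq> {..<length ms}" for X e
  using that by (induction X) (auto simp: covn_def nthd_def)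
 have sX: "set (map ?cd X) \<subseteq> set ?Cs" if "set X \<subseteq> {..<length ms}" for X using that by auto
 show "set es \<subseteq> cov ms (set (sc2 ms c es))"
 proof
  fix e assume e: "e \<in> set es"
  have "1 <= covn (map ?cd [0..<length ms]) q" if "q \<in> set ?E" for q
  proof -
   from that obtain e where q: "q = (0, e)" and e: "e \<in> set es" by auto
   then have "e < n" using es(2) by auto
   then obtain i where "i < length ms" "e \<in> set (ms ! i)" by (rule covers_univE[OF cu])
   then have "i \<in> set (filter (%i. e \<in> set (ms ! i)) [0..<length ms])" by simp
   then have "0 < length (filter (%i. e \<in> set (ms ! i)) [0..<length ms])" by (rule length_pos_if_in_set)
   then show ?thesis unfolding q by (subst cX) (auto simp: Suc_le_eq)
  qed
  from mc_covers[OF E sX this, where P = 1 and K = 1 and fuel = ?E and e = "(0, e)"] e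
  have "wt 1 h (0, e) = 0" by (auto simp: h_def atLeast0LessThan)
  then have "covn h (0, e) \<noteq> 0" by (cases "covn h (0, e)") (auto simp: wt_conv)
  then obtain d where "d \<in> set h" "(0, e) \<in> set (snd (snd d))" by (auto simp: covn_def filter_empty_conv)
  moreover then obtain i where "i < length ms" "d = ?cd i" using hC by auto
  ultimately show "e \<in> cov ms (set (sc2 ms c es))" by (force simp: r cov_def nthd_def)
 qed
 assume X: "set X \<subseteq> {..<length ms}" "1 <= \<kappa>" "\<And>e. e \<in> set es ==> \<kappa> <= length (filter (%i. e \<in> set (ms ! i)) X)"
 have "\<kappa> <= covn (map ?cd X) q" if "q \<in> set ?E" for q using that X(3) cX[OF X(1)] by auto
 from mc_cost[OF E sX[OF X(1)] this X(2), where P = 1 and fuel = ?E]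
 have m: "real \<kappa> * real (cost h) <= 2 * real (cost (map ?cd X)) * (ln (real (length es)) + 1)" by (simp add: h_def)
 have "tot c (set (sc2 ms c es)) <= cost h"
 proof -
  have hf: "c ! (snd (fst (snd d))) = fst d" if "d \<in> set h" for d using that hC len by (auto simp: nthd_def)
  have "tot c (set (sc2 ms c es)) <= (\<Sum>i\<leftarrow>sc2 ms c es. c ! i)"
  proof -
   have "tot c (set ys) <= (\<Sum>i\<leftarrow>ys. c ! i)" for ys
    by (induction ys) (auto simp: tot_def sum.insert_if intro: le_trans)
   then show ?thesis .
  qed
  also have "\<dots> = cost h" unfolding r using hf by (simp add: o_def cong: map_cong)
  finally show ?thesis .
 qed
 then have "real \<kappa> * real (tot c (set (sc2 ms c es))) <= real \<kappa> * real (cost h)" by (intro mult_left_mono) auto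
 also note m
 also have "cost (map ?cd X) = (\<Sum>i\<leftarrow>X. c ! i)"
  using X(1) len by (induction X) (auto simp: nthd_def)
 also have "2 * real (\<Sum>i\<leftarrow>X. c ! i) * (ln (real (length es)) + 1) <= 2 * real (\<Sum>i\<leftarrow>X. c ! i) * (ln (real n + 1) + 1)"
 proof -
  have "length es <= n" using card_mono[OF _ es(2)] es(1) by (simp add: distinct_card)
  then have "ln (real (length es)) <= ln (real n + 1)"
   by (cases "length es = 0") (auto intro!: ln_ge_zero)
  then show ?thesis by (intro mult_left_mono) auto
 qed
 finally show "real \<kappa> * real (tot c (set (sc2 ms c es))) <= 2 * (ln (real n + 1) + 1) * real (\<Sum>i\<leftarrow>X. c ! i)"
  by (simp only: mult_ac)
qed

section \<open>Two-stage rounding of the multicover history\<close>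

definition sc_elems :: "(nat \<times> nat list) list => (nat \<times> nat) list" where
 "sc_elems scs = concat (map (%k. map (%e. (k, e)) (snd (nthd (0, []) scs k))) [0..<length scs])"

text \<open>A first-stage candidate, label 0, covers its elements in all scenarios at once; a
  candidate with label \<open>Suc k\<close> covers them in scenario \<open>k\<close> only and costs
  its weighted second-stage price.\<close>

definition sc_cands :: "nat list list => nat list => nat list => nat => (nat \<times> nat list) list => cand list" where
 "sc_cands ms c1 c2 B scs =
   map (%i. (B * nthd 0 c1 i, ((0, i), filter (%p. snd p \<in> set (nthd [] ms i)) (sc_elems scs)))) [0..<length ms] @
   concat (map (%k. map (%i. (fst (nthd (0, []) scs k) * nthd 0 c2 i, ((Suc k, i),
     filter (%p. fst p = k \<and> snd p \<in> set (nthd [] ms i)) (sc_elems scs)))) [0..<length ms]) [0..<length scs])"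

text \<open>With \<open>T\<close> the number of pairs of scenario and element, each pair starts with
  weight \<open>2 ^ (2 * T - 1)\<close> and is to be covered \<open>2 * T\<close> times. The
  logarithm of the initial potential is then itself of order \<open>T\<close>, so a unit of coverage
  costs only a constant times the optimum: the history replaces a solution of the LP
  relaxation.\<close>

definition sc_hist :: "nat list list => nat list => nat list => nat => (nat \<times> nat list) list => cand list" where
 "sc_hist ms c1 c2 B scs = mc (prod_list (map (%_. 2) (sc_elems scs @ sc_elems scs)) div 2) (sc_elems scs)
   (sc_cands ms c1 c2 B scs) (concat (map (%_. sc_elems scs @ sc_elems scs) (sc_elems scs)))"

definition sc1 :: cover1 where
 "sc1 ms c1 c2 B scs = sc2 ms c1 (filter (%e. length (sc_elems scs) <= length (filter (%d. fst (fst (snd d)) = 0 \<and>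
   e \<in> set (nthd [] ms (snd (fst (snd d))))) (sc_hist ms c1 c2 B scs))) (dedup (concat ms)))"

lemma pt_sc2 [pt_intros]: "pt a ==> pt b ==> pt c ==> pt (%x. sc2 (a x) (b x) (c x))"
 by (rule pt_lift3) (unfold sc2_def, intro pt_intros)

lemma pt_sc_elems [pt_intros]: "pt a ==> pt (%x. sc_elems (a x))"
 by (rule pt_compose) (unfold sc_elems_def, intro pt_intros)

lemma pt_sc_cands [pt_intros]: "pt a ==> pt b ==> pt c ==> pt d ==> pt e ==> pt (%x. sc_cands (a x) (b x) (c x) (d x) (e x))"
 by (rule pt_lift5) (unfold sc_cands_def, intro pt_intros)

lemma pt_sc_hist [pt_intros]: "pt a ==> pt b ==> pt c ==> pt d ==> pt e ==> pt (%x. sc_hist (a x) (b x) (c x) (d x) (e x))"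
 by (rule pt_lift5) (unfold sc_hist_def, intro pt_intros)

locale sc_stage =
 fixes ms :: "nat list list" and n :: nat and c1 c2 :: "nat list" and B :: nat and scs :: "(nat \<times> nat list) list"
 assumes cu: "covers_univ ms n" and len: "length c1 = length ms" "length c2 = length ms"
  and H: "\<forall>p\<in>set scs. distinct (snd p) \<and> set (snd p) \<subseteq> {..<n}"
begin

abbreviation "m \<equiv> length ms"
abbreviation "es k \<equiv> set (snd (scs ! k))"
abbreviation "E \<equiv> sc_elems scs"
abbreviation "T \<equiv> length E"
abbreviation "h \<equiv> sc_hist ms c1 c2 B scs"

definition cI where "cI i = (B * c1 ! i, ((0::nat, i), filter (%p. snd p \<in> set (ms ! i)) E))"
definition cS where "cS k i = (fst (scs ! k) * c2 ! i, ((Suc k, i), filter (%p. fst p = k \<and> snd p \<in> set (ms ! i)) E))"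

definition picks where "picks j xs = map (%d. snd (fst (snd d))) (filter (%d. fst (fst (snd d)) = j) (xs :: cand list))"

lemma set_cands: "set (sc_cands ms c1 c2 B scs) = cI ` {..<m} \<union> (\<Union>k<length scs. cS k ` {..<m})"
proof -
 have a: "set (map (%i. (B * nthd 0 c1 i, ((0::nat, i), filter (%p. snd p \<in> set (nthd [] ms i)) E))) [0..<m]) = cI ` {..<m}"
  unfolding set_map using len by (intro image_cong) (auto simp: cI_def nthd_def)
 have b: "set (map (%i. (fst (nthd (0, []) scs k) * nthd 0 c2 i, ((Suc k, i),
     filter (%p. fst p = k \<and> snd p \<in> set (nthd [] ms i)) E))) [0..<m]) = cS k ` {..<m}" if "k < length scs" for k
  unfolding set_map using len that by (intro image_cong) (auto simp: cS_def nthd_def)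
 have c: "set (concat (map f [0..<k])) = (\<Union>j<k. set (f j))" for f :: "nat => cand list" and k
  by (auto simp: atLeast0LessThan)
 show ?thesis unfolding sc_cands_def set_append a c using b by (intro arg_cong2[where f = "(\<union>)"] refl SUP_cong) auto
qed

lemma set_E: "set E = {(k, e). k < length scs \<and> e \<in> es k}"
 by (auto simp: sc_elems_def nthd_def)

lemma es_props: "k < length scs ==> distinct (snd (scs ! k)) \<and> es k \<subseteq> {..<n}"
 using H by (simp add: nth_mem)

lemma distinct_E: "distinct E"
proof -
 have "distinct (concat (map (%k. map (%e. (k, e)) (snd (nthd (0, []) scs k))) [0..<j]))" if "j <= length scs" for j
  using that by (induction j) (auto simp: distinct_map inj_on_def nthd_def es_props)
 then show ?thesis by (simp add: sc_elems_def)
qed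

lemma h_sub: "set h \<subseteq> cI ` {..<m} \<union> (\<Union>k<length scs. cS k ` {..<m})"
 unfolding set_cands[symmetric] sc_hist_def by (rule mc_subset)

lemma cost_split:
 assumes "set xs \<subseteq> cI ` {..<m} \<union> (\<Union>k<length scs. cS k ` {..<m})"
 shows "cost xs = B * (\<Sum>i\<leftarrow>picks 0 xs. c1 ! i) + (\<Sum>k<length scs. fst (scs ! k) * (\<Sum>i\<leftarrow>picks (Suc k) xs. c2 ! i))"
 using assms
proof (induction xs)
 case Nil
 then show ?case by (simp add: picks_def)
next
 case (Cons d xs)
 note IH = Cons.IH[OF subset_trans[OF set_subset_Cons Cons.prems]]
 from Cons.prems have "(\<exists>i<m. d = cI i) \<or> (\<exists>k<length scs. \<exists>i<m. d = cS k i)" by auto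
 then show ?case
 proof (elim disjE exE conjE)
  fix i assume d: "d = cI i"
  have "picks 0 (d # xs) = i # picks 0 xs" "picks (Suc k) (d # xs) = picks (Suc k) xs" for k
   by (auto simp: picks_def d cI_def)
  then show ?case using IH by (simp add: d cI_def algebra_simps)
 next
  fix k i assume k: "k < length scs" and d: "d = cS k i"
  have p: "picks 0 (d # xs) = picks 0 xs" "picks (Suc j) (d # xs) = (if j = k then i # picks (Suc j) xs else picks (Suc j) xs)" for j
   by (auto simp: picks_def d cS_def)
  have "(\<Sum>j<length scs. fst (scs ! j) * (\<Sum>i\<leftarrow>picks (Suc j) (d # xs). c2 ! i)) =
   (\<Sum>j<length scs. fst (scs ! j) * (\<Sum>i\<leftarrow>picks (Suc j) xs. c2 ! i) + (if j = k then fst (scs ! k) * c2 ! i else 0))"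
   unfolding p by (intro sum.cong) (auto simp: algebra_simps)
  also have "\<dots> = (\<Sum>j<length scs. fst (scs ! j) * (\<Sum>i\<leftarrow>picks (Suc j) xs. c2 ! i)) + fst (scs ! k) * c2 ! i"
   using k by (simp add: sum.distrib)
  finally show ?case using IH p(1) by (simp add: d cS_def)
 qed
qed

lemma covn_split:
 assumes "set xs \<subseteq> cI ` {..<m} \<union> (\<Union>k<length scs. cS k ` {..<m})" "(k, e) \<in> set E"
 shows "covn xs (k, e) = length (filter (%i. e \<in> set (ms ! i)) (picks 0 xs)) + length (filter (%i. e \<in> set (ms ! i)) (picks (Suc k) xs))"
 using assms(1)
proof (induction xs)
 case Nil
 then show ?case by (simp add: picks_def covn_def)
next
 case (Cons d xs)
 note IH = Cons.IH[OF subset_trans[OF set_subset_Cons Cons.prems]]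
 from Cons.prems have "(\<exists>i<m. d = cI i) \<or> (\<exists>k<length scs. \<exists>i<m. d = cS k i)" by auto
 then show ?case
 proof (elim disjE exE conjE)
  fix i assume d: "d = cI i"
  have "picks 0 (d # xs) = i # picks 0 xs" "picks (Suc k) (d # xs) = picks (Suc k) xs" for k
   by (auto simp: picks_def d cI_def)
  moreover have "(k, e) \<in> set (snd (snd d)) \<longleftrightarrow> e \<in> set (ms ! i)" using assms(2) by (auto simp: d cI_def)
  ultimately show ?case using IH by (simp add: covn_def)
 next
  fix j i assume d: "d = cS j i"
  have p: "picks 0 (d # xs) = picks 0 xs" "picks (Suc k) (d # xs) = (if k = j then i # picks (Suc k) xs else picks (Suc k) xs)"
   by (auto simp: picks_def d cS_def)
  moreover have "(k, e) \<in> set (snd (snd d)) \<longleftrightarrow> k = j \<and> e \<in> set (ms ! i)" using assms(2) by (auto simp: d cS_def)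
  ultimately show ?case using IH by (cases "k = j") (auto simp: covn_def)
 qed
qed

lemma picks_sub: "set (picks j h) \<subseteq> {..<m}"
 using h_sub by (auto simp: picks_def cI_def cS_def)

text \<open>A feasible solution as a list of candidates that covers each pair once, with which the
  cost of the history is compared.\<close>

lemma solution_cands:
 assumes "x' \<subseteq> {..<m}" "\<And>A. A \<subseteq> {..<n} ==> z' A \<subseteq> {..<m} \<and> A \<subseteq> cov ms (x' \<union> z' A)"
 obtains X where "set X \<subseteq> cI ` {..<m} \<union> (\<Union>k<length scs. cS k ` {..<m})" "\<And>q. q \<in> set E ==> 1 <= covn X q"
  "cost X = B * tot c1 x' + (\<Sum>k<length scs. fst (scs ! k) * tot c2 (z' (es k)))"
proof -
 define ls where "ls S = sorted_list_of_set S" for S :: "nat set"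
 have ls: "set (ls S) = S" "(\<Sum>i\<leftarrow>ls S. f i) = sum f S" if "S \<subseteq> {..<m}" for S and f :: "nat => nat"
  using that finite_subset[of S "{..<m}"] by (simp_all add: ls_def sum_list_distinct_conv_sum_set)
 have zk: "z' (es k) \<subseteq> {..<m}" "es k \<subseteq> cov ms (x' \<union> z' (es k))" if "k < length scs" for k
  using assms(2)[of "es k"] es_props[OF that] by auto
 define X where "X = map cI (ls x') @ concat (map (%k. map (cS k) (ls (z' (es k)))) [0..<length scs])"
 have sX: "set X = cI ` x' \<union> (\<Union>k<length scs. cS k ` z' (es k))"
  using ls(1)[OF assms(1)] ls(1)[OF zk(1)] by (auto simp: X_def)
 show ?thesis
 proof
  show "set X \<subseteq> cI ` {..<m} \<union> (\<Union>k<length scs. cS k ` {..<m})" unfolding sX using assms(1) zk(1) by blast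
  fix q assume q: "q \<in> set E"
  then obtain k e where ke: "q = (k, e)" "k < length scs" "e \<in> es k" by (auto simp: set_E)
  from zk(2)[OF ke(2)] ke(3) obtain i where "i \<in> x' \<or> i \<in> z' (es k)" "e \<in> set (ms ! i)" by (auto simp: cov_def)
  then have "\<exists>d\<in>set X. q \<in> set (snd (snd d))" unfolding sX using ke q
   by (elim disjE) (force simp: cI_def, force simp: cS_def)
  then have "filter (%d. q \<in> set (snd (snd d))) X \<noteq> []" by (auto simp: filter_empty_conv)
  then show "1 <= covn X q" by (simp add: covn_def Suc_le_eq)
 next
  have "cost (map cI (ls x')) = B * tot c1 x'"
   using ls(2)[OF assms(1), of "%i. B * c1 ! i"] by (simp add: o_def cI_def tot_def sum_distrib_left)
  moreover have "cost (concat (map (%k. map (cS k) (ls (z' (es k)))) [0..<j])) = (\<Sum>k<j. fst (scs ! k) * tot c2 (z' (es k)))"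
   if "j <= length scs" for j
   using that
  proof (induction j)
   case (Suc j)
   have "cost (map (cS j) (ls (z' (es j)))) = fst (scs ! j) * tot c2 (z' (es j))"
    using ls(2)[OF zk(1), of j "%i. fst (scs ! j) * c2 ! i"] Suc.prems by (simp add: o_def cS_def tot_def sum_distrib_left)
   with Suc show ?case by simp
  qed simp
  ultimately show "cost X = B * tot c1 x' + (\<Sum>k<length scs. fst (scs ! k) * tot c2 (z' (es k)))"
   by (simp add: X_def)
 qed
qed

lemma weight_exp:
 assumes "0 < T"
 shows "prod_list (map (%_. 2) (E @ E)) div 2 = (2 ^ (2 * T - 1) :: nat)"
proof -
 have "prod_list (map (%_. 2) xs) = (2::nat) ^ length xs" for xs :: "(nat \<times> nat) list" by (induction xs) auto
 then have "prod_list (map (%_. 2) (E @ E)) = (2::nat) ^ Suc (2 * T - 1)" using assms by (simp add: mult_2 power_add)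
 then show ?thesis by simp
qed

lemma hist_cost:
 assumes "0 < T" "x' \<subseteq> {..<m}" "\<And>A. A \<subseteq> {..<n} ==> z' A \<subseteq> {..<m} \<and> A \<subseteq> cov ms (x' \<union> z' A)"
 shows "real (cost h) <= 6 * real T * real (B * tot c1 x' + (\<Sum>k<length scs. fst (scs ! k) * tot c2 (z' (es k))))"
proof -
 obtain X where X: "set X \<subseteq> cI ` {..<m} \<union> (\<Union>k<length scs. cS k ` {..<m})" "\<And>q. q \<in> set E ==> 1 <= covn X q"
  "cost X = B * tot c1 x' + (\<Sum>k<length scs. fst (scs ! k) * tot c2 (z' (es k)))"
  using solution_cands[OF assms(2,3)] by blast
 let ?P = "prod_list (map (%_. 2) (E @ E)) div 2 :: nat"
 have P: "?P = 2 ^ (2 * T - 1)" using assms(1) by (rule weight_exp)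
 have "real 1 * real (cost h) <= 2 * real (cost X) * (ln (real (T * ?P)) + 1)"
  unfolding sc_hist_def by (rule mc_cost[OF distinct_E]) (use X(1,2) set_cands in auto)
 also have "\<dots> <= 2 * real (cost X) * (3 * real T)"
 proof (intro mult_left_mono)
  have "ln (real (T * ?P)) = ln (real T) + real (2 * T - 1) * ln 2"
   unfolding P using assms(1) by (simp add: ln_mult ln_realpow)
  also have "\<dots> <= (real T - 1) + real (2 * T - 1) * 1"
   using ln_le_minus_one[of "real T"] ln_le_minus_one[of 2] assms(1) by (intro add_mono mult_left_mono) auto
  also have "\<dots> <= 3 * real T - 1" using assms(1) by (simp add: of_nat_diff)
  finally show "ln (real (T * ?P)) + 1 <= 3 * real T" by simp
 qed simp
 finally show ?thesis unfolding X(3) by (simp only: mult_ac of_nat_1 mult_1_left)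
qed

text \<open>Final weight 0 means that \<open>2 ^ (2 * T - 1)\<close> is below two to the coverage,
  so the coverage exceeds \<open>2 * T - 1\<close>: the exponent of the initial weight is one less
  than the wanted coverage.\<close>

lemma hist_covers:
 assumes "(k, e) \<in> set E"
 shows "2 * T <= length (filter (%i. e \<in> set (ms ! i)) (picks 0 h)) + length (filter (%i. e \<in> set (ms ! i)) (picks (Suc k) h))"
proof -
 have T: "0 < T" using assms by (cases E) auto
 \<comment> \<open>Greedy cannot get stuck as long as some cover exists; buying all sets in every
   scenario is one.\<close>
 obtain X where X: "set X \<subseteq> cI ` {..<m} \<union> (\<Union>k<length scs. cS k ` {..<m})" "\<And>q. q \<in> set E ==> 1 <= covn X q"
 proof (rule solution_cands[of "{}" "%_. {..<m}"])
  show "{..<m} \<subseteq> {..<m} \<and> A \<subseteq> cov ms ({} \<union> {..<m})" if "A \<subseteq> {..<n}" for A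
   using cu that by (auto simp: covers_univ_def cov_def)
 qed auto
 let ?P = "prod_list (map (%_. 2) (E @ E)) div 2 :: nat"
 have P: "?P = 2 ^ (2 * T - 1)" using T by (rule weight_exp)
 have lf: "length (concat (map (%_. ys) xs)) = length xs * length ys" for xs ys :: "(nat \<times> nat) list"
  by (induction xs) auto
 have "wt ?P h (k, e) = 0"
  unfolding sc_hist_def
 proof (rule mc_covers[OF distinct_E _ X(2) _ _ assms, where K = "2 * T"])
  show "set X \<subseteq> set (sc_cands ms c1 c2 B scs)" using X(1) set_cands by simp
  show "?P < 2 ^ (2 * T)" unfolding P using T by (intro power_strict_increasing) auto
  show "T * (2 * T) <= length (concat (map (%_. E @ E) E))" unfolding lf by simp
 qed
 then have "2 ^ (2 * T - 1) < (2::nat) ^ covn h (k, e)" unfolding wt_conv P by (simp add: div_eq_0_iff)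
 then have "2 * T - 1 < covn h (k, e)" by (rule power_less_imp_less_exp[rotated]) simp
 then show ?thesis using covn_split[OF h_sub assms] by simp
qed

end

text \<open>The demand of the first stage is covered \<open>T\<close> times by the first-stage
  picks, and what a scenario still demands is covered \<open>T\<close> times by the picks for that
  scenario. So \<open>sc2\<close> loses the factor \<open>L / T\<close> on each part of the history,
  in total \<open>L / T * cost h\<close>. As the history costs at most \<open>6 * T\<close> times
  the optimum and the second stage counts twice, the factor is 12 times \<open>L\<close>.\<close>

lemma sc1_approx:
 assumes cu: "covers_univ ms n" and len: "length c1 = length ms" "length c2 = length ms"
  and Hs: "\<And>w es. (w, es) \<in> set H ==> distinct es \<and> set es \<subseteq> {..<n}"
  and x: "x = sc1 ms c1 c2 B (H @ [(u, [0..<n])])"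
 shows "\<exists>Cm. (\<forall>es. distinct es --> set es \<subseteq> {..<n} --> real (tot c2 (set (sc2 ms c2 (unc ms x es)))) <= Cm) \<and>
   (\<forall>x' z'. x' \<subseteq> {..<length ms} --> (\<forall>A\<subseteq>{..<n}. z' A \<subseteq> {..<length ms} \<and> A \<subseteq> cov ms (x' \<union> z' A)) -->
    real B * real (tot c1 (set x)) +
     2 * ((\<Sum>(w, es)\<leftarrow>H. real w * real (tot c2 (set (sc2 ms c2 (unc ms x es))))) + real u * Cm)
    <= 24 * (ln (real n + 1) + 1) * (real B * real (tot c1 x') +
     ((\<Sum>(w, es)\<leftarrow>H. real w * real (tot c2 (z' (set es)))) + real u * real (tot c2 (z' {..<n})))))"
proof -
 let ?scs = "H @ [(u, [0..<n])]" let ?K = "length H"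
 have "\<forall>p\<in>set ?scs. distinct (snd p) \<and> set (snd p) \<subseteq> {..<n}" using Hs by force
 then interpret sc_stage ms n c1 c2 B ?scs using cu len by unfold_locales auto
 define E1 where "E1 = filter (%e. T <= length (filter (%d. fst (fst (snd d)) = 0 \<and>
   e \<in> set (nthd [] ms (snd (fst (snd d))))) h)) (dedup (concat ms))"
 have x: "x = sc2 ms c1 E1" by (simp add: x sc1_def E1_def)
 have cnt0: "length (filter (%d. fst (fst (snd d)) = 0 \<and> e \<in> set (nthd [] ms (snd (fst (snd d))))) h) =
   length (filter (%i. e \<in> set (ms ! i)) (picks 0 h))" for e
 proof -
  have "filter (%d. fst (fst (snd d)) = 0 \<and> e \<in> set (nthd [] ms (snd (fst (snd d))))) h =
    filter (%d. e \<in> set (ms ! (snd (fst (snd d))))) (filter (%d. fst (fst (snd d)) = 0) h)"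
   unfolding filter_filter using h_sub by (intro filter_cong refl) (auto simp: nthd_def cI_def cS_def)
  then show ?thesis by (simp add: picks_def filter_map o_def)
 qed
 have E1: "distinct E1" "set E1 \<subseteq> {..<n}" "\<And>e. e \<in> set E1 ==> T <= length (filter (%i. e \<in> set (ms ! i)) (picks 0 h))"
  using set_concat_univ[OF cu] unfolding E1_def cnt0 by (auto simp del: set_concat)
 have E1': "T <= length (filter (%i. e \<in> set (ms ! i)) (picks 0 h)) ==> e < n ==> e \<in> set E1" for e
  using set_concat_univ[OF cu] unfolding E1_def cnt0 by (auto simp del: set_concat)
 note x2 = sc2_props[OF cu len(1) E1(1,2)]
 have xm: "set x \<subseteq> {..<m}" and xc: "set E1 \<subseteq> cov ms (set x)" using x2(1,2) by (auto simp: x)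
 define L where "L = 2 * (ln (real n + 1) + 1)"
 have L0: "0 <= L" unfolding L_def by (simp add: ln_ge_zero)
 define C where "C k = real (\<Sum>i\<leftarrow>picks (Suc k) h. c2 ! i)" for k
 have C0: "0 <= C k" for k unfolding C_def by (rule of_nat_0_le_iff)
 have ub: "real T * real (tot c2 (set (sc2 ms c2 (unc ms x y)))) <= L * C k"
  if y: "distinct y" "set y \<subseteq> {..<n}" "k < length ?scs" "set y \<subseteq> es k" "0 < T" for y k
  unfolding L_def C_def
 proof (rule sc2_props(3)[OF cu len(2)])
  show "distinct (unc ms x y)" using y(1) by (rule distinct_unc)
  show "set (unc ms x y) \<subseteq> {..<n}" using y(2) set_unc[OF xm] by auto
  show "1 <= T" using y(5) by (simp add: Suc_le_eq)
  show "set (picks (Suc k) h) \<subseteq> {..<m}" by (rule picks_sub)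
  fix e assume "e \<in> set (unc ms x y)"
  then have e: "e \<in> set y" "e \<notin> cov ms (set x)" using set_unc[OF xm] by auto
  then have "e \<notin> set E1" "e < n" using xc y(2) by auto
  then have "length (filter (%i. e \<in> set (ms ! i)) (picks 0 h)) < T" using E1'[of e] by linarith
  moreover have "(k, e) \<in> set E" using y e(1) by (auto simp: set_E)
  ultimately show "T <= length (filter (%i. e \<in> set (ms ! i)) (picks (Suc k) h))" using hist_covers[of k e] by linarith
 qed
 have sums: "(\<Sum>k<length ?scs. real (fst (?scs ! k)) * F k (snd (?scs ! k))) =
   (\<Sum>k<?K. real (fst (H ! k)) * F k (snd (H ! k))) + real u * F ?K [0..<n]" for F :: "nat => nat list => real"
  by (simp add: nth_append)
 have sH: "(\<Sum>(w, es)\<leftarrow>H. real w * F es) = (\<Sum>k<?K. real (fst (H ! k)) * F (snd (H ! k)))" for F :: "nat list => real"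
  by (simp add: sum_list_sum_nth case_prod_beta lessThan_atLeast0)
 show ?thesis
 proof (cases "0 < T")
  \<comment> \<open>The full scenario is among the scenarios, so without pairs the ground set is
    empty. This case is separate because the other one divides by \<open>T\<close>.\<close>
  case False
  then have "E = []" by simp
  then have "set E = {}" by simp
  then have n0: "n = 0" unfolding set_E by (auto dest!: spec[of _ ?K] simp: nth_append)
  have e0: "sc2 ms c [] = []" for c by (simp add: sc2_def mc_def)
  have "E1 = []" using E1(2) n0 by auto
  then have x0: "x = []" by (simp add: x e0)
  have "unc ms x y = []" if "set y \<subseteq> {..<n}" for y using that n0 by (simp add: unc_def)
  then have t0: "tot c2 (set (sc2 ms c2 (unc ms x y))) = 0" if "set y \<subseteq> {..<n}" for y using that by (simp add: e0 tot_def)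
  have s0: "(\<Sum>(w, es)\<leftarrow>H. real w * real (tot c2 (set (sc2 ms c2 (unc ms x es))))) = 0"
   unfolding sH
  proof (intro sum.neutral ballI)
   fix k assume "k \<in> {..<?K}"
   then have "set (snd (H ! k)) \<subseteq> {..<n}" using Hs[of "fst (H ! k)" "snd (H ! k)"] by simp
   then show "real (fst (H ! k)) * real (tot c2 (set (sc2 ms c2 (unc ms x (snd (H ! k)))))) = 0" using t0 by simp
  qed
  have tx: "tot c1 (set x) = 0" by (simp add: x0 tot_def)
  show ?thesis
  proof (intro exI[of _ 0] conjI allI impI)
   show "real (tot c2 (set (sc2 ms c2 (unc ms x es)))) <= 0" if "set es \<subseteq> {..<n}" for es using t0[OF that] by simp
   fix x' z'
   have "0 <= (\<Sum>(w, es)\<leftarrow>H. real w * real (tot c2 (z' (set es))))" unfolding sH by (intro sum_nonneg) auto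
   then have "0 <= 24 * (ln (real n + 1) + 1) * (real B * real (tot c1 x') +
     ((\<Sum>(w, es)\<leftarrow>H. real w * real (tot c2 (z' (set es)))) + real u * real (tot c2 (z' {..<n}))))"
    by (intro mult_nonneg_nonneg add_nonneg_nonneg) (auto simp: ln_ge_zero)
   then show "real B * real (tot c1 (set x)) +
     2 * ((\<Sum>(w, es)\<leftarrow>H. real w * real (tot c2 (set (sc2 ms c2 (unc ms x es))))) + real u * 0)
    <= 24 * (ln (real n + 1) + 1) * (real B * real (tot c1 x') +
     ((\<Sum>(w, es)\<leftarrow>H. real w * real (tot c2 (z' (set es)))) + real u * real (tot c2 (z' {..<n}))))"
    unfolding s0 tx by simp
  qed
 next
  case T: True
  define Cm where "Cm = L * C ?K / real T"
  show ?thesis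
  proof (intro exI[of _ Cm] conjI allI impI)
   fix y assume "distinct y" "set y \<subseteq> {..<n}"
   then have "real T * real (tot c2 (set (sc2 ms c2 (unc ms x y)))) <= L * C ?K" using T by (intro ub) auto
   then show "real (tot c2 (set (sc2 ms c2 (unc ms x y)))) <= Cm" using T by (simp add: Cm_def field_simps)
  next
   fix x' z' assume x': "x' \<subseteq> {..<m}" and z': "\<forall>A\<subseteq>{..<n}. z' A \<subseteq> {..<m} \<and> A \<subseteq> cov ms (x' \<union> z' A)"
   define OPT where "OPT = real B * real (tot c1 x') +
     ((\<Sum>(w, es)\<leftarrow>H. real w * real (tot c2 (z' (set es)))) + real u * real (tot c2 (z' {..<n})))"
   let ?S = "\<Sum>(w, es)\<leftarrow>H. real w * real (tot c2 (set (sc2 ms c2 (unc ms x es))))"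
   have opt: "real (B * tot c1 x' + (\<Sum>k<length ?scs. fst (?scs ! k) * tot c2 (z' (es k)))) = OPT"
    using sums[of "%k es. real (tot c2 (z' (set es)))"]
    unfolding OPT_def sH by (simp add: atLeast0LessThan)
   have hc: "real (cost h) <= 6 * real T * OPT" using hist_cost[OF T x', of z'] z' unfolding opt by simp
   have a: "real T * (real B * real (tot c1 (set x))) <= L * (real B * real (\<Sum>i\<leftarrow>picks 0 h. c1 ! i))"
   proof -
    have "real T * real (tot c1 (set x)) <= L * real (\<Sum>i\<leftarrow>picks 0 h. c1 ! i)"
     unfolding x L_def using T by (intro x2(3) picks_sub E1(3)) (auto simp: Suc_le_eq)
    from mult_left_mono[OF this, of "real B"] show ?thesis by (simp only: mult_ac of_nat_0_le_iff)
   qed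
   have b: "real T * ?S <= L * (\<Sum>k<?K. real (fst (H ! k)) * C k)"
    unfolding sH sum_distrib_left
   proof (rule sum_mono)
    fix k assume k: "k \<in> {..<?K}"
    then have "distinct (snd (H ! k)) \<and> set (snd (H ! k)) \<subseteq> {..<n}" using Hs[of "fst (H ! k)" "snd (H ! k)"] by (simp add: nth_mem)
    then have "real T * real (tot c2 (set (sc2 ms c2 (unc ms x (snd (H ! k)))))) <= L * C k"
     using k T by (intro ub) (auto simp: nth_append)
    from mult_left_mono[OF this, of "real (fst (H ! k))"]
    show "real T * (real (fst (H ! k)) * real (tot c2 (set (sc2 ms c2 (unc ms x (snd (H ! k))))))) <= L * (real (fst (H ! k)) * C k)"
     by (simp only: mult_ac of_nat_0_le_iff)
   qed
   have c: "real (cost h) = real B * real (\<Sum>i\<leftarrow>picks 0 h. c1 ! i) + ((\<Sum>k<?K. real (fst (H ! k)) * C k) + real u * C ?K)"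
    using cost_split[OF h_sub] sums[of "%k _. C k"] by (simp add: C_def)
   have "real T * (real B * real (tot c1 (set x)) + 2 * (?S + real u * Cm)) <= 2 * (L * real (cost h))"
   proof -
    have "real T * (real u * Cm) = L * (real u * C ?K)" using T by (simp add: Cm_def)
    moreover have "0 <= real T * (real B * real (tot c1 (set x)))" by simp
    ultimately show ?thesis using a b unfolding c distrib_left by linarith
   qed
   also have "\<dots> <= 2 * (L * (6 * real T * OPT))" using hc L0 by (intro mult_left_mono) auto
   also have "\<dots> = real T * (24 * (ln (real n + 1) + 1) * OPT)" by (simp add: L_def mult_ac)
   finally have "real T * (real B * real (tot c1 (set x)) + 2 * (?S + real u * Cm)) <= real T * (24 * (ln (real n + 1) + 1) * OPT)" .
   then show "real B * real (tot c1 (set x)) + 2 * (?S + real u * Cm) <= 24 * (ln (real n + 1) + 1) * (real B * real (tot c1 x') +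
     ((\<Sum>(w, es)\<leftarrow>H. real w * real (tot c2 (z' (set es)))) + real u * real (tot c2 (z' {..<n}))))"
    unfolding OPT_def[symmetric] by (rule mult_left_le_imp_le) (use T in simp)
  qed
 qed
qed

theorem set_cover_log_approx:
 "\<exists>\<rho> :: nat => real. \<rho> \<in> O(%n. ln (real n)) \<and>
   has_approx_algorithm set_cover_problems (%P \<epsilon>. \<rho> (card (ground P)))"
proof (intro exI conjI)
 let ?\<rho> = "%n. 24 * (ln (real n + 1) + 1)"
 show "(%n. 4 * ?\<rho> n) \<in> O(%n. ln (real n))"
 \<comment> \<open>288 = 4 * 24 * 3: the 4 bounds \<open>(1 + \<epsilon>)\<^sup>2\<close>, and from
   \<open>n = 3\<close> on, \<open>ln (n + 1) + 1\<close> is at most three times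
   \<open>ln n\<close>, because \<open>ln n\<close> is at least 1 and \<open>n + 1\<close> at most
   the square of \<open>n\<close>.\<close>
 proof (rule bigoI[where c = 288])
  show "\<forall>\<^sub>F n in sequentially. norm (4 * ?\<rho> n) <= 288 * norm (ln (real n))"
   using eventually_ge_at_top[of 3]
  proof eventually_elim
   case (elim n)
   have "ln (exp 1) <= ln (real n)" using elim exp_le by (intro ln_mono) auto
   then have 1: "1 <= ln (real n)" by simp
   have "ln (real n + 1) <= ln (real n * real n)"
   proof (intro ln_mono)
    have "3 * real n <= real n * real n" using elim by (intro mult_right_mono) auto
    then show "real n + 1 <= real n * real n" using elim by linarith
   qed auto
   also have "\<dots> = 2 * ln (real n)" using elim by (simp add: ln_mult)
   finally show ?case using 1 by simp
  qed
 qed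
 let ?\<I> = "{I :: set_cover_inst. inj_on (members I) {..<nsets I} \<and> (\<Union>i<nsets I. members I i) = {..<nelems I} \<and>
     valid_costs {..<nsets I} (scost1 I) (scost2 I)}"
 show "has_approx_algorithm set_cover_problems (%P \<epsilon>. 4 * ?\<rho> (card (ground P)))"
  unfolding set_cover_problems_def
 proof (rule set_cover_approx[where ?a1.0 = sc1 and ?a2.0 = sc2 and ok = covers_univ and \<rho> = ?\<rho>])
  show "pt (%p. sc1 (fst p) (fst (snd p)) (fst (snd (snd p))) (fst (snd (snd (snd p)))) (snd (snd (snd (snd p)))))"
   unfolding sc1_def by (intro pt_intros)
  show "pt (%p. sc2 (fst p) (fst (snd p)) (snd (snd p)))" by (intro pt_intros)
  fix I :: set_cover_inst assume I: "I \<in> ?\<I>"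
  let ?ms = "map (%i. dec (set_encode (members I i))) [0..<nsets I]"
  have s: "set (?ms ! i) = members I i" if "i < nsets I" for i
  proof -
   have "members I i \<subseteq> {..<nelems I}" using I that by blast
   then show ?thesis using that finite_subset by (simp add: finite_subset)
  qed
  have "(\<Union>i<length ?ms. set (?ms ! i)) = (\<Union>i<nsets I. members I i)" using s by (intro SUP_cong) auto
  then show "(\<Union>i<nsets I. members I i) = {..<nelems I} \<and> valid_costs {..<nsets I} (scost1 I) (scost2 I) \<and> covers_univ ?ms (nelems I)"
   using I by (simp add: covers_univ_def)
 next
  fix n :: nat show "0 < ?\<rho> n" by (simp add: add_nonneg_pos ln_ge_zero)
 next
  fix I :: set_cover_inst and \<epsilon> :: real assume e: "0 < \<epsilon>" "\<epsilon> < 1"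
  have "(1 + \<epsilon>)\<^sup>2 <= 2\<^sup>2" using e by (intro power_mono) auto
  then have "?\<rho> (nelems I) * (1 + \<epsilon>)\<^sup>2 <= ?\<rho> (nelems I) * 4" by (intro mult_left_mono) (auto simp: ln_ge_zero)
  then show "?\<rho> (nelems I) * (1 + \<epsilon>)\<^sup>2 <= 4 * ?\<rho> (card (ground (set_cover_problem I)))"
   by (simp add: set_cover_problem_def)
 next
  fix ms n and c2 es :: "nat list" assume *: "covers_univ ms n" "length c2 = length ms" "distinct es" "set es \<subseteq> {..<n}"
  show "set (sc2 ms c2 es) \<subseteq> {..<length ms} \<and> set es \<subseteq> cov ms (set (sc2 ms c2 es))" using sc2_props(1,2)[OF *] by simp
  fix S assume S: "S \<subseteq> {..<length ms}" "set es \<subseteq> cov ms S"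
  let ?X = "sorted_list_of_set S"
  have fS: "finite S" using S(1) finite_subset by blast
  have "1 <= length (filter (%i. e \<in> set (ms ! i)) ?X)" if e: "e \<in> set es" for e
  proof -
   obtain i where "i \<in> S" "e \<in> set (ms ! i)" using S(2) e by (auto simp: cov_def)
   then have "i \<in> set (filter (%i. e \<in> set (ms ! i)) ?X)" using fS by simp
   then have "0 < length (filter (%i. e \<in> set (ms ! i)) ?X)" by (rule length_pos_if_in_set)
   then show ?thesis by (simp add: Suc_le_eq)
  qed
  then have "real 1 * real (tot c2 (set (sc2 ms c2 es))) <= 2 * (ln (real n + 1) + 1) * real (\<Sum>i\<leftarrow>?X. c2 ! i)"
   using S(1) fS by (intro sc2_props(3)[OF *]) auto
  also have "(\<Sum>i\<leftarrow>?X. c2 ! i) = tot c2 S" using fS by (simp add: tot_def sum_list_distinct_conv_sum_set)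
  also have "2 * (ln (real n + 1) + 1) * real (tot c2 S) <= ?\<rho> n * real (tot c2 S)"
   by (intro mult_right_mono) (auto simp: ln_ge_zero)
  finally show "real (tot c2 (set (sc2 ms c2 es))) <= ?\<rho> n * real (tot c2 S)" by simp
 next
  fix ms n B u and c1 c2 :: "nat list" and H :: "(nat \<times> nat list) list"
  assume *: "covers_univ ms n" "length c1 = length ms"
  show "set (sc1 ms c1 c2 B (H @ [(u, [0..<n])])) \<subseteq> {..<length ms}"
   unfolding sc1_def using set_concat_univ[OF *(1)] by (intro sc2_props(1)[OF *]) (auto simp del: set_concat)
 next
  fix ms n B u x and c1 c2 :: "nat list" and H :: "(nat \<times> nat list) list"
  assume *: "covers_univ ms n" "length c1 = length ms" "length c2 = length ms"
   and Hs: "\<And>w es. (w, es) \<in> set H ==> distinct es \<and> set es \<subseteq> {..<n}" and x: "x = sc1 ms c1 c2 B (H @ [(u, [0..<n])])"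
  show "\<exists>Cm. (\<forall>es. distinct es --> set es \<subseteq> {..<n} --> real (tot c2 (set (sc2 ms c2 (unc ms x es)))) <= Cm) \<and>
   (\<forall>x' z'. x' \<subseteq> {..<length ms} --> (\<forall>A\<subseteq>{..<n}. z' A \<subseteq> {..<length ms} \<and> A \<subseteq> cov ms (x' \<union> z' A)) -->
    real B * real (tot c1 (set x)) +
     2 * ((\<Sum>(w, es)\<leftarrow>H. real w * real (tot c2 (set (sc2 ms c2 (unc ms x es))))) + real u * Cm)
    <= ?\<rho> n * (real B * real (tot c1 x') +
     ((\<Sum>(w, es)\<leftarrow>H. real w * real (tot c2 (z' (set es)))) + real u * real (tot c2 (z' {..<n})))))"
   by (rule sc1_approx[OF * _ x]) (rule Hs)
 qed
qed

section \<open>Facility location\<close>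

definition at2 :: "nat list list => nat => nat => nat" where
 "at2 M i j = nthd 0 (nthd [] M i) j"

text \<open>What the clients contribute to opening a facility when the radius is \<open>g\<close>.
  An entry consists of a weight, a cap on what the client offers, and the distance.\<close>

definition gain :: "nat => (nat \<times> nat \<times> nat) list => nat" where
 "gain g ps = sum_list (map (%q. fst q * (min g (fst (snd q)) - snd (snd q))) ps)"

definition top2 :: "bool list => nat" where
 "top2 fuel = prod_list (map (%_. 2) fuel)"

text \<open>Bisection for the largest \<open>g\<close> below \<open>2 ^ length fuel\<close> with \<open>gain g ps < f\<close>; the second component is the step width.\<close>

definition bisect :: "nat => (nat \<times> nat \<times> nat) list => bool list => nat \<times> nat => nat \<times> nat" where
 "bisect f ps = fold (%_ s. (if gain (fst s + snd s div 2) ps < f then fst s + snd s div 2 else fst s, snd s div 2))"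

text \<open>The radius of Mettu and Plaxton, at which the contributions pay for the facility,
  rounded up to an integer.\<close>

definition rad :: "bool list => nat => (nat \<times> nat \<times> nat) list => nat" where
 "rad fuel f ps = (if f = 0 then 0 else Suc (fst (bisect f ps fuel (0, top2 fuel))))"

text \<open>Because of the caps, a facility may be unaffordable at every radius; such facilities are
  filtered out.\<close>

definition fl_cands :: "bool list => (nat \<times> (nat \<times> nat \<times> nat) list) list => (nat \<times> nat) list" where
 "fl_cands fuel fps = filter (%c. fst (nthd (0, []) fps (snd c)) <= gain (fst c) (snd (nthd (0, []) fps (snd c))))
   (map (%i. (rad fuel (fst (nthd (0, []) fps i)) (snd (nthd (0, []) fps i)), i)) [0..<length fps])"

text \<open>The dual variable of client \<open>j\<close>: the least value at which \<open>j\<close>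
  is within reach of a candidate and the candidate is paid for. Without candidates the default acts
  as infinity.\<close>

definition fl_reach :: "bool list => nat list list => (nat \<times> nat) list => nat => nat" where
 "fl_reach fuel dm cs j = best (<) (top2 fuel) (map (%c. max (fst c) (at2 dm (snd c) j)) cs)"

definition fl_cands2 :: "bool list => nat list list => nat list => nat list => (nat \<times> nat) list" where
 "fl_cands2 fuel dm f2 es =
   fl_cands fuel (map (%i. (nthd 0 f2 i, map (%j. (1, (top2 fuel, at2 dm i j))) es)) [0..<length dm])"

text \<open>A client of a scenario is capped at its reach within that scenario: it contributes to
  the first stage no more than being served in the second stage is worth to it.\<close>

definition fl_cands1 ::
 "bool list => nat list list => nat list => nat list => nat => (nat \<times> nat list) list => (nat \<times> nat) list" where
 "fl_cands1 fuel dm f1 f2 B scs = fl_cands fuel (map (%i. (B * nthd 0 f1 i,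
   concat (map (%p. let cs = fl_cands2 fuel dm f2 (snd p) in
    map (%j. (fst p, (fl_reach fuel dm cs j, at2 dm i j))) (snd p)) scs))) [0..<length dm])"

definition blocked :: "nat list list => nat list => (nat \<times> nat) list => nat \<times> nat => bool" where
 "blocked ff pre acc c \<longleftrightarrow> list_ex (%i. at2 ff (snd c) i <= 2 * fst c) (pre @ map snd acc)"

definition mp_step :: "nat list list => nat list => (nat \<times> nat) list => (nat \<times> nat) list => (nat \<times> nat) list" where
 "mp_step ff pre cs acc = (let fr = filter (%c. \<not> blocked ff pre acc c) cs in
   if fr = [] then acc else best (%a b. fst a < fst b) (0, 0) fr # acc)"

text \<open>Mettu and Plaxton's greedy: open the facility of least radius that has no open facility within twice its radius.\<close>

definition mp :: "nat list list => nat list => (nat \<times> nat) list => nat list => (nat \<times> nat) list" where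
 "mp ff pre cs fuel = fold (%_ acc. mp_step ff pre cs acc) fuel []"

definition fl_open :: "nat list list => nat list => (nat \<times> nat) list => nat list" where
 "fl_open ff pre cs = dedup (map snd (mp ff pre cs (map snd cs)))"

definition fl_assign :: "nat list list => nat list => nat => nat" where
 "fl_assign dm ops j = best (%a b. at2 dm a j < at2 dm b j) 0 ops"

definition fl_cost :: "nat list list => nat list => nat list => nat list => nat list => nat" where
 "fl_cost dm f2 x z es = sum_list (map (nthd 0 f2) z) + sum_list (map (%j. at2 dm (fl_assign dm (x @ z) j) j) es)"

text \<open>The facilities opened for the whole client set are kept as an alternative. On any subset
  they cost at most what they cost on all clients, and this supplies the bound that is uniform over
  all scenarios.\<close>

definition fl2 :: "nat list list \<times> nat list list => nat list \<times> bool list => nat list => nat list => nat list => nat list" where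
 "fl2 M F U x es = (let a = fl_open (snd M) x (fl_cands2 (snd F) (fst M) (fst F) es);
    b = fl_open (snd M) x (fl_cands2 (snd F) (fst M) (fst F) U)
   in if fl_cost (fst M) (fst F) x a es <= fl_cost (fst M) (fst F) x b es then a else b)"

lemma pt_at2 [pt_intros]: "pt a ==> pt b ==> pt c ==> pt (%x. at2 (a x) (b x) (c x))"
 by (rule pt_lift3) (unfold at2_def, intro pt_intros)
lemma pt_gain [pt_intros]: "pt a ==> pt b ==> pt (%x. gain (a x) (b x))"
 by (rule pt_lift2) (unfold gain_def, intro pt_intros)
lemma pt_top2 [pt_intros]: "pt a ==> pt (%x. top2 (a x))"
 by (rule pt_compose) (unfold top2_def, intro pt_intros)

lemma top2_conv: "top2 fuel = 2 ^ length fuel"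
 by (induction fuel) (auto simp: top2_def)

text \<open>For positive \<open>f\<close>, the contributions at \<open>g\<close> do not yet pay for
  the facility, while those at the upper end of the current interval do, unless that end is still
  the top of the whole range.\<close>

lemma bisect_inv:
 "\<exists>g. bisect f ps xs (0, 2 ^ (length xs + e)) = (g, 2 ^ e) \<and> g + 2 ^ e <= 2 ^ (length xs + e) \<and>
  (0 < f --> gain g ps < f) \<and> (f <= gain (g + 2 ^ e) ps \<or> g + 2 ^ e = 2 ^ (length xs + e))"
proof (induction xs arbitrary: e rule: rev_induct)
 case Nil
 have "gain 0 ps = 0" by (induction ps) (auto simp: gain_def)
 then show ?case by (simp add: bisect_def)
next
 case (snoc x xs)
 from snoc.IH[of "Suc e"] obtain g where g: "bisect f ps xs (0, 2 ^ (length xs + Suc e)) = (g, 2 ^ Suc e)"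
  "g + 2 ^ Suc e <= 2 ^ (length xs + Suc e)" "0 < f --> gain g ps < f"
  "f <= gain (g + 2 ^ Suc e) ps \<or> g + 2 ^ Suc e = 2 ^ (length xs + Suc e)" by blast
 have "bisect f ps (xs @ [x]) (0, 2 ^ (length (xs @ [x]) + e)) = (if gain (g + 2 ^ e) ps < f then g + 2 ^ e else g, 2 ^ e)"
  using g(1) by (simp add: bisect_def)
 then show ?case using g(2-4) by (cases "gain (g + 2 ^ e) ps < f") (auto simp: mult_2 add_ac)
qed

lemma pt_rad [pt_intros]:
 assumes "pt a" "pt b" "pt c"
 shows "pt (%x. rad (a x) (b x) (c x))"
proof -
 have "pt (%x. bisect (b x) (c x) (a x) (0, top2 (a x)))"
  unfolding bisect_def
 proof (rule pt_fold[where h = "%x _ s. (if gain (fst s + snd s div 2) (c x) < b x then fst s + snd s div 2 else fst s, snd s div 2)"])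
  show "pbd (%x. 10 + 4 * sz (a x))" by (intro pbd_add pbd_const pbd_mult pt_sz assms)
  show "sz (fold (%_ s. (if gain (fst s + snd s div 2) (c x) < b x then fst s + snd s div 2 else fst s, snd s div 2))
    (take n (a x)) (0, top2 (a x))) <= 10 + 4 * sz (a x)" if "n <= length (a x)" for x n
  proof -
   let ?L = "length (a x)"
   from bisect_inv[of "b x" "c x" "take n (a x)" "?L - n"] that obtain g where
    g: "bisect (b x) (c x) (take n (a x)) (0, 2 ^ ?L) = (g, 2 ^ (?L - n))" "g + 2 ^ (?L - n) <= 2 ^ ?L" by auto
   have "(0::nat) < 2 ^ (?L - n)" by simp
   moreover have "(2::nat) ^ Suc ?L = 2 * 2 ^ ?L" by simp
   ultimately have gb: "g < 2 ^ Suc ?L" "2 ^ (?L - n) < (2::nat) ^ Suc ?L" using g(2) by linarith+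
   show ?thesis using sz_less_power[OF gb(1)] sz_less_power[OF gb(2)] g(1) length_le_sz[of "a x"] by (simp add: bisect_def top2_conv)
  qed
 qed (intro pt_intros assms pt_compose[OF assms(2)] pt_compose[OF assms(3)])+
 then show ?thesis unfolding rad_def by (intro pt_intros assms)
qed

lemma pt_fl_cands [pt_intros]: "pt a ==> pt b ==> pt (%x. fl_cands (a x) (b x))"
 by (rule pt_lift2) (unfold fl_cands_def, intro pt_intros)
lemma pt_fl_reach [pt_intros]: "pt a ==> pt b ==> pt c ==> pt d ==> pt (%x. fl_reach (a x) (b x) (c x) (d x))"
 by (rule pt_lift4) (unfold fl_reach_def, intro pt_intros)
lemma pt_fl_cands2 [pt_intros]: "pt a ==> pt b ==> pt c ==> pt d ==> pt (%x. fl_cands2 (a x) (b x) (c x) (d x))"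
 by (rule pt_lift4) (unfold fl_cands2_def, intro pt_intros)
lemma pt_fl_cands1 [pt_intros]:
 assumes "pt a" "pt b" "pt c" "pt d" "pt e" "pt f"
 shows "pt (%x. fl_cands1 (a x) (b x) (c x) (d x) (e x) (f x))"
proof -
 have "pt (%p. fl_cands1 (fst (fst p)) (snd (fst p)) (fst (snd p)) (fst (snd (snd p))) (fst (snd (snd (snd p)))) (snd (snd (snd (snd p)))))"
  unfolding fl_cands1_def by (intro pt_intros)
 from pt_compose[OF this pt_Pair[OF pt_Pair[OF assms(1,2)] pt_Pair[OF assms(3) pt_Pair[OF assms(4) pt_Pair[OF assms(5,6)]]]]]
 show ?thesis by simp
qed
lemma pt_blocked [pt_intros]: "pt a ==> pt b ==> pt c ==> pt d ==> pt (%x. blocked (a x) (b x) (c x) (d x))"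
 by (rule pt_lift4) (unfold blocked_def, intro pt_intros)
lemma pt_mp_step [pt_intros]: "pt a ==> pt b ==> pt c ==> pt d ==> pt (%x. mp_step (a x) (b x) (c x) (d x))"
 by (rule pt_lift4) (unfold mp_step_def, intro pt_intros)

lemma mp_step_cases: "mp_step ff pre cs acc = acc \<and> (\<forall>c\<in>set cs. blocked ff pre acc c) \<or>
  (\<exists>c\<in>set cs. mp_step ff pre cs acc = c # acc \<and> \<not> blocked ff pre acc c \<and>
   (\<forall>c'\<in>set cs. \<not> blocked ff pre acc c' --> fst c <= fst c'))"
proof (cases "filter (%c. \<not> blocked ff pre acc c) cs = []")
 case True
 then show ?thesis by (auto simp: mp_step_def filter_empty_conv)
next
 case False
 let ?c = "best (%a b. fst a < fst b) (0, 0) (filter (%c. \<not> blocked ff pre acc c) cs)"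
 have "?c \<in> set cs \<and> \<not> blocked ff pre acc ?c" using best_in[OF False] by auto
 moreover have "fst ?c <= fst c'" if "c' \<in> set cs" "\<not> blocked ff pre acc c'" for c'
  by (rule best_key_min) (use that in simp)
 ultimately show ?thesis using False by (intro disjI2 bexI[of _ ?c]) (auto simp: mp_step_def Let_def)
qed

lemma mp_snoc: "mp ff pre cs (xs @ [x]) = mp_step ff pre cs (mp ff pre cs xs)" and mp_Nil: "mp ff pre cs [] = []"
 by (simp_all add: mp_def)

lemma sz_mp: "sz (mp ff pre cs xs) <= 1 + length xs * sz cs"
proof (induction xs rule: rev_induct)
 case (snoc x xs)
 from mp_step_cases[of ff pre cs "mp ff pre cs xs"]
 have "sz (mp_step ff pre cs (mp ff pre cs xs)) <= sz (mp ff pre cs xs) + sz cs"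
 proof (elim disjE bexE conjE)
  fix c assume c: "c \<in> set cs" "mp_step ff pre cs (mp ff pre cs xs) = c # mp ff pre cs xs"
  show ?thesis unfolding c(2) using sz_mem[OF c(1)] by simp
 qed simp
 then show ?case using snoc by (simp add: mp_snoc)
qed (simp add: mp_Nil)

lemma pt_mp [pt_intros]:
 assumes "pt a" "pt b" "pt c" "pt d"
 shows "pt (%x. mp (a x) (b x) (c x) (d x))"
 unfolding mp_def
proof (rule pt_fold[where h = "%x _ s. mp_step (a x) (b x) (c x) s"])
 show "pbd (%x. 1 + sz (d x) * sz (c x))" by (intro pbd_add pbd_const pbd_mult pt_sz assms)
 show "sz (fold (%_. mp_step (a x) (b x) (c x)) (take n (d x)) []) <= 1 + sz (d x) * sz (c x)" for x n
 proof -
  have "sz (mp (a x) (b x) (c x) (take n (d x))) <= 1 + length (take n (d x)) * sz (c x)" by (rule sz_mp)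
  also have "\<dots> <= 1 + sz (d x) * sz (c x)" using length_le_sz[of "d x"] by (intro add_mono mult_le_mono) auto
  finally show ?thesis by (simp add: mp_def)
 qed
 show "pt (%p. mp_step (a (fst p)) (b (fst p)) (c (fst p)) (snd (snd p)))"
  by (intro pt_intros pt_compose[OF assms(1)] pt_compose[OF assms(2)] pt_compose[OF assms(3)])
qed (intro pt_intros assms)+

lemma pt_fl_open [pt_intros]: "pt a ==> pt b ==> pt c ==> pt (%x. fl_open (a x) (b x) (c x))"
 by (rule pt_lift3) (unfold fl_open_def, intro pt_intros)
lemma pt_fl_assign [pt_intros]: "pt a ==> pt b ==> pt c ==> pt (%x. fl_assign (a x) (b x) (c x))"
 by (rule pt_lift3) (unfold fl_assign_def, intro pt_intros)
lemma pt_fl_cost [pt_intros]: "pt a ==> pt b ==> pt c ==> pt d ==> pt e ==> pt (%x. fl_cost (a x) (b x) (c x) (d x) (e x))"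
 by (rule pt_lift5) (unfold fl_cost_def, intro pt_intros)
lemma pt_fl2 [pt_intros]: "pt a ==> pt b ==> pt c ==> pt d ==> pt e ==> pt (%x. fl2 (a x) (b x) (c x) (d x) (e x))"
 by (rule pt_lift5) (unfold fl2_def, intro pt_intros)

section \<open>Integral radii and the greedy choice of facilities\<close>

lemma gain_Suc: "gain (Suc g) ps <= gain g ps + sum_list (map fst ps)"
proof (induction ps)
 case (Cons p ps)
 have "min (Suc g) (fst (snd p)) - snd (snd p) <= (min g (fst (snd p)) - snd (snd p)) + 1" by auto
 from mult_le_mono2[OF this, of "fst p"] Cons show ?case by (simp add: gain_def)
qed (simp add: gain_def)

text \<open>Rounding up increases the contributions by at most the total weight. As a positive
  opening cost is at least twice that weight, the overshoot is at most half of the cost; this is the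
  origin of the factor 3/2.\<close>

lemma rad_props:
 assumes "f = 0 \<or> 2 * sum_list (map fst ps) <= f"
 shows "2 * gain (rad fuel f ps) ps <= 3 * f" "rad fuel f ps <= top2 fuel"
  "f <= gain (rad fuel f ps) ps \<or> rad fuel f ps = top2 fuel"
proof -
 have g0: "gain 0 ps = 0" by (induction ps) (auto simp: gain_def)
 from bisect_inv[of f ps fuel 0] obtain g where g: "bisect f ps fuel (0, top2 fuel) = (g, 1)" "g + 1 <= top2 fuel"
  "0 < f --> gain g ps < f" "f <= gain (g + 1) ps \<or> g + 1 = top2 fuel" by (auto simp: top2_conv)
 show "2 * gain (rad fuel f ps) ps <= 3 * f"
 proof (cases "f = 0")
  case False
  then have "2 * gain (Suc g) ps <= 3 * f" using gain_Suc[of g ps] g(3) assms by linarith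
  then show ?thesis using False g(1) by (simp add: rad_def)
 qed (simp add: rad_def g0)
 show "rad fuel f ps <= top2 fuel" "f <= gain (rad fuel f ps) ps \<or> rad fuel f ps = top2 fuel"
  using g(1,2,4) by (auto simp: rad_def g0)
qed

lemma sum_single:
 fixes g :: "'a => nat"
 assumes "finite S" "\<And>a b. a \<in> S ==> b \<in> S ==> 0 < g a ==> 0 < g b ==> a = b"
 obtains "sum g S = 0" | a where "a \<in> S" "0 < g a" "sum g S = g a"
proof (cases "\<exists>a\<in>S. 0 < g a")
 case True
 then obtain a where a: "a \<in> S" "0 < g a" by blast
 have "g b = 0" if "b \<in> S - {a}" for b using assms(2)[OF _ a(1) _ a(2), of b] that by auto
 then have "sum g (S - {a}) = 0" by simp
 then have "sum g S = g a" using sum.remove[OF assms(1) a(1), of g] by simp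
 with a that show ?thesis by blast
qed (use that in simp)

text \<open>
 A client pays towards at most one opened facility, and that facility is then at most three
 times as far in radius as any candidate, because it was not blocked by the facility serving that candidate.
\<close>

lemma client_bound:
 fixes d :: "nat => nat" and F :: "nat => nat => nat" and C1 C2 X Z :: "(nat \<times> nat) set" and v conn :: nat
 assumes fin: "finite X" "finite Z" and tri1: "\<And>i i'. i \<in> I ==> i' \<in> I ==> d i' <= F i i' + d i"
  and tri2: "\<And>i i'. i \<in> I ==> i' \<in> I ==> F i i' <= d i + d i'"
  and sub: "snd ` C1 \<subseteq> I" "snd ` C2 \<subseteq> I" "X \<subseteq> C1" "Z \<subseteq> C2"
  and X1: "\<And>c. c \<in> C1 ==> \<exists>a\<in>X. fst a <= fst c \<and> F (snd c) (snd a) <= 2 * fst c"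
  and X2: "\<And>a b. a \<in> X ==> b \<in> X ==> a \<noteq> b ==> 2 * fst a < F (snd a) (snd b)"
  and Z1: "\<And>c. c \<in> C2 ==> (\<exists>a\<in>X. F (snd c) (snd a) <= 2 * fst c) \<or> (\<exists>b\<in>Z. fst b <= fst c \<and> F (snd c) (snd b) <= 2 * fst c)"
  and Z2: "\<And>a b. a \<in> Z ==> b \<in> Z ==> a \<noteq> b ==> 2 * fst a < F (snd a) (snd b)"
  and Z3: "\<And>a b. a \<in> X ==> b \<in> Z ==> 2 * fst b < F (snd b) (snd a)"
  and v: "\<And>c. c \<in> C2 ==> v <= max (fst c) (d (snd c))"
  and conn: "\<And>a. a \<in> X \<union> Z ==> conn <= d (snd a)" and c: "c \<in> C1 \<union> C2"
 shows "(\<Sum>b\<in>Z. fst b - d (snd b)) + (\<Sum>a\<in>X. min (fst a) v - d (snd a)) + conn <= 3 * max (fst c) (d (snd c))"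
proof -
 define \<mu> where "\<mu> = max (fst c) (d (snd c))"
 have I: "snd a \<in> I" if "a \<in> X \<union> Z \<union> C1 \<union> C2" for a using that sub by blast
 have F2: "F (snd a) (snd b) <= d (snd a) + d (snd b)" if "a \<in> X \<union> Z" "b \<in> X \<union> Z" for a b using that by (intro tri2 I) auto
 have near: "d (snd a) <= 3 * \<mu>" if "a \<in> X \<union> Z" "F (snd c) (snd a) <= 2 * fst c" for a
  using tri1[of "snd c" "snd a"] I[of a] I[of c] that c unfolding \<mu>_def by auto
 obtain s where s: "s \<in> X \<union> Z" "d (snd s) <= 3 * \<mu>"
  and sX: "c \<in> C1 ==> s \<in> X" and sr: "s \<in> Z \<or> c \<in> C1 ==> s \<notin> X \<or> c \<in> C1 ==> fst s <= fst c"
 proof (cases "c \<in> C1")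
  case True
  from X1[OF this] obtain a where "a \<in> X" "fst a <= fst c" "F (snd c) (snd a) <= 2 * fst c" by blast
  with near[of a] that[of a] show ?thesis by auto
 next
  case False
  with c have "c \<in> C2" by blast
  from Z1[OF this] show ?thesis
  proof (elim disjE bexE conjE)
   fix a assume "a \<in> X" "F (snd c) (snd a) <= 2 * fst c"
   with near[of a] that[of a] False show ?thesis by auto
  next
   fix b assume "b \<in> Z" "fst b <= fst c" "F (snd c) (snd b) <= 2 * fst c"
   with near[of b] that[of b] False show ?thesis by auto
  qed
 qed
 have far: "fst a <= 3 * \<mu>" if "a \<in> X \<union> Z" "d (snd a) < fst a" "2 * fst a < F (snd a) (snd s)" for a
  using F2[OF that(1) s(1)] s(2) that by linarith
 have \<mu>: "fst c <= 3 * \<mu>" by (simp add: \<mu>_def)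
 \<comment> \<open>Two opened facilities that both receive a contribution are at a distance below
   the sum of their radii, whereas the greedy choice separates them by more than twice the larger
   radius. The same argument applies to \<open>X\<close> below.\<close>
 have one: "(\<Sum>b\<in>Z. fst b - d (snd b)) = 0 \<or> (\<exists>b\<in>Z. d (snd b) < fst b \<and> (\<Sum>b\<in>Z. fst b - d (snd b)) = fst b - d (snd b))"
 proof (rule sum_single[OF fin(2), of "%b. fst b - d (snd b)"])
  show "a = b" if "a \<in> Z" "b \<in> Z" "0 < fst a - d (snd a)" "0 < fst b - d (snd b)" for a b
   using that Z2[of a b] Z2[of b a] F2[of a b] F2[of b a] by (cases "a = b") auto
 qed auto
 have two: "(\<Sum>a\<in>X. min (fst a) v - d (snd a)) = 0 \<or>
   (\<exists>a\<in>X. d (snd a) < min (fst a) v \<and> (\<Sum>a\<in>X. min (fst a) v - d (snd a)) = min (fst a) v - d (snd a))"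
 proof (rule sum_single[OF fin(1), of "%a. min (fst a) v - d (snd a)"])
  show "a = b" if "a \<in> X" "b \<in> X" "0 < min (fst a) v - d (snd a)" "0 < min (fst b) v - d (snd b)" for a b
   using that X2[of a b] X2[of b a] F2[of a b] F2[of b a] by (cases "a = b") auto
 qed auto
 have c0: "conn <= 3 * \<mu>" using conn[OF s(1)] s(2) by linarith
 have "(\<Sum>b\<in>Z. fst b - d (snd b)) + (\<Sum>a\<in>X. min (fst a) v - d (snd a)) + conn <= 3 * \<mu>"
 proof (cases "\<exists>b\<in>Z. d (snd b) < fst b \<and> (\<Sum>b\<in>Z. fst b - d (snd b)) = fst b - d (snd b)")
  case True
  then obtain b where b: "b \<in> Z" "d (snd b) < fst b" "(\<Sum>b\<in>Z. fst b - d (snd b)) = fst b - d (snd b)" by blast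
  \<comment> \<open>If the client pays for \<open>b\<close> in the second stage, then
    \<open>v\<close> is at most the radius of \<open>b\<close>. Contributing less than
    \<open>v\<close> to some \<open>a\<close> in \<open>X\<close> as well would place
    \<open>a\<close> within twice the radius of \<open>b\<close>, and \<open>b\<close> would have
    been blocked.\<close>
  have "(\<Sum>a\<in>X. min (fst a) v - d (snd a)) = 0"
  proof (rule ccontr)
   assume "(\<Sum>a\<in>X. min (fst a) v - d (snd a)) \<noteq> 0"
   with two obtain a where a: "a \<in> X" "d (snd a) < min (fst a) v" by blast
   have "v <= fst b" using v[of b] b sub(4) by auto
   then show False using Z3[OF a(1) b(1)] F2[of b a] a b(1,2) by auto
  qed
  moreover have "fst b <= 3 * \<mu>"
  proof (cases "s = b")
   case True
   then show ?thesis using sr sX b(1) \<mu> Z3[of s s] F2[of s s] b(2) by (cases "s \<in> X") auto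
  next
   case False
   then have "2 * fst b < F (snd b) (snd s)" using s(1) Z2[of b s] Z3[of s b] b(1) by auto
   then show ?thesis using far[of b] b by simp
  qed
  moreover have "conn <= d (snd b)" using conn b(1) by simp
  ultimately show ?thesis using b(2,3) by simp
 next
  case F: False
  then have z0: "(\<Sum>b\<in>Z. fst b - d (snd b)) = 0" using one by blast
  show ?thesis
  proof (cases "(\<Sum>a\<in>X. min (fst a) v - d (snd a)) = 0")
   case True
   then show ?thesis using z0 c0 by simp
  next
   case False
   obtain a where a: "a \<in> X" "d (snd a) < min (fst a) v" "(\<Sum>a\<in>X. min (fst a) v - d (snd a)) = min (fst a) v - d (snd a)"
    using two by (elim disjE bexE conjE) (simp add: False, rule that)
   have "min (fst a) v <= 3 * \<mu>"
   proof (cases "c \<in> C1")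
    case True
    then have "s \<in> X" by (rule sX)
    then show ?thesis using True sr \<mu> X2[of a s] far[of a] a(1,2) by (cases "s = a") auto
   next
    case False
    then have "v <= \<mu>" using v[of c] c by (auto simp: \<mu>_def)
    then show ?thesis by linarith
   qed
   moreover have "conn <= d (snd a)" using conn a(1) by simp
   ultimately show ?thesis using a(2,3) z0 by linarith
  qed
 qed
 then show ?thesis by (simp add: \<mu>_def)
qed

text \<open>Facilities are opened in order of increasing radius: a candidate that is not blocked has
  at least the radius of every opened facility. So the facility of \<open>acc\<close> that comes to
  block a candidate is no larger than it, and the separation holds in both directions by symmetry.
  Every round blocks a new candidate, so one round per candidate suffices.\<close>

lemma mp_props:
 assumes I: "snd ` set cs \<subseteq> I" "set pre \<subseteq> I"
  and sym: "\<forall>i\<in>I. \<forall>i'\<in>I. at2 ff i i' = at2 ff i' i" and refl0: "\<forall>i\<in>I. at2 ff i i = 0"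
 defines "acc \<equiv> mp ff pre cs (map snd cs)"
 shows "set acc \<subseteq> set cs"
  and "a \<in> set acc ==> b \<in> set acc ==> a \<noteq> b ==> 2 * fst a < at2 ff (snd a) (snd b)"
  and "b \<in> set acc ==> i \<in> set pre ==> 2 * fst b < at2 ff (snd b) i"
  and "c \<in> set cs ==> (\<exists>i\<in>set pre. at2 ff (snd c) i <= 2 * fst c) \<or>
   (\<exists>b\<in>set acc. fst b <= fst c \<and> at2 ff (snd c) (snd b) <= 2 * fst c)"
proof -
 let ?F = "at2 ff" and ?bl = "blocked ff pre"
 have bl: "?bl acc c \<longleftrightarrow> (\<exists>i\<in>set pre. ?F (snd c) i <= 2 * fst c) \<or> (\<exists>b\<in>set acc. ?F (snd c) (snd b) <= 2 * fst c)" for acc c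
  by (auto simp: blocked_def list_ex_iff)
 define inv where "inv acc \<longleftrightarrow> set acc \<subseteq> set cs \<and>
   (\<forall>a\<in>set acc. \<forall>b\<in>set acc. a \<noteq> b --> 2 * fst a < ?F (snd a) (snd b)) \<and>
   (\<forall>b\<in>set acc. \<forall>i\<in>set pre. 2 * fst b < ?F (snd b) i) \<and>
   (\<forall>c\<in>set cs. ?bl acc c --> (\<exists>i\<in>set pre. ?F (snd c) i <= 2 * fst c) \<or>
    (\<exists>b\<in>set acc. fst b <= fst c \<and> ?F (snd c) (snd b) <= 2 * fst c)) \<and>
   (\<forall>c\<in>set cs. \<not> ?bl acc c --> (\<forall>b\<in>set acc. fst b <= fst c))" for acc
 have inv1: "set acc \<subseteq> set cs" if "inv acc" for acc using that unfolding inv_def by (elim conjE)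
 have inv2: "\<forall>a\<in>set acc. \<forall>b\<in>set acc. a \<noteq> b --> 2 * fst a < ?F (snd a) (snd b)" if "inv acc" for acc
  using that unfolding inv_def by (elim conjE)
 have inv3: "\<forall>b\<in>set acc. \<forall>i\<in>set pre. 2 * fst b < ?F (snd b) i" if "inv acc" for acc
  using that unfolding inv_def by (elim conjE)
 have inv4: "\<forall>c\<in>set cs. ?bl acc c --> (\<exists>i\<in>set pre. ?F (snd c) i <= 2 * fst c) \<or>
    (\<exists>b\<in>set acc. fst b <= fst c \<and> ?F (snd c) (snd b) <= 2 * fst c)" if "inv acc" for acc
  using that unfolding inv_def by (elim conjE)
 have inv5: "\<forall>c\<in>set cs. \<not> ?bl acc c --> (\<forall>b\<in>set acc. fst b <= fst c)" if "inv acc" for acc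
  using that unfolding inv_def by (elim conjE)
 define num where "num acc = card {c \<in> set cs. ?bl acc c}" for acc
 have main: "inv (mp ff pre cs xs) \<and> ((\<forall>c\<in>set cs. ?bl (mp ff pre cs xs) c) \<or> length xs <= num (mp ff pre cs xs))" for xs
 proof (induction xs rule: rev_induct)
  case Nil
  show ?case by (auto simp: mp_Nil inv_def bl)
 next
  case (snoc x xs)
  let ?acc = "mp ff pre cs xs"
  have IH: "inv ?acc" "(\<forall>c\<in>set cs. ?bl ?acc c) \<or> length xs <= num ?acc" using snoc by auto
  from mp_step_cases[of ff pre cs ?acc] show ?case
  proof (elim disjE bexE conjE)
   assume "mp_step ff pre cs ?acc = ?acc" "\<forall>c\<in>set cs. ?bl ?acc c"
   then show ?case using IH by (simp add: mp_snoc)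
  next
   fix c assume c: "c \<in> set cs" "mp_step ff pre cs ?acc = c # ?acc" "\<not> ?bl ?acc c"
    and m: "\<forall>c'\<in>set cs. \<not> ?bl ?acc c' --> fst c <= fst c'"
   have cI: "snd c \<in> I" using c(1) I(1) by auto
   have bc: "?bl (c # ?acc) c" using refl0[rule_format, OF cI] by (auto simp: bl)
   have mono: "?bl ?acc c' ==> ?bl (c # ?acc) c'" for c' by (auto simp: bl)
   have far: "2 * fst c < ?F (snd c) (snd b)" "2 * fst b < ?F (snd b) (snd c)" if "b \<in> set ?acc" for b
   proof -
    show 1: "2 * fst c < ?F (snd c) (snd b)" using c(3) that by (auto simp: bl not_le)
    have "fst b <= fst c" using inv5[OF IH(1)] c(1,3) that by simp
    moreover have "snd b \<in> I" using inv1[OF IH(1)] that I(1) by auto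
    ultimately show "2 * fst b < ?F (snd b) (snd c)" using 1 sym[rule_format, OF cI, of "snd b"] by simp
   qed
   have "inv (c # ?acc)"
    unfolding inv_def
   proof (intro conjI ballI impI)
    show "set (c # ?acc) \<subseteq> set cs" using inv1[OF IH(1)] c(1) by auto
    show "2 * fst a < ?F (snd a) (snd b)" if "a \<in> set (c # ?acc)" "b \<in> set (c # ?acc)" "a \<noteq> b" for a b
     using that far[of a] far[of b] inv2[OF IH(1)] by (cases "a = c"; cases "b = c") auto
    show "2 * fst b < ?F (snd b) i" if "b \<in> set (c # ?acc)" "i \<in> set pre" for b i
     using that inv3[OF IH(1)] c(3) by (auto simp: bl not_le)
    show "(\<exists>i\<in>set pre. ?F (snd c') i <= 2 * fst c') \<or>
     (\<exists>b\<in>set (c # ?acc). fst b <= fst c' \<and> ?F (snd c') (snd b) <= 2 * fst c')" if "c' \<in> set cs" "?bl (c # ?acc) c'" for c'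
    proof (cases "?bl ?acc c'")
     case True
     then show ?thesis using inv4[OF IH(1)] that(1) by fastforce
    next
     case False
     then have "fst c <= fst c'" using m that(1) by blast
     moreover have "?F (snd c') (snd c) <= 2 * fst c'" using that(2) False by (auto simp: bl)
     ultimately show ?thesis by auto
    qed
    show "fst b <= fst c'" if "c' \<in> set cs" "\<not> ?bl (c # ?acc) c'" "b \<in> set (c # ?acc)" for c' b
     using that mono[of c'] m inv5[OF IH(1)] by auto
   qed
   moreover have "num ?acc < num (c # ?acc)"
    unfolding num_def using c(1,3) bc mono by (intro psubset_card_mono) auto
   moreover have "length xs <= num ?acc" using IH(2) c(1,3) by blast
   ultimately show ?case unfolding mp_snoc c(2) by simp
  qed
 qed
 have inv: "inv acc" using main[of "map snd cs"] by (simp add: acc_def)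
 have all: "?bl acc c" if "c \<in> set cs" for c
 proof (rule ccontr)
  assume n: "\<not> ?bl acc c"
  then have "length cs <= num acc" using main[of "map snd cs"] that by (auto simp: acc_def)
  also have "\<dots> < card (set cs)" unfolding num_def using that n by (intro psubset_card_mono) auto
  also have "\<dots> <= length cs" by (rule card_length)
  finally show False by simp
 qed
 show "set acc \<subseteq> set cs" by (rule inv1[OF inv])
 show "a \<in> set acc ==> b \<in> set acc ==> a \<noteq> b ==> 2 * fst a < ?F (snd a) (snd b)" using inv2[OF inv] by blast
 show "b \<in> set acc ==> i \<in> set pre ==> 2 * fst b < ?F (snd b) i" using inv3[OF inv] by blast
 show "c \<in> set cs ==> (\<exists>i\<in>set pre. ?F (snd c) i <= 2 * fst c) \<or>
   (\<exists>b\<in>set acc. fst b <= fst c \<and> ?F (snd c) (snd b) <= 2 * fst c)" using inv4[OF inv] all by blast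
qed

lemma fl_cands_mem: "c \<in> set (fl_cands fuel fps) \<longleftrightarrow> snd c < length fps \<and>
  fst c = rad fuel (fst (fps ! snd c)) (snd (fps ! snd c)) \<and> fst (fps ! snd c) <= gain (fst c) (snd (fps ! snd c))"
 by (cases c) (auto simp: fl_cands_def nthd_def)

lemma sum_list_sum_swap: "(\<Sum>p\<leftarrow>ps. (\<Sum>a\<in>S. g p a)) = (\<Sum>a\<in>S. (\<Sum>p\<leftarrow>ps. g p a :: nat))"
 by (induction ps) (auto simp: sum.distrib)

lemma tot_snd_image_le: "finite X ==> tot f (snd ` X) <= (\<Sum>a\<in>X. f ! snd a)"
 unfolding tot_def using sum_image_le[of X "(!) f" snd] by (simp add: o_def)

text \<open>\<open>dm\<close> contains distances from facilities to clients, \<open>ff\<close> those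
  between facilities. The assumptions \<open>big1\<close> and \<open>big2\<close> result from the
  scaling of the instance and control the rounding of radii; by \<open>top\<close>, a single client
  can pay for any facility before the range of the bisection ends.\<close>

locale fl_stage =
 fixes dm ff :: "nat list list" and f1 f2 :: "nat list" and fuel :: "bool list" and nf nc :: nat
 assumes len: "length dm = nf" "length f1 = nf" "length f2 = nf"
  and tri1: "\<And>i i' j. i < nf ==> i' < nf ==> j < nc ==> at2 dm i' j <= at2 ff i i' + at2 dm i j"
  and tri2: "\<And>i i' j. i < nf ==> i' < nf ==> j < nc ==> at2 ff i i' <= at2 dm i j + at2 dm i' j"
  and sym: "\<And>i i'. i < nf ==> i' < nf ==> at2 ff i i' = at2 ff i' i" and refl0: "\<And>i. i < nf ==> at2 ff i i = 0"
  and big1: "\<And>i. i < nf ==> f1 ! i = 0 \<or> 2 * nc <= f1 ! i" and big2: "\<And>i. i < nf ==> f2 ! i = 0 \<or> 2 * nc <= f2 ! i"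
  and top: "\<And>i j. i < nf ==> j < nc ==> f2 ! i + at2 dm i j <= top2 fuel"
  and ne: "0 < nc ==> 0 < nf"
begin

abbreviation "d \<equiv> at2 dm"
abbreviation "T \<equiv> top2 fuel"
abbreviation "cs2 \<equiv> fl_cands2 fuel dm f2"
abbreviation "v es \<equiv> fl_reach fuel dm (cs2 es)"
abbreviation "ok es \<equiv> distinct es \<and> set es \<subseteq> {..<nc}"

definition ps2 where "ps2 es i = map (%j. (1::nat, (T, d i j))) es"

lemma cs2_mem: "c \<in> set (cs2 es) \<longleftrightarrow> snd c < nf \<and> fst c = rad fuel (f2 ! snd c) (ps2 es (snd c)) \<and>
  f2 ! snd c <= gain (fst c) (ps2 es (snd c))"
 unfolding fl_cands2_def fl_cands_mem ps2_def using len by (auto simp: nthd_def)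

lemma gain_ps2: "distinct es ==> gain g (ps2 es i) = (\<Sum>j\<in>set es. min g T - d i j)"
 by (simp add: gain_def ps2_def o_def sum_list_distinct_conv_sum_set)

lemma length_ok: "ok es ==> length es <= nc"
 using card_mono[of "{..<nc}" "set es"] by (simp add: distinct_card)

lemma rad2: "ok es ==> i < nf ==> 2 * gain (rad fuel (f2 ! i) (ps2 es i)) (ps2 es i) <= 3 * f2 ! i \<and>
  rad fuel (f2 ! i) (ps2 es i) <= T \<and>
  (f2 ! i <= gain (rad fuel (f2 ! i) (ps2 es i)) (ps2 es i) \<or> rad fuel (f2 ! i) (ps2 es i) = T)"
proof -
 assume a: "ok es" "i < nf"
 have "sum_list (map fst (ps2 es i)) = length es" by (simp add: ps2_def o_def sum_list_triv)
 then have "f2 ! i = 0 \<or> 2 * sum_list (map fst (ps2 es i)) <= f2 ! i" using big2[OF a(2)] length_ok[OF a(1)] by auto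
 from rad_props[OF this, of fuel] show ?thesis by blast
qed

text \<open>In a nonempty scenario no facility is lost by the filter in \<open>fl_cands\<close>: at
  radius \<open>T\<close> one client pays for it alone.\<close>

lemma cs2_all:
 assumes "ok es" "j \<in> set es" "i < nf"
 shows "(rad fuel (f2 ! i) (ps2 es i), i) \<in> set (cs2 es)"
proof -
 have "f2 ! i <= gain T (ps2 es i)"
 proof -
  have "f2 ! i <= T - d i j" using top[of i j] assms by auto
  also have "\<dots> <= (\<Sum>j\<in>set es. min T T - d i j)" using assms(2) member_le_sum[of j "set es" "%j. min T T - d i j"] by simp
  finally show ?thesis using assms(1) by (simp add: gain_ps2)
 qed
 then show ?thesis using rad2[OF assms(1,3)] assms(3) by (auto simp: cs2_mem)
qed

lemma reach_le: "c \<in> set cs ==> fl_reach fuel dm cs j <= max (fst c) (d (snd c) j)"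
 unfolding fl_reach_def by (rule best_key_min[where key = "%x. x"]) auto

lemma reach_in: "cs \<noteq> [] ==> \<exists>c\<in>set cs. fl_reach fuel dm cs j = max (fst c) (d (snd c) j)"
 using best_in[of "map (%c. max (fst c) (d (snd c) j)) cs" "(<)" T] unfolding fl_reach_def by auto

lemma v_le_T:
 assumes "ok es" "j \<in> set es"
 shows "v es j <= T" "\<exists>c\<in>set (cs2 es). v es j = max (fst c) (d (snd c) j)"
proof -
 have "0 < nf" using ne assms by fastforce
 then have "cs2 es \<noteq> []" using cs2_all[OF assms] by auto
 from reach_in[OF this] show "\<exists>c\<in>set (cs2 es). v es j = max (fst c) (d (snd c) j)" .
 then obtain c where "c \<in> set (cs2 es)" "v es j = max (fst c) (d (snd c) j)" by blast
 then show "v es j <= T" using rad2[OF assms(1), of "snd c"] top[of "snd c" j] assms by (auto simp: cs2_mem)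
qed

text \<open>The dual variable of a client in a scenario, which may be reached by a first-stage
  candidate or by one of the scenario.\<close>

definition \<alpha> where "\<alpha> C1 es j = min (fl_reach fuel dm C1 j) (v es j)"

lemma fsym: "\<forall>i\<in>{..<nf}. \<forall>i'\<in>{..<nf}. at2 ff i i' = at2 ff i' i" and frefl: "\<forall>i\<in>{..<nf}. at2 ff i i = 0"
 using sym refl0 by auto

lemma dual2:
 assumes "ok es" "i < nf"
 shows "2 * (\<Sum>j\<in>set es. \<alpha> C1 es j - d i j) <= 3 * f2 ! i"
proof -
 let ?r = "rad fuel (f2 ! i) (ps2 es i)"
 have "(\<Sum>j\<in>set es. \<alpha> C1 es j - d i j) <= (\<Sum>j\<in>set es. min ?r T - d i j)"
 proof (rule sum_mono)
  fix j assume "j \<in> set es"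
  from reach_le[OF cs2_all[OF assms(1) this assms(2)], of j] rad2[OF assms]
  show "\<alpha> C1 es j - d i j <= min ?r T - d i j" by (auto simp: \<alpha>_def)
 qed
 also have "\<dots> = gain ?r (ps2 es i)" using assms(1) by (simp add: gain_ps2)
 finally show ?thesis using rad2[OF assms] by linarith
qed

text \<open>Weak duality. A dual variable is at most the connection cost plus the surplus at the
  facility that serves the client. The surpluses at second-stage facilities are paid by 3/2 of their
  opening costs (\<open>dual2\<close>); those at first-stage facilities remain as a term, because
  they are bounded only after summation over the scenarios.\<close>

lemma duality:
 assumes "ok es" "x' \<subseteq> {..<nf}" "z' \<subseteq> {..<nf}" "\<And>j. j \<in> set es ==> \<sigma> j \<in> x' \<union> z'"
 shows "2 * (\<Sum>j\<in>set es. \<alpha> C1 es j) <= 2 * (\<Sum>j\<in>set es. d (\<sigma> j) j) + 3 * tot f2 z' +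
   2 * (\<Sum>i\<in>x'. \<Sum>j\<in>set es. \<alpha> C1 es j - d i j)"
proof -
 let ?g = "%i j. \<alpha> C1 es j - d i j"
 have fin: "finite x'" "finite z'" using assms(2,3) finite_subset by blast+
 have "(\<Sum>j\<in>set es. \<alpha> C1 es j) <= (\<Sum>j\<in>set es. d (\<sigma> j) j + ((\<Sum>i\<in>x'. ?g i j) + (\<Sum>i\<in>z'. ?g i j)))"
 proof (rule sum_mono)
  fix j assume "j \<in> set es"
  then have "\<sigma> j \<in> x' \<or> \<sigma> j \<in> z'" using assms(4) by blast
  then have "?g (\<sigma> j) j <= (\<Sum>i\<in>x'. ?g i j) + (\<Sum>i\<in>z'. ?g i j)"
   using member_le_sum[of "\<sigma> j" x' "%i. ?g i j"] member_le_sum[of "\<sigma> j" z' "%i. ?g i j"] fin by auto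
  then show "\<alpha> C1 es j <= d (\<sigma> j) j + ((\<Sum>i\<in>x'. ?g i j) + (\<Sum>i\<in>z'. ?g i j))" by linarith
 qed
 also have "\<dots> = (\<Sum>j\<in>set es. d (\<sigma> j) j) + ((\<Sum>i\<in>x'. \<Sum>j\<in>set es. ?g i j) + (\<Sum>i\<in>z'. \<Sum>j\<in>set es. ?g i j))"
  using sum.swap[of ?g "set es" x'] sum.swap[of ?g "set es" z'] by (simp add: sum.distrib sum.swap[of _ _ "set es"])
 finally have "(\<Sum>j\<in>set es. \<alpha> C1 es j) <= \<dots>" .
 moreover have "2 * (\<Sum>i\<in>z'. \<Sum>j\<in>set es. ?g i j) <= 3 * tot f2 z'"
  unfolding tot_def sum_distrib_left[of 2] sum_distrib_left[of 3]
  using dual2[OF assms(1), of _ C1] assms(3) by (intro sum_mono) (auto simp: sum_distrib_left)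
 ultimately show ?thesis by linarith
qed

text \<open>The sum of \<open>client_bound\<close> over the clients, each taken at the candidate
  that attains \<open>\<alpha>\<close>. The second summand on the left is what this scenario
  contributes to the first-stage facilities; summed over the scenarios it pays for opening
  them.\<close>

lemma scenario_cost:
 assumes "ok es" and C1: "snd ` set C1 \<subseteq> {..<nf}" and X: "X = set (mp ff [] C1 (map snd C1))" and x: "set x = snd ` X"
  and z: "z = fl_open ff x (cs2 es)"
 shows "fl_cost dm f2 x z es + (\<Sum>j\<in>set es. \<Sum>a\<in>X. min (fst a) (v es j) - d (snd a) j) <= 3 * (\<Sum>j\<in>set es. \<alpha> C1 es j)"
  and "j \<in> set es ==> x @ z \<noteq> []" and "set z \<subseteq> {..<nf}" "distinct z"
proof -
 define Z where "Z = set (mp ff x (cs2 es) (map snd (cs2 es)))"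
 have C2: "snd ` set (cs2 es) \<subseteq> {..<nf}" by (auto simp: cs2_mem)
 have e: "set [] \<subseteq> {..<nf}" by simp
 note PX = mp_props[OF C1 e fsym frefl, folded X]
 have XC: "X \<subseteq> set C1" using PX(1) by simp
 have xn: "set x \<subseteq> {..<nf}" using XC C1 x by auto
 note PZ = mp_props[OF C2 xn fsym frefl, folded Z_def]
 have zZ: "set z = snd ` Z" "distinct z" by (simp_all add: z fl_open_def Z_def)
 show "set z \<subseteq> {..<nf}" "distinct z" using zZ PZ(1) C2 by auto
 have fin: "finite X" "finite Z" by (simp_all add: X Z_def)
 let ?c = "%j. d (fl_assign dm (x @ z) j) j"
 have cl: "(\<Sum>b\<in>Z. fst b - d (snd b) j) + (\<Sum>a\<in>X. min (fst a) (v es j) - d (snd a) j) + ?c j <= 3 * max (fst c) (d (snd c) j)"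
  if c: "c \<in> set C1 \<union> set (cs2 es)" and j: "j \<in> set es" for c j
 proof (rule client_bound[OF fin, where I = "{..<nf}" and F = "at2 ff" and ?C1.0 = "set C1" and ?C2.0 = "set (cs2 es)"])
  have jn: "j < nc" using j assms(1) by auto
  show "d i' j <= at2 ff i i' + d i j" if "i \<in> {..<nf}" "i' \<in> {..<nf}" for i i' using tri1 that jn by auto
  show "at2 ff i i' <= d i j + d i' j" if "i \<in> {..<nf}" "i' \<in> {..<nf}" for i i' using tri2 that jn by auto
  show "\<exists>a\<in>X. fst a <= fst c \<and> at2 ff (snd c) (snd a) <= 2 * fst c" if "c \<in> set C1" for c using PX(4)[of c] that by simp
  show "2 * fst a < at2 ff (snd a) (snd b)" if "a \<in> X" "b \<in> X" "a \<noteq> b" for a b using PX(2)[of a b] that by simp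
  show "(\<exists>a\<in>X. at2 ff (snd c) (snd a) <= 2 * fst c) \<or> (\<exists>b\<in>Z. fst b <= fst c \<and> at2 ff (snd c) (snd b) <= 2 * fst c)"
   if "c \<in> set (cs2 es)" for c using PZ(4)[of c] that x by simp
  show "2 * fst a < at2 ff (snd a) (snd b)" if "a \<in> Z" "b \<in> Z" "a \<noteq> b" for a b using PZ(2)[of a b] that by simp
  show "2 * fst b < at2 ff (snd b) (snd a)" if "a \<in> X" "b \<in> Z" for a b using PZ(3)[of b "snd a"] that x by simp
  show "v es j <= max (fst c) (d (snd c) j)" if "c \<in> set (cs2 es)" for c using reach_le[OF that] .
  show "?c j <= d (snd a) j" if "a \<in> X \<union> Z" for a
   unfolding fl_assign_def by (rule best_key_min) (use that x zZ in auto)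
 qed (use C1 C2 XC PZ(1) c in auto)
 show "x @ z \<noteq> []" if "j \<in> set es" for j
 proof -
  from v_le_T(2)[OF assms(1) that] obtain c where "c \<in> set (cs2 es)" by blast
  from PZ(4)[OF this] show ?thesis using zZ by auto
 qed
 have cl': "(\<Sum>b\<in>Z. fst b - d (snd b) j) + (\<Sum>a\<in>X. min (fst a) (v es j) - d (snd a) j) + ?c j <= 3 * \<alpha> C1 es j"
  if j: "j \<in> set es" for j
 proof -
  have "\<exists>c\<in>set C1 \<union> set (cs2 es). \<alpha> C1 es j = max (fst c) (d (snd c) j)"
  proof (cases "C1 = []")
   case True
   then have "\<alpha> C1 es j = v es j" using v_le_T(1)[OF assms(1) j] by (simp add: \<alpha>_def fl_reach_def)
   then show ?thesis using v_le_T(2)[OF assms(1) j] by auto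
  next
   case False
   then show ?thesis using v_le_T(2)[OF assms(1) j] reach_in[OF False, of j] unfolding \<alpha>_def min_def by auto
  qed
  then obtain c where c: "c \<in> set C1 \<union> set (cs2 es)" "\<alpha> C1 es j = max (fst c) (d (snd c) j)" by blast
  show ?thesis unfolding c(2) by (rule cl[OF c(1) j])
 qed
 have "sum_list (map (nthd 0 f2) z) = tot f2 (snd ` Z)"
 proof -
  have "sum_list (map (nthd 0 f2) z) = (\<Sum>i\<in>set z. nthd 0 f2 i)" using zZ(2) by (simp add: sum_list_distinct_conv_sum_set)
  also have "\<dots> = tot f2 (snd ` Z)" unfolding tot_def zZ(1) using PZ(1) C2 len by (intro sum.cong) (auto simp: nthd_def)
  finally show ?thesis .
 qed
 also have "\<dots> <= (\<Sum>b\<in>Z. f2 ! snd b)" by (rule tot_snd_image_le[OF fin(2)])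
 also have "\<dots> <= (\<Sum>b\<in>Z. \<Sum>j\<in>set es. fst b - d (snd b) j)"
 proof (rule sum_mono)
  fix b assume "b \<in> Z"
  then have "b \<in> set (cs2 es)" using PZ(1) by blast
  then have "f2 ! snd b <= gain (fst b) (ps2 es (snd b))" unfolding cs2_mem by blast
  also have "\<dots> <= (\<Sum>j\<in>set es. fst b - d (snd b) j)" using assms(1) by (auto simp: gain_ps2 intro!: sum_mono)
  finally show "f2 ! snd b <= (\<Sum>j\<in>set es. fst b - d (snd b) j)" .
 qed
 also have "\<dots> = (\<Sum>j\<in>set es. \<Sum>b\<in>Z. fst b - d (snd b) j)" by (rule sum.swap)
 finally have "fl_cost dm f2 x z es <= (\<Sum>j\<in>set es. \<Sum>b\<in>Z. fst b - d (snd b) j) + (\<Sum>j\<in>set es. ?c j)"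
  using assms(1) by (simp add: fl_cost_def sum_list_distinct_conv_sum_set)
 moreover have "(\<Sum>j\<in>set es. \<Sum>b\<in>Z. fst b - d (snd b) j) + (\<Sum>j\<in>set es. \<Sum>a\<in>X. min (fst a) (v es j) - d (snd a) j) +
   (\<Sum>j\<in>set es. ?c j) <= (\<Sum>j\<in>set es. 3 * \<alpha> C1 es j)"
  unfolding sum.distrib[symmetric] by (rule sum_mono) (rule cl')
 moreover have "c + q <= t" if "c <= p + y" "p + q + y <= t" for c p q t y :: nat using that by linarith
 ultimately show "fl_cost dm f2 x z es + (\<Sum>j\<in>set es. \<Sum>a\<in>X. min (fst a) (v es j) - d (snd a) j) <= 3 * (\<Sum>j\<in>set es. \<alpha> C1 es j)"
  unfolding sum_distrib_left by blast
qed

lemma fl2_props: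
 assumes "ok es" and C1: "snd ` set C1 \<subseteq> {..<nf}" and x: "set x = snd ` set (mp ff [] C1 (map snd C1))"
  and z: "z = fl2 (dm, ff) (f2, fuel) [0..<nc] x es"
 shows "set x \<subseteq> {..<nf}" "set z \<subseteq> {..<nf}" "distinct z" "j \<in> set es ==> x @ z \<noteq> []"
  and "fl_cost dm f2 x z es <= fl_cost dm f2 x (fl_open ff x (cs2 es)) es"
  and "fl_cost dm f2 x z es <= fl_cost dm f2 x (fl_open ff x (cs2 [0..<nc])) [0..<nc]"
proof -
 let ?a = "fl_open ff x (cs2 es)" and ?b = "fl_open ff x (cs2 [0..<nc])"
 have okU: "ok [0..<nc]" by auto
 have zc: "z = (if fl_cost dm f2 x ?a es <= fl_cost dm f2 x ?b es then ?a else ?b)" by (simp add: z fl2_def Let_def)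
 note A = scenario_cost(2-4)[OF assms(1) C1 refl x refl] and B = scenario_cost(2-4)[OF okU C1 refl x refl]
 have "set [] \<subseteq> {..<nf}" by simp
 from mp_props(1)[OF C1 this fsym frefl] show "set x \<subseteq> {..<nf}" unfolding x using C1 by blast
 show "set z \<subseteq> {..<nf}" "distinct z" using A(2,3) B(2,3) unfolding zc by simp_all
 show "x @ z \<noteq> []" if "j \<in> set es"
 proof -
  have "j \<in> set [0..<nc]" using that assms(1) by auto
  then show ?thesis using A(1)[OF that] B(1)[of j] unfolding zc by (simp split: if_splits)
 qed
 show "fl_cost dm f2 x z es <= fl_cost dm f2 x ?a es" unfolding zc by simp
 have "fl_cost dm f2 x z es <= fl_cost dm f2 x ?b es" unfolding zc by simp
 also have "\<dots> <= fl_cost dm f2 x ?b [0..<nc]"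
  using assms(1) by (auto simp: fl_cost_def sum_list_distinct_conv_sum_set intro!: sum_mono2)
 finally show "fl_cost dm f2 x z es <= fl_cost dm f2 x ?b [0..<nc]" .
qed

lemma cands1_sub: "snd ` set (fl_cands1 fuel dm f1 f2 B scs) \<subseteq> {..<nf}"
 using len by (auto simp: fl_cands1_def fl_cands_mem)

text \<open>The factor 9/2 is 3 from \<open>scenario_cost\<close> times 3/2 from the rounded radii.
  The premise on the total weight extends the rounding bound to the first stage: the clients of all
  scenarios together have weight at most \<open>B * nc\<close>.\<close>

lemma stage_bound:
 fixes B scs
 assumes scs: "\<And>p. p \<in> set scs ==> ok (snd p)" and W: "sum_list (map fst scs) <= B"
  and x: "set x = set (fl_open ff [] (fl_cands1 fuel dm f1 f2 B scs))"
  and x': "x' \<subseteq> {..<nf}" and z': "\<And>p. p \<in> set scs ==> z' (snd p) \<subseteq> {..<nf} \<and> (\<forall>j\<in>set (snd p). \<sigma> (snd p) j \<in> x' \<union> z' (snd p))"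
 shows "2 * (B * tot f1 (set x) + (\<Sum>p\<leftarrow>scs. fst p * fl_cost dm f2 x (fl_open ff x (cs2 (snd p))) (snd p))) <=
  9 * (B * tot f1 x' + (\<Sum>p\<leftarrow>scs. fst p * (tot f2 (z' (snd p)) + (\<Sum>j\<in>set (snd p). d (\<sigma> (snd p) j) j))))"
proof -
 define C1 where "C1 = fl_cands1 fuel dm f1 f2 B scs"
 define X where "X = set (mp ff [] C1 (map snd C1))"
 define ps1 where "ps1 i = concat (map (%p. map (%j. (fst p, (v (snd p) j, d i j))) (snd p)) scs)" for i
 have mem: "c \<in> set C1 \<longleftrightarrow> snd c < nf \<and> fst c = rad fuel (B * f1 ! snd c) (ps1 (snd c)) \<and>
   B * f1 ! snd c <= gain (fst c) (ps1 (snd c))" for c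
  unfolding C1_def fl_cands1_def fl_cands_mem ps1_def Let_def using len by (auto simp: nthd_def)
 have C1n: "snd ` set C1 \<subseteq> {..<nf}" by (auto simp: mem)
 have xX: "set x = snd ` X" by (simp add: x fl_open_def X_def C1_def)
 have XC: "X \<subseteq> set C1"
  unfolding X_def by (rule mp_props(1)[OF C1n _ fsym frefl]) simp
 have fX: "finite X" by (simp add: X_def)
 have gain1: "gain g (ps1 i) = (\<Sum>p\<leftarrow>scs. fst p * (\<Sum>j\<in>set (snd p). min g (v (snd p) j) - d i j))" for g i
  unfolding ps1_def using scs
 proof (induction scs)
  case (Cons p scs)
  have "distinct (snd p)" using Cons.prems by auto
  then have "gain g (map (%j. (fst p, (v (snd p) j, d i j))) (snd p)) = fst p * (\<Sum>j\<in>set (snd p). min g (v (snd p) j) - d i j)"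
   by (simp add: gain_def o_def sum_list_distinct_conv_sum_set sum_distrib_left)
  moreover have "gain g (xs @ ys) = gain g xs + gain g ys" for xs ys by (simp add: gain_def)
  ultimately show ?case using Cons by simp
 qed (simp add: gain_def)
 have rad1: "2 * gain (rad fuel (B * f1 ! i) (ps1 i)) (ps1 i) <= 3 * (B * f1 ! i) \<and>
   (B * f1 ! i <= gain (rad fuel (B * f1 ! i) (ps1 i)) (ps1 i) \<or> rad fuel (B * f1 ! i) (ps1 i) = T)" if "i < nf" for i
 proof -
  have "sum_list (map fst (ps1 i)) <= sum_list (map fst scs) * nc"
   unfolding ps1_def using scs
  proof (induction scs)
   case (Cons p scs)
   have "length (snd p) <= nc" using Cons.prems length_ok by auto
   then have "fst p * length (snd p) <= fst p * nc" by simp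
   then have k: "fst p * length (snd p) + s <= (fst p + t) * nc" if "s <= t * nc" for s t
    using that unfolding add_mult_distrib by linarith
   have "sum_list (map fst (map (%j. (fst p, (v (snd p) j, d i j))) (snd p))) = fst p * length (snd p)"
    by (simp add: o_def sum_list_triv)
   then show ?case using k[OF Cons.IH] Cons.prems by simp
  qed simp
  also have "\<dots> <= B * nc" using W by simp
  finally have "2 * sum_list (map fst (ps1 i)) <= B * (2 * nc)" by simp
  moreover have "f1 ! i = 0 \<or> B * (2 * nc) <= B * f1 ! i" using big1[OF that] by auto
  ultimately have "B * f1 ! i = 0 \<or> 2 * sum_list (map fst (ps1 i)) <= B * f1 ! i" by (metis le_trans mult_0_right)
  from rad_props(1,3)[OF this, of fuel] show ?thesis by blast
 qed
 have dual1: "2 * (\<Sum>p\<leftarrow>scs. fst p * (\<Sum>j\<in>set (snd p). \<alpha> C1 (snd p) j - d i j)) <= 3 * (B * f1 ! i)" if i: "i < nf" for i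
 proof -
  let ?r = "rad fuel (B * f1 ! i) (ps1 i)"
  have "(\<Sum>p\<leftarrow>scs. fst p * (\<Sum>j\<in>set (snd p). \<alpha> C1 (snd p) j - d i j)) <= gain ?r (ps1 i)"
   unfolding gain1
  proof (intro sum_list_mono mult_le_mono2 sum_mono)
   fix p j assume p: "p \<in> set scs" and j: "j \<in> set (snd p)"
   show "\<alpha> C1 (snd p) j - d i j <= min ?r (v (snd p) j) - d i j"
   proof (cases "(?r, i) \<in> set C1")
    case True
    from reach_le[OF this, of j] show ?thesis by (auto simp: \<alpha>_def)
   next
    case False
    \<comment> \<open>A facility outside \<open>C1\<close> cannot be paid for within the caps. Its
      bisection then ends at \<open>T\<close>, which is at least every cap.\<close>
    then have "?r = T" using rad1[OF i] i by (auto simp: mem)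
    then show ?thesis using v_le_T(1)[OF scs[OF p] j] by (auto simp: \<alpha>_def)
   qed
  qed
  then show ?thesis using rad1[OF i] by linarith
 qed
 let ?S = "%G. \<Sum>p\<leftarrow>scs. fst p * (G (snd p) :: nat)"
 have "B * tot f1 (set x) <= B * (\<Sum>a\<in>X. f1 ! snd a)" unfolding xX by (intro mult_le_mono2 tot_snd_image_le fX)
 also have "\<dots> <= (\<Sum>a\<in>X. gain (fst a) (ps1 (snd a)))"
  unfolding sum_distrib_left
 proof (rule sum_mono)
  fix a assume "a \<in> X"
  then have "a \<in> set C1" using XC by blast
  then show "B * f1 ! snd a <= gain (fst a) (ps1 (snd a))" unfolding mem by blast
 qed
 also have "\<dots> = ?S (%es. \<Sum>j\<in>set es. \<Sum>a\<in>X. min (fst a) (v es j) - d (snd a) j)"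
  unfolding gain1 sum_list_sum_swap[symmetric] sum_distrib_left[symmetric] by (subst sum.swap) (rule refl)
 finally have 1: "B * tot f1 (set x) <= \<dots>" .
 have Smono: "?S G <= ?S G'" if "\<And>p. p \<in> set scs ==> G (snd p) <= G' (snd p)" for G G'
  using that by (intro sum_list_mono mult_le_mono2) auto
 have Sadd: "?S (%es. G es + G' es) = ?S G + ?S G'" for G G'
  by (simp add: add_mult_distrib2 sum_list_addf)
 have Smul: "?S (%es. k * G es) = k * ?S G" for k G
  by (simp add: sum_list_const_mult[symmetric] mult.left_commute)
 let ?c = "%es. fl_cost dm f2 x (fl_open ff x (cs2 es)) es" and ?a = "%es. \<Sum>j\<in>set es. \<alpha> C1 es j"
 let ?p = "%es. \<Sum>j\<in>set es. \<Sum>a\<in>X. min (fst a) (v es j) - d (snd a) j"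
 let ?y = "%es. \<Sum>i\<in>x'. \<Sum>j\<in>set es. \<alpha> C1 es j - d i j" and ?t = "%es. \<Sum>j\<in>set es. d (\<sigma> es j) j"
 have 2: "?S ?c + ?S ?p <= 3 * ?S ?a"
 proof -
  have "?S (%es. ?c es + ?p es) <= ?S (%es. 3 * ?a es)"
   by (rule Smono) (rule scenario_cost(1)[OF scs C1n X_def xX refl])
  then show ?thesis unfolding Sadd[of ?c ?p] Smul[of 3 ?a] .
 qed
 have 3: "2 * ?S ?a <= 2 * ?S ?t + 3 * ?S (%es. tot f2 (z' es)) + 2 * ?S ?y"
 proof -
  have "?S (%es. 2 * ?a es) <= ?S (%es. (2 * ?t es + 3 * tot f2 (z' es)) + 2 * ?y es)"
  proof (rule Smono)
   fix p assume p: "p \<in> set scs"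
   show "2 * ?a (snd p) <= 2 * ?t (snd p) + 3 * tot f2 (z' (snd p)) + 2 * ?y (snd p)"
    by (rule duality[OF scs[OF p] x']) (use z'[OF p] in auto)
  qed
  then show ?thesis
   unfolding Sadd[of "%es. 2 * ?t es + 3 * tot f2 (z' es)" "%es. 2 * ?y es"]
    Sadd[of "%es. 2 * ?t es" "%es. 3 * tot f2 (z' es)"] Smul[of 2 ?a] Smul[of 2 ?t]
    Smul[of 3 "%es. tot f2 (z' es)"] Smul[of 2 ?y] .
 qed
 have "?S (%es. \<Sum>i\<in>x'. \<Sum>j\<in>set es. \<alpha> C1 es j - d i j) = (\<Sum>i\<in>x'. ?S (%es. \<Sum>j\<in>set es. \<alpha> C1 es j - d i j))"
  unfolding sum_distrib_left sum_list_sum_swap ..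
 moreover have "2 * (\<Sum>i\<in>x'. ?S (%es. \<Sum>j\<in>set es. \<alpha> C1 es j - d i j)) <= (\<Sum>i\<in>x'. 3 * (B * f1 ! i))"
  unfolding sum_distrib_left[of 2] using dual1 x' by (intro sum_mono) auto
 moreover have "(\<Sum>i\<in>x'. 3 * (B * f1 ! i)) = 3 * (B * tot f1 x')" by (simp add: tot_def sum_distrib_left)
 ultimately have 4: "2 * ?S (%es. \<Sum>i\<in>x'. \<Sum>j\<in>set es. \<alpha> C1 es j - d i j) <= 3 * (B * tot f1 x')" by simp
 show "2 * (B * tot f1 (set x) + ?S (%es. fl_cost dm f2 x (fl_open ff x (cs2 es)) es)) <=
  9 * (B * tot f1 x' + ?S (%es. tot f2 (z' es) + (\<Sum>j\<in>set es. d (\<sigma> es j) j)))"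
 proof -
  have "2 * (a + c) <= 9 * (b + (s + t))"
   if "a <= p" "c + p <= 3 * al" "2 * al <= 2 * t + 3 * s + 2 * y" "2 * y <= 3 * b" for a b c p al s t y :: nat
  proof -
   have "2 * a + 2 * c <= 2 * p + 2 * c" using that(1) by simp
   also have "\<dots> <= 6 * al" using that(2) by simp
   also have "\<dots> <= 6 * t + 9 * s + 6 * y" using that(3) by simp
   also have "\<dots> <= 6 * t + 9 * s + 9 * b" using that(4) by simp
   also have "\<dots> <= 9 * (b + (s + t))" by simp
   finally show ?thesis by simp
  qed
  from this[OF 1 2 3 4] show ?thesis unfolding Sadd[of "%es. tot f2 (z' es)" ?t] .
 qed
qed

text \<open>The first stage has no candidates here, so the dual variables are the reaches within the
  scenario, and all facilities of the other solution may be regarded as second-stage ones.\<close>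

lemma pointwise_bound:
 assumes "ok es" "x' \<subseteq> {..<nf}" "z' \<subseteq> {..<nf}" "\<And>j. j \<in> set es ==> \<sigma> j \<in> x' \<union> z'"
 shows "2 * fl_cost dm f2 [] (fl_open ff [] (cs2 es)) es <= 9 * (tot f2 (x' \<union> z') + (\<Sum>j\<in>set es. d (\<sigma> j) j))"
proof -
 have "fl_cost dm f2 [] (fl_open ff [] (cs2 es)) es <= 3 * (\<Sum>j\<in>set es. \<alpha> [] es j)"
  using scenario_cost(1)[OF assms(1), of "[]" "{}" "[]"] by (simp add: mp_Nil)
 moreover have "2 * (\<Sum>j\<in>set es. \<alpha> [] es j) <= 2 * (\<Sum>j\<in>set es. d (\<sigma> j) j) + 3 * tot f2 (x' \<union> z')"
  using duality[OF assms(1), of "{}" "x' \<union> z'" \<sigma> "[]"] assms(2-4) by simp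
 moreover have "2 * c <= 9 * (t + D)" if "c <= 3 * s" "2 * s <= 2 * D + 3 * t" for c s t D :: nat using that by presburger
 ultimately show ?thesis by blast
qed

end

section \<open>Decoding of facility location instances\<close>

definition fl_np where "fl_np inp = nthd (0::nat) inp 0"
definition fl_nf where "fl_nf inp = nthd (0::nat) inp 1"
definition fl_nc where "fl_nc inp = nthd (0::nat) inp 2"
definition fl_off where "fl_off inp = 3 + fl_nf inp + fl_nc inp"
definition fl_m where "fl_m inp = 2 * fl_nf inp + fl_np inp * fl_np inp"
text \<open>The additional factor makes every nonzero number larger than twice the number of
  clients, so that integral radii are accurate enough.\<close>

definition fl_scl where "fl_scl inp k = (2 * fl_nc inp + 1) * scl inp (fl_off inp) (fl_m inp) k"
definition fl_fac where "fl_fac inp = rng inp (fl_nf inp)"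
definition fl_cli where "fl_cli inp = rng inp (fl_nc inp)"
definition fl_f1 where "fl_f1 inp = map (%i. fl_scl inp (2 * i)) (fl_fac inp)"
definition fl_f2 where "fl_f2 inp = map (%i. fl_scl inp (2 * i + 1)) (fl_fac inp)"
definition fl_dist where "fl_dist inp u v = fl_scl inp (2 * fl_nf inp + (u * fl_np inp + v))"
definition fl_dm where
 "fl_dm inp = map (%i. map (%j. fl_dist inp (nthd 0 inp (3 + i)) (nthd 0 inp (3 + fl_nf inp + j))) (fl_cli inp)) (fl_fac inp)"
definition fl_ff where
 "fl_ff inp = map (%i. map (%j. fl_dist inp (nthd 0 inp (3 + i)) (nthd 0 inp (3 + j))) (fl_fac inp)) (fl_fac inp)"
text \<open>As long as the binary expansion of a bound on any opening cost plus distance; so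
  \<open>top2\<close> of it serves as infinity.\<close>

definition fl_fuel where "fl_fuel inp = bits (sum_list (fl_f2 inp) + sum_list (concat (fl_dm inp)))"
definition fl_cheap where
 "fl_cheap inp \<longleftrightarrow> \<not> list_ex (%i. nthd 0 (fl_f1 inp) i < nthd 0 (fl_f2 inp) i) (fl_fac inp)"
definition fl_samples where
 "fl_samples inp = (if fl_cheap inp then 0 else nsamp inp (fl_off inp) (fl_m inp) (fl_nc inp))"
definition fl_scen where
 "fl_scen inp ws = (let rn = rnum inp (fl_off inp) (fl_m inp); rd = rden inp (fl_off inp) (fl_m inp) in
   heavy rn rd ws @ [(rest rn rd ws, fl_cli inp)])"

definition fl_stage1 :: "nat list \<times> nat list => nat" where
 "fl_stage1 p = (let inp = fst p; ws = snd p in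
   if fl_cheap inp then 0
   else mask (%i. i \<in> set (fl_open (fl_ff inp) [] (fl_cands1 (fl_fuel inp) (fl_dm inp) (fl_f1 inp) (fl_f2 inp)
     (2 * (length ws * rden inp (fl_off inp) (fl_m inp))) (fl_scen inp ws)))) (fl_fac inp))"

definition fl_stage2 :: "nat list => nat \<times> nat list" where
 "fl_stage2 inp = (let x = dec (nthd 0 inp (fl_off inp + 2 * fl_m inp + 6));
    z = fl2 (fl_dm inp, fl_ff inp) (fl_f2 inp, fl_fuel inp) (fl_cli inp) x (dec (nthd 0 inp (fl_off inp + 2 * fl_m inp + 8)))
   in (mask (%i. i \<in> set z) (fl_fac inp), map (%j. fl_assign (fl_dm inp) (x @ z) j) (fl_cli inp)))"

lemma pt_fl_np [pt_intros]: "pt a ==> pt (%x. fl_np (a x))"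
 by (rule pt_compose) (unfold fl_np_def, intro pt_intros)
lemma pt_fl_nf [pt_intros]: "pt a ==> pt (%x. fl_nf (a x))"
 by (rule pt_compose) (unfold fl_nf_def, intro pt_intros)
lemma pt_fl_nc [pt_intros]: "pt a ==> pt (%x. fl_nc (a x))"
 by (rule pt_compose) (unfold fl_nc_def, intro pt_intros)
lemma pt_fl_off [pt_intros]: "pt a ==> pt (%x. fl_off (a x))"
 by (rule pt_compose) (unfold fl_off_def, intro pt_intros)
lemma pt_fl_m [pt_intros]: "pt a ==> pt (%x. fl_m (a x))"
 by (rule pt_compose) (unfold fl_m_def, intro pt_intros)
lemma pt_fl_scl [pt_intros]: "pt a ==> pt b ==> pt (%x. fl_scl (a x) (b x))"
 by (rule pt_lift2) (unfold fl_scl_def, intro pt_intros)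
lemma pt_fl_fac [pt_intros]: "pt a ==> pt (%x. fl_fac (a x))"
 by (rule pt_compose) (unfold fl_fac_def, intro pt_intros)
lemma pt_fl_cli [pt_intros]: "pt a ==> pt (%x. fl_cli (a x))"
 by (rule pt_compose) (unfold fl_cli_def, intro pt_intros)
lemma pt_fl_f1 [pt_intros]: "pt a ==> pt (%x. fl_f1 (a x))"
 by (rule pt_compose) (unfold fl_f1_def, intro pt_intros)
lemma pt_fl_f2 [pt_intros]: "pt a ==> pt (%x. fl_f2 (a x))"
 by (rule pt_compose) (unfold fl_f2_def, intro pt_intros)
lemma pt_fl_dist [pt_intros]: "pt a ==> pt b ==> pt c ==> pt (%x. fl_dist (a x) (b x) (c x))"
 by (rule pt_lift3) (unfold fl_dist_def, intro pt_intros)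
lemma pt_fl_dm [pt_intros]: "pt a ==> pt (%x. fl_dm (a x))"
 by (rule pt_compose) (unfold fl_dm_def, intro pt_intros)
lemma pt_fl_ff [pt_intros]: "pt a ==> pt (%x. fl_ff (a x))"
 by (rule pt_compose) (unfold fl_ff_def, intro pt_intros)
lemma pt_fl_fuel [pt_intros]: "pt a ==> pt (%x. fl_fuel (a x))"
 by (rule pt_compose) (unfold fl_fuel_def, intro pt_intros)
lemma pt_fl_cheap [pt_intros]: "pt a ==> pt (%x. fl_cheap (a x))"
 by (rule pt_compose) (unfold fl_cheap_def, intro pt_intros)
lemma pt_fl_samples [pt_intros]: "pt a ==> pt (%x. fl_samples (a x))"
 by (rule pt_compose) (unfold fl_samples_def, intro pt_intros)
lemma pt_fl_scen [pt_intros]: "pt a ==> pt b ==> pt (%x. fl_scen (a x) (b x))"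
 by (rule pt_lift2) (unfold fl_scen_def, intro pt_intros)

definition fl_qs where
 "fl_qs I r \<epsilon> \<delta> = concat (map (%i. [open1 I i, open2 I i]) [0..<nfac I]) @
   map (%p. dst I (fst p) (snd p)) (List.product [0..<npoints I] [0..<npoints I]) @ [r, \<epsilon>, \<delta>]"

text \<open>\<open>fl_scl\<close> in terms of the instance alone, so that both stages provably work
  with the same integers. The three parameters are set to 0 because they lie beyond the first
  \<open>m\<close> entries of the table.\<close>

definition fl_val where
 "fl_val I k = (let qs = fl_qs I 0 0 0 in (2 * ncli I + 1) * (nat (fst (quotient_of (qs ! k))) *
   prod_list (map (%j. if j = k then 1 else nat (snd (quotient_of (qs ! j)))) [0..<2 * nfac I + npoints I * npoints I])))"

definition fl_d where "fl_d I u v = fl_val I (2 * nfac I + (u * npoints I + v))"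

locale fl_input =
 fixes I :: facility_inst and r \<epsilon> \<delta> :: rat and inp post :: "nat list"
 assumes inp: "inp = stage1_input (facility_problem I) r \<epsilon> \<delta> @ post"
  and metric: "Metric_space {..<npoints I} (%u v. of_rat (dst I u v))"
  and locs: "fac_loc I ` {..<nfac I} \<subseteq> {..<npoints I}" "cli_loc I ` {..<ncli I} \<subseteq> {..<npoints I}"
  and ne: "ncli I > 0 --> nfac I > 0"
  and costs: "valid_costs {..<nfac I} (open1 I) (open2 I)"
begin

abbreviation "np \<equiv> npoints I"
abbreviation "nf \<equiv> nfac I"
abbreviation "nc \<equiv> ncli I"
abbreviation "off \<equiv> 3 + nf + nc"
abbreviation "m \<equiv> 2 * nf + np * np"
definition "E = (2 * nc + 1) * dprod inp off m"

definition pre where "pre = [np, nf, nc] @ map (fac_loc I) [0..<nf] @ map (cli_loc I) [0..<nc]"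

lemma inp_eq: "inp = pre @ concat (map rat_code (fl_qs I r \<epsilon> \<delta>)) @ post"
proof -
 have "concat (map (%i. rat_code (open1 I i) @ rat_code (open2 I i)) xs) =
   concat (map rat_code (concat (map (%i. [open1 I i, open2 I i]) xs)))" for xs
  by (induction xs) auto
 moreover have "concat (map (%(u, v). rat_code (dst I u v)) ps) = concat (map rat_code (map (%p. dst I (fst p) (snd p)) ps))" for ps
  by (induction ps) auto
 ultimately show ?thesis
  by (simp add: inp stage1_input_def facility_problem_def pre_def fl_qs_def)
qed

lemma length_pre: "length pre = off" by (simp add: pre_def)

lemma length_qs: "length (fl_qs I r \<epsilon> \<delta>) = m + 3" by (simp add: fl_qs_def concat_pairs length_product)

lemma length_inp: "length inp = off + 2 * (m + 3) + length post"
 by (simp add: inp_eq length_pre length_rat_codes length_qs)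

lemma qs_nth:
 "i < nf ==> fl_qs I r' \<epsilon>' \<delta>' ! (2 * i) = open1 I i" "i < nf ==> fl_qs I r' \<epsilon>' \<delta>' ! Suc (2 * i) = open2 I i"
 "u < np ==> v < np ==> fl_qs I r' \<epsilon>' \<delta>' ! (2 * nf + (u * np + v)) = dst I u v"
 "fl_qs I r' \<epsilon>' \<delta>' ! m = r'" "fl_qs I r' \<epsilon>' \<delta>' ! (m + 1) = \<epsilon>'" "fl_qs I r' \<epsilon>' \<delta>' ! (m + 2) = \<delta>'"
proof -
 show "i < nf ==> fl_qs I r' \<epsilon>' \<delta>' ! (2 * i) = open1 I i" "i < nf ==> fl_qs I r' \<epsilon>' \<delta>' ! Suc (2 * i) = open2 I i"
  by (simp_all add: fl_qs_def concat_pairs)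
 define A where "A = concat (map (%i. [open1 I i, open2 I i]) [0..<nf])"
 define B where "B = map (%p. dst I (fst p) (snd p)) (List.product [0..<np] [0..<np])"
 have l: "length A = 2 * nf" "length B = np * np" by (simp_all add: A_def B_def concat_pairs length_product)
 have q: "fl_qs I r' \<epsilon>' \<delta>' = A @ B @ [r', \<epsilon>', \<delta>']" by (simp add: fl_qs_def A_def B_def)
 show "fl_qs I r' \<epsilon>' \<delta>' ! m = r'" "fl_qs I r' \<epsilon>' \<delta>' ! (m + 1) = \<epsilon>'" "fl_qs I r' \<epsilon>' \<delta>' ! (m + 2) = \<delta>'"
  unfolding q by (simp_all add: nth_append l)
 assume uv: "u < np" "v < np"
 have "u * np + v < Suc u * np" using uv by simp
 also have "\<dots> <= np * np" using uv by (intro mult_le_mono1) simp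
 finally have k: "u * np + v < np * np" .
 then show "fl_qs I r' \<epsilon>' \<delta>' ! (2 * nf + (u * np + v)) = dst I u v"
  unfolding q using uv by (simp add: nth_append l) (simp add: B_def product_nth length_product)
qed

lemma idx_less: "u < np ==> v < np ==> 2 * nf + (u * np + v) < m"
proof -
 assume uv: "u < np" "v < np"
 have "u * np + v < Suc u * np" using uv by simp
 also have "\<dots> <= np * np" using uv by (intro mult_le_mono1) simp
 finally show ?thesis by simp
qed

lemma ns [simp]: "fl_np inp = np" "fl_nf inp = nf" "fl_nc inp = nc" "fl_off inp = off" "fl_m inp = m"
 by (simp_all add: fl_np_def fl_nf_def fl_nc_def fl_off_def fl_m_def inp_eq pre_def nthd_def)

lemma idx [simp]: "fl_fac inp = [0..<nf]" "fl_cli inp = [0..<nc]"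
 by (simp_all add: fl_fac_def fl_cli_def rng_eq length_inp)

lemma loc_nth:
 "i < nf ==> nthd 0 inp (3 + i) = fac_loc I i" "j < nc ==> nthd 0 inp (3 + nf + j) = cli_loc I j"
 by (simp_all add: inp_eq pre_def nthd_def nth_append)

lemma loc_less: "i < nf ==> fac_loc I i < np" "j < nc ==> cli_loc I j < np"
 using locs by auto

lemma costs_nonneg: "i < nf ==> 0 <= open1 I i" "i < nf ==> 0 <= open2 I i"
 "i < nf ==> open1 I i = 0 ==> open2 I i = 0"
 using costs by (auto simp: valid_costs_def)

lemma dst_nonneg: "0 <= dst I u v"
 using Metric_space.nonneg[OF metric, of u v] by simp

lemma qs_nonneg: "k < m ==> 0 <= fl_qs I r \<epsilon> \<delta> ! k"
proof -
 assume k: "k < m"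
 show ?thesis
 proof (cases "k < 2 * nf")
  case True
  show ?thesis
  proof (cases "even k")
   case e: True
   then obtain i where "k = 2 * i" by (auto elim: evenE)
   then show ?thesis using True costs_nonneg(1)[of i] qs_nth(1)[of i] by auto
  next
   case False
   then obtain i where "k = 2 * i + 1" by (auto elim: oddE)
   then show ?thesis using True costs_nonneg(2)[of i] qs_nth(2)[of i] by auto
  qed
 next
  case False
  define q where "q = k - 2 * nf"
  have q: "k = 2 * nf + q" "q < np * np" using k False by (auto simp: q_def)
  have "np \<noteq> 0" using q(2) by (cases np) auto
  have "q div np < np" "q mod np < np" using q(2) \<open>np \<noteq> 0\<close> by (auto simp: less_mult_imp_div_less)
  from qs_nth(3)[OF this] show ?thesis using q(1) dst_nonneg by simp
 qed
qed

lemma scl_val: "k < m ==> fl_scl inp k = fl_val I k"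
proof -
 assume k: "k < m"
 have same: "fl_qs I r \<epsilon> \<delta> ! j = fl_qs I 0 0 0 ! j" if "j < m" for j
 proof (cases "j < 2 * nf")
  case False
  then have "j - 2 * nf < np * np" using that by linarith
  with False show ?thesis by (simp add: fl_qs_def nth_append concat_pairs length_product)
 qed (simp add: fl_qs_def nth_append concat_pairs)
 have rg: "rng inp m = [0..<m]" by (simp add: rng_eq length_inp)
 have e: "map (%j. if j = k then 1 else rden inp off j) [0..<m] =
   map (%j. if j = k then 1 else nat (snd (quotient_of (fl_qs I 0 0 0 ! j)))) [0..<m]"
  using rat_table(2)[OF inp_eq length_pre[symmetric]] length_qs same by (intro map_cong) auto
 have "rnum inp off k = nat (fst (quotient_of (fl_qs I 0 0 0 ! k)))"
  using rat_table(1)[OF inp_eq length_pre[symmetric], of k] k length_qs same[OF k] by simp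
 then show ?thesis unfolding fl_scl_def fl_val_def Let_def scl_def ns rg e by (simp only:)
qed

lemma val_real: "k < m ==> real (fl_val I k) = real E * of_rat (fl_qs I r \<epsilon> \<delta> ! k)"
proof -
 assume k: "k < m"
 have "real (fl_val I k) = real (2 * nc + 1) * real (scl inp off m k)"
  unfolding scl_val[OF k, symmetric] fl_scl_def ns by (rule of_nat_mult)
 also have "real (scl inp off m k) = real (dprod inp off m) * of_rat (fl_qs I r \<epsilon> \<delta> ! k)"
  using k qs_nonneg[OF k] by (intro scl_real[OF inp_eq]) (simp_all add: length_pre length_qs)
 finally show ?thesis by (simp only: E_def of_nat_mult mult.assoc)
qed

lemma E_pos: "0 < E"
proof -
 have "0 < dprod inp off m"
 proof (rule dprod_pos)
  show "0 < rden inp off k" if "k < m" for k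
   using rat_table_value(1)[OF inp_eq, of off k] qs_nonneg[OF that] that by (simp add: length_pre length_qs)
 qed (simp add: length_inp)
 then show ?thesis by (simp add: E_def)
qed

lemma f_eq: "fl_f1 inp = map (%i. fl_val I (2 * i)) [0..<nf]" "fl_f2 inp = map (%i. fl_val I (2 * i + 1)) [0..<nf]"
 by (auto simp: fl_f1_def fl_f2_def scl_val)

lemma dist_eq: "u < np ==> v < np ==> fl_dist inp u v = fl_d I u v"
 using idx_less[of u v] by (simp add: fl_dist_def fl_d_def scl_val)

lemma dm_eq: "fl_dm inp = map (%i. map (%j. fl_d I (fac_loc I i) (cli_loc I j)) [0..<nc]) [0..<nf]"
 unfolding fl_dm_def idx ns
 by (intro map_cong refl) (simp add: loc_nth[simplified] loc_less dist_eq)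

lemma ff_eq: "fl_ff inp = map (%i. map (%j. fl_d I (fac_loc I i) (fac_loc I j)) [0..<nf]) [0..<nf]"
 unfolding fl_ff_def idx ns
 by (intro map_cong refl) (simp add: loc_nth[simplified] loc_less dist_eq)

lemma f_real: "i < nf ==> real (fl_f1 inp ! i) = real E * of_rat (open1 I i)"
 "i < nf ==> real (fl_f2 inp ! i) = real E * of_rat (open2 I i)"
 using val_real[of "2 * i"] val_real[of "2 * i + 1"] by (simp_all add: f_eq qs_nth)

lemma d_real: "u < np ==> v < np ==> real (fl_d I u v) = real E * of_rat (dst I u v)"
 using val_real[OF idx_less] qs_nth(3) by (simp add: fl_d_def)

lemma at2_dm: "i < nf ==> j < nc ==> at2 (fl_dm inp) i j = fl_d I (fac_loc I i) (cli_loc I j)"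
 by (simp add: dm_eq at2_def nthd_def)

lemma at2_ff: "i < nf ==> j < nf ==> at2 (fl_ff inp) i j = fl_d I (fac_loc I i) (fac_loc I j)"
 by (simp add: ff_eq at2_def nthd_def)

lemma d_metric:
 assumes "u < np" "v < np"
 shows "fl_d I u v = fl_d I v u" "fl_d I u u = 0" "w < np ==> fl_d I u w <= fl_d I u v + fl_d I v w"
proof -
 interpret M: Metric_space "{..<np}" "%u v. of_rat (dst I u v)" by (rule metric)
 have "real (fl_d I u v) = real (fl_d I v u)" using d_real assms M.commute[of u v] by simp
 then show "fl_d I u v = fl_d I v u" by simp
 have "real (fl_d I u u) = 0" using d_real assms M.zero[of u u] by simp
 then show "fl_d I u u = 0" by simp
 assume w: "w < np"
 have "real E * of_rat (dst I u w) <= real E * (of_rat (dst I u v) + of_rat (dst I v w))"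
  using M.triangle[of u v w] assms w by (intro mult_left_mono) auto
 then have "real (fl_d I u w) <= real (fl_d I u v + fl_d I v w)" using d_real assms w by (simp add: distrib_left)
 then show "fl_d I u w <= fl_d I u v + fl_d I v w" by (simp only: of_nat_le_iff)
qed

sublocale fl_stage "fl_dm inp" "fl_ff inp" "fl_f1 inp" "fl_f2 inp" "fl_fuel inp" nf nc
proof
 show "length (fl_dm inp) = nf" "length (fl_f1 inp) = nf" "length (fl_f2 inp) = nf" by (simp_all add: dm_eq f_eq)
 fix i assume i: "i < nf"
 have big: "fl_val I k = 0 \<or> 2 * nc <= fl_val I k" for k
 proof -
  have "(2 * nc + 1) * c = 0 \<or> 2 * nc <= (2 * nc + 1) * c" for c :: nat by (cases c) auto
  then show ?thesis unfolding fl_val_def Let_def .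
 qed
 show "fl_f1 inp ! i = 0 \<or> 2 * nc <= fl_f1 inp ! i" "fl_f2 inp ! i = 0 \<or> 2 * nc <= fl_f2 inp ! i"
  using big i by (simp_all add: f_eq)
 show "at2 (fl_ff inp) i i = 0" using i d_metric(2)[OF loc_less(1) loc_less(1)] by (simp add: at2_ff)
 show "fl_f2 inp ! i + at2 (fl_dm inp) i j <= top2 (fl_fuel inp)" if j: "j < nc" for j
 proof -
  have "fl_f2 inp ! i <= sum_list (fl_f2 inp)" using i by (intro member_le_sum_list) (auto simp: f_eq)
  moreover have "at2 (fl_dm inp) i j <= sum_list (concat (fl_dm inp))"
   unfolding at2_dm[OF i j] unfolding dm_eq using i j by (intro member_le_sum_list) (auto intro!: bexI[of _ i] image_eqI[of _ _ j])
  ultimately show ?thesis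
   using less_pow_length_bits[of "sum_list (fl_f2 inp) + sum_list (concat (fl_dm inp))"] by (simp add: fl_fuel_def top2_conv)
 qed
 fix i' assume i': "i' < nf"
 note L = loc_less(1)[OF i] loc_less(1)[OF i']
 show "at2 (fl_ff inp) i i' = at2 (fl_ff inp) i' i" using i i' d_metric(1)[OF L] by (simp add: at2_ff)
 fix j assume j: "j < nc"
 note Lj = loc_less(2)[OF j]
 show "at2 (fl_dm inp) i' j <= at2 (fl_ff inp) i i' + at2 (fl_dm inp) i j"
  using d_metric(3)[OF L(2) L(1) Lj] d_metric(1)[OF L] i i' j by (simp add: at2_ff at2_dm)
 show "at2 (fl_ff inp) i i' <= at2 (fl_dm inp) i j + at2 (fl_dm inp) i' j"
  using d_metric(3)[OF L(1) Lj L(2)] d_metric(1)[OF L(2) Lj] i i' j by (simp add: at2_ff at2_dm)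
next
 show "0 < nf" if "0 < nc" using ne that by simp
qed

lemma cheap_iff: "fl_cheap inp \<longleftrightarrow> (\<forall>i<nf. open2 I i <= open1 I i)"
proof -
 have "fl_f1 inp ! i < fl_f2 inp ! i \<longleftrightarrow> open1 I i < open2 I i" if "i < nf" for i
 proof -
  have "fl_f1 inp ! i < fl_f2 inp ! i \<longleftrightarrow> real (fl_f1 inp ! i) < real (fl_f2 inp ! i)" by simp
  also have "\<dots> \<longleftrightarrow> real_of_rat (open1 I i) < real_of_rat (open2 I i)"
   unfolding f_real[OF that] using E_pos by simp
  finally show ?thesis by (simp add: of_rat_less)
 qed
 then show ?thesis using len by (auto simp: fl_cheap_def list_ex_iff nthd_def not_less)
qed

lemma not_cheap_inflation: "\<not> fl_cheap inp ==> 1 <= inflation (facility_problem I)"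
proof -
 assume "\<not> fl_cheap inp"
 then obtain i where i: "i < nf" "open1 I i < open2 I i" by (auto simp: cheap_iff not_le)
 have "0 < open1 I i" using i costs_nonneg[of i] by (metis less_le)
 then have "1 <= of_rat (open2 I i) / (of_rat (open1 I i) :: real)"
  using i by (simp add: of_rat_less_eq)
 also have "\<dots> <= inflation (facility_problem I)"
  unfolding inflation_def using i by (intro Max_ge) (auto simp: facility_problem_def)
 finally show ?thesis .
qed

lemma radius:
 assumes "0 < r"
 shows "0 < rden inp off m" "of_rat r = real (rnum inp off m) / real (rden inp off m)"
 using rat_table_value[OF inp_eq, of off m] assms by (simp_all add: length_pre length_qs qs_nth)

lemma extra:
 assumes "post = [x, y, a]"
 shows "nthd 0 inp (off + 2 * m + 6) = x" "nthd 0 inp (off + 2 * m + 8) = a"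
proof -
 define l where "l = pre @ concat (map rat_code (fl_qs I r \<epsilon> \<delta>))"
 have e: "inp = l @ [x, y, a]" by (simp add: inp_eq assms l_def)
 have l: "length l = off + 2 * m + 6" by (simp add: l_def length_pre length_rat_codes length_qs)
 then have "off + 2 * m + 8 = Suc (Suc (length l))" by simp
 then show "nthd 0 inp (off + 2 * m + 6) = x" "nthd 0 inp (off + 2 * m + 8) = a"
  unfolding l[symmetric] by (simp_all add: nthd_def e nth_append)
qed

lemma tot_real:
 "S \<subseteq> {..<nf} ==> real (tot (fl_f1 inp) S) = real E * (\<Sum>i\<in>S. of_rat (open1 I i))"
 "S \<subseteq> {..<nf} ==> real (tot (fl_f2 inp) S) = real E * (\<Sum>i\<in>S. of_rat (open2 I i))"
 unfolding tot_def of_nat_sum sum_distrib_left by (intro sum.cong refl f_real; auto)+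

lemma conn_real:
 assumes "A \<subseteq> {..<nc}" "\<And>j. j \<in> A ==> \<sigma> j < nf"
 shows "real (\<Sum>j\<in>A. at2 (fl_dm inp) (\<sigma> j) j) = real E * (\<Sum>j\<in>A. of_rat (dst I (fac_loc I (\<sigma> j)) (cli_loc I j)))"
 unfolding of_nat_sum sum_distrib_left
proof (rule sum.cong[OF refl])
 fix j assume "j \<in> A"
 then have "j < nc" "\<sigma> j < nf" using assms by auto
 then show "real (at2 (fl_dm inp) (\<sigma> j) j) = real E * of_rat (dst I (fac_loc I (\<sigma> j)) (cli_loc I j))"
  by (simp only: at2_dm d_real[OF loc_less])
qed

end

theorem facility_location_approx: "has_approx_algorithm facility_problems (%P \<epsilon>. 10.98 + 27 * \<epsilon>)"
proof -
 let ?P = facility_problem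
 let ?V = "%I. Metric_space {..<npoints I} (%u v. of_rat (dst I u v)) \<and> fac_loc I ` {..<nfac I} \<subseteq> {..<npoints I} \<and>
     cli_loc I ` {..<ncli I} \<subseteq> {..<npoints I} \<and> (ncli I > 0 --> nfac I > 0) \<and> valid_costs {..<nfac I} (open1 I) (open2 I)"
 have flds: "ground (?P I) = {..<ncli I}" "actions (?P I) = {..<nfac I}"
  "cost1 (?P I) = (%i. of_rat (open1 I i))" "cost2 (?P I) = (%i. of_rat (open2 I i))"
  "feasible (?P I) x A z \<longleftrightarrow> fst z \<subseteq> {..<nfac I} \<and> (\<forall>j\<in>A. snd z j \<in> x \<union> fst z)"
  "recourse_cost (?P I) A z = (\<Sum>i\<in>fst z. of_rat (open2 I i)) + (\<Sum>j\<in>A. of_rat (dst I (fac_loc I (snd z j)) (cli_loc I j)))"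
  "recourse_of (?P I) s = (set_decode (fst s 0), snd s)" for I x A z s
  by (simp_all add: facility_problem_def split: prod.splits)
 have loc: "fl_input I r \<epsilon> \<delta> (stage1_input (?P I) r \<epsilon> \<delta> @ post) post" if "?V I" for I r \<epsilon> \<delta> post
  using that by (simp add: fl_input_def)
 show ?thesis
  unfolding facility_problems_def
 proof (rule has_approx_algorithmI[where h = fl_samples and ?f1.0 = fl_stage1 and ?f2.0 = fl_stage2 and C = 512 and e = 5])
  show "pt fl_samples" by (intro pt_fl_samples pt_id)
  show "pt fl_stage1" unfolding fl_stage1_def by (intro pt_intros)
  show "pt fl_stage2" unfolding fl_stage2_def by (intro pt_intros)
  fix P assume "P \<in> ?P ` {I. ?V I}"
  then obtain I where I: "?V I" and P: "P = ?P I" by (elim imageE CollectE) (rule that)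
  show "0 <= inflation P" unfolding inflation_def by (rule Max_ge) (auto simp: P flds)
  fix r \<epsilon> \<delta> :: rat
  interpret fl_input I r \<epsilon> \<delta> "stage1_input (?P I) r \<epsilon> \<delta>" "[]" using loc[OF I, of _ _ _ "[]"] by simp
  let ?inp = "stage1_input (?P I) r \<epsilon> \<delta>"
  have nc_le: "nc <= input_size ?inp" "nf <= input_size ?inp" using length_inp length_le_input_size[of ?inp] by simp_all
  show "ground P \<subseteq> {..<input_size (stage1_input P r \<epsilon> \<delta>)}" using nc_le(1) by (auto simp: P flds)
  show "fl_stage1 (stage1_input P r \<epsilon> \<delta>, ws) < 2 ^ input_size (stage1_input P r \<epsilon> \<delta>)" for ws
  proof -
   have "set_encode {i. i < nf \<and> Q i} < 2 ^ input_size ?inp" for Q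
    using nc_le(2) by (intro set_encode_less) auto
   then show ?thesis by (simp add: fl_stage1_def Let_def P mask_upt)
  qed
  show "length (snd (fl_stage2 (stage1_input P r \<epsilon> \<delta> @ [x, 0, a]))) <= length (stage1_input P r \<epsilon> \<delta>)" for x a
  proof -
   interpret S2: fl_input I r \<epsilon> \<delta> "?inp @ [x, 0, a]" "[x, 0, a]" by (rule loc[OF I])
   show ?thesis using length_inp by (simp add: fl_stage2_def Let_def P)
  qed
  assume v: "0 < r" "r <= 1" "0 < \<epsilon>" "\<epsilon> < 1" "0 < \<delta>" "\<delta> < 1"
  have m2: "m + 2 < length (fl_qs I r \<epsilon> \<delta>)" by (simp add: length_qs)
  note np = nsamp_properties[OF inp_eq length_pre[symmetric] m2 qs_nth(4-6) v, of nc]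
  show "real (fl_samples (stage1_input P r \<epsilon> \<delta>)) <= real 512 *
    (1 + real (input_size (stage1_input P r \<epsilon> \<delta>)) + inflation P / (of_rat \<epsilon> * of_rat r)) ^ 5"
  proof (cases "fl_cheap ?inp")
   case True
   have "0 <= inflation P / (of_rat \<epsilon> * of_rat r)" using \<open>0 <= inflation P\<close> v by simp
   with True show ?thesis by (simp add: fl_samples_def P)
  next
   case False
   from np(3)[OF nc_le(1) not_cheap_inflation[OF False]] False show ?thesis by (simp add: fl_samples_def P)
  qed
  show "2 * 2 ^ card (ground P) * exp (- 2 * real (fl_samples (stage1_input P r \<epsilon> \<delta>)) * (of_rat \<epsilon> * (of_rat r)\<^sup>2 / 2)\<^sup>2)
    <= of_rat \<delta>" if "0 < fl_samples (stage1_input P r \<epsilon> \<delta>)"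
   using that np(2) by (simp add: fl_samples_def P flds split: if_splits)
  fix p ws inp and s :: "nat set => state"
  assume p: "p \<in> distributions P" and inp: "inp = stage1_input P r \<epsilon> \<delta>" and lenw: "length ws = fl_samples inp"
   and ws: "set ws \<subseteq> set_encode ` Pow (ground P)"
   and acc: "0 < fl_samples inp --> accurate P p (of_rat \<epsilon> * (of_rat r)\<^sup>2 / 2) ws"
   and s: "\<And>A. A \<subseteq> ground P ==> fst (s A) 0 = fst (fl_stage2 (inp @ [fl_stage1 (inp, ws), 0, set_encode A])) \<and>
     (\<forall>j < length (snd (fl_stage2 (inp @ [fl_stage1 (inp, ws), 0, set_encode A]))).
      snd (s A) j = snd (fl_stage2 (inp @ [fl_stage1 (inp, ws), 0, set_encode A])) ! j)"
  have inp': "inp = ?inp" by (simp add: inp P)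
  let ?dm = "fl_dm ?inp" and ?ff = "fl_ff ?inp" and ?f1 = "fl_f1 ?inp" and ?f2 = "fl_f2 ?inp" and ?fu = "fl_fuel ?inp"
  let ?r = "of_rat r :: real" let ?e = "of_rat \<epsilon> :: real"
  let ?z = "%A. recourse_of P (s A)"
  define X where "X = fl_stage1 (inp, ws)"
  define x where "x = dec X"
  define rn rd where "rn = rnum ?inp off m" and "rd = rden ?inp off m"
  let ?H = "heavy rn rd ws" and ?u = "rest rn rd ws" and ?B = "2 * (length ws * rd)"
  \<comment> \<open>An empty candidate list describes the empty first stage of an instance without
    increasing costs, so the facts about \<open>x\<close> can be proved for both cases at
    once.\<close>
  define C1 where "C1 = (if fl_cheap ?inp then [] else fl_cands1 ?fu ?dm ?f1 ?f2 ?B (?H @ [(?u, [0..<nc])]))"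
  have C1n: "snd ` set C1 \<subseteq> {..<nf}" using cands1_sub by (simp add: C1_def)
  have open_C1: "set (fl_open ?ff [] C1) = snd ` set (mp ?ff [] C1 (map snd C1))" by (simp add: fl_open_def)
  have open_nf: "set (fl_open ?ff [] C1) \<subseteq> {..<nf}"
  proof -
   have "set [] \<subseteq> {..<nf}" by simp
   from mp_props(1)[OF C1n this fsym frefl] show ?thesis unfolding open_C1 using C1n by blast
  qed
  have set_x: "set x = set (fl_open ?ff [] C1)"
  proof (cases "fl_cheap ?inp")
   case True
   then have "X = 0" by (simp add: X_def inp' fl_stage1_def Let_def)
   then show ?thesis using True by (simp add: x_def C1_def fl_open_def mp_Nil)
  next
   case False
   then have "X = mask (%i. i \<in> set (fl_open ?ff [] C1)) [0..<nf]"
    by (simp add: X_def inp' fl_stage1_def Let_def C1_def fl_scen_def rn_def rd_def)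
   then show ?thesis using open_nf by (auto simp: x_def set_decode_mask)
  qed
  have xX: "set x = snd ` set (mp ?ff [] C1 (map snd C1))" unfolding set_x open_C1 ..
  have decX: "set_decode X = set x" by (simp add: x_def)
  have decA: "set (dec (set_encode A)) = A" if "A \<subseteq> {..<nc}" for A
   using that finite_subset[of A "{..<nc}"] by simp
  have okA: "ok (dec (set_encode A))" if "A \<subseteq> {..<nc}" for A using decA[OF that] that by simp
  define z where "z A = fl2 (?dm, ?ff) (?f2, ?fu) [0..<nc] x (dec (set_encode A))" for A
  note zp = fl2_props[OF okA C1n xX z_def]
  have xn: "set x \<subseteq> {..<nf}" unfolding set_x by (rule open_nf)
  have zs: "fst (?z A) = set (z A)" "\<And>j. j \<in> A ==> snd (?z A) j = fl_assign ?dm (x @ z A) j" if A: "A \<subseteq> {..<nc}" for A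
  proof -
   interpret S2: fl_input I r \<epsilon> \<delta> "?inp @ [X, 0, set_encode A]" "[X, 0, set_encode A]" by (rule loc[OF I])
   have dm: "fl_dm (?inp @ [X, 0, set_encode A]) = ?dm" unfolding S2.dm_eq dm_eq ..
   have ff: "fl_ff (?inp @ [X, 0, set_encode A]) = ?ff" unfolding S2.ff_eq ff_eq ..
   have f2: "fl_f2 (?inp @ [X, 0, set_encode A]) = ?f2" unfolding S2.f_eq f_eq ..
   have fu: "fl_fuel (?inp @ [X, 0, set_encode A]) = ?fu" unfolding fl_fuel_def dm f2 ..
   have st: "fl_stage2 (?inp @ [X, 0, set_encode A]) =
     (mask (%i. i \<in> set (z A)) [0..<nf], map (%j. fl_assign ?dm (x @ z A) j) [0..<nc])"
    unfolding fl_stage2_def Let_def S2.ns S2.idx S2.extra[OF refl] dm ff f2 fu x_def[symmetric] z_def[symmetric] ..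
   have sA: "fst (s A) 0 = mask (%i. i \<in> set (z A)) [0..<nf]" "\<And>j. j < nc ==> snd (s A) j = fl_assign ?dm (x @ z A) j"
    using s[of A, folded X_def] A unfolding inp' st by (simp_all add: P flds)
   show "fst (?z A) = set (z A)" using zp(2)[OF A] by (auto simp: P flds sA(1) set_decode_mask)
   show "snd (?z A) j = fl_assign ?dm (x @ z A) j" if "j \<in> A" for j using that A by (auto simp: P flds sA(2))
  qed
  have asg: "fl_assign ?dm (x @ z A) j \<in> set (x @ z A)" if "A \<subseteq> {..<nc}" "j \<in> A" for A j
   unfolding fl_assign_def using zp(4)[OF that(1), of j] decA[OF that(1)] that(2) by (intro best_in) simp
  have sol: "(set_decode X, ?z) \<in> solutions P"
   using xn zs zp(2) asg unfolding decX by (auto simp: solutions_def P flds)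
  have costz: "real E * recourse_cost P A (?z A) = real (fl_cost ?dm ?f2 x (z A) (dec (set_encode A)))" if A: "A \<subseteq> {..<nc}" for A
  proof -
   have an: "fl_assign ?dm (x @ z A) j < nf" if "j \<in> A" for j using asg[OF A that] xn zp(2)[OF A] by auto
   have "sum_list (map (nthd 0 ?f2) (z A)) = tot ?f2 (set (z A))"
    unfolding tot_def using zp(2,3)[OF A] len by (auto simp: sum_list_distinct_conv_sum_set nthd_def intro!: sum.cong)
   then have "fl_cost ?dm ?f2 x (z A) (dec (set_encode A)) = tot ?f2 (set (z A)) + (\<Sum>j\<in>A. at2 ?dm (fl_assign ?dm (x @ z A) j) j)"
    using okA[OF A] decA[OF A] by (simp add: fl_cost_def sum_list_distinct_conv_sum_set)
   moreover have "recourse_cost P A (?z A) = (\<Sum>i\<in>set (z A). of_rat (open2 I i)) +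
     (\<Sum>j\<in>A. of_rat (dst I (fac_loc I (fl_assign ?dm (x @ z A) j)) (cli_loc I j)))"
    unfolding P flds(6) using zs[OF A] by (simp add: P)
   ultimately show ?thesis
    by (simp only: of_nat_add tot_real(2)[OF zp(2)[OF A]] conn_real[OF A an] distrib_left)
  qed
  have sol': "x' \<subseteq> {..<nf} \<and> (\<forall>A\<subseteq>{..<nc}. fst (z' A) \<subseteq> {..<nf} \<and> (\<forall>j\<in>A. snd (z' A) j \<in> x' \<union> fst (z' A)) \<and>
    real E * recourse_cost P A (z' A) = real (tot ?f2 (fst (z' A)) + (\<Sum>j\<in>A. at2 ?dm (snd (z' A) j) j)))"
   if xz: "(x', z') \<in> solutions P" for x' z'
  proof (intro conjI allI impI)
   show x': "x' \<subseteq> {..<nf}" using xz by (auto simp: solutions_def P flds)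
   fix A assume A: "A \<subseteq> {..<nc}"
   show f: "fst (z' A) \<subseteq> {..<nf}" and j: "\<forall>j\<in>A. snd (z' A) j \<in> x' \<union> fst (z' A)"
    using xz A by (auto simp: solutions_def P flds)
   have "snd (z' A) j < nf" if "j \<in> A" for j using j that x' f by blast
   from conn_real[OF A this]
   show "real E * recourse_cost P A (z' A) = real (tot ?f2 (fst (z' A)) + (\<Sum>j\<in>A. at2 ?dm (snd (z' A) j) j))"
    unfolding P flds(6) by (simp only: of_nat_add tot_real(2)[OF f] distrib_left)
  qed
  have c0: "\<And>a. a \<in> actions P ==> 0 <= cost1 P a" using costs_nonneg by (auto simp: P flds)
  have nn: "\<And>x A z. x \<subseteq> actions P ==> A \<subseteq> ground P ==> feasible P x A z ==> 0 <= recourse_cost P A z"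
   using costs_nonneg dst_nonneg by (auto simp: P flds intro!: sum_nonneg add_nonneg_nonneg)
  have rr: "0 < ?r" "?r <= 1" "0 < ?e" "?e < 1" using v by auto
  have fin: "finite (ground P)" by (simp add: P flds)
  have opt0: "0 <= opt P p ?r" by (rule opt_nonneg[OF fin p _ c0 nn sol]) (use rr in auto)
  have Ep: "0 < real E" using E_pos by simp
  have cost1: "real E * sum (cost1 P) y = real (tot ?f1 y)" if "y \<subseteq> {..<nf}" for y
   using tot_real(1)[OF that] by (simp add: P flds)
  have "?e * ?e <= 1 * ?e" using rr by (intro mult_right_mono) auto
  then have "9 * (1 + ?e)\<^sup>2 <= 10.98 + 27 * ?e" by (simp add: power2_eq_square algebra_simps)
  then have "9 * (1 + ?e)\<^sup>2 * opt P p ?r <= (10.98 + 27 * ?e) * opt P p ?r" using opt0 by (intro mult_right_mono)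
  moreover have "objective P p ?r (set_decode X) ?z <= 9 * (1 + ?e)\<^sup>2 * opt P p ?r"
  proof (cases "fl_cheap ?inp")
   case True
   then have X0: "X = 0" by (simp add: X_def inp' fl_stage1_def Let_def)
   then have x0: "x = []" using decX by simp
   have "objective P p ?r {} ?z <= 9 * opt P p ?r"
   proof (rule pointwise_reduction[OF fin p])
    show "({}, ?z) \<in> solutions P" using sol X0 by simp
    fix x' z' A assume xz: "(x', z') \<in> solutions P" and "A \<subseteq> ground P"
    then have A: "A \<subseteq> {..<nc}" by (simp add: P flds)
    note S = sol'[OF xz]
    from S A have SA: "x' \<subseteq> {..<nf}" "fst (z' A) \<subseteq> {..<nf}" "\<And>j. j \<in> A ==> snd (z' A) j \<in> x' \<union> fst (z' A)"
     "real E * recourse_cost P A (z' A) = real (tot ?f2 (fst (z' A)) + (\<Sum>j\<in>A. at2 ?dm (snd (z' A) j) j))" by auto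
    have fS: "finite x'" "finite (fst (z' A))" using SA finite_subset by blast+
    let ?es = "dec (set_encode A)" and ?cn = "\<Sum>j\<in>A. at2 ?dm (snd (z' A) j) j"
    have "fl_cost ?dm ?f2 x (z A) ?es <= 9 * (tot ?f2 (x' \<union> fst (z' A)) + ?cn)"
    proof -
     have "2 * fl_cost ?dm ?f2 [] (fl_open ?ff [] (cs2 ?es)) ?es <= 9 * (tot ?f2 (x' \<union> fst (z' A)) + (\<Sum>j\<in>set ?es. at2 ?dm (snd (z' A) j) j))"
      by (rule pointwise_bound[OF okA[OF A] SA(1,2)]) (use SA(3) decA[OF A] in auto)
     then show ?thesis using zp(5)[OF A] unfolding x0 decA[OF A] by linarith
    qed
    also have "\<dots> <= 9 * (tot ?f2 x' + tot ?f2 (fst (z' A)) + ?cn)" using tot_Un_le[OF fS, of ?f2] by simp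
    finally have "real (fl_cost ?dm ?f2 x (z A) ?es) <= real (9 * (tot ?f2 x' + tot ?f2 (fst (z' A)) + ?cn))" by (simp only: of_nat_le_iff)
    also have "\<dots> = 9 * (real (tot ?f2 x') + real (tot ?f2 (fst (z' A)) + ?cn))" by (simp only: of_nat_mult of_nat_add of_nat_numeral add.assoc)
    also have "\<dots> <= 9 * (real (tot ?f1 x') + real (tot ?f2 (fst (z' A)) + ?cn))"
    proof -
     have "real (tot ?f2 x') <= real (tot ?f1 x')"
      unfolding tot_real[OF SA(1)] using True SA(1)
      by (intro mult_left_mono sum_mono) (auto simp: cheap_iff of_rat_less_eq)
     then show ?thesis by (intro mult_left_mono add_right_mono) simp_all
    qed
    finally have "real E * recourse_cost P A (?z A) <= real E * (9 * (sum (cost1 P) x' + recourse_cost P A (z' A)))"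
     unfolding costz[OF A] SA(4)[symmetric] cost1[OF SA(1), symmetric] by (simp only: algebra_simps)
    then show "recourse_cost P A (?z A) <= 9 * (sum (cost1 P) x' + recourse_cost P A (z' A))"
     using Ep by (rule mult_left_le_imp_le)
   qed (use rr in auto)
   also have "\<dots> <= 9 * (1 + ?e)\<^sup>2 * opt P p ?r"
    using opt0 rr by (intro mult_right_mono) (auto simp: power2_eq_square algebra_simps)
   finally show ?thesis using X0 by simp
  next
   case False
   have N0: "0 < fl_samples inp" using False np(1) by (simp add: inp' fl_samples_def)
   have w0: "ws \<noteq> []" using N0 lenw by auto
   let ?scs = "?H @ [(?u, [0..<nc])]"
   have rad: "0 < rd" "?r = real rn / real rd" using radius[OF v(1)] by (auto simp: rn_def rd_def)
   have Hd: "ok es \<and> dec (set_encode (set es)) = es" if "(w, es) \<in> set ?H" for w es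
   proof -
    from that obtain a where a: "a \<in> set ws" "es = dec a" by (auto simp: heavy_def)
    then obtain A where "A \<subseteq> {..<nc}" "a = set_encode A" using ws by (auto simp: P flds)
    with a decA[of A] show ?thesis by simp
   qed
   have oks: "ok (snd p)" if "p \<in> set ?scs" for p
    using that Hd[of "fst p" "snd p"] by (cases "p \<in> set ?H") auto
   have W: "sum_list (map fst ?scs) <= ?B"
    using scenario_weights(4)[OF fin ws rad rr(1,2) w0] by simp
   let ?C = "%es. fl_cost ?dm ?f2 x (fl_open ?ff x (cs2 es)) es"
   \<comment> \<open>The cost of serving all clients by the facilities opened for all clients; the
     alternative in \<open>fl2\<close> keeps every scenario below it.\<close>
   define Cm where "Cm = real (?C [0..<nc])"
   show ?thesis
   proof (rule scenario_reduction[where rn = rn and rd = rd and ws = ws and D = "real E" and Cm = "Cm / real E"])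
    show "0 < rd" "?r = real rn / real rd" by (rule rad)+
    show "ws \<noteq> []" by (rule w0)
    show "accurate P p (?e * ?r\<^sup>2 / 2) ws" using acc N0 by simp
    show "0 < real E" by (rule Ep)
    show "recourse_cost P A (?z A) <= Cm / real E" if "A \<subseteq> ground P" for A
    proof -
     have A: "A \<subseteq> {..<nc}" using that by (simp add: P flds)
     have "real E * recourse_cost P A (?z A) <= Cm"
      unfolding costz[OF A] Cm_def using zp(6)[OF A] by (simp only: of_nat_le_iff)
     then show ?thesis using Ep by (simp add: field_simps)
    qed
    fix x' z' assume "(x', z') \<in> solutions P"
    note S = sol'[OF this]
    have x': "x' \<subseteq> {..<nf}" using S by blast
    let ?C' = "%es. tot ?f2 (fst (z' (set es))) + (\<Sum>j\<in>set es. at2 ?dm (snd (z' (set es)) j) j)"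
    have main: "2 * (?B * tot ?f1 (set x) + (\<Sum>p\<leftarrow>?scs. fst p * ?C (snd p))) <=
      9 * (?B * tot ?f1 x' + (\<Sum>p\<leftarrow>?scs. fst p * ?C' (snd p)))"
    proof (rule stage_bound[where z' = "%es. fst (z' (set es))" and \<sigma> = "%es. snd (z' (set es))"])
     show "set x = set (fl_open ?ff [] (fl_cands1 ?fu ?dm ?f1 ?f2 ?B ?scs))" using set_x False by (simp add: C1_def)
     show "fst (z' (set (snd p))) \<subseteq> {..<nf} \<and> (\<forall>j\<in>set (snd p). snd (z' (set (snd p))) j \<in> x' \<union> fst (z' (set (snd p))))"
      if "p \<in> set ?scs" for p using S oks[OF that] by blast
    qed (use oks W x' in auto)
    have toR: "(\<Sum>(w, es)\<leftarrow>L. real w * real (G es)) = real (\<Sum>p\<leftarrow>L. fst p * G (snd p))" for L :: "(nat \<times> nat list) list" and G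
     by (induction L) auto
    have h1: "(\<Sum>(w, es)\<leftarrow>?H. real w * (real E * recourse_cost P (set es) (?z (set es)))) <= (\<Sum>(w, es)\<leftarrow>?H. real w * real (?C es))"
    proof (rule sum_list_mono, clarify)
     fix w es assume wes: "(w, es) \<in> set ?H"
     note H = Hd[OF wes]
     have A: "set es \<subseteq> {..<nc}" using H by blast
     have "real E * recourse_cost P (set es) (?z (set es)) <= real (?C es)"
      unfolding costz[OF A] using zp(5)[OF A] H by (simp only: of_nat_le_iff)
     then show "real w * (real E * recourse_cost P (set es) (?z (set es))) <= real w * real (?C es)"
      by (intro mult_left_mono) auto
    qed
    have h2: "(\<Sum>(w, es)\<leftarrow>?H. real w * (real E * recourse_cost P (set es) (z' (set es)))) = (\<Sum>(w, es)\<leftarrow>?H. real w * real (?C' es))"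
    proof (intro arg_cong[where f = sum_list] map_cong refl, clarify)
     fix w es assume "(w, es) \<in> set ?H"
     then have "set es \<subseteq> {..<nc}" using Hd by blast
     then have "real E * recourse_cost P (set es) (z' (set es)) = real (?C' es)" using S by blast
     then show "real w * (real E * recourse_cost P (set es) (z' (set es))) = real w * real (?C' es)" by simp
    qed
    have gr: "real E * recourse_cost P (ground P) (z' (ground P)) = real (?C' [0..<nc])"
    proof -
     have g: "ground P = set [0..<nc]" by (auto simp: P flds)
     have "set [0..<nc] \<subseteq> {..<nc}" by auto
     then show ?thesis unfolding g using S by blast
    qed
    have EC: "real E * (Cm / real E) = Cm" using Ep by simp
    define hC hC' b b' cu cu' where d: "hC = (\<Sum>p\<leftarrow>?H. fst p * ?C (snd p))" "hC' = (\<Sum>p\<leftarrow>?H. fst p * ?C' (snd p))"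
     "b = ?B * tot ?f1 (set x)" "b' = ?B * tot ?f1 x'" "cu = ?u * ?C [0..<nc]" "cu' = ?u * ?C' [0..<nc]"
    have "2 * (b + (hC + cu)) <= 9 * (b' + (hC' + cu'))" using main unfolding d by (simp only: map_append sum_list_append list.map sum_list_simps fst_conv snd_conv add_0_right)
    then have "real (2 * (b + (hC + cu))) <= real (9 * (b' + (hC' + cu')))" by (simp only: of_nat_le_iff)
    then have k: "real b + 2 * (real hC + real cu) <= 9 * (real b' + (real hC' + real cu'))" by simp
    have eqs: "real ?u * Cm = real cu" "real ?u * real (?C' [0..<nc]) = real cu'" "real ?B * real (tot ?f1 (set x)) = real b"
     "real ?B * real (tot ?f1 x') = real b'" unfolding d Cm_def by (simp_all only: of_nat_mult)
    define hz where "hz = (\<Sum>(w, es)\<leftarrow>?H. real w * (real E * recourse_cost P (set es) (?z (set es))))"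
    have "hz <= real hC" using h1 unfolding hz_def toR d(1)[symmetric] .
    then have "real b + 2 * (hz + real cu) <= real b + 2 * (real hC + real cu)" by simp
    also note k
    finally have "real b + 2 * (hz + real cu) <= 9 * (real b' + (real hC' + real cu'))" .
    then show "real ?B * (real E * sum (cost1 P) (set_decode X)) +
     2 * ((\<Sum>(w, es)\<leftarrow>?H. real w * (real E * recourse_cost P (set es) (?z (set es)))) + real ?u * (real E * (Cm / real E)))
     <= 9 * (real ?B * (real E * sum (cost1 P) x') +
     ((\<Sum>(w, es)\<leftarrow>?H. real w * (real E * recourse_cost P (set es) (z' (set es)))) +
      real ?u * (real E * recourse_cost P (ground P) (z' (ground P)))))"
     unfolding hz_def[symmetric] h2 gr EC decX cost1[OF xn] cost1[OF x'] toR d(1,2)[symmetric] eqs .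
   next
    show "\<exists>y. feasible P x (A \<union> B) y \<and> recourse_cost P (A \<union> B) y <= recourse_cost P A z + recourse_cost P B z'"
     if "A \<subseteq> ground P" "B \<subseteq> ground P" "feasible P x A z" "feasible P x B z'" for x A B z z'
    proof (intro exI[of _ "(fst z \<union> fst z', %j. if j \<in> A then snd z j else snd z' j)"] conjI)
     have f: "fst z \<subseteq> {..<nf}" "fst z' \<subseteq> {..<nf}" using that by (auto simp: P flds)
     have fAB: "finite A" "finite B" using that(1,2) fin finite_subset by blast+
     show "feasible P x (A \<union> B) (fst z \<union> fst z', %j. if j \<in> A then snd z j else snd z' j)" using that by (auto simp: P flds)
     let ?o = "%i. real_of_rat (open2 I i)" and ?d = "%z j. real_of_rat (dst I (fac_loc I (snd z j)) (cli_loc I j))"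
     have "sum ?o (fst z \<union> fst z') <= sum ?o (fst z) + sum ?o (fst z')"
      using f finite_subset[OF f(1)] finite_subset[OF f(2)] costs_nonneg
       sum.union_inter[of "fst z" "fst z'" ?o] sum_nonneg[of "fst z \<inter> fst z'" ?o] by force
     moreover have "(\<Sum>j\<in>A \<union> B. real_of_rat (dst I (fac_loc I (if j \<in> A then snd z j else snd z' j)) (cli_loc I j))) <= sum (?d z) A + sum (?d z') B"
     proof -
      have "(\<Sum>j\<in>A \<union> B. real_of_rat (dst I (fac_loc I (if j \<in> A then snd z j else snd z' j)) (cli_loc I j))) = sum (?d z) A + sum (?d z') (B - A)"
       unfolding Un_Diff_cancel[of A B, symmetric] using fAB by (subst sum.union_disjoint) (auto intro!: sum.cong arg_cong2[where f = "(+)"])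
      also have "sum (?d z') (B - A) <= sum (?d z') B" using fAB dst_nonneg by (intro sum_mono2) auto
      finally show ?thesis by simp
     qed
     ultimately show "recourse_cost P (A \<union> B) (fst z \<union> fst z', %j. if j \<in> A then snd z j else snd z' j) <= recourse_cost P A z + recourse_cost P B z'"
      by (simp add: P flds)
    qed
    show "feasible P x A z \<and> recourse_cost P A z <= recourse_cost P (ground P) z"
     if "A \<subseteq> ground P" "feasible P x (ground P) z" for x A z
     using that dst_nonneg by (auto simp: P flds intro!: sum_mono2)
   qed (use fin p rr c0 nn ws sol in auto)
  qed
  ultimately show "(set_decode (fl_stage1 (inp, ws)), ?z) \<in> solutions P \<and>
   objective P p ?r (set_decode (fl_stage1 (inp, ws))) ?z <= (10.98 + 27 * ?e) * opt P p ?r"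
   using sol unfolding X_def by linarith
 qed
qed

theorem theorem4p2:
  shows "(\<exists>\<rho> :: nat \<Rightarrow> real. \<rho> \<in> O(\<lambda>n. ln (real n)) \<and>
            has_approx_algorithm set_cover_problems (\<lambda>P \<epsilon>. \<rho> (card (ground P)))) \<and>
         (\<exists>K :: real. has_approx_algorithm vertex_cover_problems (\<lambda>P \<epsilon>. 8 + K * \<epsilon>)) \<and>
         (\<exists>K :: real. has_approx_algorithm edge_cover_problems (\<lambda>P \<epsilon>. 6 + K * \<epsilon>)) \<and>
         (\<exists>K :: real. has_approx_algorithm facility_problems (\<lambda>P \<epsilon>. 10.98 + K * \<epsilon>))"
  using set_cover_log_approx vertex_cover_approx edge_cover_approx facility_location_approx by blast

end
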